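(* Let $(\mathcal{S},\mathcal{B}_F,\psi,0)$ be an extreme wave (so $Q=0$), where $F<0$, such that $\psi_Y<0$ in $\Omega$; $\mathcal{S}=\{(u(s),v(s)):s\in\mathbb{R}\}$, where $s\mapsto(u(s),v(s))$ is injective, $u(0)=v(0)=0$, $s\mapsto u(s)$ is nondecreasing on $\mathbb{R}$, and there exist $d<0<e$ such that $s\mapsto v(s)$ is nondecreasing on $[d,0]$ and nonincreasing on $[0,e]$; and $$T[\psi]:=\tfrac12|\nabla\psi|^2+gY+\hat\Gamma(\psi)-\varpi\psi\le0\quad\text{in }\Omega,$$ where $\hat\Gamma(r):=\int_0^r\gamma(t)\,dt$ and $\varpi:=\frac12\max\{0,\max_{[0,B]}\gamma\}$. Suppose that there exist $q_+,q_-\in[0,\infty]$ such that $\lim_{s\to0\pm}\frac{|v(s)|}{|u(s)|}=q_\pm$. Then either $q_+=q_-=\frac1{\sqrt3}$ or $q_+=q_-=0$. Moreover, if $\gamma(r)\ge0$ for all $r\in[0,\delta]$, for some $\delta\in(0,B]$, then $q_+=q_-=\frac1{\sqrt3}$.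
   Context: Fix constants $g,B,L>0$, $\alpha\in(0,1)$ and $\gamma\in C^{1,\alpha}([0,B])$. For $F\in\mathbb{R}$, $\mathcal{B}_F:=\{(X,F):X\in\mathbb{R}\}$ and $\mathcal{U}_F:=\{(X,Y):X\in\mathbb{R},\,Y>F\}$. $\mathcal{S}$ is a non-self-intersecting locally rectifiable curve lying in $\mathcal{U}_F$, $2L$-periodic in the horizontal direction, and $\Omega$ is the domain lying above $\mathcal{B}_F$ and below $\mathcal{S}$, with boundary $\mathcal{S}\cup\mathcal{B}_F$. The water-wave problem is: $\Delta\psi=-\gamma(\psi)$ in $\Omega$; $0\le\psi\le B$ in $\Omega$; $\psi=B$ on $\mathcal{B}_F$; $\psi=0$ on $\mathcal{S}$; $|\nabla\psi|^2+2gY=Q$ on $\mathcal{S}$, with $Q\in\mathbb{R}$. It is always required that $\psi\in\mathrm{Lip}(\overline\Omega)$, that $\psi$ is $2L$-periodic in $X$, that $0\le\psi\le B$ in $\Omega$, $\psi=B$ on $\mathcal{B}_F$, $\psi=0$ on $\mathcal{S}$ hold classically, and that $\int_{\Omega}\nabla\psi\cdot\nabla\zeta\,d\mathcal{L}^2=\int_\Omega\gamma(\psi)\zeta\,d\mathcal{L}^2$ for all $\zeta\in C^1_0(\Omega)$ (compact support); then $\psi\in C^{3,\alpha}_{\rm loc}(\Omega\cup\mathcal{B}_F)$ and the PDE holds classically. Such a $(\mathcal{S},\mathcal{B}_F,\psi,Q)$ is a weak solution if (with $Q-2gY\ge0$ on $\mathcal{S}$ understood) $\int_{\Omega}\nabla\psi\cdot\nabla\zeta\,d\mathcal{L}^2=\int_\Omega\gamma(\psi)\zeta\,d\mathcal{L}^2-\int_{\mathcal{S}}(Q-2gY)^{1/2}\zeta\,d\mathcal{H}^1$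 for all $\zeta\in C^1_0(\mathcal{U}_F)$. A point $(X_0,Y_0)\in\mathcal{S}$ is a stagnation point if $Q-2gY_0=0$; an extreme wave is a weak solution having stagnation points on $\mathcal{S}$. A quotient $|v(s)|/|u(s)|$ with $u(s)=0\neq v(s)$ is read as $+\infty$. *)

theory Defs
  imports "HOL-Analysis.Analysis"
begin

text \<open>Points of the \<open>(X, Y)\<close>-plane are pairs \<open>(X, Y) :: real \<times> real\<close>, with the
  Euclidean norm.\<close>

subsection \<open>Function spaces\<close>

text \<open>\<open>C\<^sup>1\<^sup>,\<^sup>\<alpha>\<close> on a closed interval; derivatives at the end points are one-sided.\<close>

definition C1_holder_on :: "real \<Rightarrow> real set \<Rightarrow> (real \<Rightarrow> real) \<Rightarrow> bool" where
  "C1_holder_on \<alpha> I f \<longleftrightarrow>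
     (\<exists>f'. (\<forall>x\<in>I. (f has_real_derivative f' x) (at x within I)) \<and>
           (\<exists>C. \<forall>x\<in>I. \<forall>y\<in>I. \<bar>f' x - f' y\<bar> \<le> C * \<bar>x - y\<bar> powr \<alpha>))"

text \<open>Only meaningful where \<open>f\<close> is differentiable. For a Lipschitz function this is almost
  everywhere, and the pointwise gradient then represents the distributional one.\<close>

definition grad :: "(real \<times> real \<Rightarrow> real) \<Rightarrow> real \<times> real \<Rightarrow> real \<times> real" where
  "grad f x = (THE D. GDERIV f x :> D)"

text \<open>\<open>C\<^sup>1\<close> functions with compact support in \<open>A\<close>, extended by zero to the whole plane.\<close>

definition C1_compact_support :: "(real \<times> real) set \<Rightarrow> (real \<times> real \<Rightarrow> real) set" where
  "C1_compact_support A =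
     {\<zeta>. (\<forall>x. \<zeta> differentiable (at x)) \<and> continuous_on UNIV (grad \<zeta>) \<and>
          compact (closure {x. \<zeta> x \<noteq> 0}) \<and> closure {x. \<zeta> x \<noteq> 0} \<subseteq> A}"

subsection \<open>One-dimensional Hausdorff measure\<close>

text \<open>The size-\<open>\<delta>\<close> approximation. Boundedness is required because \<^const>\<open>diameter\<close> has no
  meaning on unbounded sets; the normalising constant of \<open>\<H>\<^sup>1\<close> is 1.\<close>

definition hausdorff1_pre :: "real \<Rightarrow> 'a::metric_space set \<Rightarrow> ennreal" where
  "hausdorff1_pre \<delta> A =
     (INF U\<in>{U :: nat \<Rightarrow> 'a set. A \<subseteq> (\<Union>i. U i) \<and> (\<forall>i. bounded (U i) \<and> diameter (U i) \<le> \<delta>)}.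
        \<Sum>i. ennreal (diameter (U i)))"

definition hausdorff1_outer :: "'a::metric_space set \<Rightarrow> ennreal" where
  "hausdorff1_outer A = (SUP \<delta>\<in>{0<..}. hausdorff1_pre \<delta> A)"

definition hausdorff1 :: "'a::metric_space measure" where
  "hausdorff1 = measure_of UNIV (sets borel) hausdorff1_outer"

text \<open>\<^const>\<open>measure_of\<close> is the zero measure unless its argument is countably additive. The next
  lemmas, ending in \<open>emeasure_hausdorff1\<close>, show that this is the case here.\<close>

lemma hausdorff1_pre_mono: "A \<subseteq> B \<Longrightarrow> hausdorff1_pre \<delta> A \<le> hausdorff1_pre \<delta> B"
  unfolding hausdorff1_pre_def by (rule INF_superset_mono) auto

lemma hausdorff1_pre_antimono: "\<delta> \<le> \<delta>' \<Longrightarrow> hausdorff1_pre \<delta>' A \<le> hausdorff1_pre \<delta> A"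
  unfolding hausdorff1_pre_def by (rule INF_superset_mono) (auto intro: order_trans)

lemma hausdorff1_pre_le:
  assumes "A \<subseteq> (\<Union>i. U i)" "\<And>i::nat. bounded (U i)" "\<And>i. diameter (U i) \<le> \<delta>"
  shows "hausdorff1_pre \<delta> A \<le> (\<Sum>i. ennreal (diameter (U i)))"
  unfolding hausdorff1_pre_def using assms by (intro INF_lower) auto

lemma hausdorff1_pre_empty: "\<delta> > 0 \<Longrightarrow> hausdorff1_pre \<delta> {} = 0"
  using hausdorff1_pre_le[of "{}" "\<lambda>_. {}" \<delta>] by simp

lemma hausdorff1_pre_subadditive:
  fixes A :: "nat \<Rightarrow> 'a::metric_space set"
  assumes "\<delta> > 0"
  shows "hausdorff1_pre \<delta> (\<Union>n. A n) \<le> (\<Sum>n. hausdorff1_pre \<delta> (A n))"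
proof (rule ennreal_le_epsilon)
  fix e :: real
  assume e: "0 < e" and fin: "(\<Sum>n. hausdorff1_pre \<delta> (A n)) < top"
  have pos: "0 < ennreal (e * (1/2) ^ Suc n)" for n
    using e by simp
  have "hausdorff1_pre \<delta> (A n) < hausdorff1_pre \<delta> (A n) + ennreal (e * (1/2) ^ Suc n)" for n
    using pos[of n] ennreal_suminf_lessD[OF fin, of n]
    by (metis add.right_neutral ennreal_add_left_cancel_less infinity_ennreal_def less_irrefl)
  then have "\<exists>U :: nat \<Rightarrow> 'a set. A n \<subseteq> (\<Union>i. U i) \<and> (\<forall>i. bounded (U i) \<and> diameter (U i) \<le> \<delta>) \<and>
      (\<Sum>i. ennreal (diameter (U i))) < hausdorff1_pre \<delta> (A n) + ennreal (e * (1/2) ^ Suc n)" for n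
    unfolding hausdorff1_pre_def INF_less_iff by simp
  then obtain U :: "nat \<Rightarrow> nat \<Rightarrow> 'a set" where U: "\<And>n. A n \<subseteq> (\<Union>i. U n i)" "\<And>n i. bounded (U n i)"
      "\<And>n i. diameter (U n i) \<le> \<delta>"
      "\<And>n. (\<Sum>i. ennreal (diameter (U n i))) < hausdorff1_pre \<delta> (A n) + ennreal (e * (1/2) ^ Suc n)"
    by metis
  define W where "W k = (case prod_decode k of (n, i) \<Rightarrow> U n i)" for k
  have cover: "(\<Union>n. A n) \<subseteq> (\<Union>k. W k)"
  proof
    fix x assume "x \<in> (\<Union>n. A n)"
    then obtain n i where "x \<in> U n i"
      using U(1) by blast
    then have "x \<in> W (prod_encode (n, i))"
      by (simp add: W_def)
    then show "x \<in> (\<Union>k. W k)" by blast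
  qed
  have "hausdorff1_pre \<delta> (\<Union>n. A n) \<le> (\<Sum>k. ennreal (diameter (W k)))"
    using cover by (rule hausdorff1_pre_le) (auto simp: W_def U split: prod.split)
  also have "\<dots> = (\<Sum>k. (\<lambda>(n, i). ennreal (diameter (U n i))) (prod_decode k))"
    by (simp add: W_def case_prod_unfold)
  also have "\<dots> = (\<Sum>n. \<Sum>i. ennreal (diameter (U n i)))"
    by (rule suminf_ennreal_2dimen) simp
  also have "\<dots> \<le> (\<Sum>n. hausdorff1_pre \<delta> (A n) + ennreal (e * (1/2) ^ Suc n))"
    using U(4) by (intro suminf_le) (auto intro: less_imp_le)
  also have "\<dots> = (\<Sum>n. hausdorff1_pre \<delta> (A n)) + (\<Sum>n. ennreal (e * (1/2) ^ Suc n))"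
    by (rule suminf_add[symmetric]) auto
  also have "(\<Sum>n. ennreal (e * (1/2) ^ Suc n)) = ennreal e"
    using sums_mult[OF power_half_series, of e] e
    by (intro sums_unique[symmetric] sums_ennreal[THEN iffD2]) auto
  finally show "hausdorff1_pre \<delta> (\<Union>n. A n) \<le> (\<Sum>n. hausdorff1_pre \<delta> (A n)) + ennreal e" .
qed

lemma hausdorff1_outer_mono: "A \<subseteq> B \<Longrightarrow> hausdorff1_outer A \<le> hausdorff1_outer B"
  unfolding hausdorff1_outer_def by (intro SUP_mono) (auto intro: hausdorff1_pre_mono)

lemma hausdorff1_outer_empty [simp]: "hausdorff1_outer {} = 0"
proof -
  have "hausdorff1_outer ({} :: 'a set) = (SUP \<delta>\<in>{0::real<..}. 0)"
    unfolding hausdorff1_outer_def by (intro SUP_cong) (auto simp: hausdorff1_pre_empty)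
  then show ?thesis by simp
qed

lemma hausdorff1_outer_subadditive:
  "hausdorff1_outer (\<Union>n::nat. A n) \<le> (\<Sum>n. hausdorff1_outer (A n))"
  unfolding hausdorff1_outer_def[of "\<Union>n. A n"]
proof (rule SUP_least)
  fix \<delta> :: real assume "\<delta> \<in> {0<..}"
  then have "hausdorff1_pre \<delta> (\<Union>n. A n) \<le> (\<Sum>n. hausdorff1_pre \<delta> (A n))"
    by (intro hausdorff1_pre_subadditive) simp
  also have "\<dots> \<le> (\<Sum>n. hausdorff1_outer (A n))"
    using \<open>\<delta> \<in> {0<..}\<close> by (intro suminf_le) (auto simp: hausdorff1_outer_def intro: SUP_upper)
  finally show "hausdorff1_pre \<delta> (\<Union>n. A n) \<le> (\<Sum>n. hausdorff1_outer (A n))" .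
qed

lemma hausdorff1_outer_Un: "hausdorff1_outer (A \<union> B) \<le> hausdorff1_outer A + hausdorff1_outer B"
proof -
  have "hausdorff1_outer (A \<union> B) \<le> (\<Sum>n. hausdorff1_outer (binaryset A B n))"
    using hausdorff1_outer_subadditive[of "binaryset A B"] by (simp add: UN_binaryset_eq)
  also have "\<dots> = hausdorff1_outer A + hausdorff1_outer B"
    by (rule suminf_binaryset_eq) simp
  finally show ?thesis .
qed

lemma hausdorff1_outer_separated:
  assumes "\<epsilon> > 0" and sep: "\<And>x y. x \<in> P \<Longrightarrow> y \<in> Q \<Longrightarrow> dist x y \<ge> \<epsilon>"
  shows "hausdorff1_outer P + hausdorff1_outer Q \<le> hausdorff1_outer (P \<union> Q)"
proof -
  have *: "hausdorff1_pre \<delta> P + hausdorff1_pre \<delta> Q \<le> hausdorff1_pre \<delta> (P \<union> Q)"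
    if "0 < \<delta>" "\<delta> < \<epsilon>" for \<delta>
    unfolding hausdorff1_pre_def[of \<delta> "P \<union> Q"]
  proof (rule INF_greatest, clarify)
    fix U :: "nat \<Rightarrow> 'a set"
    assume cov: "P \<union> Q \<subseteq> (\<Union>i. U i)" and U: "\<forall>i. bounded (U i) \<and> diameter (U i) \<le> \<delta>"
    define V where "V i = (if U i \<inter> P = {} then {} else U i)" for i
    define W where "W i = (if U i \<inter> P = {} then U i else {})" for i
    have "y \<in> (\<Union>i. W i)" if "y \<in> Q" for y
    proof -
      obtain i where i: "y \<in> U i" using cov \<open>y \<in> Q\<close> by blast
      have "U i \<inter> P = {}"
      proof (rule ccontr)
        assume "U i \<inter> P \<noteq> {}"
        then obtain x where x: "x \<in> U i" "x \<in> P" by blast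
        have "dist x y \<le> diameter (U i)"
          using U x i by (intro diameter_bounded_bound) auto
        then show False
          using sep[OF x(2) \<open>y \<in> Q\<close>] U \<open>\<delta> < \<epsilon>\<close> by (meson leD le_less_trans order_trans)
      qed
      then show ?thesis using i by (auto simp: W_def)
    qed
    then have "hausdorff1_pre \<delta> Q \<le> (\<Sum>i. ennreal (diameter (W i)))"
      using U \<open>0 < \<delta>\<close> by (intro hausdorff1_pre_le) (auto simp: W_def)
    moreover have "P \<subseteq> (\<Union>i. V i)"
      using cov by (fastforce simp: V_def)
    then have "hausdorff1_pre \<delta> P \<le> (\<Sum>i. ennreal (diameter (V i)))"
      using U \<open>0 < \<delta>\<close> by (intro hausdorff1_pre_le) (auto simp: V_def)
    ultimately have "hausdorff1_pre \<delta> P + hausdorff1_pre \<delta> Q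
        \<le> (\<Sum>i. ennreal (diameter (V i))) + (\<Sum>i. ennreal (diameter (W i)))"
      by (intro add_mono)
    also have "\<dots> = (\<Sum>i. ennreal (diameter (V i)) + ennreal (diameter (W i)))"
      by (rule suminf_add) auto
    also have "\<dots> = (\<Sum>i. ennreal (diameter (U i)))"
      by (intro suminf_cong) (auto simp: V_def W_def)
    finally show "hausdorff1_pre \<delta> P + hausdorff1_pre \<delta> Q \<le> (\<Sum>i. ennreal (diameter (U i)))" .
  qed
  have **: "hausdorff1_pre a P + hausdorff1_pre b Q \<le> hausdorff1_outer (P \<union> Q)"
    if "a > 0" "b > 0" for a b
  proof -
    define m where "m = min (min a b) (\<epsilon> / 2)"
    have m: "0 < m" "m < \<epsilon>" "m \<le> a" "m \<le> b"
      using that \<open>\<epsilon> > 0\<close> by (auto simp: m_def)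
    have "hausdorff1_pre a P + hausdorff1_pre b Q \<le> hausdorff1_pre m P + hausdorff1_pre m Q"
      using m by (intro add_mono hausdorff1_pre_antimono)
    also have "\<dots> \<le> hausdorff1_pre m (P \<union> Q)" using m by (intro *)
    also have "\<dots> \<le> hausdorff1_outer (P \<union> Q)"
      unfolding hausdorff1_outer_def using m by (intro SUP_upper) auto
    finally show ?thesis .
  qed
  have "hausdorff1_outer P + hausdorff1_outer Q
      = (SUP a\<in>{0<..}. hausdorff1_pre a P + hausdorff1_outer Q)"
    unfolding hausdorff1_outer_def[of P] by (rule ennreal_SUP_add_left[symmetric]) (simp add: ex_gt_or_lt gt_ex)
  also have "\<dots> = (SUP a\<in>{0<..}. SUP b\<in>{0<..}. hausdorff1_pre a P + hausdorff1_pre b Q)"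
    unfolding hausdorff1_outer_def[of Q] by (subst ennreal_SUP_add_right) (auto simp: gt_ex)
  also have "\<dots> \<le> hausdorff1_outer (P \<union> Q)"
    by (intro SUP_least) (auto intro: **)
  finally show ?thesis .
qed

lemma hausdorff1_outer_caratheodory_closed:
  fixes C :: "'a::metric_space set"
  assumes "closed C"
  shows "hausdorff1_outer (A \<inter> C) + hausdorff1_outer (A - C) \<le> hausdorff1_outer A"
proof (cases "C = {} \<or> hausdorff1_outer A = top")
  case True
  then show ?thesis by (elim disjE) simp_all
next
  case False
  then have ne: "C \<noteq> {}" and fin: "hausdorff1_outer A < top" by (auto simp: less_top)
  define D where "D n = {x \<in> A. infdist x C \<ge> 1 / real (Suc n)}" for n
  define R where "R n = D (Suc n) - D n" for n
  have DA: "D n \<subseteq> A - C" for n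
  proof
    fix x assume "x \<in> D n"
    moreover have "\<not> 1 / real (Suc n) \<le> 0" by simp
    ultimately show "x \<in> A - C" by (auto simp: D_def simp del: of_nat_Suc)
  qed
  have Dmono: "D m \<subseteq> D n" if "m \<le> n" for m n
  proof -
    have "1 / real (Suc n) \<le> 1 / real (Suc m)" using that by (intro divide_left_mono) auto
    then show ?thesis unfolding D_def by (blast intro: order_trans)
  qed
  have DR: "D m \<subseteq> D n \<union> (\<Union>k. R (k + n))" for m n
  proof (cases "m \<le> n")
    case True then show ?thesis using Dmono[OF True] by (simp add: le_supI1)
  next
    case False
    then obtain j where "m = n + j" by (metis le_add_diff_inverse nat_le_linear)
    have "D (n + j) \<subseteq> D n \<union> (\<Union>k. R (k + n))"
    proof (induction j)
      case (Suc j)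
      have "D (n + Suc j) \<subseteq> D (n + j) \<union> R (j + n)"
        by (auto simp: R_def add.commute)
      also have "R (j + n) \<subseteq> (\<Union>k. R (k + n))"
        by (rule UN_upper) simp
      finally show ?case using Suc by blast
    qed simp
    then show ?thesis using \<open>m = n + j\<close> by simp
  qed
  have UD: "(\<Union>m. D m) = A - C"
  proof
    show "A - C \<subseteq> (\<Union>m. D m)"
    proof
      fix x assume x: "x \<in> A - C"
      then have "infdist x C > 0"
        using ne assms by (simp add: infdist_pos_not_in_closed)
      then obtain m where "inverse (real (Suc m)) < infdist x C"
        using reals_Archimedean by blast
      then show "x \<in> (\<Union>m. D m)"
        using x by (intro UN_I[of m]) (simp_all add: D_def inverse_eq_divide del: of_nat_Suc)
    qed
  qed (use DA in \<open>intro UN_least\<close>)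
  have AC: "A - C \<subseteq> D n \<union> (\<Union>k. R (k + n))" for n
    unfolding UD[symmetric] using DR by (intro UN_least)
  have sepD: "dist x y \<ge> 1 / real (Suc m) - 1 / real (Suc n)" if "x \<in> D m" "y \<in> A - D n" for x y m n
  proof -
    have "infdist x C \<le> infdist y C + dist x y" by (rule infdist_triangle)
    then show ?thesis using that unfolding D_def by (simp del: of_nat_Suc) linarith
  qed
  have gap: "1 / real (Suc m) - 1 / real (Suc n) > 0" if "m < n" for m n
    using that by (simp add: divide_strict_left_mono)
  have odd_sum: "(\<Sum>k<Suc N. hausdorff1_outer (R (2 * k + i))) \<le> hausdorff1_outer (D (2 * N + i + 1))" for N i
  proof (induction N)
    case 0
    have "R i \<subseteq> D (i + 1)" by (simp add: R_def)
    then show ?case by (simp add: hausdorff1_outer_mono)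
  next
    case (Suc N)
    have "(\<Sum>k<Suc (Suc N). hausdorff1_outer (R (2 * k + i)))
        = (\<Sum>k<Suc N. hausdorff1_outer (R (2 * k + i))) + hausdorff1_outer (R (2 * N + i + 2))"
      by (simp add: algebra_simps)
    also have "\<dots> \<le> hausdorff1_outer (D (2 * N + i + 1)) + hausdorff1_outer (R (2 * N + i + 2))"
      using Suc by (rule add_right_mono)
    also have "\<dots> \<le> hausdorff1_outer (D (2 * N + i + 1) \<union> R (2 * N + i + 2))"
    proof (rule hausdorff1_outer_separated[OF gap])
      show "2 * N + i + 1 < 2 * N + i + 2" by simp
    next
      fix x y assume "x \<in> D (2 * N + i + 1)" "y \<in> R (2 * N + i + 2)"
      then show "1 / real (Suc (2 * N + i + 1)) - 1 / real (Suc (2 * N + i + 2)) \<le> dist x y"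
        using DA[of "Suc (2 * N + i + 2)"] by (intro sepD) (unfold R_def, blast+)
    qed
    also have "\<dots> \<le> hausdorff1_outer (D (2 * Suc N + i + 1))"
    proof (rule hausdorff1_outer_mono)
      have "R (2 * N + i + 2) \<subseteq> D (2 * Suc N + i + 1)" by (simp add: R_def)
      moreover have "D (2 * N + i + 1) \<subseteq> D (2 * Suc N + i + 1)" by (rule Dmono) simp
      ultimately show "D (2 * N + i + 1) \<union> R (2 * N + i + 2) \<subseteq> D (2 * Suc N + i + 1)" by simp
    qed
    finally show ?case .
  qed
  define f where "f k = hausdorff1_outer (R k)" for k
  have half: "(\<Sum>k<N. f (2 * k + i)) \<le> hausdorff1_outer A" for N i
  proof -
    have "(\<Sum>k<N. f (2 * k + i)) \<le> (\<Sum>k<Suc N. f (2 * k + i))"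
      by simp
    also have "\<dots> \<le> hausdorff1_outer (D (2 * N + i + 1))"
      unfolding f_def by (rule odd_sum)
    also have "\<dots> \<le> hausdorff1_outer A"
      using DA[of "2 * N + i + 1"] by (intro hausdorff1_outer_mono) blast
    finally show ?thesis .
  qed
  have "(\<Sum>k<N. f k) \<le> hausdorff1_outer A + hausdorff1_outer A" for N
  proof -
    have "(\<Sum>k<N. f k) \<le> (\<Sum>k<2 * N. f k)"
      by (intro sum_mono2) auto
    also have "\<dots> = (\<Sum>k<N. f (2 * k + 0)) + (\<Sum>k<N. f (2 * k + 1))"
      by (induction N) (simp_all add: ac_simps)
    also have "\<dots> \<le> hausdorff1_outer A + hausdorff1_outer A"
      by (intro add_mono half)
    finally show ?thesis .
  qed
  then have "(\<Sum>k. f k) \<le> hausdorff1_outer A + hausdorff1_outer A"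
    by (intro suminf_le_const) auto
  also have "\<dots> < top" using fin by simp
  finally have f_fin: "(\<Sum>k. f k) < top" .
  show ?thesis
  proof (rule ennreal_le_epsilon)
    fix e :: real assume e: "0 < e"
    have "(\<lambda>n. (\<Sum>k<n. f k) + ennreal e) \<longlonglongrightarrow> (\<Sum>k. f k) + ennreal e"
      by (intro tendsto_add summable_LIMSEQ tendsto_const) auto
    moreover have "(\<Sum>k. f k) < (\<Sum>k. f k) + ennreal e"
      using ennreal_add_left_cancel_less[of "\<Sum>k. f k" 0 "ennreal e"] f_fin e by simp
    ultimately have "\<forall>\<^sub>F n in sequentially. (\<Sum>k. f k) < (\<Sum>k<n. f k) + ennreal e"
      by (rule order_tendstoD(1))
    then obtain n where n: "(\<Sum>k. f k) < (\<Sum>k<n. f k) + ennreal e"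
      using eventually_happens trivial_limit_sequentially by blast
    have "(\<Sum>k. f k) = (\<Sum>k. f (k + n)) + (\<Sum>k<n. f k)"
      by (rule suminf_offset) simp
    with n have "(\<Sum>k<n. f k) + (\<Sum>k. f (k + n)) < (\<Sum>k<n. f k) + ennreal e"
      by (simp add: add.commute)
    then have tail: "(\<Sum>k. f (k + n)) < ennreal e"
      by (simp add: ennreal_add_left_cancel_less)
    have "hausdorff1_outer (A - C) \<le> hausdorff1_outer (D n \<union> (\<Union>k. R (k + n)))"
      by (rule hausdorff1_outer_mono[OF AC])
    also have "\<dots> \<le> hausdorff1_outer (D n) + hausdorff1_outer (\<Union>k. R (k + n))"
      by (rule hausdorff1_outer_Un)
    also have "\<dots> \<le> hausdorff1_outer (D n) + (\<Sum>k. f (k + n))"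
      unfolding f_def by (intro add_left_mono hausdorff1_outer_subadditive)
    also have "\<dots> \<le> hausdorff1_outer (D n) + ennreal e"
      using tail by (intro add_left_mono) simp
    finally have 1: "hausdorff1_outer (A - C) \<le> hausdorff1_outer (D n) + ennreal e" .
    have "hausdorff1_outer (A \<inter> C) + hausdorff1_outer (D n) \<le> hausdorff1_outer (A \<inter> C \<union> D n)"
    proof (rule hausdorff1_outer_separated[of "1 / real (Suc n)"])
      fix x y assume "x \<in> A \<inter> C" "y \<in> D n"
      then have "1 / real (Suc n) \<le> infdist y C" by (simp add: D_def)
      also have "\<dots> \<le> dist y x" using \<open>x \<in> A \<inter> C\<close> by (intro infdist_le) simp
      finally show "1 / real (Suc n) \<le> dist x y" by (simp add: dist_commute)
    qed simp
    also have "\<dots> \<le> hausdorff1_outer A"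
      using DA[of n] by (intro hausdorff1_outer_mono) blast
    finally have 2: "hausdorff1_outer (A \<inter> C) + hausdorff1_outer (D n) \<le> hausdorff1_outer A" .
    have "hausdorff1_outer (A \<inter> C) + hausdorff1_outer (A - C)
        \<le> hausdorff1_outer (A \<inter> C) + (hausdorff1_outer (D n) + ennreal e)"
      by (intro add_left_mono 1)
    also have "\<dots> \<le> hausdorff1_outer A + ennreal e"
      using add_right_mono[OF 2, of "ennreal e"] by (simp add: add.assoc)
    finally show "hausdorff1_outer (A \<inter> C) + hausdorff1_outer (A - C) \<le> hausdorff1_outer A + ennreal e" .
  qed
qed

lemma sets_hausdorff1 [simp, measurable_cong]:
  "sets (hausdorff1 :: 'a::metric_space measure) = sets borel"
  using sets.sigma_sets_eq[of "borel :: 'a::metric_space measure"]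
  by (simp add: hausdorff1_def sets_measure_of)

lemma space_hausdorff1 [simp]: "space hausdorff1 = UNIV"
  using sets_eq_imp_space_eq[OF sets_hausdorff1] by simp

lemma emeasure_hausdorff1:
  fixes A :: "'a::metric_space set"
  assumes "A \<in> sets borel"
  shows "emeasure hausdorff1 A = hausdorff1_outer A"
proof -
  interpret P: sigma_algebra "UNIV :: 'a set" "UNIV :: 'a set set"
    using sigma_algebra_Pow[of "UNIV :: 'a set"] by simp
  let ?L = "lambda_system (UNIV :: 'a set) UNIV hausdorff1_outer"
  have "outer_measure_space (UNIV :: 'a set set) hausdorff1_outer"
    by (auto simp: outer_measure_space_def positive_def increasing_def countably_subadditive_def
        intro: hausdorff1_outer_mono hausdorff1_outer_subadditive)
  then have L: "measure_space UNIV ?L hausdorff1_outer"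
    by (rule P.caratheodory_lemma)
  have "C \<in> ?L" if "closed C" for C
  proof -
    have "hausdorff1_outer X \<le> hausdorff1_outer (X \<inter> C) + hausdorff1_outer (X - C)" for X
      using hausdorff1_outer_Un[of "X \<inter> C" "X - C"] by (simp add: Int_Diff_Un)
    then show ?thesis
      using hausdorff1_outer_caratheodory_closed[OF that]
      by (auto simp: P.lambda_system_eq intro: antisym)
  qed
  then have "sigma_sets UNIV (Collect closed) \<subseteq> ?L"
    using L by (intro sigma_algebra.sigma_sets_subset) (auto simp: measure_space_def)
  then have "sets (borel :: 'a measure) \<subseteq> ?L"
    by (simp add: borel_eq_closed)
  moreover have sa: "sigma_algebra UNIV (sets (borel :: 'a measure))"
    using sets.sigma_algebra_axioms[of "borel :: 'a measure"] by simp
  ultimately have "measure_space UNIV (sets borel) (hausdorff1_outer :: 'a set \<Rightarrow> ennreal)"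
    by (intro measure_down[OF L])
  then show ?thesis
    using assms sa unfolding hausdorff1_def
    by (intro emeasure_measure_of_sigma) (auto simp: measure_space_def)
qed

subsection \<open>The flow domain\<close>

definition bottom :: "real \<Rightarrow> (real \<times> real) set" where
  "bottom F = {(X, Y). Y = F}"

definition upper_half_plane :: "real \<Rightarrow> (real \<times> real) set" where
  "upper_half_plane F = {(X, Y). Y > F}"

definition locally_rectifiable :: "(real \<Rightarrow> 'a::metric_space) \<Rightarrow> bool" where
  "locally_rectifiable p \<longleftrightarrow>
     (\<forall>a b. \<exists>M. \<forall>t n. mono t \<and> range t \<subseteq> {a..b} \<longrightarrow>
        (\<Sum>i<(n::nat). dist (p (t i)) (p (t (Suc i)))) \<le> M)"

text \<open>\<open>P\<close> is the period of the parametrization, \<open>2L\<close> the spatial one.\<close>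

definition periodic_curve :: "real \<Rightarrow> (real \<times> real) set \<Rightarrow> bool" where
  "periodic_curve L S \<longleftrightarrow>
     (\<exists>p P. continuous_on UNIV p \<and> inj p \<and> range p = S \<and> locally_rectifiable p \<and>
            P > 0 \<and> (\<forall>s. p (s + P) = p s + (2 * L, 0)))"

text \<open>For \<open>S\<close> a periodic curve above the bottom, the complement of the union of \<open>S\<close> and the bottom has three components; the
  condition on the frontier singles out the one between the two curves.\<close>

definition flow_domain :: "real \<Rightarrow> (real \<times> real) set \<Rightarrow> (real \<times> real) set \<Rightarrow> bool" where
  "flow_domain F S \<Omega> \<longleftrightarrow>
     open \<Omega> \<and> connected \<Omega> \<and> \<Omega> \<subseteq> upper_half_plane F \<and> frontier \<Omega> = S \<union> bottom F"

subsection \<open>Weak solutions and extreme waves\<close>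

text \<open>Values of \<open>\<psi>\<close> outside the closure of \<open>\<Omega>\<close>, and of \<open>\<gamma>\<close> outside \<open>[0, B]\<close>,
  are irrelevant.\<close>

definition weak_solution ::
  "real \<Rightarrow> real \<Rightarrow> real \<Rightarrow> (real \<Rightarrow> real) \<Rightarrow> real \<Rightarrow> (real \<times> real) set \<Rightarrow> (real \<times> real) set
     \<Rightarrow> (real \<times> real \<Rightarrow> real) \<Rightarrow> real \<Rightarrow> bool" where
  "weak_solution g B L \<gamma> F S \<Omega> \<psi> Q \<longleftrightarrow>
     periodic_curve L S \<and> S \<subseteq> upper_half_plane F \<and> flow_domain F S \<Omega> \<and>
     (\<exists>C. C-lipschitz_on (closure \<Omega>) \<psi>) \<and>
     (\<forall>X Y. (X, Y) \<in> closure \<Omega> \<longrightarrow> \<psi> (X + 2 * L, Y) = \<psi> (X, Y)) \<and>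
     (\<forall>x\<in>\<Omega>. 0 \<le> \<psi> x \<and> \<psi> x \<le> B) \<and>
     (\<forall>x\<in>bottom F. \<psi> x = B) \<and>
     (\<forall>x\<in>S. \<psi> x = 0) \<and>
     (\<forall>\<zeta>\<in>C1_compact_support \<Omega>.
        (LINT x:\<Omega>|lborel. grad \<psi> x \<bullet> grad \<zeta> x) = (LINT x:\<Omega>|lborel. \<gamma> (\<psi> x) * \<zeta> x)) \<and>
     (\<forall>x\<in>S. Q - 2 * g * snd x \<ge> 0) \<and>
     (\<forall>\<zeta>\<in>C1_compact_support (upper_half_plane F).
        (LINT x:\<Omega>|lborel. grad \<psi> x \<bullet> grad \<zeta> x) =
        (LINT x:\<Omega>|lborel. \<gamma> (\<psi> x) * \<zeta> x) -
        (LINT x:S|hausdorff1. sqrt (Q - 2 * g * snd x) * \<zeta> x))"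

definition stagnation_point :: "real \<Rightarrow> real \<Rightarrow> (real \<times> real) set \<Rightarrow> real \<times> real \<Rightarrow> bool" where
  "stagnation_point g Q S x \<longleftrightarrow> x \<in> S \<and> Q - 2 * g * snd x = 0"

definition extreme_wave ::
  "real \<Rightarrow> real \<Rightarrow> real \<Rightarrow> (real \<Rightarrow> real) \<Rightarrow> real \<Rightarrow> (real \<times> real) set \<Rightarrow> (real \<times> real) set
     \<Rightarrow> (real \<times> real \<Rightarrow> real) \<Rightarrow> real \<Rightarrow> bool" where
  "extreme_wave g B L \<gamma> F S \<Omega> \<psi> Q \<longleftrightarrow>
     weak_solution g B L \<gamma> F S \<Omega> \<psi> Q \<and> (\<exists>x. stagnation_point g Q S x)"

subsection \<open>The function \<open>T[\<psi>]\<close> and the slope quotient\<close>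

definition Gamma_hat :: "(real \<Rightarrow> real) \<Rightarrow> real \<Rightarrow> real" where
  "Gamma_hat \<gamma> r = integral {0..r} \<gamma>"

text \<open>For continuous \<open>\<gamma>\<close> the supremum over \<open>[0, B]\<close> is a maximum.\<close>

definition varpi :: "real \<Rightarrow> (real \<Rightarrow> real) \<Rightarrow> real" where
  "varpi B \<gamma> = 1/2 * max 0 (SUP r\<in>{0..B}. \<gamma> r)"

definition T_fun ::
  "real \<Rightarrow> real \<Rightarrow> (real \<Rightarrow> real) \<Rightarrow> (real \<times> real \<Rightarrow> real) \<Rightarrow> real \<times> real \<Rightarrow> real" where
  "T_fun g B \<gamma> \<psi> x =
     1/2 * (norm (grad \<psi> x))\<^sup>2 + g * snd x + Gamma_hat \<gamma> (\<psi> x) - varpi B \<gamma> * \<psi> x"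

text \<open>Division in \<^typ>\<open>ennreal\<close> gives \<open>\<infinity>\<close> when \<open>u s = 0 \<noteq> v s\<close>.\<close>

definition slope_quotient :: "(real \<Rightarrow> real) \<Rightarrow> (real \<Rightarrow> real) \<Rightarrow> real \<Rightarrow> ennreal" where
  "slope_quotient u v s = ennreal \<bar>v s\<bar> / ennreal \<bar>u s\<bar>"

end

theory Submission
  imports Defs
begin

text \<open>
  The weak formulation near the crest is tested with
  \<open>r\<close> to the power \<open>- 3/2\<close> times \<open>cos (3/2 (s - m))\<close>, a harmonic function of the polar coordinates
  \<open>r, s\<close>, times a bump of length \<open>\<Lambda>\<close> in \<open>ln r\<close>. As \<open>T[\<psi>] \<le> 0\<close> gives \<open>|\<nabla>\<psi>|\<^sup>2 = O(r)\<close> and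
  \<open>\<psi> = O(r\<^bsup>3/2\<^esup>)\<close>, the integral over \<open>\<Omega>\<close> stays bounded as \<open>\<Lambda> \<rightarrow> \<infinity>\<close>, whereas a ray of \<open>S\<close> at
  angle \<open>\<theta>\<close> from the downward vertical contributes at least a multiple of
  \<open>sqrt (cos \<theta>) cos (3/2 (\<theta> - m)) \<Lambda>\<close>. Let \<open>\<theta>\<^sub>+\<close> and \<open>\<theta>\<^sub>-\<close> be the limiting angles on the two sides.
  Unless \<open>\<theta>\<^sub>+ + \<theta>\<^sub>- = 2\<pi>/3\<close>, the phase \<open>m\<close> and the sign can be chosen so that both rays contribute
  with the same sign, which forces \<open>cos \<theta> = 0\<close> on both. If the sum is \<open>2\<pi>/3\<close>, the two contributions have
  opposite signs for the best \<open>m\<close>; the upper bound for one of them that follows from the sharp form of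
  \<open>T[\<psi>] \<le> 0\<close> in a thin sector then yields \<open>cos \<theta>\<^sub>+ = cos \<theta>\<^sub>-\<close>.

  If both angles are \<open>\<pi>/2\<close>, then \<open>\<Omega>\<close> contains cones of angle close to \<open>\<pi>\<close>. In such a cone there are
  subsolutions growing like \<open>r\<close> to the power \<open>- \<lambda>\<close> with \<open>\<lambda> < 3/2\<close>; testing with these, the condition
  \<open>\<gamma> \<ge> 0\<close> near \<open>0\<close> and \<open>\<psi> = O(r\<^bsup>3/2\<^esup>)\<close> give \<open>\<psi> = 0\<close> on an open subset of \<open>\<Omega>\<close>, against \<open>\<psi>\<^sub>Y < 0\<close>.
\<close>

subsection \<open>Lipschitz functions are differentiable almost everywhere\<close>

text \<open>With t = ln r, the power -3/2 is the scale invariant one. Along a ray that is not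
  horizontal, \<open>sqrt (- 2 * g * Y)\<close> is of the order of the square root of r, so its
  product with r^(-3/2) dr is a multiple of dt; and \<psi> = O(r^(3/2)) times the Laplacian of a
  function of degree -3/2 is an O(1) density for dt ds. Harmonicity removes exactly this critical
  density: what remains in the fluid carries a derivative of the bump, O(1 / \<Lambda>) on a length
  \<Lambda>. The vorticity term is smaller by a factor sqrt r and is absorbed by first fixing a
  small outer scale. Long logarithmic intervals thus take the place of a blow-up limit. The mode
  that is even about the bisector of the wedge takes the same value on both rays and vanishes there
  only for the opening 2 \<pi>/3: this is the origin of the Stokes angle. The obstacle is
  regularity: the gradient bound concerns the pointwise gradient of a Lipschitz function in a domain
  without smooth boundary. Extending by zero moves all integrals to the plane, where a.e.
  differentiability and integration by parts of Lipschitz functions suffice.\<close>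

lemma bounded_not_oscillating_convergent:
  fixes \<sigma> :: "'a \<Rightarrow> real"
  assumes "F \<noteq> bot" and bd: "\<And>x. \<bar>\<sigma> x\<bar> \<le> M"
    and osc: "\<And>p q. p < q \<Longrightarrow> p \<in> \<rat> \<Longrightarrow> q \<in> \<rat> \<Longrightarrow> \<not> ((\<exists>\<^sub>F x in F. \<sigma> x < p) \<and> (\<exists>\<^sub>F x in F. \<sigma> x > q))"
  shows "\<exists>l. (\<sigma> \<longlongrightarrow> l) F"
proof -
  define A where "A = {q. \<forall>\<^sub>F x in F. \<sigma> x \<le> q}"
  \<comment> \<open>\<open>l\<close> is the limit superior of \<open>\<sigma>\<close> along
    \<open>F\<close>; the eventual upper bounds are bounded below because \<open>F\<close> is not
    trivial.\<close>
  define l where "l = Inf A"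
  have MA: "M \<in> A" using bd by (auto simp: A_def abs_le_iff)
  have lowA: "- M \<le> q" if "q \<in> A" for q
  proof -
    have "\<exists>x. \<sigma> x \<le> q"
      using eventually_happens'[OF \<open>F \<noteq> bot\<close>] that unfolding A_def by blast
    then show ?thesis using bd by (smt (verit) abs_le_iff)
  qed
  have bb: "bdd_below A" using lowA by (auto simp: bdd_below_def)
  have "(\<sigma> \<longlongrightarrow> l) F"
  proof (rule order_tendstoI)
    fix a assume "l < a"
    then obtain q where "q \<in> A" "q < a"
      unfolding l_def using MA bb by (metis cInf_less_iff empty_iff)
    then show "\<forall>\<^sub>F x in F. \<sigma> x < a"
      unfolding A_def by (auto elim!: eventually_mono)
  next
    fix a assume "a < l"
    then obtain p where p: "a < p" "p < l" "p \<in> \<rat>" using Rats_dense_in_real by blast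
    then obtain q where q: "p < q" "q < l" "q \<in> \<rat>" using Rats_dense_in_real by blast
    have "q \<notin> A" using q(2) bb unfolding l_def by (meson cInf_lower not_less)
    then have "\<exists>\<^sub>F x in F. \<sigma> x > q"
      unfolding A_def frequently_def by (simp add: not_less)
    then have "\<forall>\<^sub>F x in F. \<not> \<sigma> x < p"
      using osc[OF q(1) p(3) q(3)] by (auto simp: not_frequently)
    then show "\<forall>\<^sub>F x in F. a < \<sigma> x"
      using p(1) by (auto elim!: eventually_mono)
  qed
  then show ?thesis by blast
qed

section \<open>Oscillation sets of difference quotients\<close>

definition osc_points :: "('a::real_normed_vector \<Rightarrow> real) \<Rightarrow> 'a \<Rightarrow> real \<Rightarrow> real \<Rightarrow> 'a set" where
  "osc_points f e p q =
     {x. (\<exists>\<^sub>F h in at 0. (f (x + h *\<^sub>R e) - f x) / h < p) \<and>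
         (\<exists>\<^sub>F h in at 0. (f (x + h *\<^sub>R e) - f x) / h > q)}"

lemma frequently_at_0_iff:
  "(\<exists>\<^sub>F h in at (0::real). P h) \<longleftrightarrow> (\<forall>n::nat. \<exists>h. h \<noteq> 0 \<and> \<bar>h\<bar> < inverse (Suc n) \<and> P h)"
proof -
  have "(\<exists>\<^sub>F h in at (0::real). P h) \<longleftrightarrow> (\<forall>d>0. \<exists>h. h \<noteq> 0 \<and> \<bar>h\<bar> < d \<and> P h)"
    unfolding frequently_def eventually_at by (auto simp: dist_real_def)
  also have "\<dots> \<longleftrightarrow> (\<forall>n::nat. \<exists>h. h \<noteq> 0 \<and> \<bar>h\<bar> < inverse (Suc n) \<and> P h)"
  proof (intro iffI allI impI)
    fix n :: nat assume "\<forall>d>0. \<exists>h. h \<noteq> 0 \<and> \<bar>h\<bar> < d \<and> P h"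
    then show "\<exists>h. h \<noteq> 0 \<and> \<bar>h\<bar> < inverse (Suc n) \<and> P h"
      by (auto simp del: of_nat_Suc)
  next
    fix d :: real assume *: "\<forall>n::nat. \<exists>h. h \<noteq> 0 \<and> \<bar>h\<bar> < inverse (Suc n) \<and> P h" and "d > 0"
    from reals_Archimedean[OF \<open>d > 0\<close>] obtain n where n: "inverse (real (Suc n)) < d" ..
    from * obtain h where "h \<noteq> 0" "\<bar>h\<bar> < inverse (Suc n)" "P h" by blast
    with n show "\<exists>h. h \<noteq> 0 \<and> \<bar>h\<bar> < d \<and> P h" by (intro exI[of _ h]) (simp del: of_nat_Suc)
  qed
  finally show ?thesis .
qed

text \<open>For fixed n, the points that admit some h below 1/(n+1) with slope under p form a union
  of open sets, so measurability survives although h ranges over an uncountable set.\<close>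

lemma osc_points_borel:
  fixes f :: "'a::real_normed_vector \<Rightarrow> real"
  assumes "continuous_on UNIV f"
  shows "osc_points f e p q \<in> sets borel"
proof -
  have c: "continuous_on UNIV (\<lambda>x. (f (x + h *\<^sub>R e) - f x) / h)" if "h \<noteq> 0" for h
    by (intro continuous_intros continuous_on_compose2[OF assms]) (use that in auto)
  define A where "A n = (\<Union>h\<in>{h. h \<noteq> 0 \<and> \<bar>h\<bar> < inverse (Suc n)}. {x. (f (x + h *\<^sub>R e) - f x) / h < p})" for n :: nat
  define B where "B n = (\<Union>h\<in>{h. h \<noteq> 0 \<and> \<bar>h\<bar> < inverse (Suc n)}. {x. (f (x + h *\<^sub>R e) - f x) / h > q})" for n :: nat
  have "open (A n)" "open (B n)" for n
    unfolding A_def B_def by (auto intro!: open_UN open_Collect_less continuous_on_const c)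
  then have "(\<Inter>n. A n) \<inter> (\<Inter>n. B n) \<in> sets borel" by auto
  moreover have "osc_points f e p q = (\<Inter>n. A n) \<inter> (\<Inter>n. B n)"
    unfolding osc_points_def A_def B_def frequently_at_0_iff by blast
  ultimately show ?thesis by simp
qed

text \<open>The segments have x as an end point, not as centre, and may lie on either side of it,
  whence min and max. Pairs of end points index the balls of the covering theorem.\<close>

lemma vitali_segments:
  fixes E U :: "real set" and R :: "real \<Rightarrow> real \<Rightarrow> bool"
  assumes U: "open U" "E \<subseteq> U"
    and fine: "\<And>x. x \<in> E \<Longrightarrow> \<exists>\<^sub>F h in at 0. R (min x (x + h)) (max x (x + h))"
  obtains C where "countable C" "\<And>c. c \<in> C \<Longrightarrow> fst c < snd c \<and> {fst c..snd c} \<subseteq> U \<and> R (fst c) (snd c)"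
    "disjoint_family_on (\<lambda>c. {fst c..snd c}) C" "negligible (E - (\<Union>c\<in>C. {fst c..snd c}))"
proof -
  define K where "K = {c::real\<times>real. fst c < snd c \<and> {fst c..snd c} \<subseteq> U \<and> R (fst c) (snd c)}"
  have cb: "cball ((fst c + snd c)/2) ((snd c - fst c)/2) = {fst c..snd c}" for c :: "real\<times>real"
    unfolding cball_eq_atLeastAtMost by (simp add: field_simps)
  have "\<exists>c. c \<in> K \<and> x \<in> cball ((fst c + snd c)/2) ((snd c - fst c)/2) \<and> (snd c - fst c)/2 < d"
    if "x \<in> E" "0 < d" for x d
  proof -
    obtain r where r: "r > 0" "cball x r \<subseteq> U" using U \<open>x \<in> E\<close> open_contains_cball by blast
    have "\<forall>\<^sub>F h in at (0::real). h \<noteq> 0 \<and> \<bar>h\<bar> < min r d"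
      unfolding eventually_at using r(1) \<open>0 < d\<close> by (intro exI[of _ "min r d"]) (auto simp: dist_real_def)
    from frequently_eventually_frequently[OF fine[OF \<open>x \<in> E\<close>] this]
    obtain h where h: "R (min x (x + h)) (max x (x + h))" "h \<noteq> 0" "\<bar>h\<bar> < r" "\<bar>h\<bar> < d"
      by (auto dest: frequently_ex)
    have "{min x (x + h)..max x (x + h)} \<subseteq> cball x r"
      using h by (auto simp: cball_eq_atLeastAtMost)
    with r h show ?thesis
      unfolding cb by (intro exI[of _ "(min x (x+h), max x (x+h))"]) (auto simp: K_def)
  qed
  then obtain C where C: "countable C" "C \<subseteq> K"
     "pairwise (\<lambda>i j. disjnt (cball ((fst i + snd i)/2) ((snd i - fst i)/2)) (cball ((fst j + snd j)/2) ((snd j - fst j)/2))) C"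
     "negligible (E - (\<Union>c\<in>C. cball ((fst c + snd c)/2) ((snd c - fst c)/2)))"
    by (rule Vitali_covering_theorem_cballs[of K "\<lambda>c. (snd c - fst c)/2" E "\<lambda>c. (fst c + snd c)/2", rotated])
       (auto simp: K_def)
  show ?thesis
  proof
    show "disjoint_family_on (\<lambda>c. {fst c..snd c}) C"
      using C(3) unfolding cb disjoint_family_on_def pairwise_def disjnt_def by blast
  qed (use C in \<open>auto simp: cb K_def\<close>)
qed

text \<open>Lebesgue's argument for monotone functions: cover the set by segments of slope below p,
  then cover it again, inside those, by segments of slope above q. The Stieltjes measure of f adds
  up the increments and is monotone in the set, which gives q |E| \<le> p |E|.\<close>

lemma osc_points_mono_negligible:
  fixes f :: "real \<Rightarrow> real"
  assumes mono: "mono f" and cont: "continuous_on UNIV f" and pq: "p < q"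
  shows "negligible (osc_points f 1 p q)"
proof -
  define E where "E = osc_points f 1 p q"
  have slope0: "0 \<le> (f (x + h) - f x) / h" for x h
    using mono by (cases "h \<ge> 0") (auto simp: mono_def divide_nonneg_nonneg divide_nonpos_nonpos)
  have slope_sym: "(f (x + h) - f x) / h = (f (max x (x+h)) - f (min x (x+h))) / (max x (x+h) - min x (x+h))" for x h
    by (cases "h \<ge> 0") (auto simp: max_def min_def field_simps)
  show ?thesis
  proof (cases "p \<le> 0")
    case True
    have "osc_points f 1 p q = {}"
    proof -
      have "\<not> (f (x + h) - f x) / h < p" for x h using slope0[of x h] True by linarith
      then show ?thesis by (simp add: osc_points_def)
    qed
    then show ?thesis by simp
  next
    case False
    then have p0: "p > 0" by simp
    let ?\<mu> = "interval_measure f"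
    have rc: "continuous (at_right a) f" for a
      using cont by (simp add: continuous_on_eq_continuous_at continuous_at_imp_continuous_at_within)
    have mu_Icc: "emeasure ?\<mu> {a..b} = ennreal (f b - f a)" if "a \<le> b" for a b
      by (rule emeasure_interval_measure_Icc[OF that])
         (use mono cont in \<open>auto simp: mono_def intro: continuous_on_subset\<close>)
    have "negligible (E \<inter> {-m<..<m})" for m :: real
    proof -
      \<comment> \<open>q s \<le> p s forces s = 0 only for finite s, so the set is cut into bounded
        pieces.\<close>
      define E0 where "E0 = E \<inter> {-m<..<m}"
      have E0b: "E0 \<in> sets borel" unfolding E0_def E_def using osc_points_borel[OF cont] by auto
      have E0l: "E0 \<in> lmeasurable"
      proof (rule bounded_set_imp_lmeasurable)
        show "bounded E0" unfolding E0_def by (rule bounded_subset[of "{-m<..<m}"]) auto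
        show "E0 \<in> sets lebesgue" using E0b by (simp add: sets_completionI_sets)
      qed
      have key: "ennreal q * emeasure lebesgue E0 \<le> ennreal p * (emeasure lebesgue E0 + ennreal \<epsilon>)" if "\<epsilon> > 0" for \<epsilon>
      proof -
        obtain U where U: "open U" "E0 \<subseteq> U" "(U - E0) \<in> lmeasurable" "emeasure lebesgue (U - E0) < ennreal \<epsilon>"
          using sets_lebesgue_outer_open[of E0 \<epsilon>] E0l \<open>\<epsilon> > 0\<close> by (metis fmeasurableD)
        have Ubor: "U \<in> sets borel" using U(1) by simp
        have emU: "emeasure lebesgue U \<le> emeasure lebesgue E0 + ennreal \<epsilon>"
        proof -
          have "U = E0 \<union> (U - E0)" using U(2) by auto
          then have "emeasure lebesgue U \<le> emeasure lebesgue E0 + emeasure lebesgue (U - E0)"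
            using emeasure_subadditive[of E0 lebesgue "U - E0"] E0l U(3) by (metis fmeasurableD)
          also have "\<dots> \<le> emeasure lebesgue E0 + ennreal \<epsilon>" using U(4) by (intro add_left_mono) simp
          finally show ?thesis .
        qed
        obtain C where C: "countable C" "\<And>c. c \<in> C \<Longrightarrow> fst c < snd c \<and> {fst c..snd c} \<subseteq> U \<and> (f (snd c) - f (fst c)) / (snd c - fst c) < p"
            "disjoint_family_on (\<lambda>c. {fst c..snd c}) C" "negligible (E0 - (\<Union>c\<in>C. {fst c..snd c}))"
          by (rule vitali_segments[OF U(1,2), of "\<lambda>x y. (f y - f x) / (y - x) < p"])
             (auto simp: E0_def E_def osc_points_def slope_sym[symmetric])
        \<comment> \<open>Passing to open segments loses only countably many end points and gives an
          open set inside which the second covering can stay.\<close>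
        define V where "V = (\<Union>c\<in>C. {fst c<..<snd c})"
        have "open V" unfolding V_def by auto
        have negV: "negligible (E0 - V)"
        proof -
          have "E0 - V \<subseteq> (E0 - (\<Union>c\<in>C. {fst c..snd c})) \<union> (fst ` C \<union> snd ` C)"
            by (force simp: V_def)
          moreover have "negligible (fst ` C \<union> snd ` C)" using C(1)
            by (simp add: negligible_iff_null_sets null_sets_completionI countable_imp_null_set_lborel)
          ultimately show ?thesis using C(4) by (meson negligible_Un negligible_subset)
        qed
        obtain D where D: "countable D" "\<And>c. c \<in> D \<Longrightarrow> fst c < snd c \<and> {fst c..snd c} \<subseteq> V \<and> (f (snd c) - f (fst c)) / (snd c - fst c) > q"
            "disjoint_family_on (\<lambda>c. {fst c..snd c}) D" "negligible (E0 \<inter> V - (\<Union>c\<in>D. {fst c..snd c}))"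
          by (rule vitali_segments[OF \<open>open V\<close>, of "E0 \<inter> V" "\<lambda>x y. (f y - f x) / (y - x) > q"])
             (auto simp: E0_def E_def osc_points_def slope_sym[symmetric])
        have em: "emeasure lborel {a..b} = ennreal (b - a)" if "a < b" for a b :: real
          using that by simp
        have mu: "emeasure ?\<mu> {a..b} = ennreal (f b - f a)" if "a < b" for a b
          using that mu_Icc by simp
        have UD: "emeasure lebesgue (\<Union>c\<in>D. {fst c..snd c}) = (\<integral>\<^sup>+c. ennreal (snd c - fst c) \<partial>count_space D)"
          using D by (subst emeasure_UN_countable) (auto intro!: nn_integral_cong simp: em)
        have UDm: "emeasure ?\<mu> (\<Union>c\<in>D. {fst c..snd c}) = (\<integral>\<^sup>+c. ennreal (f (snd c) - f (fst c)) \<partial>count_space D)"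
          using D by (subst emeasure_UN_countable) (auto intro!: nn_integral_cong simp: mu)
        have UC: "emeasure lebesgue (\<Union>c\<in>C. {fst c..snd c}) = (\<integral>\<^sup>+c. ennreal (snd c - fst c) \<partial>count_space C)"
          using C by (subst emeasure_UN_countable) (auto intro!: nn_integral_cong simp: em)
        have UCm: "emeasure ?\<mu> (\<Union>c\<in>C. {fst c..snd c}) = (\<integral>\<^sup>+c. ennreal (f (snd c) - f (fst c)) \<partial>count_space C)"
          using C by (subst emeasure_UN_countable) (auto intro!: nn_integral_cong simp: mu)
        have UDb: "(\<Union>c\<in>D. {fst c..snd c}) \<in> sets borel" using D(1) by auto
        have UCb: "(\<Union>c\<in>C. {fst c..snd c}) \<in> sets borel" using C(1) by auto
        have "emeasure lebesgue E0 \<le> emeasure lebesgue ((\<Union>c\<in>D. {fst c..snd c}) \<union> ((E0 \<inter> V - (\<Union>c\<in>D. {fst c..snd c})) \<union> (E0 - V)))"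
          using UDb D(4) negV by (intro emeasure_mono) (auto simp: negligible_imp_sets)
        also have "\<dots> = emeasure lebesgue (\<Union>c\<in>D. {fst c..snd c})"
        proof (rule emeasure_Un_null_set)
          show "(\<Union>c\<in>D. {fst c..snd c}) \<in> sets lebesgue" using UDb by auto
          show "(E0 \<inter> V - (\<Union>c\<in>D. {fst c..snd c})) \<union> (E0 - V) \<in> null_sets lebesgue"
            using D(4) negV by (simp add: negligible_iff_null_sets[symmetric] negligible_Un)
        qed
        finally have "ennreal q * emeasure lebesgue E0 \<le> ennreal q * emeasure lebesgue (\<Union>c\<in>D. {fst c..snd c})"
          by (intro mult_left_mono) auto
        also have "\<dots> = (\<integral>\<^sup>+c. ennreal q * ennreal (snd c - fst c) \<partial>count_space D)"
          unfolding UD by (subst nn_integral_cmult) auto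
        also have "\<dots> \<le> (\<integral>\<^sup>+c. ennreal (f (snd c) - f (fst c)) \<partial>count_space D)"
        proof (intro nn_integral_mono)
          fix c assume "c \<in> space (count_space D)"
          then have "fst c < snd c" "q < (f (snd c) - f (fst c)) / (snd c - fst c)" using D(2) by auto
          then have "q * (snd c - fst c) \<le> f (snd c) - f (fst c)" by (simp add: field_simps)
          then show "ennreal q * ennreal (snd c - fst c) \<le> ennreal (f (snd c) - f (fst c))"
            using p0 pq \<open>fst c < snd c\<close> by (simp add: ennreal_mult[symmetric] ennreal_leI)
        qed
        also have "\<dots> = emeasure ?\<mu> (\<Union>c\<in>D. {fst c..snd c})" unfolding UDm ..
        also have "\<dots> \<le> emeasure ?\<mu> (\<Union>c\<in>C. {fst c..snd c})"
        proof (rule emeasure_mono)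
          have "V \<subseteq> (\<Union>c\<in>C. {fst c..snd c})" by (force simp: V_def)
          then show "(\<Union>c\<in>D. {fst c..snd c}) \<subseteq> (\<Union>c\<in>C. {fst c..snd c})" using D(2) by blast
          show "(\<Union>c\<in>C. {fst c..snd c}) \<in> sets ?\<mu>" using UCb by simp
        qed
        also have "\<dots> = (\<integral>\<^sup>+c. ennreal (f (snd c) - f (fst c)) \<partial>count_space C)" unfolding UCm ..
        also have "\<dots> \<le> (\<integral>\<^sup>+c. ennreal p * ennreal (snd c - fst c) \<partial>count_space C)"
        proof (intro nn_integral_mono)
          fix c assume "c \<in> space (count_space C)"
          then have "fst c < snd c" "(f (snd c) - f (fst c)) / (snd c - fst c) < p" using C(2) by auto
          then have "f (snd c) - f (fst c) \<le> p * (snd c - fst c)" by (simp add: field_simps)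
          then show "ennreal (f (snd c) - f (fst c)) \<le> ennreal p * ennreal (snd c - fst c)"
            using p0 \<open>fst c < snd c\<close> by (simp add: ennreal_mult[symmetric] ennreal_leI)
        qed
        also have "\<dots> = ennreal p * emeasure lebesgue (\<Union>c\<in>C. {fst c..snd c})"
          unfolding UC by (subst nn_integral_cmult) auto
        also have "\<dots> \<le> ennreal p * emeasure lebesgue U"
          using C(2) Ubor by (intro mult_left_mono emeasure_mono) auto
        also have "\<dots> \<le> ennreal p * (emeasure lebesgue E0 + ennreal \<epsilon>)"
          using emU by (intro mult_left_mono) auto
        finally show ?thesis .
      qed
      define s where "s = measure lebesgue E0"
      have s: "emeasure lebesgue E0 = ennreal s" "s \<ge> 0"
        using E0l by (auto simp: s_def emeasure_eq_measure2)
      have "q * s \<le> p * (s + \<epsilon>)" if "\<epsilon> > 0" for \<epsilon>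
        using key[OF that] p0 pq s that
        by (simp add: ennreal_mult[symmetric] ennreal_plus[symmetric] del: ennreal_plus)
      note this' = this
      have "(q - p) * s \<le> 0"
      proof (rule field_le_epsilon)
        fix e :: real assume "e > 0"
        then show "(q - p) * s \<le> 0 + e" using this'[of "e / p"] p0 by (simp add: distrib_left left_diff_distrib)
      qed
      then have "s \<le> 0" using pq by (simp add: mult_le_0_iff)
      then have "emeasure lebesgue E0 = 0" using s by simp
      then show ?thesis using E0l unfolding E0_def[symmetric]
        by (simp add: negligible_iff_emeasure0 fmeasurableD)
    qed
    then have "negligible (\<Union>n::nat. E \<inter> {-real n<..<real n})" by (intro negligible_Union_nat) auto
    moreover have "E \<subseteq> (\<Union>n::nat. E \<inter> {-real n<..<real n})"
    proof
      fix x assume "x \<in> E"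
      obtain n :: nat where "\<bar>x\<bar> < real n" using reals_Archimedean2 by blast
      then show "x \<in> (\<Union>n::nat. E \<inter> {-real n<..<real n})" using \<open>x \<in> E\<close> by (auto intro!: exI[of _ n])
    qed
    ultimately show ?thesis unfolding E_def by (rule negligible_subset)
  qed
qed

text \<open>Adding K x makes f monotone and moves every slope, hence p and q, by K.\<close>

lemma osc_points_lipschitz_negligible:
  fixes f :: "real \<Rightarrow> real"
  assumes lip: "K-lipschitz_on UNIV f" and pq: "p < q"
  shows "negligible (osc_points f 1 p q)"
proof -
  define k where "k x = f x + K * x" for x
  have "mono k"
  proof (rule monoI)
    fix x y :: real assume "x \<le> y"
    then show "k x \<le> k y" using lipschitz_onD[OF lip, of x y] by (auto simp: k_def dist_real_def algebra_simps)
  qed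
  moreover have "continuous_on UNIV k"
    unfolding k_def by (intro continuous_intros lipschitz_on_continuous_on[OF lip])
  moreover have "osc_points f 1 p q = osc_points k 1 (p + K) (q + K)"
  proof -
    have ev: "\<forall>\<^sub>F h in at (0::real). h \<noteq> 0" by (simp add: eventually_at_filter)
    have *: "(k (x + h) - k x) / h = (f (x + h) - f x) / h + K" if "h \<noteq> 0" for x h
      using that by (simp add: k_def field_simps)
    have "(\<exists>\<^sub>F h in at 0. (f (x + h) - f x) / h < p) \<longleftrightarrow> (\<exists>\<^sub>F h in at 0. (k (x + h) - k x) / h < p + K)"
      "(\<exists>\<^sub>F h in at 0. (f (x + h) - f x) / h > q) \<longleftrightarrow> (\<exists>\<^sub>F h in at 0. (k (x + h) - k x) / h > q + K)" for x
      by (intro frequently_cong[OF ev]; simp add: *)+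
    then show ?thesis unfolding osc_points_def by simp
  qed
  ultimately show ?thesis using osc_points_mono_negligible[of k "p+K" "q+K"] pq by simp
qed

text \<open>The shear (X, Y) to (X + a Y, Y) preserves area and takes vertical lines to lines of
  direction (a, 1), on each of which the one-variable lemma applies; Tonelli does the rest.\<close>

lemma osc_points_oblique_null:
  fixes f :: "real \<times> real \<Rightarrow> real"
  assumes lip: "K-lipschitz_on UNIV f" and pq: "p < q"
  shows "osc_points f (a, 1) p q \<in> null_sets lborel"
proof -
  define N where "N = osc_points f (a, 1) p q"
  have cont: "continuous_on UNIV f" by (rule lipschitz_on_continuous_on[OF lip])
  have N: "N \<in> sets borel" unfolding N_def by (rule osc_points_borel[OF cont])
  then have N2[measurable]: "N \<in> sets (borel \<Otimes>\<^sub>M borel)" unfolding borel_prod .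
  have slice: "emeasure lborel {y. (x + a * y, y) \<in> N} = 0" for x
  proof -
    have "(sqrt (a\<^sup>2 + 1) * K)-lipschitz_on UNIV (\<lambda>y. f (x + a * y, y))"
    proof (rule lipschitz_onI)
      fix y z :: real
      have "dist (f (x + a * y, y)) (f (x + a * z, z)) \<le> K * dist (x + a * y, y) (x + a * z, z)"
        using lipschitz_onD[OF lip] by blast
      also have "dist (x + a * y, y) (x + a * z, z) = sqrt (a\<^sup>2 + 1) * dist y z"
      proof -
        have "(x + a * y - (x + a * z))\<^sup>2 + (y - z)\<^sup>2 = (a\<^sup>2 + 1) * (y - z)\<^sup>2"
          by (simp add: power2_eq_square algebra_simps)
        then show ?thesis by (simp add: dist_Pair_Pair dist_real_def real_sqrt_mult)
      qed
      finally show "dist (f (x + a * y, y)) (f (x + a * z, z)) \<le> sqrt (a\<^sup>2 + 1) * K * dist y z"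
        by (simp add: mult_ac)
    qed (use lipschitz_on_nonneg[OF lip] in simp)
    from osc_points_lipschitz_negligible[OF this pq]
    have neg: "negligible (osc_points (\<lambda>y. f (x + a * y, y)) 1 p q)" .
    have eq: "{y. (x + a * y, y) \<in> N} = osc_points (\<lambda>y. f (x + a * y, y)) 1 p q"
      unfolding N_def osc_points_def by (simp add: algebra_simps)
    have "{y. (x + a * y, y) \<in> N} \<in> sets borel"
      unfolding eq by (intro osc_points_borel continuous_on_compose2[OF cont] continuous_intros) auto
    then show ?thesis using neg eq by (simp add: negligible_iff_emeasure0 sets_completionI_sets)
  qed
  have [measurable]: "(\<lambda>p. indicator N p :: ennreal) \<in> borel_measurable (lborel \<Otimes>\<^sub>M lborel)" by measurable
  have "emeasure (lborel :: (real\<times>real) measure) N = (\<integral>\<^sup>+p. indicator N p \<partial>(lborel \<Otimes>\<^sub>M lborel))"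
    using N by (simp add: lborel_prod)
  also have "\<dots> = (\<integral>\<^sup>+y. \<integral>\<^sup>+x. indicator N (x, y) \<partial>lborel \<partial>lborel)"
    by (rule lborel_pair.nn_integral_snd[symmetric]) simp
  also have "\<dots> = (\<integral>\<^sup>+y. \<integral>\<^sup>+x. indicator N (x + a * y, y) \<partial>lborel \<partial>lborel)"
  proof (rule nn_integral_cong)
    fix y :: real
    have "(\<lambda>x. indicator N (x, y) :: ennreal) \<in> borel_measurable borel" by measurable
    from nn_integral_real_affine[OF this, of 1 "a * y"]
    show "(\<integral>\<^sup>+x. indicator N (x, y) \<partial>lborel) = (\<integral>\<^sup>+x. indicator N (x + a * y, y) \<partial>lborel)"
      by (simp add: add.commute)
  qed
  also have "\<dots> = (\<integral>\<^sup>+x. \<integral>\<^sup>+y. indicator N (x + a * y, y) \<partial>lborel \<partial>lborel)"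
    by (rule lborel_pair.Fubini') measurable
  also have "\<dots> = (\<integral>\<^sup>+x. emeasure lborel {y. (x + a * y, y) \<in> N} \<partial>lborel)"
  proof (rule nn_integral_cong)
    fix x :: real
    have [measurable]: "{y. (x + a * y, y) \<in> N} \<in> sets lborel" by measurable
    have "(\<integral>\<^sup>+y. indicator N (x + a * y, y) \<partial>lborel) = (\<integral>\<^sup>+y. indicator {y. (x + a * y, y) \<in> N} y \<partial>lborel)"
      by (intro nn_integral_cong) (auto simp: indicator_def)
    then show "(\<integral>\<^sup>+y. indicator N (x + a * y, y) \<partial>lborel) = emeasure lborel {y. (x + a * y, y) \<in> N}"
      by simp
  qed
  also have "\<dots> = 0" by (simp add: slice)
  finally show ?thesis using N unfolding N_def[symmetric] by (simp add: null_sets_def)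
qed

lemma AE_zero_of_integral_open_zero:
  fixes g :: "'a::euclidean_space \<Rightarrow> real"
  assumes g[measurable]: "g \<in> borel_measurable borel" and M: "\<And>x. \<bar>g x\<bar> \<le> M"
    and zero: "\<And>U. open U \<Longrightarrow> bounded U \<Longrightarrow> (LINT x:U|lborel. g x) = 0"
  shows "AE x in lborel. g x \<le> 0"
proof -
  have M0: "M \<ge> 0" using M[of undefined] by linarith
  have *: "emeasure lborel {x \<in> ball 0 (real n). g x > inverse (Suc m)} = 0" for m n :: nat
  proof -
    define A where "A = {x \<in> ball 0 (real n). g x > inverse (Suc m)}"
    define \<epsilon> where "\<epsilon> = inverse (real (Suc m))"
    have \<epsilon>: "\<epsilon> > 0" by (simp add: \<epsilon>_def)
    have Ab[measurable]: "A \<in> sets borel" unfolding A_def by measurable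
    have int: "set_integrable lborel U g" if "U \<in> sets borel" "bounded U" for U
      unfolding set_integrable_def
    proof (rule Bochner_Integration.integrable_bound[where f="\<lambda>x. M * indicator U x"])
      show "integrable lborel (\<lambda>x. M * indicat_real U x)"
        using that emeasure_bounded_finite[OF \<open>bounded U\<close>] by auto
      show "(\<lambda>x. indicat_real U x *\<^sub>R g x) \<in> borel_measurable lborel" using that(1) by simp
    qed (use M M0 in \<open>auto simp: indicator_def\<close>)
    have key: "\<epsilon> * measure lborel A \<le> M * \<eta>" if "\<eta> > 0" for \<eta>
    proof -
      have "A \<in> sets lebesgue" using Ab by (simp add: sets_completionI_sets)
      then obtain U where U: "open U" "A \<subseteq> U" "(U - A) \<in> lmeasurable" "emeasure lebesgue (U - A) < ennreal \<eta>"
        using sets_lebesgue_outer_open[of A \<eta>] \<open>\<eta> > 0\<close> by metis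
      define V where "V = U \<inter> ball 0 (real n)"
      have V: "open V" "bounded V" "A \<subseteq> V" "V \<in> sets borel"
        using U by (auto simp: V_def A_def bounded_Int)
      have bA: "bounded A" "bounded (V - A)" using V(2,3) by (auto intro: bounded_subset)
      have "emeasure lborel (V - A) \<le> emeasure lborel (U - A)"
        using U(1) Ab by (intro emeasure_mono) (auto simp: V_def)
      also have "emeasure lborel (U - A) = emeasure lebesgue (U - A)"
        using U(1) Ab by (simp add: emeasure_completion)
      finally have small: "measure lborel (V - A) \<le> \<eta>"
        using U(4) \<open>\<eta> > 0\<close> unfolding measure_def
        by (metis enn2real_leI less_imp_le order_le_less_trans)
      have "0 = (LINT x:V|lborel. g x)" using zero[OF V(1,2)] by simp
      moreover have "V = A \<union> (V - A)" using V(3) by auto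
      moreover have "(LINT x:(A \<union> (V - A))|lborel. g x) = (LINT x:A|lborel. g x) + (LINT x:(V - A)|lborel. g x)"
        by (rule set_integral_Un) (use bA V(4) Ab int in auto)
      moreover have "(LINT x:A|lborel. g x) \<ge> \<epsilon> * measure lborel A"
      proof -
        have "(LINT x:A|lborel. \<epsilon>) \<le> (LINT x:A|lborel. g x)"
          by (rule set_integral_mono)
             (use bA Ab int emeasure_bounded_finite[OF bA(1)] in \<open>auto simp: set_integrable_def A_def \<epsilon>_def\<close>)
        then show ?thesis using Ab by (simp add: set_lebesgue_integral_def mult.commute)
      qed
      moreover have "(LINT x:(V - A)|lborel. g x) \<ge> - M * measure lborel (V - A)"
      proof -
        have "(LINT x:(V - A)|lborel. - M) \<le> (LINT x:(V - A)|lborel. g x)"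
        proof (rule set_integral_mono)
          show "set_integrable lborel (V - A) (\<lambda>_. - M)"
            using bA V(4) Ab emeasure_bounded_finite[OF bA(2)] by (auto simp: set_integrable_def)
          show "set_integrable lborel (V - A) g" using bA V(4) Ab by (intro int) auto
          show "- M \<le> g x" for x using M[of x] by linarith
        qed
        then show ?thesis using Ab V(4) by (simp add: set_lebesgue_integral_def mult.commute)
      qed
      ultimately have "\<epsilon> * measure lborel A \<le> M * measure lborel (V - A)" by simp
      also have "\<dots> \<le> M * \<eta>" using small M0 by (rule mult_left_mono)
      finally show ?thesis .
    qed
    have "\<epsilon> * measure lborel A \<le> 0"
    proof (rule field_le_epsilon)
      fix e :: real assume "e > 0"
      have "\<epsilon> * measure lborel A \<le> M * (e / (M + 1))" using key[of "e / (M+1)"] \<open>e > 0\<close> M0 by simp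
      also have "\<dots> \<le> 0 + e" using M0 \<open>e > 0\<close> by (simp add: field_simps)
      finally show "\<epsilon> * measure lborel A \<le> 0 + e" .
    qed
    then have "measure lborel A = 0" using \<epsilon> by (simp add: mult_le_0_iff measure_le_0_iff)
    moreover have "bounded A" by (rule bounded_subset[of "ball 0 (real n)"]) (auto simp: A_def)
    then have "emeasure lborel A < \<infinity>" by (rule emeasure_bounded_finite)
    ultimately show ?thesis unfolding A_def[symmetric] by (auto simp: measure_def enn2real_eq_0_iff)
  qed
  have "AE x in lborel. \<forall>n m. \<not> (x \<in> ball 0 (real n) \<and> g x > inverse (Suc m))"
    unfolding AE_all_countable
  proof (intro allI)
    fix n m :: nat
    show "AE x in lborel. \<not> (x \<in> ball 0 (real n) \<and> g x > inverse (Suc m))"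
      by (rule AE_I[OF _ *[of n m]]) auto
  qed
  then show ?thesis
  proof (rule AE_mp, intro AE_I2 impI)
    fix x assume a: "\<forall>n m. \<not> (x \<in> ball 0 (real n) \<and> g x > inverse (Suc m))"
    obtain n :: nat where n: "norm x < real n" using reals_Archimedean2 by blast
    show "g x \<le> 0"
    proof (rule ccontr)
      assume "\<not> g x \<le> 0"
      then obtain m where "inverse (real (Suc m)) < g x" using reals_Archimedean[of "g x"] by auto
      with a n show False by (auto dest!: spec[of _ n] spec[of _ m])
    qed
  qed
qed

text \<open>The truncated distances \<open>min 1 (n * infdist x (- U))\<close> tend to the indicator
  of an open U, so orthogonality to continuous functions makes all integrals over bounded open sets
  vanish.\<close>

lemma AE_zero_of_test_integrals:
  fixes g :: "'a::euclidean_space \<Rightarrow> real"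
  assumes g[measurable]: "g \<in> borel_measurable borel" and M: "\<And>x. \<bar>g x\<bar> \<le> M"
    and zero: "\<And>\<phi>::'a\<Rightarrow>real. continuous_on UNIV \<phi> \<Longrightarrow> (\<And>x. \<bar>\<phi> x\<bar> \<le> 1) \<Longrightarrow> bounded {x. \<phi> x \<noteq> 0} \<Longrightarrow>
       (LINT x|lborel. g x * \<phi> x) = 0"
  shows "AE x in lborel. g x = 0"
proof -
  have z: "(LINT x:U|lborel. g x) = 0" if U: "open U" "bounded U" for U
  proof -
    define \<phi> :: "nat \<Rightarrow> 'a \<Rightarrow> real" where "\<phi> n x = min 1 (real n * infdist x (- U))" for n x
    have "- U \<noteq> {}" using U(2) not_bounded_UNIV by (metis Compl_empty_eq double_complement)
    have \<phi>0: "\<phi> n x = 0" if "x \<notin> U" for n x using that by (simp add: \<phi>_def)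
    have \<phi>1: "0 \<le> \<phi> n x" "\<phi> n x \<le> 1" for n x by (auto simp: \<phi>_def infdist_nonneg)
    have c[measurable]: "\<phi> n \<in> borel_measurable borel" for n
      unfolding \<phi>_def by (intro borel_measurable_continuous_onI continuous_intros)
    have "(\<lambda>n. LINT x|lborel. g x * \<phi> n x) \<longlonglongrightarrow> (LINT x|lborel. g x * indicator U x)"
    proof (rule integral_dominated_convergence[where w="\<lambda>x. M * indicator U x"])
      show "integrable lborel (\<lambda>x. M * indicat_real U x)"
        using U emeasure_bounded_finite[OF U(2)] by auto
      show "(\<lambda>x. g x * indicat_real U x) \<in> borel_measurable lborel" using U by simp
      show "AE x in lborel. (\<lambda>n. g x * \<phi> n x) \<longlonglongrightarrow> g x * indicat_real U x"
      proof (intro AE_I2 tendsto_mult tendsto_const)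
        fix x
        show "(\<lambda>n. \<phi> n x) \<longlonglongrightarrow> indicat_real U x"
        proof (cases "x \<in> U")
          case True
          have pos: "infdist x (- U) > 0"
            using True U(1) \<open>- U \<noteq> {}\<close> by (intro infdist_pos_not_in_closed) auto
          obtain N :: nat where N: "real N > 1 / infdist x (- U)" using reals_Archimedean2 by blast
          have "\<forall>\<^sub>F n in sequentially. \<phi> n x = 1"
          proof (rule eventually_sequentiallyI[of N])
            fix n assume "N \<le> n"
            then have "1 / infdist x (- U) < real n" using N by linarith
            then have "1 < real n * infdist x (- U)" using pos by (simp add: field_simps)
            then show "\<phi> n x = 1" by (simp add: \<phi>_def)
          qed
          then show ?thesis using True by (simp add: tendsto_eventually)
        qed (simp add: \<phi>0)
      qed
      show "AE x in lborel. norm (g x * \<phi> n x) \<le> M * indicat_real U x" for n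
      proof (intro AE_I2)
        fix x show "norm (g x * \<phi> n x) \<le> M * indicat_real U x"
        proof (cases "x \<in> U")
          case True
          have "\<bar>g x\<bar> * \<bar>\<phi> n x\<bar> \<le> M * 1" using M[of x] \<phi>1[of n x] by (intro mult_mono) auto
          then show ?thesis using True by (simp add: abs_mult)
        qed (simp add: \<phi>0)
      qed
    qed simp
    moreover have "(LINT x|lborel. g x * \<phi> n x) = 0" for n
    proof (rule zero)
      show "continuous_on UNIV (\<phi> n)" unfolding \<phi>_def by (intro continuous_intros)
      show "bounded {x. \<phi> n x \<noteq> 0}" by (rule bounded_subset[OF U(2)]) (use \<phi>0 in auto)
    qed (use \<phi>1 in \<open>simp add: abs_le_iff order_trans[of _ 0]\<close>)
    ultimately have "(\<lambda>n. 0) \<longlonglongrightarrow> (LINT x|lborel. g x * indicator U x)" by simp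
    then have "(LINT x|lborel. g x * indicator U x) = 0" using LIMSEQ_unique[OF _ tendsto_const] by blast
    then show ?thesis by (simp add: set_lebesgue_integral_def mult.commute)
  qed
  have "AE x in lborel. g x \<le> 0" by (rule AE_zero_of_integral_open_zero[OF g M z])
  moreover have "AE x in lborel. - g x \<le> 0"
  proof (rule AE_zero_of_integral_open_zero)
    show "(LINT x:U|lborel. - g x) = 0" if "open U" "bounded U" for U
      using z[OF that] by (simp add: set_lebesgue_integral_def)
  qed (use M in auto)
  ultimately show ?thesis by eventually_elim simp
qed

section \<open>Difference quotients and directional derivatives\<close>

definition dq :: "('a::real_normed_vector \<Rightarrow> real) \<Rightarrow> 'a \<Rightarrow> real \<Rightarrow> 'a \<Rightarrow> real" where
  "dq f e h x = (f (x + h *\<^sub>R e) - f x) / h"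

lemma dq_bound:
  assumes "K-lipschitz_on UNIV f"
  shows "\<bar>dq f e h x\<bar> \<le> K * norm e"
proof (cases "h = 0")
  case False
  have "\<bar>f (x + h *\<^sub>R e) - f x\<bar> \<le> K * (\<bar>h\<bar> * norm e)"
    using lipschitz_onD[OF assms, of "x + h *\<^sub>R e" x] by (simp add: dist_norm)
  with False show ?thesis by (simp add: dq_def field_simps)
qed (use lipschitz_on_nonneg[OF assms] in \<open>simp add: dq_def\<close>)

lemma dq_measurable [measurable]:
  fixes f :: "'a::euclidean_space \<Rightarrow> real"
  assumes [measurable]: "f \<in> borel_measurable borel"
  shows "dq f e h \<in> borel_measurable borel"
  unfolding dq_def by measurable

text \<open>Stated without measurability: for a non-measurable f both sides are 0, the default value
  of the Bochner integral.\<close>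

lemma lborel_integral_shift:
  fixes f :: "'a::euclidean_space \<Rightarrow> real"
  shows "(LINT x|lborel. f (x + c)) = (LINT x|lborel. f x)"
proof -
  have "(LINT x|distr lborel borel ((+) c). f x) = (LINT x|lborel. f (c + x))" if "f \<in> borel_measurable borel"
    using that by (subst integral_distr) auto
  note * = this
  have shift: "lborel = distr lborel borel ((+) c)" by (rule lborel_distr_plus[symmetric])
  show ?thesis
  proof (cases "f \<in> borel_measurable borel")
    case True
    with * shift show ?thesis by (simp add: add.commute)
  next
    case False
    have "(\<lambda>x. f (x + c)) \<notin> borel_measurable borel"
    proof
      assume "(\<lambda>x. f (x + c)) \<in> borel_measurable borel"
      then have "(\<lambda>x. (\<lambda>x. f (x + c)) (x - c)) \<in> borel_measurable borel"
        by (intro measurable_compose[of "\<lambda>x. x - c" borel borel "\<lambda>x. f (x + c)"]) auto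
      with False show False by simp
    qed
    with False have "\<not> integrable lborel f" "\<not> integrable lborel (\<lambda>x. f (x + c))"
      by (auto dest!: borel_measurable_integrable)
    then show ?thesis by (simp add: not_integrable_integral_eq)
  qed
qed

text \<open>The directions (a, 1) with a rational are countable, so one null set serves all of them,
  and their multiples are dense among all directions; having height 1 they also suit the
  shear.\<close>

definition regular_points :: "(real \<times> real \<Rightarrow> real) \<Rightarrow> (real \<times> real) set" where
  "regular_points f = - (\<Union>a\<in>\<rat>. \<Union>p\<in>\<rat>. \<Union>q\<in>{q\<in>\<rat>. p < q}. osc_points f (a, 1) p q)"

lemma AE_regular_points:
  assumes "K-lipschitz_on UNIV f"
  shows "AE x in lborel. x \<in> regular_points f"
proof -
  have "(\<Union>a\<in>\<rat>. \<Union>p\<in>\<rat>. \<Union>q\<in>{q\<in>\<rat>. p < q}. osc_points f (a, 1) p q) \<in> null_sets lborel"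
    by (intro null_sets_UN' countable_rat countable_subset[OF _ countable_rat] osc_points_oblique_null[OF assms]) auto
  then show ?thesis unfolding regular_points_def by (rule AE_I') auto
qed

lemma regular_points_dq_converges:
  assumes "K-lipschitz_on UNIV f" "x \<in> regular_points f" "a \<in> \<rat>"
  shows "\<exists>l. ((\<lambda>h. dq f (a, 1) h x) \<longlongrightarrow> l) (at 0)"
proof (rule bounded_not_oscillating_convergent)
  show "\<bar>dq f (a, 1) h x\<bar> \<le> K * norm (a, 1::real)" for h by (rule dq_bound[OF assms(1)])
  show "\<not> ((\<exists>\<^sub>F h in at 0. dq f (a, 1) h x < p) \<and> (\<exists>\<^sub>F h in at 0. dq f (a, 1) h x > q))"
    if "p < q" "p \<in> \<rat>" "q \<in> \<rat>" for p q
    using assms(2,3) that unfolding regular_points_def osc_points_def dq_def by blast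
qed simp

text \<open>A limit along the fixed sequence 1/(n+1) rather than in h, so that the function is Borel
  measurable on the whole plane; at regular points and for rational a it is the true directional
  derivative.\<close>

definition oblique_deriv :: "(real \<times> real \<Rightarrow> real) \<Rightarrow> real \<Rightarrow> real \<times> real \<Rightarrow> real" where
  "oblique_deriv f a x = lim (\<lambda>n. dq f (a, 1) (inverse (real (Suc n))) x)"

lemma oblique_deriv_measurable [measurable]:
  assumes [measurable]: "f \<in> borel_measurable borel"
  shows "oblique_deriv f a \<in> borel_measurable borel"
  unfolding oblique_deriv_def by (intro borel_measurable_lim_metric) measurable

lemma inverse_Suc_at_0: "filterlim (\<lambda>n. inverse (real (Suc n))) (at 0) sequentially"
  unfolding filterlim_at using LIMSEQ_inverse_real_of_nat by auto

lemma dq_tendsto_oblique_deriv: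
  assumes "K-lipschitz_on UNIV f" "x \<in> regular_points f" "a \<in> \<rat>"
  shows "((\<lambda>h. dq f (a, 1) h x) \<longlongrightarrow> oblique_deriv f a x) (at 0)"
proof -
  obtain l where l: "((\<lambda>h. dq f (a, 1) h x) \<longlongrightarrow> l) (at 0)"
    using regular_points_dq_converges[OF assms] by blast
  have "(\<lambda>n. dq f (a, 1) (inverse (real (Suc n))) x) \<longlonglongrightarrow> l"
    by (rule filterlim_compose[OF l inverse_Suc_at_0])
  then show ?thesis using l unfolding oblique_deriv_def by (simp add: limI)
qed

lemma oblique_deriv_bound:
  assumes "K-lipschitz_on UNIV f" "x \<in> regular_points f" "a \<in> \<rat>"
  shows "\<bar>oblique_deriv f a x\<bar> \<le> K * norm (a, 1::real)"
  by (rule tendsto_le[OF _ tendsto_const tendsto_rabs[OF dq_tendsto_oblique_deriv[OF assms]]])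
     (auto intro!: always_eventually dq_bound[OF assms(1)])

lemma integrable_bounded_support:
  fixes g :: "'a::euclidean_space \<Rightarrow> real"
  assumes "g \<in> borel_measurable borel" "AE x in lborel. \<bar>g x\<bar> \<le> M" "bounded U" "\<And>x. g x \<noteq> 0 \<Longrightarrow> x \<in> U"
  shows "integrable lborel g"
proof -
  obtain r where "U \<subseteq> ball 0 r" using bounded_subset_ballD[OF assms(3)] by blast
  then have r: "U \<subseteq> cball 0 r" using ball_subset_cball by blast
  show ?thesis
  proof (rule Bochner_Integration.integrable_bound)
    show "integrable lborel (\<lambda>x. M * indicat_real (cball (0::'a) r) x)"
      using emeasure_bounded_finite[OF bounded_cball, of "0::'a" r] by auto
    show "AE x in lborel. norm (g x) \<le> norm (M * indicat_real (cball 0 r) x)"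
      using assms(2) by eventually_elim (use assms(4) r in \<open>force simp: indicator_def\<close>)
  qed (use assms(1) in simp)
qed

text \<open>Discrete integration by parts: translation invariance moves the shift from f to the test
  function, which is where the minus sign and the step - h come from.\<close>

lemma integral_dq_swap:
  fixes f \<phi> :: "'a::euclidean_space \<Rightarrow> real"
  assumes f: "continuous_on UNIV f" and \<phi>: "continuous_on UNIV \<phi>" "bounded {x. \<phi> x \<noteq> 0}" and "h \<noteq> 0"
  shows "(LINT x|lborel. dq f e h x * \<phi> x) = - (LINT x|lborel. f x * dq \<phi> e (- h) x) "
proof -
  have int: "integrable lborel (\<lambda>x. k x * \<phi> x)" if k: "continuous_on UNIV k" for k :: "'a \<Rightarrow> real"
  proof -
    have ck: "continuous_on UNIV (\<lambda>x. k x * \<phi> x)" by (intro continuous_intros k \<phi>)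
    define C where "C = closure {x. \<phi> x \<noteq> 0}"
    have "compact C" using \<phi>(2) by (simp add: C_def compact_closure)
    then have "bounded ((\<lambda>x. k x * \<phi> x) ` C)"
      by (intro compact_imp_bounded compact_continuous_image continuous_on_subset[OF ck]) auto
    then obtain B where B: "\<And>x. x \<in> C \<Longrightarrow> \<bar>k x * \<phi> x\<bar> \<le> B" by (auto simp: bounded_iff)
    have "\<bar>k x * \<phi> x\<bar> \<le> max B 0" for x
      using B[of x] closure_subset[of "{x. \<phi> x \<noteq> 0}"] by (cases "\<phi> x = 0") (auto simp: C_def)
    then show ?thesis
      by (intro integrable_bounded_support[where M="max B 0" and U="{x. \<phi> x \<noteq> 0}"] \<phi>(2) borel_measurable_continuous_onI[OF ck]) auto
  qed
  have c1: "continuous_on UNIV (\<lambda>x. f (x + h *\<^sub>R e))" by (intro continuous_on_compose2[OF f] continuous_intros) auto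
  have e1: "(LINT x|lborel. f (x + h *\<^sub>R e) * \<phi> x) = (LINT x|lborel. f x * \<phi> (x - h *\<^sub>R e))"
    using lborel_integral_shift[of "\<lambda>x. f x * \<phi> (x - h *\<^sub>R e)" "h *\<^sub>R e"] by simp
  have i2: "integrable lborel (\<lambda>x. f x * \<phi> (x - h *\<^sub>R e))"
  proof -
    have "integrable (distr lborel borel ((+) (h *\<^sub>R e))) (\<lambda>x. f x * \<phi> (x - h *\<^sub>R e))"
    proof (subst integrable_distr_eq)
      show "(\<lambda>x. f x * \<phi> (x - h *\<^sub>R e)) \<in> borel_measurable borel"
        by (intro borel_measurable_continuous_onI continuous_intros f continuous_on_compose2[OF \<phi>(1)]) auto
      show "integrable lborel (\<lambda>x. f (h *\<^sub>R e + x) * \<phi> (h *\<^sub>R e + x - h *\<^sub>R e))"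
        using int[OF c1] by (simp add: add.commute)
    qed simp
    then show ?thesis by (simp add: lborel_distr_plus)
  qed
  have "(LINT x|lborel. dq f e h x * \<phi> x) = (LINT x|lborel. f (x + h *\<^sub>R e) * \<phi> x / h - f x * \<phi> x / h)"
    by (intro Bochner_Integration.integral_cong) (auto simp: dq_def diff_divide_distrib left_diff_distrib)
  also have "\<dots> = (LINT x|lborel. f x * \<phi> (x - h *\<^sub>R e) / h) - (LINT x|lborel. f x * \<phi> x / h)"
    using int[OF c1] int[OF f] e1 by (subst Bochner_Integration.integral_diff) auto
  also have "\<dots> = (LINT x|lborel. f x * \<phi> (x - h *\<^sub>R e) / h - f x * \<phi> x / h)"
    using i2 int[OF f] by (subst Bochner_Integration.integral_diff) auto
  also have "\<dots> = - (LINT x|lborel. f x * dq \<phi> e (- h) x)"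
    unfolding Bochner_Integration.integral_minus[symmetric]
    by (intro Bochner_Integration.integral_cong) (auto simp: dq_def right_diff_distrib diff_divide_distrib)
  finally show ?thesis .
qed

text \<open>Splitting the increment of \<open>f\<close> along \<open>(a, 1) = a (1, 1) + (1 - a) (0, 1)\<close> and moving the
  first shift onto the test function makes the a.e. derivatives additive in the direction.\<close>

lemma oblique_deriv_linear_AE:
  assumes lip: "K-lipschitz_on UNIV f" and a: "a \<in> \<rat>"
  shows "AE x in lborel. oblique_deriv f a x = a * oblique_deriv f 1 x + (1 - a) * oblique_deriv f 0 x"
proof -
  have cont: "continuous_on UNIV f" by (rule lipschitz_on_continuous_on[OF lip])
  have [measurable]: "f \<in> borel_measurable borel" by (rule borel_measurable_continuous_onI[OF cont])
  note zero_prod_def[symmetric, simp]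
  have [simp]: "K \<ge> 0" by (rule lipschitz_on_nonneg[OF lip])
  define M where "M = K * norm (a, 1::real) + \<bar>a\<bar> * (K * norm (1::real, 1::real)) + \<bar>1 - a\<bar> * (K * norm (0::real, 1::real))"
  define R where "R = regular_points f"
  \<comment> \<open>The truncation changes nothing at regular points but makes \<open>g\<close>
    bounded everywhere, as the testing lemma demands.\<close>
  define g where "g x = max (-M) (min M (oblique_deriv f a x - a * oblique_deriv f 1 x - (1 - a) * oblique_deriv f 0 x))" for x
  have M0: "M \<ge> 0" unfolding M_def by (intro add_nonneg_nonneg mult_nonneg_nonneg) auto
  have AER: "AE x in lborel. x \<in> R" unfolding R_def by (rule AE_regular_points[OF lip])
  have geq: "g x = oblique_deriv f a x - a * oblique_deriv f 1 x - (1 - a) * oblique_deriv f 0 x" if "x \<in> R" for x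
  proof -
    have b: "\<bar>oblique_deriv f b x\<bar> \<le> K * norm (b, 1::real)" if "b \<in> \<rat>" for b
      using oblique_deriv_bound[OF lip \<open>x \<in> R\<close>[unfolded R_def] that] .
    have "\<bar>oblique_deriv f a x\<bar> \<le> K * norm (a, 1::real)"
      "\<bar>a * oblique_deriv f 1 x\<bar> \<le> \<bar>a\<bar> * (K * norm (1::real, 1::real))"
      "\<bar>(1 - a) * oblique_deriv f 0 x\<bar> \<le> \<bar>1 - a\<bar> * (K * norm (0::real, 1::real))"
      unfolding abs_mult by (intro mult_left_mono b a Rats_0 Rats_1 abs_ge_zero)+
    moreover have "\<bar>u - v - w\<bar> \<le> r + s + t" if "\<bar>u\<bar> \<le> r" "\<bar>v\<bar> \<le> s" "\<bar>w\<bar> \<le> t" for u v w r s t :: real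
      using that by linarith
    ultimately have "\<bar>oblique_deriv f a x - a * oblique_deriv f 1 x - (1 - a) * oblique_deriv f 0 x\<bar> \<le> M"
      unfolding M_def by blast
    then show ?thesis unfolding g_def by linarith
  qed
  have [measurable]: "g \<in> borel_measurable borel" unfolding g_def by measurable
  have "AE x in lborel. g x = 0"
  proof (rule AE_zero_of_test_integrals[where M=M])
    show "\<bar>g x\<bar> \<le> M" for x using M0 by (auto simp: g_def)
    fix \<phi> :: "real \<times> real \<Rightarrow> real"
    assume \<phi>: "continuous_on UNIV \<phi>" "\<And>x. \<bar>\<phi> x\<bar> \<le> 1" "bounded {x. \<phi> x \<noteq> 0}"
    have [measurable]: "\<phi> \<in> borel_measurable borel" by (rule borel_measurable_continuous_onI[OF \<phi>(1)])
    obtain r where "{x. \<phi> x \<noteq> 0} \<subseteq> ball 0 r" using bounded_subset_ballD[OF \<phi>(3)] by blast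
    then have r: "{x. \<phi> x \<noteq> 0} \<subseteq> cball 0 r" using ball_subset_cball by blast
    define U where "U = cball (0::real\<times>real) (r + norm (a, a))"
    have phiU: "\<phi> (x - (h * a) *\<^sub>R (1, 1)) = 0" if "x \<notin> U" "\<bar>h\<bar> \<le> 1" for x h
    proof (rule ccontr)
      assume "\<phi> (x - (h * a) *\<^sub>R (1, 1)) \<noteq> 0"
      then have "norm (x - (h * a) *\<^sub>R (1, 1)) \<le> r" using r by auto
      moreover have "norm ((h * a) *\<^sub>R (1::real, 1::real)) \<le> norm (a, a)"
      proof -
        have eq: "(h * a) *\<^sub>R (1::real, 1::real) = h *\<^sub>R (a, a)" by simp
        have "norm ((h * a) *\<^sub>R (1::real, 1::real)) = \<bar>h\<bar> * norm (a, a)" unfolding eq by (rule norm_scaleR)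
        then show ?thesis using that(2) mult_left_le_one_le[of "norm (a, a)" "\<bar>h\<bar>"] by simp
      qed
      ultimately have "norm x \<le> r + norm (a, a)" 
        using norm_triangle_sub[of x "(h * a) *\<^sub>R (1, 1)"] by linarith
      with that(1) show False by (simp add: U_def)
    qed
    have phi0: "\<phi> x = 0" if "x \<notin> U" for x using phiU[OF that, of 0] by simp
    have emU: "emeasure lborel U < \<infinity>" unfolding U_def by (rule emeasure_bounded_finite) simp
    have intU: "integrable lborel (\<lambda>x. c * indicat_real U x)" for c
      using emU by (auto simp: U_def)
    define hn where "hn n = inverse (real (Suc n))" for n
    have hn0: "hn n > 0" "hn n \<le> 1" for n by (auto simp: hn_def field_simps)
    have hn: "filterlim hn (at 0) sequentially" unfolding hn_def by (rule inverse_Suc_at_0)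
    have hnt: "hn \<longlonglongrightarrow> 0" using hn by (simp add: filterlim_at)
    \<comment> \<open>The scale c and the shift d are general because the two parts of the increment
      have step lengths a h and (1 - a) h, and one of them is moved onto \<phi>.\<close>
    have lim1: "(\<lambda>n. LINT x|lborel. dq f (b, 1) (c * hn n) x * \<phi> (x - (hn n * d) *\<^sub>R (1, 1)))
        \<longlonglongrightarrow> (LINT x|lborel. oblique_deriv f b x * \<phi> x)"
      if b: "b \<in> \<rat>" and c: "c \<noteq> 0" and d: "d = 0 \<or> d = a" for b c d
    proof (rule integral_dominated_convergence[where w="\<lambda>x. (K * norm (b, 1::real)) * indicator U x"])
      show "AE x in lborel. (\<lambda>n. dq f (b, 1) (c * hn n) x * \<phi> (x - (hn n * d) *\<^sub>R (1, 1))) \<longlonglongrightarrow> oblique_deriv f b x * \<phi> x"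
        using AER
      proof eventually_elim
        case (elim x)
        have "filterlim (\<lambda>n. c * hn n) (at 0) sequentially"
          unfolding filterlim_at using c hn0 hnt by (auto intro!: tendsto_mult_right_zero simp: less_imp_neq[symmetric] always_eventually)
        then have "(\<lambda>n. dq f (b, 1) (c * hn n) x) \<longlonglongrightarrow> oblique_deriv f b x"
          by (rule filterlim_compose[OF dq_tendsto_oblique_deriv[OF lip elim[unfolded R_def] b]])
        moreover have "(\<lambda>n. \<phi> (x - (hn n * d) *\<^sub>R (1, 1))) \<longlonglongrightarrow> \<phi> (x - (0 * d) *\<^sub>R (1, 1))"
          by (rule continuous_on_tendsto_compose[OF \<phi>(1)])
             ((intro tendsto_diff tendsto_scaleR tendsto_mult tendsto_const hnt), simp_all)
        ultimately have "(\<lambda>n. dq f (b, 1) (c * hn n) x * \<phi> (x - (hn n * d) *\<^sub>R (1, 1)))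
            \<longlonglongrightarrow> oblique_deriv f b x * \<phi> (x - (0 * d) *\<^sub>R (1, 1))"
          by (rule tendsto_mult)
        then show ?case by simp
      qed
      show "AE x in lborel. norm (dq f (b, 1) (c * hn n) x * \<phi> (x - (hn n * d) *\<^sub>R (1, 1))) \<le> K * norm (b, 1::real) * indicat_real U x" for n
      proof (intro AE_I2)
        fix x
        show "norm (dq f (b, 1) (c * hn n) x * \<phi> (x - (hn n * d) *\<^sub>R (1, 1))) \<le> K * norm (b, 1::real) * indicat_real U x"
        proof (cases "x \<in> U")
          case True
          have "\<bar>dq f (b, 1) (c * hn n) x\<bar> * \<bar>\<phi> (x - (hn n * d) *\<^sub>R (1, 1))\<bar> \<le> (K * norm (b, 1::real)) * 1"
            using \<phi>(2) by (intro mult_mono dq_bound[OF lip]) (auto simp del: norm_Pair)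
          then show ?thesis using True by (simp add: abs_mult del: norm_Pair)
        next
          case False
          then have "\<phi> (x - (hn n * d) *\<^sub>R (1, 1)) = 0"
            using d phiU[OF False, of "hn n"] phi0[OF False] hn0[of n] by auto
          then show ?thesis using False by simp
        qed
      qed
      show "integrable lborel (\<lambda>x. (K * norm (b, 1::real)) * indicator U x)" by (rule intU)
    qed measurable
    have intq: "integrable lborel (\<lambda>x. dq f e h x * \<phi> (x - (s * a) *\<^sub>R (1, 1)))" if "\<bar>s\<bar> \<le> 1" for e h s
    proof (rule integrable_bounded_support[where M="K * norm e" and U=U])
      show "AE x in lborel. \<bar>dq f e h x * \<phi> (x - (s * a) *\<^sub>R (1, 1))\<bar> \<le> K * norm e"
      proof (intro AE_I2)
        fix x
        have "\<bar>dq f e h x\<bar> * \<bar>\<phi> (x - (s * a) *\<^sub>R (1, 1))\<bar> \<le> (K * norm e) * 1"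
          using \<phi>(2) by (intro mult_mono dq_bound[OF lip]) auto
        then show "\<bar>dq f e h x * \<phi> (x - (s * a) *\<^sub>R (1, 1))\<bar> \<le> K * norm e" by (simp add: abs_mult)
      qed
      show "x \<in> U" if "dq f e h x * \<phi> (x - (s * a) *\<^sub>R (1, 1)) \<noteq> 0" for x
        using that phiU[of x s] \<open>\<bar>s\<bar> \<le> 1\<close> by auto
    qed (auto simp: U_def)
    have intq0: "integrable lborel (\<lambda>x. dq f e h x * \<phi> x)" for e h
      using intq[of 0 e h] by simp
    have decomp: "(LINT x|lborel. dq f (a, 1) (hn n) x * \<phi> x)
        = a * (LINT x|lborel. dq f (1, 1) (a * hn n) x * \<phi> x)
          + (1 - a) * (LINT x|lborel. dq f (0, 1) ((1 - a) * hn n) x * \<phi> (x - (hn n * a) *\<^sub>R (1, 1)))" for n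
    proof -
      have "dq f (a, 1) (hn n) x * \<phi> x = a * (dq f (1, 1) (a * hn n) x * \<phi> x)
          + (1 - a) * (dq f (0, 1) ((1 - a) * hn n) (x + (hn n * a) *\<^sub>R (1, 1)) * \<phi> x)" for x
      proof -
        have e1: "x + hn n *\<^sub>R (a, 1) = x + (hn n * a) *\<^sub>R (1, 1) + ((1 - a) * hn n) *\<^sub>R (0, 1)"
          by (cases x) (simp add: algebra_simps)
        have e2: "x + (a * hn n) *\<^sub>R (1, 1) = x + (hn n * a) *\<^sub>R (1, 1)" by (simp add: mult.commute)
        have r1: "a * dq f (1, 1) (a * hn n) x = (f (x + (hn n * a) *\<^sub>R (1, 1)) - f x) / hn n"
          using hn0[of n] by (cases "a = 0") (auto simp: dq_def e2 field_simps)
        have r2: "(1 - a) * dq f (0, 1) ((1 - a) * hn n) (x + (hn n * a) *\<^sub>R (1, 1)) =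
            (f (x + hn n *\<^sub>R (a, 1)) - f (x + (hn n * a) *\<^sub>R (1, 1))) / hn n"
          unfolding e1 dq_def using hn0[of n] by (cases "a = 1") auto
        have "dq f (a, 1) (hn n) x = a * dq f (1, 1) (a * hn n) x + (1 - a) * dq f (0, 1) ((1 - a) * hn n) (x + (hn n * a) *\<^sub>R (1, 1))"
          unfolding r1 r2 by (simp add: dq_def add_divide_distrib[symmetric])
        then show ?thesis by (simp only: distrib_right mult.assoc)
      qed
      then have "(LINT x|lborel. dq f (a, 1) (hn n) x * \<phi> x) =
         (LINT x|lborel. a * (dq f (1, 1) (a * hn n) x * \<phi> x)
          + (1 - a) * (dq f (0, 1) ((1 - a) * hn n) (x + (hn n * a) *\<^sub>R (1, 1)) * \<phi> x))" by simp
      also have "\<dots> = a * (LINT x|lborel. dq f (1, 1) (a * hn n) x * \<phi> x)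
          + (1 - a) * (LINT x|lborel. dq f (0, 1) ((1 - a) * hn n) (x + (hn n * a) *\<^sub>R (1, 1)) * \<phi> x)"
      proof -
        have i: "integrable lborel (\<lambda>x. dq f (0, 1) ((1 - a) * hn n) (x + (hn n * a) *\<^sub>R (1, 1)) * \<phi> x)"
        proof (rule integrable_bounded_support[where M="K * norm (0::real, 1::real)" and U=U])
          show "AE x in lborel. \<bar>dq f (0, 1) ((1 - a) * hn n) (x + (hn n * a) *\<^sub>R (1, 1)) * \<phi> x\<bar> \<le> K * norm (0::real, 1::real)"
          proof (intro AE_I2)
            fix x
            have "\<bar>dq f (0, 1) ((1 - a) * hn n) (x + (hn n * a) *\<^sub>R (1, 1))\<bar> * \<bar>\<phi> x\<bar> \<le> (K * norm (0::real, 1::real)) * 1"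
              using \<phi>(2) by (intro mult_mono dq_bound[OF lip]) (auto simp del: norm_Pair)
            then show "\<bar>dq f (0, 1) ((1 - a) * hn n) (x + (hn n * a) *\<^sub>R (1, 1)) * \<phi> x\<bar> \<le> K * norm (0::real, 1::real)"
              by (simp add: abs_mult del: norm_Pair)
          qed
        qed (use phi0 in \<open>auto simp: U_def\<close>)
        show ?thesis using intq0 i by simp
      qed
      also have "(LINT x|lborel. dq f (0, 1) ((1 - a) * hn n) (x + (hn n * a) *\<^sub>R (1, 1)) * \<phi> x)
          = (LINT x|lborel. dq f (0, 1) ((1 - a) * hn n) x * \<phi> (x - (hn n * a) *\<^sub>R (1, 1)))"
        using lborel_integral_shift[of "\<lambda>x. dq f (0, 1) ((1 - a) * hn n) x * \<phi> (x - (hn n * a) *\<^sub>R (1, 1))" "(hn n * a) *\<^sub>R (1, 1)"]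
        by simp
      finally show ?thesis .
    qed
    \<comment> \<open>For a = 0 the step length degenerates, but then the term carries the factor 0;
      likewise for a = 1 in \<open>l2\<close>.\<close>
    have l1: "(\<lambda>n. a * (LINT x|lborel. dq f (1, 1) (a * hn n) x * \<phi> x)) \<longlonglongrightarrow> a * (LINT x|lborel. oblique_deriv f 1 x * \<phi> x)"
      using lim1[of 1 a 0] by (cases "a = 0") (auto intro!: tendsto_mult_left)
    have l2: "(\<lambda>n. (1 - a) * (LINT x|lborel. dq f (0, 1) ((1 - a) * hn n) x * \<phi> (x - (hn n * a) *\<^sub>R (1, 1))))
       \<longlonglongrightarrow> (1 - a) * (LINT x|lborel. oblique_deriv f 0 x * \<phi> x)"
      using lim1[of 0 "1 - a" a] by (cases "a = 1") (auto intro!: tendsto_mult_left)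
    have l0: "(\<lambda>n. LINT x|lborel. dq f (a, 1) (hn n) x * \<phi> x) \<longlonglongrightarrow> (LINT x|lborel. oblique_deriv f a x * \<phi> x)"
      using lim1[of a 1 0] a by simp
    have eq: "(LINT x|lborel. oblique_deriv f a x * \<phi> x) = a * (LINT x|lborel. oblique_deriv f 1 x * \<phi> x) + (1 - a) * (LINT x|lborel. oblique_deriv f 0 x * \<phi> x)"
      using LIMSEQ_unique[OF l0] tendsto_add[OF l1 l2] unfolding decomp[symmetric] by blast
    have io: "integrable lborel (\<lambda>x. oblique_deriv f b x * \<phi> x)" if b: "b \<in> \<rat>" for b
    proof (rule integrable_bounded_support[where M="K * norm (b, 1::real)" and U=U])
      show "AE x in lborel. \<bar>oblique_deriv f b x * \<phi> x\<bar> \<le> K * norm (b, 1::real)"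
        using AER
      proof eventually_elim
        case (elim x)
        have "\<bar>oblique_deriv f b x\<bar> * \<bar>\<phi> x\<bar> \<le> (K * norm (b, 1::real)) * 1"
          using \<phi>(2) elim b by (intro mult_mono oblique_deriv_bound[OF lip]) (auto simp: R_def simp del: norm_Pair)
        then show ?case by (simp add: abs_mult del: norm_Pair)
      qed
    qed (use phi0 in \<open>auto simp: U_def\<close>)
    have "(LINT x|lborel. g x * \<phi> x) = (LINT x|lborel. oblique_deriv f a x * \<phi> x - a * (oblique_deriv f 1 x * \<phi> x) - (1 - a) * (oblique_deriv f 0 x * \<phi> x))"
    proof (rule integral_cong_AE)
      show "AE x in lborel. g x * \<phi> x = oblique_deriv f a x * \<phi> x - a * (oblique_deriv f 1 x * \<phi> x) - (1 - a) * (oblique_deriv f 0 x * \<phi> x)"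
        using AER by eventually_elim (simp add: geq algebra_simps)
    qed measurable
    also have "\<dots> = 0" using io a eq by simp
    finally show "(LINT x|lborel. g x * \<phi> x) = 0" .
  qed simp
  with AER show ?thesis by eventually_elim (use geq in force)
qed

section \<open>Gradients of Lipschitz functions\<close>

lemma GDERIV_iff:
  fixes f :: "'a::real_inner \<Rightarrow> real"
  shows "GDERIV f x :> D \<longleftrightarrow> (\<forall>e>0. \<exists>d>0. \<forall>h. norm h < d \<longrightarrow> \<bar>f (x + h) - f x - h \<bullet> D\<bar> \<le> e * norm h)"
proof -
  have "GDERIV f x :> D \<longleftrightarrow> (\<forall>e>0. \<exists>d>0. \<forall>y. norm (y - x) < d \<longrightarrow> norm (f y - f x - (y - x) \<bullet> D) \<le> e * norm (y - x))"
    unfolding gderiv_def has_derivative_at_alt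
    by (simp add: bounded_linear_inner_left)
  also have "\<dots> \<longleftrightarrow> (\<forall>e>0. \<exists>d>0. \<forall>h. norm h < d \<longrightarrow> \<bar>f (x + h) - f x - h \<bullet> D\<bar> \<le> e * norm h)"
  proof (intro all_cong ex_cong conj_cong refl)
    fix e d :: real
    show "(\<forall>y. norm (y - x) < d \<longrightarrow> norm (f y - f x - (y - x) \<bullet> D) \<le> e * norm (y - x)) \<longleftrightarrow>
      (\<forall>h. norm h < d \<longrightarrow> \<bar>f (x + h) - f x - h \<bullet> D\<bar> \<le> e * norm h)"
      by (metis add_diff_cancel_left' diff_add_cancel add.commute real_norm_def)
  qed
  finally show ?thesis .
qed

lemma GDERIV_unique:
  assumes "GDERIV f x :> D" "GDERIV f x :> E"
  shows "D = E"
proof -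
  have "(\<lambda>h. h \<bullet> D) = (\<lambda>h. h \<bullet> E)"
    using assms unfolding gderiv_def by (rule has_derivative_unique)
  then have "(D - E) \<bullet> D = (D - E) \<bullet> E" by metis
  then have "(D - E) \<bullet> (D - E) = 0" by (simp add: inner_diff_right)
  then show ?thesis by simp
qed

lemma grad_eqI:
  assumes "GDERIV f x :> D"
  shows "grad f x = D"
  unfolding grad_def using assms GDERIV_unique by (intro the_equality) blast+

lemma GDERIV_dq_tendsto:
  assumes "GDERIV f x :> D"
  shows "((\<lambda>h. dq f e h x) \<longlongrightarrow> D \<bullet> e) (at 0)"
proof -
  have "((\<lambda>h. f (x + h *\<^sub>R e)) has_derivative (\<lambda>h. (h *\<^sub>R e) \<bullet> D)) (at 0)"
  proof -
    have "(f has_derivative (\<lambda>h. h \<bullet> D)) (at (x + 0 *\<^sub>R e))" using assms by (simp add: gderiv_def)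
    then show ?thesis
      by (rule has_derivative_compose[rotated]) (auto intro!: derivative_eq_intros)
  qed
  then have "DERIV (\<lambda>h. f (x + h *\<^sub>R e)) 0 :> D \<bullet> e"
    unfolding has_field_derivative_def
    by (rule has_derivative_eq_rhs) (auto simp: inner_commute mult.commute)
  then show ?thesis by (simp add: DERIV_def dq_def)
qed

text \<open>The horizontal direction is not of the form (a, 1); it is obtained as (1, 1) - (0,
  1).\<close>

definition plane_grad :: "(real \<times> real \<Rightarrow> real) \<Rightarrow> real \<times> real \<Rightarrow> real \<times> real" where
  "plane_grad f x = (oblique_deriv f 1 x - oblique_deriv f 0 x, oblique_deriv f 0 x)"

lemma plane_grad_measurable [measurable]:
  assumes [measurable]: "f \<in> borel_measurable borel"
  shows "plane_grad f \<in> borel_measurable borel"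
  unfolding plane_grad_def by (intro borel_measurable_Pair) measurable

lemma oblique_deriv_GDERIV:
  assumes "GDERIV f x :> D"
  shows "oblique_deriv f a x = D \<bullet> (a, 1)"
  unfolding oblique_deriv_def
  by (rule limI) (rule filterlim_compose[OF GDERIV_dq_tendsto[OF assms] inverse_Suc_at_0])

lemma plane_grad_eq:
  assumes "GDERIV f x :> D"
  shows "plane_grad f x = D"
  unfolding plane_grad_def by (simp add: oblique_deriv_GDERIV[OF assms] prod_eq_iff inner_prod_def)

text \<open>Rademacher's theorem in the plane. At a regular point where the directional derivatives
  are linear in the direction, a finite net of admissible directions for the unit circle gives a
  uniform error, and the Lipschitz constant bridges the gap between net and circle.\<close>

theorem AE_GDERIV_lipschitz:
  fixes f :: "real \<times> real \<Rightarrow> real"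
  assumes lip: "K-lipschitz_on UNIV f"
  shows "AE x in lborel. GDERIV f x :> plane_grad f x"
proof -
  have "AE x in lborel. \<forall>a\<in>\<rat>. oblique_deriv f a x = a * oblique_deriv f 1 x + (1 - a) * oblique_deriv f 0 x"
    by (subst AE_ball_countable[OF countable_rat]) (use oblique_deriv_linear_AE[OF lip] in blast)
  with AE_regular_points[OF lip] show ?thesis
  proof eventually_elim
    case (elim x)
    define D where "D = plane_grad f x"
    have lin: "oblique_deriv f a x = (a, 1) \<bullet> D" if "a \<in> \<rat>" for a
      using elim(2) that by (auto simp: D_def plane_grad_def inner_prod_def algebra_simps)
    have K0: "K \<ge> 0" by (rule lipschitz_on_nonneg[OF lip])
    show ?case unfolding D_def[symmetric] GDERIV_iff
    proof (intro allI impI)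
      fix e :: real assume "e > 0"
      define \<epsilon> where "\<epsilon> = e / (K + norm D + 1)"
      have pos: "K + norm D + 1 > 0" using K0 by (smt (verit) norm_ge_zero)
      have \<epsilon>: "\<epsilon> > 0" using \<open>e > 0\<close> pos by (simp add: \<epsilon>_def)
      \<comment> \<open>t \<noteq> 0 keeps s t away from 0 whenever s is; horizontal directions are
        only approximated.\<close>
      define T where "T = (\<lambda>(t::real, a::real). t *\<^sub>R (a, 1::real)) ` ((- {0}) \<times> \<rat>)"
      have "sphere (0::real\<times>real) 1 \<subseteq> (\<Union>w\<in>T. ball w \<epsilon>)"
      proof
        fix w :: "real \<times> real" assume "w \<in> sphere 0 1"
        obtain t where t: "t \<noteq> 0" "\<bar>t - snd w\<bar> < \<epsilon> / 2"
        proof (cases "snd w = 0")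
          case True then show ?thesis using that[of "\<epsilon> / 4"] \<epsilon> by auto
        next
          case False then show ?thesis using that[of "snd w"] \<epsilon> by auto
        qed
        obtain a where a: "a \<in> \<rat>" "\<bar>a - fst w / t\<bar> < \<epsilon> / 2 / \<bar>t\<bar>"
        proof -
          have "fst w / t - \<epsilon> / 2 / \<bar>t\<bar> < fst w / t + \<epsilon> / 2 / \<bar>t\<bar>" using \<epsilon> t by simp
          then obtain a where "a \<in> \<rat>" "fst w / t - \<epsilon> / 2 / \<bar>t\<bar> < a" "a < fst w / t + \<epsilon> / 2 / \<bar>t\<bar>"
            using Rats_dense_in_real by blast
          then show ?thesis using that[of a] by (simp add: abs_less_iff)
        qed
        have "\<bar>t * a - fst w\<bar> = \<bar>t\<bar> * \<bar>a - fst w / t\<bar>"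
          using t(1) by (simp add: abs_mult[symmetric] right_diff_distrib)
        also have "\<dots> < \<epsilon> / 2" using a(2) t(1) by (simp add: field_simps)
        finally have "\<bar>t * a - fst w\<bar> < \<epsilon> / 2" .
        with t(2) have "dist (t * a, t) w < \<epsilon>"
          using norm_Pair_le[of "t * a - fst w" "t - snd w"] by (cases w) (auto simp: dist_norm)
        then show "w \<in> (\<Union>w\<in>T. ball w \<epsilon>)"
          using a(1) t(1) by (auto simp: T_def intro!: bexI[of _ "(t, a)"])
      qed
      then obtain T' where T': "T' \<subseteq> T" "finite T'" "sphere (0::real\<times>real) 1 \<subseteq> (\<Union>w\<in>T'. ball w \<epsilon>)"
        using compactE_image[OF compact_sphere, of T "\<lambda>w. ball w \<epsilon>" 0 1] by (metis open_ball)
      have ev: "\<forall>\<^sub>F s in at (0::real). \<bar>f (x + s *\<^sub>R w) - f x - (s *\<^sub>R w) \<bullet> D\<bar> \<le> \<epsilon> * \<bar>s\<bar>" if "w \<in> T" for w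
      proof -
        obtain t a where w: "w = t *\<^sub>R (a, 1)" "t \<noteq> 0" "a \<in> \<rat>" using \<open>w \<in> T\<close> by (auto simp: T_def)
        have "((\<lambda>h. dq f (a, 1) h x) \<longlongrightarrow> (a, 1) \<bullet> D) (at 0)"
          using dq_tendsto_oblique_deriv[OF lip elim(1) w(3)] lin[OF w(3)] by simp
        moreover have "filterlim (\<lambda>s. s * t) (at 0) (at (0::real))"
          unfolding filterlim_at using w(2) by (auto intro!: tendsto_mult_left_zero tendsto_ident_at simp: eventually_at_filter)
        ultimately have "((\<lambda>s. dq f (a, 1) (s * t) x) \<longlongrightarrow> (a, 1) \<bullet> D) (at 0)"
          by (rule filterlim_compose)
        then have "((\<lambda>s. t * dq f (a, 1) (s * t) x) \<longlongrightarrow> t * ((a, 1) \<bullet> D)) (at 0)" by (intro tendsto_intros)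
        then have "\<forall>\<^sub>F s in at 0. dist (t * dq f (a, 1) (s * t) x) (t * ((a, 1) \<bullet> D)) < \<epsilon>"
          using \<epsilon> by (rule tendstoD)
        moreover have "\<forall>\<^sub>F s in at (0::real). s \<noteq> 0" by (simp add: eventually_at_filter)
        ultimately show ?thesis
        proof eventually_elim
          case (elim s)
          have "s * (t * dq f (a, 1) (s * t) x - t * ((a, 1) \<bullet> D)) = f (x + s *\<^sub>R w) - f x - (s *\<^sub>R w) \<bullet> D"
          proof -
            have eqw: "s *\<^sub>R w = (s * t) *\<^sub>R (a, 1)" by (simp add: w(1))
            show ?thesis unfolding eqw dq_def inner_scaleR_left
              using elim(2) w(2) by (simp add: field_simps del: scaleR_Pair)
          qed
          then have "\<bar>f (x + s *\<^sub>R w) - f x - (s *\<^sub>R w) \<bullet> D\<bar> = \<bar>s\<bar> * \<bar>t * dq f (a, 1) (s * t) x - t * ((a, 1) \<bullet> D)\<bar>"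
            by (metis abs_mult)
          also have "\<dots> \<le> \<bar>s\<bar> * \<epsilon>" using elim(1) by (intro mult_left_mono) (auto simp: dist_real_def)
          finally show ?case by (simp add: mult.commute)
        qed
      qed
      have "\<forall>\<^sub>F s in at (0::real). \<forall>w\<in>T'. \<bar>f (x + s *\<^sub>R w) - f x - (s *\<^sub>R w) \<bullet> D\<bar> \<le> \<epsilon> * \<bar>s\<bar>"
        using T'(1,2) ev by (intro eventually_ball_finite) auto
      then obtain d where d: "d > 0" "\<And>s. s \<noteq> 0 \<Longrightarrow> \<bar>s\<bar> < d \<Longrightarrow> \<forall>w\<in>T'. \<bar>f (x + s *\<^sub>R w) - f x - (s *\<^sub>R w) \<bullet> D\<bar> \<le> \<epsilon> * \<bar>s\<bar>"
        unfolding eventually_at by (auto simp: dist_real_def)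
      show "\<exists>d>0. \<forall>h. norm h < d \<longrightarrow> \<bar>f (x + h) - f x - h \<bullet> D\<bar> \<le> e * norm h"
      proof (intro exI[of _ d] conjI allI impI)
        fix h :: "real \<times> real" assume h: "norm h < d"
        show "\<bar>f (x + h) - f x - h \<bullet> D\<bar> \<le> e * norm h"
        proof (cases "h = 0")
          case False
          define s where "s = norm h"
          have s: "s > 0" "s < d" using False h by (auto simp: s_def)
          have "(1 / s) *\<^sub>R h \<in> sphere 0 1" using s by (simp add: s_def)
          then obtain w where w: "w \<in> T'" "dist w ((1 / s) *\<^sub>R h) < \<epsilon>"
            using T'(3) unfolding UN_iff mem_ball subset_iff by blast
          have close: "norm (h - s *\<^sub>R w) \<le> \<epsilon> * s"
          proof -
            have "h - s *\<^sub>R w = s *\<^sub>R ((1 / s) *\<^sub>R h - w)" using s by (simp add: scaleR_diff_right)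
            then have "norm (h - s *\<^sub>R w) = s * dist w ((1 / s) *\<^sub>R h)"
              using s by (metis abs_of_pos dist_commute dist_norm norm_scaleR)
            then show ?thesis using w(2) s by (simp add: mult.commute)
          qed
          have 1: "\<bar>f (x + h) - f (x + s *\<^sub>R w)\<bar> \<le> K * (\<epsilon> * s)"
          proof -
            have "\<bar>f (x + h) - f (x + s *\<^sub>R w)\<bar> \<le> K * norm (h - s *\<^sub>R w)"
              using lipschitz_onD[OF lip, of "x + h" "x + s *\<^sub>R w"] by (simp add: dist_norm)
            also have "\<dots> \<le> K * (\<epsilon> * s)" using close K0 by (rule mult_left_mono)
            finally show ?thesis .
          qed
          have 2: "\<bar>(h - s *\<^sub>R w) \<bullet> D\<bar> \<le> (\<epsilon> * s) * norm D"
            using Cauchy_Schwarz_ineq2[of "h - s *\<^sub>R w" D] close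
            by (meson mult_right_mono norm_ge_zero order_trans)
          have 3: "\<bar>f (x + s *\<^sub>R w) - f x - (s *\<^sub>R w) \<bullet> D\<bar> \<le> \<epsilon> * s"
            using d(2)[of s] s w(1) by auto
          have "f (x + h) - f x - h \<bullet> D = (f (x + h) - f (x + s *\<^sub>R w)) + (f (x + s *\<^sub>R w) - f x - (s *\<^sub>R w) \<bullet> D) - (h - s *\<^sub>R w) \<bullet> D"
            by (simp add: inner_diff_left)
          then have "\<bar>f (x + h) - f x - h \<bullet> D\<bar> \<le> K * (\<epsilon> * s) + \<epsilon> * s + (\<epsilon> * s) * norm D"
            using 1 2 3 by linarith
          also have "\<dots> = (\<epsilon> * (K + norm D + 1)) * s" by (simp add: algebra_simps)
          also have "\<epsilon> * (K + norm D + 1) = e" using pos by (simp add: \<epsilon>_def)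
          finally show ?thesis by (simp add: s_def)
        qed simp
      qed (rule d(1))
    qed
  qed
qed

text \<open>By continuity it suffices to test increments h from a countable dense set, which makes
  differentiability a countable combination of Borel conditions.\<close>

lemma GDERIV_set_measurable:
  fixes f :: "real \<times> real \<Rightarrow> real"
  assumes cont: "continuous_on UNIV f"
  shows "{x. GDERIV f x :> plane_grad f x} \<in> sets borel"
proof -
  have [measurable]: "f \<in> borel_measurable borel" by (rule borel_measurable_continuous_onI[OF cont])
  obtain C :: "(real \<times> real) set" where C: "countable C" "\<And>X. open X \<Longrightarrow> X \<noteq> {} \<Longrightarrow> \<exists>d\<in>C. d \<in> X"
    using countable_dense_exists by metis
  have eq: "GDERIV f x :> D \<longleftrightarrow> (\<forall>n::nat. \<exists>m::nat. \<forall>h\<in>{h\<in>C. norm h < inverse (Suc m)}. \<bar>f (x + h) - f x - h \<bullet> D\<bar> \<le> inverse (Suc n) * norm h)" for x D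
  proof
    assume L: "GDERIV f x :> D"
    show "\<forall>n::nat. \<exists>m::nat. \<forall>h\<in>{h\<in>C. norm h < inverse (Suc m)}. \<bar>f (x + h) - f x - h \<bullet> D\<bar> \<le> inverse (Suc n) * norm h"
    proof
      fix n :: nat
      have "inverse (real (Suc n)) > 0" by simp
      then obtain d where d: "d > 0" "\<forall>h. norm h < d \<longrightarrow> \<bar>f (x + h) - f x - h \<bullet> D\<bar> \<le> inverse (Suc n) * norm h"
        using L unfolding GDERIV_iff by blast
      from reals_Archimedean[OF d(1)] obtain m where "inverse (real (Suc m)) < d" ..
      with d(2) show "\<exists>m::nat. \<forall>h\<in>{h\<in>C. norm h < inverse (Suc m)}. \<bar>f (x + h) - f x - h \<bullet> D\<bar> \<le> inverse (Suc n) * norm h"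
        by (intro exI[of _ m]) auto
    qed
  next
    assume R: "\<forall>n::nat. \<exists>m::nat. \<forall>h\<in>{h\<in>C. norm h < inverse (Suc m)}. \<bar>f (x + h) - f x - h \<bullet> D\<bar> \<le> inverse (Suc n) * norm h"
    show "GDERIV f x :> D"
      unfolding GDERIV_iff
    proof (intro allI impI)
      fix e :: real assume "e > 0"
      from reals_Archimedean[OF this] obtain n where n: "inverse (real (Suc n)) < e" ..
      from R obtain m where m: "\<And>h. h \<in> C \<Longrightarrow> norm h < inverse (real (Suc m)) \<Longrightarrow> \<bar>f (x + h) - f x - h \<bullet> D\<bar> \<le> inverse (Suc n) * norm h"
        by blast
      show "\<exists>d>0. \<forall>h. norm h < d \<longrightarrow> \<bar>f (x + h) - f x - h \<bullet> D\<bar> \<le> e * norm h"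
      proof (intro exI[of _ "inverse (real (Suc m))"] conjI allI impI)
        fix h :: "real \<times> real" assume h: "norm h < inverse (real (Suc m))"
        have "\<bar>f (x + h) - f x - h \<bullet> D\<bar> \<le> inverse (Suc n) * norm h"
        proof (rule ccontr)
          assume neg: "\<not> ?thesis"
          define O' where "O' = {h. norm h < inverse (real (Suc m))} \<inter> {h. inverse (Suc n) * norm h < \<bar>f (x + h) - f x - h \<bullet> D\<bar>}"
          have "continuous_on UNIV (\<lambda>h. f (x + h))" by (intro continuous_on_compose2[OF cont] continuous_intros) auto
          then have "open O'" unfolding O'_def
            by (intro open_Int open_Collect_less continuous_intros)
          moreover have "h \<in> O'" using h neg by (simp add: O'_def)
          ultimately obtain k where "k \<in> C" "k \<in> O'" using C(2)[of O'] by blast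
          then show False using m[of k] by (simp add: O'_def)
        qed
        also have "\<dots> \<le> e * norm h" using n by (intro mult_right_mono) auto
        finally show "\<bar>f (x + h) - f x - h \<bullet> D\<bar> \<le> e * norm h" .
      qed simp
    qed
  qed
  have cC: "countable {h\<in>C. norm h < r}" for r by (rule countable_subset[OF _ C(1)]) auto
  have "{x. GDERIV f x :> plane_grad f x} = (\<Inter>n::nat. \<Union>m::nat. \<Inter>h\<in>{h\<in>C. norm h < inverse (Suc m)}. {x. \<bar>f (x + h) - f x - h \<bullet> plane_grad f x\<bar> \<le> inverse (Suc n) * norm h})"
    unfolding eq by auto
  also have "\<dots> \<in> sets borel"
  proof -
    have "{x. \<bar>f (x + h) - f x - h \<bullet> plane_grad f x\<bar> \<le> inverse (Suc n) * norm h} \<in> sets borel" for h and n :: nat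
      by measurable
    then have "(\<Inter>h\<in>{h\<in>C. norm h < inverse (Suc m)}. {x. \<bar>f (x + h) - f x - h \<bullet> plane_grad f x\<bar> \<le> inverse (Suc n) * norm h}) \<in> sets borel" for n m :: nat
      using cC by (intro sets.countable_INT'') auto
    then show ?thesis by (intro sets.countable_INT'' sets.countable_UN) auto
  qed
  finally show ?thesis .
qed

lemma grad_measurable:
  fixes f :: "real \<times> real \<Rightarrow> real"
  assumes cont: "continuous_on UNIV f"
  shows "grad f \<in> borel_measurable borel"
proof -
  have [measurable]: "f \<in> borel_measurable borel" by (rule borel_measurable_continuous_onI[OF cont])
  have [measurable]: "{x. GDERIV f x :> plane_grad f x} \<in> sets borel" by (rule GDERIV_set_measurable[OF cont])
  \<comment> \<open>Where f is not differentiable, \<open>grad f\<close> is the fixed, unspecified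
    value \<open>THE D. False\<close>, hence measurable there as a constant.\<close>
  have "grad f = (\<lambda>x. if x \<in> {x. GDERIV f x :> plane_grad f x} then plane_grad f x else (THE D. False))"
  proof
    fix x
    show "grad f x = (if x \<in> {x. GDERIV f x :> plane_grad f x} then plane_grad f x else (THE D. False))"
    proof (cases "GDERIV f x :> plane_grad f x")
      case True then show ?thesis by (simp add: grad_eqI)
    next
      case False
      then have "\<not> GDERIV f x :> D" for D using plane_grad_eq by metis
      then have "(\<lambda>D. GDERIV f x :> D) = (\<lambda>D. False)" by auto
      then show ?thesis using False by (simp add: grad_def)
    qed
  qed
  also have "\<dots> \<in> borel_measurable borel" by measurable
  finally show ?thesis .
qed

lemma AE_GDERIV_grad:
  fixes f :: "real \<times> real \<Rightarrow> real"
  assumes "K-lipschitz_on UNIV f"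
  shows "AE x in lborel. GDERIV f x :> grad f x"
  using AE_GDERIV_lipschitz[OF assms] by eventually_elim (simp add: grad_eqI)

lemma GDERIV_lipschitz_bound:
  assumes "K-lipschitz_on UNIV f" "GDERIV f x :> D"
  shows "norm D \<le> K"
proof -
  have "\<bar>D \<bullet> D\<bar> \<le> K * norm D"
    by (rule tendsto_le[OF _ tendsto_const tendsto_rabs[OF GDERIV_dq_tendsto[OF assms(2)]]])
       (auto intro!: always_eventually dq_bound[OF assms(1)])
  then have "norm D * norm D \<le> K * norm D" by (simp add: dot_square_norm power2_eq_square)
  then show ?thesis using lipschitz_on_nonneg[OF assms(1)] by (cases "D = 0") auto
qed

text \<open>Dominated convergence in \<open>integral_dq_swap\<close> along h = 1/(n+1): the
  Lipschitz bounds supply the majorants, Rademacher's theorem the pointwise limits.\<close>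

theorem integral_by_parts_lipschitz:
  fixes f \<phi> :: "real \<times> real \<Rightarrow> real"
  assumes f: "K-lipschitz_on UNIV f" and \<phi>: "L-lipschitz_on UNIV \<phi>"
    and bd: "bounded {x. \<phi> x \<noteq> 0}" 
  shows "(LINT x|lborel. (grad f x \<bullet> e) * \<phi> x) = - (LINT x|lborel. f x * (grad \<phi> x \<bullet> e))"
proof -
  have cf: "continuous_on UNIV f" and cp: "continuous_on UNIV \<phi>"
    using f \<phi> by (auto intro: lipschitz_on_continuous_on)
  have [measurable]: "f \<in> borel_measurable borel" "\<phi> \<in> borel_measurable borel"
    using cf cp by (auto intro: borel_measurable_continuous_onI)
  have [measurable]: "grad f \<in> borel_measurable borel" "grad \<phi> \<in> borel_measurable borel"
    using cf cp by (auto intro: grad_measurable)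
  have KL: "K \<ge> 0" "L \<ge> 0" using f \<phi> by (auto intro: lipschitz_on_nonneg)
  obtain r where r: "{x. \<phi> x \<noteq> 0} \<subseteq> ball 0 r" using bounded_subset_ballD[OF bd] by blast
  define U where "U = cball (0::real\<times>real) (r + norm e)"
  have U: "bounded U" "compact U" by (auto simp: U_def)
  have phi0: "\<phi> (x + s *\<^sub>R e) = 0" if "x \<notin> U" "\<bar>s\<bar> \<le> 1" for x s
  proof (rule ccontr)
    assume "\<phi> (x + s *\<^sub>R e) \<noteq> 0"
    then have "norm (x + s *\<^sub>R e) < r" using r by auto
    moreover have "norm (s *\<^sub>R e) \<le> norm e" using that(2) mult_left_le_one_le[of "norm e" "\<bar>s\<bar>"] by simp
    ultimately have "norm x \<le> r + norm e" using norm_triangle_ineq4[of "x + s *\<^sub>R e" "s *\<^sub>R e"] by simp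
    with that(1) show False by (simp add: U_def)
  qed
  have phi00: "\<phi> x = 0" if "x \<notin> U" for x using phi0[OF that, of 0] by simp
  obtain B where B: "\<And>x. x \<in> U \<Longrightarrow> \<bar>f x\<bar> \<le> B"
    using compact_imp_bounded[OF compact_continuous_image[OF continuous_on_subset[OF cf] U(2)]] by (auto simp: bounded_iff)
  obtain C where C: "\<And>x. x \<in> U \<Longrightarrow> \<bar>\<phi> x\<bar> \<le> C"
    using compact_imp_bounded[OF compact_continuous_image[OF continuous_on_subset[OF cp] U(2)]] by (auto simp: bounded_iff)
  have intU: "integrable lborel (\<lambda>x. c * indicat_real U x)" for c
    using emeasure_bounded_finite[OF U(1)] by (auto simp: U_def)
  define hn where "hn n = inverse (real (Suc n))" for n
  have hn0: "hn n \<noteq> 0" "\<bar>hn n\<bar> \<le> 1" for n by (auto simp: hn_def field_simps)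
  have hn: "filterlim hn (at 0) sequentially" unfolding hn_def by (rule inverse_Suc_at_0)
  have hn': "filterlim (\<lambda>n. - hn n) (at 0) sequentially"
    using hn unfolding filterlim_at by (auto simp: tendsto_minus_cancel_left[symmetric] hn0)
  have l1: "(\<lambda>n. LINT x|lborel. dq f e (hn n) x * \<phi> x) \<longlonglongrightarrow> (LINT x|lborel. (grad f x \<bullet> e) * \<phi> x)"
  proof (rule integral_dominated_convergence[where w="\<lambda>x. (K * norm e * C) * indicator U x"])
    show "AE x in lborel. (\<lambda>n. dq f e (hn n) x * \<phi> x) \<longlonglongrightarrow> grad f x \<bullet> e * \<phi> x"
      using AE_GDERIV_grad[OF f]
      by eventually_elim (intro tendsto_intros filterlim_compose[OF GDERIV_dq_tendsto hn])
    show "AE x in lborel. norm (dq f e (hn n) x * \<phi> x) \<le> K * norm e * C * indicat_real U x" for n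
    proof (intro AE_I2)
      fix x show "norm (dq f e (hn n) x * \<phi> x) \<le> K * norm e * C * indicat_real U x"
      proof (cases "x \<in> U")
        case True
        then have "\<bar>dq f e (hn n) x\<bar> * \<bar>\<phi> x\<bar> \<le> (K * norm e) * C"
          using KL by (intro mult_mono dq_bound[OF f] C) auto
        then show ?thesis using True by (simp add: abs_mult)
      qed (simp add: phi00)
    qed
  qed (use intU in measurable)
  have l2: "(\<lambda>n. LINT x|lborel. f x * dq \<phi> e (- hn n) x) \<longlonglongrightarrow> (LINT x|lborel. f x * (grad \<phi> x \<bullet> e))"
  proof (rule integral_dominated_convergence[where w="\<lambda>x. (B * (L * norm e)) * indicator U x"])
    show "AE x in lborel. (\<lambda>n. f x * dq \<phi> e (- hn n) x) \<longlonglongrightarrow> f x * (grad \<phi> x \<bullet> e)"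
      using AE_GDERIV_grad[OF \<phi>]
      by eventually_elim (intro tendsto_intros filterlim_compose[OF GDERIV_dq_tendsto hn'])
    show "AE x in lborel. norm (f x * dq \<phi> e (- hn n) x) \<le> B * (L * norm e) * indicat_real U x" for n
    proof (intro AE_I2)
      fix x show "norm (f x * dq \<phi> e (- hn n) x) \<le> B * (L * norm e) * indicat_real U x"
      proof (cases "x \<in> U")
        case True
        then have "\<bar>f x\<bar> * \<bar>dq \<phi> e (- hn n) x\<bar> \<le> B * (L * norm e)"
          using KL B[OF True] by (intro mult_mono dq_bound[OF \<phi>] B) auto
        then show ?thesis using True by (simp add: abs_mult)
      next
        case False
        then have "dq \<phi> e (- hn n) x = 0" using phi0[of x "- hn n"] phi00[of x] hn0[of n] by (simp add: dq_def)
        then show ?thesis using False by simp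
      qed
    qed
  qed (use intU in measurable)
  have "(LINT x|lborel. dq f e (hn n) x * \<phi> x) = - (LINT x|lborel. f x * dq \<phi> e (- hn n) x)" for n
    by (rule integral_dq_swap[OF cf cp bd hn0(1)])
  then show ?thesis using LIMSEQ_unique[OF l1] tendsto_minus[OF l2] by simp
qed

subsection \<open>Test functions in logarithmic polar coordinates\<close>

text \<open>A rotation that takes the downward vertical to the positive real axis, so that the
  principal logarithm is smooth on the lower half plane.\<close>

definition pol_z :: "real \<times> real \<Rightarrow> complex" where
  "pol_z x = Complex (- snd x) (fst x)"

text \<open>The angle is measured from the downward vertical; its branch cut is the upward vertical.\<close>

definition pol_angle :: "real \<times> real \<Rightarrow> real" where
  "pol_angle x = Im (Ln (pol_z x))"

text \<open>The radial factor is a function of t = ln r: scalings become translations and powers of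
  r become exponentials.\<close>

definition polar_lift :: "(real \<Rightarrow> real) \<Rightarrow> (real \<Rightarrow> real) \<Rightarrow> real \<times> real \<Rightarrow> real" where
  "polar_lift A K x = (if x = 0 then 0 else A (ln (norm x)) * K (pol_angle x))"

lemma norm_pol_z [simp]: "norm (pol_z x) = norm x"
  by (cases x) (simp add: pol_z_def cmod_def norm_Pair add.commute)

lemma pol_z_eq_0_iff [simp]: "pol_z x = 0 \<longleftrightarrow> x = 0"
  by (metis norm_eq_zero norm_pol_z)

lemma pol_z_0 [simp]: "pol_z 0 = 0"
  by simp

lemma Re_Ln_pol_z: "x \<noteq> 0 \<Longrightarrow> Re (Ln (pol_z x)) = ln (norm x)"
  by (simp add: Re_Ln)

lemma pol_z_polar: "x \<noteq> 0 \<Longrightarrow> pol_z x = of_real (norm x) * exp (\<i> * of_real (pol_angle x))"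
proof -
  assume "x \<noteq> 0"
  then have "pol_z x = exp (Ln (pol_z x))" by simp
  also have "Ln (pol_z x) = of_real (ln (norm x)) + \<i> * of_real (pol_angle x)"
    using \<open>x \<noteq> 0\<close> by (simp add: complex_eq_iff Re_Ln_pol_z pol_angle_def)
  finally show ?thesis using \<open>x \<noteq> 0\<close> by (simp add: exp_add exp_of_real)
qed

lemma fst_polar: "x \<noteq> 0 \<Longrightarrow> fst x = norm x * sin (pol_angle x)"
  and snd_polar: "x \<noteq> 0 \<Longrightarrow> snd x = - norm x * cos (pol_angle x)"
  using arg_cong[OF pol_z_polar[of x], of Im] arg_cong[OF pol_z_polar[of x], of Re]
  by (auto simp: pol_z_def Im_exp Re_exp)

lemma pol_angle_bounds: "x \<noteq> 0 \<Longrightarrow> - pi < pol_angle x \<and> pol_angle x \<le> pi"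
  unfolding pol_angle_def using mpi_less_Im_Ln Im_Ln_le_pi by simp

lemma bounded_linear_pol_z: "bounded_linear pol_z"
proof -
  have "pol_z = (\<lambda>x. of_real (- snd x) + \<i> * of_real (fst x))"
    by (auto simp: pol_z_def complex_eq_iff)
  moreover have "bounded_linear (\<lambda>x::real\<times>real. of_real (- snd x) + \<i> * of_real (fst x))"
    by (intro bounded_linear_add bounded_linear_compose[OF bounded_linear_of_real]
        bounded_linear_minus bounded_linear_fst bounded_linear_snd
        bounded_linear_compose[OF bounded_linear_mult_right])
  ultimately show ?thesis by simp
qed

lemma has_derivative_pol:
  assumes "pol_z x \<notin> \<real>\<^sub>\<le>\<^sub>0"
  shows "((\<lambda>x. ln (norm x)) has_derivative (\<lambda>h. (fst x * fst h + snd x * snd h) / (norm x)\<^sup>2)) (at x)"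
    and "(pol_angle has_derivative (\<lambda>h. (- snd x * fst h + fst x * snd h) / (norm x)\<^sup>2)) (at x)"
proof -
  have x0: "x \<noteq> 0" using assms by (auto simp del: pol_z_eq_0_iff)
  have L: "((\<lambda>x. Ln (pol_z x)) has_derivative (\<lambda>h. pol_z h / pol_z x)) (at x)"
  proof -
    have "(Ln has_derivative (\<lambda>h. inverse (pol_z x) * h)) (at (pol_z x))"
      using has_field_derivative_Ln[OF assms] by (simp add: has_field_derivative_def)
    from has_derivative_compose[OF bounded_linear_imp_has_derivative[OF bounded_linear_pol_z] this]
    show ?thesis by (simp add: field_simps)
  qed
  have q: "pol_z h / pol_z x = pol_z h * cnj (pol_z x) / of_real ((norm x)\<^sup>2)" for h
    by (metis complex_div_cnj norm_pol_z of_real_power)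
  have q1: "Re (pol_z h / pol_z x) = (fst x * fst h + snd x * snd h) / (norm x)\<^sup>2"
    "Im (pol_z h / pol_z x) = (- snd x * fst h + fst x * snd h) / (norm x)\<^sup>2" for h
    unfolding q Re_divide_of_real Im_divide_of_real by (simp_all add: pol_z_def mult.commute)
  have "((\<lambda>x. Re (Ln (pol_z x))) has_derivative (\<lambda>h. Re (pol_z h / pol_z x))) (at x)"
    by (rule bounded_linear.has_derivative[OF bounded_linear_Re L])
  then show "((\<lambda>x. ln (norm x)) has_derivative (\<lambda>h. (fst x * fst h + snd x * snd h) / (norm x)\<^sup>2)) (at x)"
    unfolding q1
    by (rule has_derivative_transform_within_open[of _ _ _ _ "- {0}"]) (use x0 in \<open>auto simp: Re_Ln_pol_z\<close>)
  show "(pol_angle has_derivative (\<lambda>h. (- snd x * fst h + fst x * snd h) / (norm x)\<^sup>2)) (at x)"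
    using bounded_linear.has_derivative[OF bounded_linear_Im L] unfolding q1 pol_angle_def .
qed

lemma pol_z_cut: "x \<noteq> 0 \<Longrightarrow> pol_z x \<in> \<real>\<^sub>\<le>\<^sub>0 \<Longrightarrow> snd x > norm x / 2"
  by (cases x) (auto simp: pol_z_def complex_nonpos_Reals_iff zero_prod_def)

text \<open>The two support conditions keep the lift away from the origin and from a neighbourhood
  of the branch cut, the only places where ln r and the angle are not smooth; so the lift is as
  smooth as its factors.\<close>

locale lift_profile =
  fixes A K :: "real \<Rightarrow> real" and t1 t2 :: real
  assumes A_supp: "\<And>t. A t \<noteq> 0 \<Longrightarrow> t1 \<le> t \<and> t \<le> t2"
    and K_supp: "\<And>s. cos s \<le> - 1/2 \<Longrightarrow> K s = 0"
begin

lemma lift_zero: "polar_lift A K x = 0" if "norm x < exp t1 \<or> norm x > exp t2 \<or> snd x \<ge> norm x / 2"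
proof (cases "x = 0")
  case False
  then have nx: "norm x > 0" by simp
  have "A (ln (norm x)) = 0 \<or> K (pol_angle x) = 0"
  proof (cases "snd x \<ge> norm x / 2")
    case True
    then have "norm x * (cos (pol_angle x) + 1/2) \<le> 0" using snd_polar[OF False] by (simp add: algebra_simps)
    then have "cos (pol_angle x) \<le> - 1/2" using nx by (simp add: mult_le_0_iff)
    then show ?thesis using K_supp by blast
  next
    case False
    then have "norm x < exp t1 \<or> norm x > exp t2" using that by blast
    then have "ln (norm x) < t1 \<or> ln (norm x) > t2"
      using nx by (metis exp_gt_zero ln_exp ln_less_cancel_iff)
    then show ?thesis using A_supp by force
  qed
  then show ?thesis by (auto simp: polar_lift_def)
qed (simp add: polar_lift_def)

lemma lift_support: "polar_lift A K x \<noteq> 0 \<Longrightarrow> x \<in> cball 0 (exp t2)"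
  using lift_zero[of x] by (force simp: not_less)

lemma lift_near_zero:
  assumes "pol_z x \<in> \<real>\<^sub>\<le>\<^sub>0"
  obtains U where "open U" "x \<in> U" "\<And>y. y \<in> U \<Longrightarrow> polar_lift A K y = 0"
proof (cases "x = 0")
  case True
  show ?thesis by (rule that[of "ball 0 (exp t1)"]) (use True in \<open>auto intro: lift_zero\<close>)
next
  case False
  show ?thesis
    by (rule that[of "{y. norm y / 2 < snd y}"])
       (use pol_z_cut[OF False assms] in \<open>auto intro!: lift_zero open_Collect_less continuous_intros\<close>)
qed

lemma lift_continuous:
  assumes "continuous_on UNIV A" "continuous_on UNIV K"
  shows "continuous_on UNIV (polar_lift A K)"
proof -
  have "isCont (polar_lift A K) x" for x
  proof (cases "pol_z x \<in> \<real>\<^sub>\<le>\<^sub>0")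
    case True
    then obtain U where U: "open U" "x \<in> U" "\<And>y. y \<in> U \<Longrightarrow> polar_lift A K y = 0"
    using lift_near_zero by blast
    have "\<forall>\<^sub>F y in nhds x. polar_lift A K y = (\<lambda>_. 0) y"
      using U by (auto simp: eventually_nhds)
    from isCont_cong[OF this] show ?thesis by simp
  next
    case False
    then have x0: "x \<noteq> 0" by (auto simp del: pol_z_eq_0_iff)
    have AK: "isCont A a" "isCont K a" for a
      using assms by (simp_all add: continuous_on_eq_continuous_at)
    have "isCont (\<lambda>x. A (ln (norm x))) x"
      by (rule isCont_o2[OF has_derivative_continuous[OF has_derivative_pol(1)[OF False]] AK(1)])
    moreover have "isCont (\<lambda>x. K (pol_angle x)) x"
      by (rule isCont_o2[OF has_derivative_continuous[OF has_derivative_pol(2)[OF False]] AK(2)])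
    ultimately have "isCont (\<lambda>x. A (ln (norm x)) * K (pol_angle x)) x" by (rule continuous_mult)
    moreover have "\<forall>\<^sub>F y in nhds x. polar_lift A K y = A (ln (norm y)) * K (pol_angle y)"
      using x0 by (auto simp: eventually_nhds polar_lift_def intro!: exI[of _ "- {0}"])
    note isCont_cong[OF this]
    ultimately show ?thesis by simp
  qed
  then show ?thesis by (simp add: continuous_on_eq_continuous_at)
qed

end

locale lift_C1 = lift_profile +
  fixes A' K' :: "real \<Rightarrow> real"
  assumes DA: "\<And>t. (A has_real_derivative A' t) (at t)"
    and DK: "\<And>s. (K has_real_derivative K' s) (at s)"
    and cA': "continuous_on UNIV A'" and cK': "continuous_on UNIV K'"
begin

text \<open>With e_r = (sin s, - cos s) and e_s = (cos s, sin s), the pair \<open>gX\<close>,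
  \<open>gY\<close> is (A' K e_r + A K' e_s) / r. Each term is again a polar lift, so second
  derivatives come from the same lemma.\<close>

definition gX :: "real \<times> real \<Rightarrow> real" where
  "gX x = polar_lift (\<lambda>t. exp (- t) * A' t) (\<lambda>s. K s * sin s) x + polar_lift (\<lambda>t. exp (- t) * A t) (\<lambda>s. K' s * cos s) x"

definition gY :: "real \<times> real \<Rightarrow> real" where
  "gY x = polar_lift (\<lambda>t. exp (- t) * A t) (\<lambda>s. K' s * sin s) x - polar_lift (\<lambda>t. exp (- t) * A' t) (\<lambda>s. K s * cos s) x"

lemma cA: "continuous_on UNIV A" and cK: "continuous_on UNIV K"
  using DA DK by (auto simp: continuous_on_eq_continuous_at intro: DERIV_isCont)

lemma A'_supp: "A' t \<noteq> 0 \<Longrightarrow> t1 \<le> t \<and> t \<le> t2"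
proof (rule ccontr)
  assume a: "A' t \<noteq> 0" "\<not> (t1 \<le> t \<and> t \<le> t2)"
  have "\<forall>\<^sub>F s in nhds t. A s = 0"
    unfolding eventually_nhds using a(2) A_supp
    by (intro exI[of _ "- {t1..t2}"]) fastforce
  then have "(A has_real_derivative 0) (at t)" by (subst DERIV_cong_ev[OF refl]) auto
  then show False using DA[of t] a(1) DERIV_unique by blast
qed

text \<open>On the open set cos s < -1/2 the function K vanishes identically; a boundary point is a
  limit point of that set because sin s \<noteq> 0 there, and K' is continuous.\<close>

lemma K'_supp: "K' s = 0" if "cos s \<le> - 1/2"
proof -
  have lt: "K' s = 0" if "cos s < - 1/2" for s
  proof -
    have "\<forall>\<^sub>F r in nhds s. K r = 0"
      unfolding eventually_nhds
      by (intro exI[of _ "{r. cos r < - 1/2}"])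
         (use that K_supp in \<open>auto intro!: open_Collect_less continuous_intros\<close>)
    then have "(K has_real_derivative 0) (at s)" by (subst DERIV_cong_ev[OF refl]) auto
    then show ?thesis using DK[of s] DERIV_unique by blast
  qed
  show ?thesis
  proof (cases "cos s < - 1/2")
    case False
    with that have c: "cos s = - 1/2" by simp
    then have s0: "sin s \<noteq> 0"
    proof -
      have "(sin s)\<^sup>2 = 3/4" using c sin_squared_eq[of s] by (simp add: power2_eq_square)
      then show ?thesis by auto
    qed
    have "s islimpt {r. cos r < - 1/2}"
    proof (rule ccontr)
      assume "\<not> ?thesis"
      then obtain T where T: "open T" "s \<in> T" "\<And>y. y \<in> T \<Longrightarrow> y \<noteq> s \<Longrightarrow> \<not> cos y < -1/2"
        by (auto simp: islimpt_def)
      then obtain d where d: "d > 0" "\<And>y. \<bar>s - y\<bar> < d \<Longrightarrow> cos s \<le> cos y"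
        using c unfolding open_dist by (metis dist_commute dist_real_def not_less order_refl)
      from DERIV_local_min[OF DERIV_cos d(1)] d(2) have "- sin s = 0" by blast
      with s0 show False by simp
    qed
    moreover have "closed {r. K' r = 0}"
      by (intro closed_Collect_eq continuous_on_const cK')
    ultimately show ?thesis using lt closed_limpt islimpt_subset
      by (metis (mono_tags, lifting) mem_Collect_eq subsetI)
  qed (rule lt)
qed

lemma GDERIV_lift: "GDERIV (polar_lift A K) x :> (gX x, gY x)"
proof (cases "pol_z x \<in> \<real>\<^sub>\<le>\<^sub>0")
  case True
  then obtain U where U: "open U" "x \<in> U" "\<And>y. y \<in> U \<Longrightarrow> polar_lift A K y = 0"
    using lift_near_zero by blast
  have g0: "(gX x, gY x) = 0"
  proof -
    interpret a: lift_profile "\<lambda>t. exp (- t) * A' t" "\<lambda>s. K s * sin s" t1 t2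
      by unfold_locales (use A'_supp K_supp in auto)
    interpret b: lift_profile "\<lambda>t. exp (- t) * A t" "\<lambda>s. K' s * cos s" t1 t2
      by unfold_locales (use A_supp K'_supp in auto)
    interpret c: lift_profile "\<lambda>t. exp (- t) * A t" "\<lambda>s. K' s * sin s" t1 t2
      by unfold_locales (use A_supp K'_supp in auto)
    interpret d: lift_profile "\<lambda>t. exp (- t) * A' t" "\<lambda>s. K s * cos s" t1 t2
      by unfold_locales (use A'_supp K_supp in auto)
    have "norm x < exp t1 \<or> norm x > exp t2 \<or> snd x \<ge> norm x / 2"
      using pol_z_cut[OF _ True] by (cases "x = 0") auto
    then show ?thesis unfolding gX_def gY_def
      by (simp only: a.lift_zero b.lift_zero c.lift_zero d.lift_zero) (simp add: zero_prod_def)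
  qed
  have "(polar_lift A K has_derivative (\<lambda>h. 0)) (at x)"
    by (rule has_derivative_transform_within_open[OF has_derivative_const[of 0] U(1,2)]) (simp add: U(3))
  then show ?thesis unfolding gderiv_def g0 by simp
next
  case False
  then have x0: "x \<noteq> 0" by (auto simp del: pol_z_eq_0_iff)
  define t s where "t = ln (norm x)" and "s = pol_angle x"
  have n0: "norm x > 0" using x0 by simp
  have et: "exp (- t) = 1 / norm x" using n0 by (simp add: t_def exp_minus divide_inverse)
  have A1: "((\<lambda>x. A (ln (norm x))) has_derivative (\<lambda>h. (fst x * fst h + snd x * snd h) / (norm x)\<^sup>2 * A' t)) (at x)"
    using has_derivative_compose[OF has_derivative_pol(1)[OF False], of A "(*) (A' t)"]
      DA[of t] by (simp add: has_field_derivative_def t_def mult.commute)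
  have K1: "((\<lambda>x. K (pol_angle x)) has_derivative (\<lambda>h. (- snd x * fst h + fst x * snd h) / (norm x)\<^sup>2 * K' s)) (at x)"
    using has_derivative_compose[OF has_derivative_pol(2)[OF False], of K "(*) (K' s)"]
      DK[of s] by (simp add: has_field_derivative_def s_def mult.commute)
  have "((\<lambda>x. A (ln (norm x)) * K (pol_angle x)) has_derivative (\<lambda>h. h \<bullet> (gX x, gY x))) (at x)"
  proof (rule has_derivative_eq_rhs[OF has_derivative_mult[OF A1 K1]], rule ext)
    fix h :: "real \<times> real"
    have f: "fst x = norm x * sin s" "snd x = - norm x * cos s"
      unfolding s_def by (rule fst_polar[OF x0], rule snd_polar[OF x0])
    have gg: "gX x = (A' t * K s * sin s + A t * K' s * cos s) / norm x"
      "gY x = (A t * K' s * sin s - A' t * K s * cos s) / norm x"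
      using x0 unfolding gX_def gY_def polar_lift_def t_def[symmetric] s_def[symmetric] et
      by (simp_all add: add_divide_distrib diff_divide_distrib)
    have "A (ln (norm x)) * ((- snd x * fst h + fst x * snd h) / (norm x)\<^sup>2 * K' s) +
      (fst x * fst h + snd x * snd h) / (norm x)\<^sup>2 * A' t * K (pol_angle x) = fst h * gX x + snd h * gY x"
      unfolding gg f s_def[symmetric] t_def[symmetric] using n0
      by (simp add: field_simps power2_eq_square)
    then show "A (ln (norm x)) * ((- snd x * fst h + fst x * snd h) / (norm x)\<^sup>2 * K' s) +
      (fst x * fst h + snd x * snd h) / (norm x)\<^sup>2 * A' t * K (pol_angle x) = h \<bullet> (gX x, gY x)"
      by (simp add: inner_prod_def)
  qed
  then show ?thesis unfolding gderiv_def
    by (rule has_derivative_transform_within_open[of _ _ _ _ "- {0}"]) (use x0 in \<open>auto simp: polar_lift_def\<close>)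
qed

lemma grad_lift: "grad (polar_lift A K) x = (gX x, gY x)"
  by (rule grad_eqI[OF GDERIV_lift])

lemma continuous_gX: "continuous_on UNIV gX" and continuous_gY: "continuous_on UNIV gY"
proof -
  interpret a: lift_profile "\<lambda>t. exp (- t) * A' t" "\<lambda>s. K s * sin s" t1 t2
    by unfold_locales (use A'_supp K_supp in auto)
  interpret b: lift_profile "\<lambda>t. exp (- t) * A t" "\<lambda>s. K' s * cos s" t1 t2
    by unfold_locales (use A_supp K'_supp in auto)
  interpret c: lift_profile "\<lambda>t. exp (- t) * A t" "\<lambda>s. K' s * sin s" t1 t2
    by unfold_locales (use A_supp K'_supp in auto)
  interpret d: lift_profile "\<lambda>t. exp (- t) * A' t" "\<lambda>s. K s * cos s" t1 t2
    by unfold_locales (use A'_supp K_supp in auto)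
  show "continuous_on UNIV gX" "continuous_on UNIV gY"
    unfolding gX_def gY_def
    by (intro continuous_intros a.lift_continuous b.lift_continuous c.lift_continuous d.lift_continuous cA cA' cK cK')+
qed

lemma grad_support: "grad (polar_lift A K) x \<noteq> 0 \<Longrightarrow> x \<in> cball 0 (exp t2)"
proof (rule ccontr)
  assume "grad (polar_lift A K) x \<noteq> 0" "x \<notin> cball 0 (exp t2)"
  then have n: "norm x > exp t2" by simp
  have "(polar_lift A K has_derivative (\<lambda>h. 0)) (at x)"
    by (rule has_derivative_transform_within_open[OF has_derivative_const[of 0], of "{y. exp t2 < norm y}"])
       (use n in \<open>auto intro!: open_Collect_less continuous_intros simp: lift_zero\<close>)
  then have "GDERIV (polar_lift A K) x :> 0" by (simp add: gderiv_def)
  from grad_eqI[OF this] \<open>grad (polar_lift A K) x \<noteq> 0\<close> show False by simp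
qed

lemma lift_C1_compact_support:
  assumes "cball 0 (exp t2) \<subseteq> U"
  shows "polar_lift A K \<in> C1_compact_support U"
proof -
  have sub: "closure {x. polar_lift A K x \<noteq> 0} \<subseteq> cball 0 (exp t2)"
    by (intro closure_minimal) (use lift_support in auto)
  then have "compact (closure {x. polar_lift A K x \<noteq> 0})"
    by (meson bounded_cball bounded_subset closed_closure compact_eq_bounded_closed)
  moreover have "polar_lift A K differentiable (at x)" for x
    using GDERIV_lift[of x] unfolding gderiv_def by (auto simp: differentiable_def)
  moreover have "continuous_on UNIV (grad (polar_lift A K))"
  proof -
    have "grad (polar_lift A K) = (\<lambda>x. (gX x, gY x))" using grad_lift by auto
    then show ?thesis by (simp only:) (intro continuous_intros continuous_gX continuous_gY)
  qed
  ultimately show ?thesis unfolding C1_compact_support_def using sub assms by blast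
qed

lemma lift_lipschitz: "\<exists>L. L-lipschitz_on UNIV (polar_lift A K)"
proof -
  have cg: "continuous_on UNIV (grad (polar_lift A K))"
    using lift_C1_compact_support[of UNIV] by (simp add: C1_compact_support_def)
  have "bounded (grad (polar_lift A K) ` cball 0 (exp t2))"
    by (intro compact_imp_bounded compact_continuous_image continuous_on_subset[OF cg]) auto
  then obtain B where B: "\<And>x. x \<in> cball 0 (exp t2) \<Longrightarrow> norm (grad (polar_lift A K) x) \<le> B"
    unfolding bounded_iff by blast
  have B': "norm (grad (polar_lift A K) x) \<le> max 0 B" for x
    using B[of x] grad_support[of x] by (cases "grad (polar_lift A K) x = 0") auto
  have "(max 0 B)-lipschitz_on UNIV (polar_lift A K)"
  proof (rule bounded_derivative_imp_lipschitz)
    show "(polar_lift A K has_derivative (\<lambda>h. h \<bullet> grad (polar_lift A K) x)) (at x within UNIV)" for x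
      using GDERIV_lift[of x] unfolding gderiv_def grad_lift .
    show "onorm (\<lambda>h. h \<bullet> grad (polar_lift A K) x) \<le> max 0 B" for x
    proof (rule onorm_le)
      fix h
      have "norm (h \<bullet> grad (polar_lift A K) x) \<le> norm h * norm (grad (polar_lift A K) x)"
        using Cauchy_Schwarz_ineq2 by simp
      also have "\<dots> \<le> norm h * max 0 B" by (intro mult_left_mono B') auto
      finally show "norm (h \<bullet> grad (polar_lift A K) x) \<le> max 0 B * norm h" by (simp add: mult.commute)
    qed
  qed auto
  then show ?thesis by blast
qed

end

text \<open>The first-order data of (A, K), (A', K) and (A, K') are exactly what a second
  differentiation of the product requires.\<close>

locale lift_C2 = lift_C1 A K t1 t2 A' K' + d: lift_C1 A' K t1 t2 A'' K' + k: lift_C1 A K' t1 t2 A' K''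
  for A K t1 t2 A' K' A'' K''
begin

text \<open>Green's formula without boundary term: the Laplacian of A(t) K(s) is (A'' K + A K'') /
  r^2, with exp (-2 t) for 1 / r^2. All derivatives end up on the smooth factor.\<close>

lemma integral_grad_lift:
  assumes f: "C-lipschitz_on UNIV f"
  shows "(LINT x|lborel. grad f x \<bullet> grad (polar_lift A K) x)
     = - (LINT x|lborel. f x * (polar_lift (\<lambda>t. exp (-2*t) * A'' t) K x + polar_lift (\<lambda>t. exp (-2*t) * A t) K'' x))"
proof -
  have e: "exp (- 2 * t) = exp (- t) * exp (- t)" for t :: real by (simp add: exp_add[symmetric])
  have DA1: "((\<lambda>t. exp (- t) * A' t) has_real_derivative exp (- t) * A'' t - exp (- t) * A' t) (at t)" for t
    by (auto intro!: derivative_eq_intros d.DA)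
  have DA0: "((\<lambda>t. exp (- t) * A t) has_real_derivative exp (- t) * A' t - exp (- t) * A t) (at t)" for t
    by (auto intro!: derivative_eq_intros DA)
  interpret p: lift_C1 "\<lambda>t. exp (- t) * A' t" "\<lambda>s. K s * sin s" t1 t2 "\<lambda>t. exp (- t) * A'' t - exp (- t) * A' t" "\<lambda>s. K' s * sin s + K s * cos s"
    by unfold_locales (use A'_supp K_supp DA1 in \<open>auto intro!: derivative_eq_intros DK continuous_intros cA' d.cA' cK cK' simp: mult.commute\<close>)
  interpret q: lift_C1 "\<lambda>t. exp (- t) * A t" "\<lambda>s. K' s * cos s" t1 t2 "\<lambda>t. exp (- t) * A' t - exp (- t) * A t" "\<lambda>s. K'' s * cos s - K' s * sin s"
    by unfold_locales (use A_supp K'_supp DA0 in \<open>auto intro!: derivative_eq_intros k.DK continuous_intros cA cA' k.cK' cK' simp: mult.commute\<close>)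
  interpret r: lift_C1 "\<lambda>t. exp (- t) * A t" "\<lambda>s. K' s * sin s" t1 t2 "\<lambda>t. exp (- t) * A' t - exp (- t) * A t" "\<lambda>s. K'' s * sin s + K' s * cos s"
    by unfold_locales (use A_supp K'_supp DA0 in \<open>auto intro!: derivative_eq_intros k.DK continuous_intros cA cA' k.cK' cK' simp: mult.commute\<close>)
  interpret w: lift_C1 "\<lambda>t. exp (- t) * A' t" "\<lambda>s. K s * cos s" t1 t2 "\<lambda>t. exp (- t) * A'' t - exp (- t) * A' t" "\<lambda>s. K' s * cos s - K s * sin s"
    by unfold_locales (use A'_supp K_supp DA1 in \<open>auto intro!: derivative_eq_intros DK continuous_intros cA' d.cA' cK cK' simp: mult.commute\<close>)
  have GX: "GDERIV gX x :> (p.gX x + q.gX x, p.gY x + q.gY x)" for x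
    unfolding gX_def using GDERIV_add[OF p.GDERIV_lift q.GDERIV_lift, of x] by simp
  have GY: "GDERIV gY x :> (r.gX x - w.gX x, r.gY x - w.gY x)" for x
    unfolding gY_def using GDERIV_diff[OF r.GDERIV_lift w.GDERIV_lift, of x] by simp
  obtain L1 L2 L3 L4 where "L1-lipschitz_on UNIV (polar_lift (\<lambda>t. exp (- t) * A' t) (\<lambda>s. K s * sin s))"
    "L2-lipschitz_on UNIV (polar_lift (\<lambda>t. exp (- t) * A t) (\<lambda>s. K' s * cos s))"
    "L3-lipschitz_on UNIV (polar_lift (\<lambda>t. exp (- t) * A t) (\<lambda>s. K' s * sin s))"
    "L4-lipschitz_on UNIV (polar_lift (\<lambda>t. exp (- t) * A' t) (\<lambda>s. K s * cos s))"
    using p.lift_lipschitz q.lift_lipschitz r.lift_lipschitz w.lift_lipschitz by blast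
  then have lX: "(L1 + L2)-lipschitz_on UNIV gX" and lY: "(L3 + L4)-lipschitz_on UNIV gY"
    unfolding gX_def[abs_def] gY_def[abs_def] by (auto intro: lipschitz_on_add lipschitz_on_diff)
  have bX: "bounded {x. gX x \<noteq> 0}" and bY: "bounded {x. gY x \<noteq> 0}"
    by (rule bounded_subset[of "cball 0 (exp t2)"]; use grad_support in \<open>force simp: grad_lift zero_prod_def\<close>)+
  have cf: "continuous_on UNIV f" by (rule lipschitz_on_continuous_on[OF f])
  have cmX: "grad gX \<in> borel_measurable borel" "gX \<in> borel_measurable borel"
    and cmY: "grad gY \<in> borel_measurable borel" "gY \<in> borel_measurable borel"
    and cmf: "grad f \<in> borel_measurable borel" "f \<in> borel_measurable borel"
    by (rule grad_measurable borel_measurable_continuous_onI continuous_gX continuous_gY cf)+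
  note [measurable] = cmX cmY cmf
  have bg: "\<exists>B. \<forall>x. \<bar>g x\<bar> \<le> B" if "continuous_on UNIV g" "bounded {x. g x \<noteq> 0}" for g :: "real\<times>real \<Rightarrow> real"
  proof -
    have "bounded (g ` closure {x. g x \<noteq> 0})"
      by (intro compact_imp_bounded compact_continuous_image continuous_on_subset[OF that(1)])
         (use that(2) in \<open>auto simp: compact_closure\<close>)
    then obtain B where "\<And>x. x \<in> closure {x. g x \<noteq> 0} \<Longrightarrow> \<bar>g x\<bar> \<le> B" by (auto simp: bounded_iff)
    moreover have "x \<in> closure {x. g x \<noteq> 0}" if "g x \<noteq> 0" for x
      using that closure_subset[of "{x. g x \<noteq> 0}"] by blast
    ultimately have "\<bar>g x\<bar> \<le> max 0 B" for x by (cases "g x = 0") (auto simp: le_max_iff_disj)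
    then show ?thesis by blast
  qed
  have AEf: "AE x in lborel. norm (grad f x) \<le> C"
    using AE_GDERIV_grad[OF f] by eventually_elim (rule GDERIV_lipschitz_bound[OF f])
  have int1: "integrable lborel (\<lambda>x. (grad f x \<bullet> e) * g x)"
    if g: "continuous_on UNIV g" "bounded {x. g x \<noteq> 0}" for g and e :: "real\<times>real"
  proof -
    obtain B where B: "\<And>x. \<bar>g x\<bar> \<le> B" using bg[OF g] by blast
    show ?thesis
    proof (rule integrable_bounded_support[where M="C * norm e * B" and U="{x. g x \<noteq> 0}"])
      show "AE x in lborel. \<bar>grad f x \<bullet> e * g x\<bar> \<le> C * norm e * B"
        using AEf
      proof eventually_elim
        case (elim x)
        have "\<bar>grad f x \<bullet> e\<bar> \<le> C * norm e"
          using Cauchy_Schwarz_ineq2[of "grad f x" e] elim by (meson mult_right_mono norm_ge_zero order_trans)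
        then have "\<bar>grad f x \<bullet> e\<bar> * \<bar>g x\<bar> \<le> (C * norm e) * B" using B by (intro mult_mono) auto
        then show ?case by (simp add: abs_mult)
      qed
    qed (use g(2) borel_measurable_continuous_onI[OF g(1)] in auto)
  qed
  have int2: "integrable lborel (\<lambda>x. f x * (grad g x \<bullet> e))"
    if g: "L-lipschitz_on UNIV g" "bounded {x. g x \<noteq> 0}" "\<And>x. GDERIV g x :> grad g x" for g L and e :: "real\<times>real"
  proof -
    have cg: "continuous_on UNIV g" by (rule lipschitz_on_continuous_on[OF g(1)])
    have [measurable]: "grad g \<in> borel_measurable borel" by (rule grad_measurable[OF cg])
    define U where "U = closure {x. g x \<noteq> 0}"
    have U: "compact U" using g(2) by (simp add: U_def compact_closure)
    have g0: "grad g x = 0" if "x \<notin> U" for x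
    proof -
      have "(g has_derivative (\<lambda>h. 0)) (at x)"
        by (rule has_derivative_transform_within_open[OF has_derivative_const[of 0], of "- U"])
           (use that closure_subset[of "{x. g x \<noteq> 0}"] in \<open>auto simp: U_def\<close>)
      then have "GDERIV g x :> 0" by (simp add: gderiv_def)
      then show ?thesis by (rule grad_eqI)
    qed
    obtain B where B: "\<And>x. x \<in> U \<Longrightarrow> \<bar>f x\<bar> \<le> B"
      using compact_imp_bounded[OF compact_continuous_image[OF continuous_on_subset[OF cf] U]] by (auto simp: bounded_iff)
    show ?thesis
    proof (rule integrable_bounded_support[where M="max 0 (B * (L * norm e))" and U=U])
      show "AE x in lborel. \<bar>f x * (grad g x \<bullet> e)\<bar> \<le> max 0 (B * (L * norm e))"
      proof (intro AE_I2)
        fix x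
        show "\<bar>f x * (grad g x \<bullet> e)\<bar> \<le> max 0 (B * (L * norm e))"
        proof (cases "x \<in> U")
          case True
          have "\<bar>grad g x \<bullet> e\<bar> \<le> L * norm e"
            using Cauchy_Schwarz_ineq2[of "grad g x" e] GDERIV_lipschitz_bound[OF g(1,3)]
            by (meson mult_right_mono norm_ge_zero order_trans)
          then have "\<bar>f x\<bar> * \<bar>grad g x \<bullet> e\<bar> \<le> B * (L * norm e)" using B[OF True] by (intro mult_mono) auto
          then show ?thesis by (simp add: abs_mult)
        qed (simp add: g0)
      qed
      show "x \<in> U" if "f x * (grad g x \<bullet> e) \<noteq> 0" for x using that g0[of x] by (metis inner_zero_left mult_zero_right)
    qed (use U compact_imp_bounded in auto)
  qed
  have gX': "GDERIV gX x :> grad gX x" and gY': "GDERIV gY x :> grad gY x" for x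
    using GX[of x] GY[of x] by (auto simp: grad_eqI)
  have "(LINT x|lborel. grad f x \<bullet> grad (polar_lift A K) x)
     = (LINT x|lborel. (grad f x \<bullet> (1, 0)) * gX x + (grad f x \<bullet> (0, 1)) * gY x)"
    by (intro Bochner_Integration.integral_cong) (auto simp: grad_lift inner_prod_def)
  also have "\<dots> = (LINT x|lborel. (grad f x \<bullet> (1, 0)) * gX x) + (LINT x|lborel. (grad f x \<bullet> (0, 1)) * gY x)"
    by (intro Bochner_Integration.integral_add int1 continuous_gX continuous_gY bX bY)
  also have "\<dots> = - (LINT x|lborel. f x * (grad gX x \<bullet> (1, 0))) - (LINT x|lborel. f x * (grad gY x \<bullet> (0, 1)))"
    using integral_by_parts_lipschitz[OF f lX bX, of "(1,0)"] integral_by_parts_lipschitz[OF f lY bY, of "(0,1)"] by simp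
  also have "\<dots> = - (LINT x|lborel. f x * (grad gX x \<bullet> (1, 0)) + f x * (grad gY x \<bullet> (0, 1)))"
    using int2[OF lX bX gX', of "(1,0)"] int2[OF lY bY gY', of "(0,1)"] by simp
  also have "(LINT x|lborel. f x * (grad gX x \<bullet> (1, 0)) + f x * (grad gY x \<bullet> (0, 1)))
    = (LINT x|lborel. f x * (polar_lift (\<lambda>t. exp (-2*t) * A'' t) K x + polar_lift (\<lambda>t. exp (-2*t) * A t) K'' x))"
  proof (intro Bochner_Integration.integral_cong refl)
    fix x :: "real \<times> real"
    have "grad gX x \<bullet> (1, 0) + grad gY x \<bullet> (0, 1) = p.gX x + q.gX x + r.gY x - w.gY x"
      using grad_eqI[OF GX, of x] grad_eqI[OF GY, of x] by (simp add: inner_prod_def)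
    also have "\<dots> = polar_lift (\<lambda>t. exp (-2*t) * A'' t) K x + polar_lift (\<lambda>t. exp (-2*t) * A t) K'' x"
    proof (cases "x = 0")
      case True then show ?thesis
        by (simp add: p.gX_def q.gX_def r.gY_def w.gY_def polar_lift_def)
    next
      case False
      define a a1 a2 k k1 k2 S c E where "a = A (ln (norm x))" "a1 = A' (ln (norm x))" "a2 = A'' (ln (norm x))"
        "k = K (pol_angle x)" "k1 = K' (pol_angle x)" "k2 = K'' (pol_angle x)"
        "S = sin (pol_angle x)" "c = cos (pol_angle x)" "E = exp (- ln (norm x))"
      note defs = this
      have cS: "c * c = 1 - S * S" unfolding defs by (metis cos_squared_eq power2_eq_square)
      have "p.gX x + q.gX x + r.gY x - w.gY x =
         (E * (E * a2 - E * a1) * (k * S * S) + E * (E * a1) * ((k1 * S + k * c) * c))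
       + (E * (E * a1 - E * a) * (k1 * c * S) + E * (E * a) * ((k2 * c - k1 * S) * c))
       + (E * (E * a) * ((k2 * S + k1 * c) * S) - E * (E * a1 - E * a) * (k1 * S * c))
       - (E * (E * a1) * ((k1 * c - k * S) * S) - E * (E * a2 - E * a1) * (k * c * c))"
        using False unfolding p.gX_def q.gX_def r.gY_def w.gY_def polar_lift_def defs by simp
      also have "\<dots> = E * E * a2 * k * (S * S + c * c) + E * E * a * k2 * (S * S + c * c)"
        by (simp add: algebra_simps)
      also have "\<dots> = E * E * a2 * k + E * E * a * k2" by (simp add: cS)
      finally show ?thesis using False unfolding polar_lift_def e defs by simp
    qed
    finally show "f x * (grad gX x \<bullet> (1, 0)) + f x * (grad gY x \<bullet> (0, 1)) =
       f x * (polar_lift (\<lambda>t. exp (-2*t) * A'' t) K x + polar_lift (\<lambda>t. exp (-2*t) * A t) K'' x)"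
      by (metis distrib_left)
  qed
  finally show ?thesis .
qed

end

subsection \<open>Integrals over the half plane and along the free surface\<close>

lemma pol_angle_arctan:
  assumes "snd x < 0"
  shows "pol_angle x = arctan (fst x / (- snd x))"
proof -
  define y m where "y = - snd x" and "m = fst x / y"
  have y: "y > 0" and xm: "fst x = y * m" using assms by (auto simp: y_def m_def)
  have s: "sqrt (1 + m\<^sup>2) > 0" by (simp add: add_pos_nonneg)
  define w where "w = Complex (ln (y * sqrt (1 + m\<^sup>2))) (arctan m)"
  have "exp w = pol_z x"
    using y s by (simp add: complex_eq_iff w_def Re_exp Im_exp cos_arctan sin_arctan pol_z_def xm flip: y_def)
  moreover have "Ln (exp w) = w"
    using arctan_lbound[of m] arctan_ubound[of m] pi_gt_zero by (intro Ln_exp) (auto simp: w_def)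
  ultimately show ?thesis by (simp add: pol_angle_def w_def m_def y_def)
qed

lemma pol_angle_lower_bounds:
  assumes "snd x < 0"
  shows "- (pi/2) < pol_angle x" "pol_angle x < pi/2"
  unfolding pol_angle_arctan[OF assms] by (rule arctan_lbound, rule arctan_ubound)

text \<open>Lets the substitutions below be carried out on compact intervals.\<close>

lemma nn_integral_exhaust:
  fixes f :: "real \<Rightarrow> ennreal"
  assumes [measurable]: "f \<in> borel_measurable borel" "\<And>n. I n \<in> sets borel" and inc: "incseq I"
    and le: "\<And>n. (\<integral>\<^sup>+x. f x * indicator (I n) x \<partial>lborel) \<le> C"
  shows "(\<integral>\<^sup>+x. f x * indicator (\<Union>n. I n) x \<partial>lborel) \<le> C"
proof -
  have "(\<integral>\<^sup>+x. f x * indicator (\<Union>n. I n) x \<partial>lborel) = (\<integral>\<^sup>+x. (SUP n. f x * indicator (I n) x) \<partial>lborel)"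
  proof (intro nn_integral_cong)
    fix x :: real
    show "f x * indicator (\<Union>n. I n) x = (SUP n. f x * indicator (I n) x)"
    proof (cases "\<exists>n. x \<in> I n")
      case True
      then obtain n where n: "x \<in> I n" by blast
      have "f x \<le> (SUP n. f x * indicator (I n) x)"
        by (rule SUP_upper2[of n]) (use n in auto)
      moreover have "(SUP n. f x * indicator (I n) x) \<le> f x"
        by (rule SUP_least) (auto simp: indicator_def)
      ultimately show ?thesis using n by (auto simp: indicator_def)
    qed (auto simp: indicator_def)
  qed
  also have "\<dots> = (SUP n. \<integral>\<^sup>+x. f x * indicator (I n) x \<partial>lborel)"
  proof (rule nn_integral_monotone_convergence_SUP)
    show "incseq (\<lambda>n x. f x * indicator (I n) x)"
      using inc by (auto simp: incseq_def le_fun_def indicator_def)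
  qed measurable
  also have "\<dots> \<le> C" by (rule SUP_least) (rule le)
  finally show ?thesis .
qed

lemma nn_integral_log_scale_le:
  fixes A :: "real \<Rightarrow> ennreal"
  assumes [measurable]: "A \<in> borel_measurable borel"
  shows "(\<integral>\<^sup>+y. A (ln y + c) * ennreal (1 / y) * indicator {0<..} y \<partial>lborel) \<le> (\<integral>\<^sup>+t. A t \<partial>lborel)"
proof -
  define f where "f y = A (ln y + c) * ennreal (1 / y)" for y
  have [measurable]: "f \<in> borel_measurable borel" unfolding f_def by measurable
  have "(\<integral>\<^sup>+y. f y * indicator (\<Union>n. {exp (- real (Suc n))..exp (real (Suc n))}) y \<partial>lborel) \<le> (\<integral>\<^sup>+t. A t \<partial>lborel)"
  proof (rule nn_integral_exhaust)
    show "incseq (\<lambda>n. {exp (- real (Suc n))..exp (real (Suc n))})"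
      by (auto simp: incseq_def elim: order_trans[rotated] order_trans)
    fix n
    have "(\<integral>\<^sup>+y. f y * indicator {exp (- real (Suc n))..exp (real (Suc n))} y \<partial>lborel)
      = (\<integral>\<^sup>+t. f (exp t) * ennreal (exp t) * indicator {- real (Suc n)..real (Suc n)} t \<partial>lborel)"
      by (rule nn_integral_substitution_aux) (auto intro!: derivative_eq_intros continuous_intros)
    also have "\<dots> \<le> (\<integral>\<^sup>+t. A (c + 1 * t) \<partial>lborel)"
    proof (intro nn_integral_mono)
      fix t :: real
      have "ennreal (1 / exp t) * ennreal (exp t) = 1" by (simp flip: ennreal_mult)
      then have "f (exp t) * ennreal (exp t) = A (c + 1 * t)"
        by (simp add: f_def mult.assoc add.commute)
      then show "f (exp t) * ennreal (exp t) * indicator {- real (Suc n)..real (Suc n)} t \<le> A (c + 1 * t)"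
        by (auto simp: indicator_def)
    qed
    also have "\<dots> = (\<integral>\<^sup>+t. A t \<partial>lborel)"
      using nn_integral_real_affine[of A 1 c] by simp
    finally show "(\<integral>\<^sup>+y. f y * indicator {exp (- real (Suc n))..exp (real (Suc n))} y \<partial>lborel) \<le> (\<integral>\<^sup>+t. A t \<partial>lborel)" .
  qed auto
  also have "(\<Union>n. {exp (- real (Suc n))..exp (real (Suc n))}) = {0<..}"
  proof (intro equalityI subsetI)
    fix y :: real assume "y \<in> {0<..}"
    then have y: "y > 0" by simp
    obtain n :: nat where n: "\<bar>ln y\<bar> < real n" using reals_Archimedean2 by blast
    have "exp (- real (Suc n)) \<le> exp (ln y)" "exp (ln y) \<le> exp (real (Suc n))"
      using n by (auto simp del: exp_ln)
    then show "y \<in> (\<Union>n. {exp (- real (Suc n))..exp (real (Suc n))})" using y by auto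
  qed (auto intro: less_le_trans[OF exp_gt_zero])
  finally show ?thesis unfolding f_def .
qed

lemma nn_integral_arctan_le:
  fixes K :: "real \<Rightarrow> ennreal"
  assumes [measurable]: "K \<in> borel_measurable borel"
  shows "(\<integral>\<^sup>+m. K (arctan m) * ennreal (1 / (1 + m\<^sup>2)) \<partial>lborel) \<le> (\<integral>\<^sup>+s. K s * indicator {- (pi/2)..pi/2} s \<partial>lborel)"
proof -
  define f where "f m = K (arctan m) * ennreal (1 / (1 + m\<^sup>2))" for m
  have [measurable]: "f \<in> borel_measurable borel" unfolding f_def by measurable
  have "(\<integral>\<^sup>+m. f m * indicator (\<Union>n. {- real (Suc n)..real (Suc n)}) m \<partial>lborel) \<le> (\<integral>\<^sup>+s. K s * indicator {- (pi/2)..pi/2} s \<partial>lborel)"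
  proof (rule nn_integral_exhaust)
    show "incseq (\<lambda>n. {- real (Suc n)..real (Suc n)})" by (auto simp: incseq_def)
    fix n
    have "(\<integral>\<^sup>+m. f m * indicator {- real (Suc n)..real (Suc n)} m \<partial>lborel)
      = (\<integral>\<^sup>+s. K s * indicator {arctan (- real (Suc n))..arctan (real (Suc n))} s \<partial>lborel)"
      unfolding f_def
      by (rule nn_integral_substitution_aux[symmetric])
         (auto intro!: derivative_eq_intros continuous_intros simp: add_nonneg_eq_0_iff divide_inverse)
    also have "\<dots> \<le> (\<integral>\<^sup>+s. K s * indicator {- (pi/2)..pi/2} s \<partial>lborel)"
      using arctan_lbound[of "- real (Suc n)"] arctan_ubound[of "real (Suc n)"]
      by (intro nn_integral_mono) (auto simp: indicator_def)
    finally show "(\<integral>\<^sup>+m. f m * indicator {- real (Suc n)..real (Suc n)} m \<partial>lborel) \<le> (\<integral>\<^sup>+s. K s * indicator {- (pi/2)..pi/2} s \<partial>lborel)" .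
  qed auto
  also have "(\<Union>n. {- real (Suc n)..real (Suc n)}) = UNIV"
  proof (intro equalityI subsetI)
    fix y :: real
    obtain n :: nat where n: "\<bar>y\<bar> < real n" using reals_Archimedean2 by blast
    then show "y \<in> (\<Union>n. {- real (Suc n)..real (Suc n)})" by (intro UN_I[of n]) auto
  qed auto
  finally show ?thesis unfolding f_def by simp
qed

text \<open>Slicing the half plane by \<open>X = - m Y\<close> turns both integrations into one-dimensional
  substitutions.\<close>

lemma nn_integral_lower_half_plane_le:
  fixes A K :: "real \<Rightarrow> ennreal"
  assumes A[measurable]: "A \<in> borel_measurable borel" and K[measurable]: "K \<in> borel_measurable borel"
  shows "(\<integral>\<^sup>+x. A (ln (norm x)) * K (arctan (fst x / (- snd x))) * ennreal (1 / (norm x)\<^sup>2) * indicator {x. snd x < 0} x \<partial>lborel)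
    \<le> (\<integral>\<^sup>+t. A t \<partial>lborel) * (\<integral>\<^sup>+s. K s * indicator {- (pi/2)..pi/2} s \<partial>lborel)"
proof -
  define G where "G X Y = A (ln (sqrt (X\<^sup>2 + Y\<^sup>2))) * K (arctan (X / (- Y))) * ennreal (1 / (X\<^sup>2 + Y\<^sup>2)) * indicator {..<0} Y" for X Y :: real
  have [measurable]: "(\<lambda>(X, Y). G X Y) \<in> borel_measurable (borel \<Otimes>\<^sub>M borel)" unfolding G_def by measurable
  have [measurable]: "(\<lambda>X. G X Y) \<in> borel_measurable borel" for Y unfolding G_def by measurable
  have "(\<integral>\<^sup>+x. A (ln (norm x)) * K (arctan (fst x / (- snd x))) * ennreal (1 / (norm x)\<^sup>2) * indicator {x. snd x < 0} x \<partial>lborel)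
    = (\<integral>\<^sup>+x. (\<lambda>(X, Y). G X Y) x \<partial>(lborel \<Otimes>\<^sub>M lborel))"
    unfolding lborel_prod by (intro nn_integral_cong) (auto simp: G_def norm_Pair indicator_def)
  also have "\<dots> = (\<integral>\<^sup>+Y. \<integral>\<^sup>+X. G X Y \<partial>lborel \<partial>lborel)"
    by (subst lborel_pair.nn_integral_snd[symmetric]) auto
  also have "\<dots> = (\<integral>\<^sup>+y. \<integral>\<^sup>+X. G X (- y) \<partial>lborel \<partial>lborel)"
    using nn_integral_real_affine[of "\<lambda>Y. \<integral>\<^sup>+X. G X Y \<partial>lborel" "-1" 0] by simp
  \<comment> \<open>Substituting X = m y with y = - Y: then r = y sqrt (1 + m^2) and dX dY / r^2
    becomes dm / (1 + m^2) times dy / y.\<close>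
  also have "\<dots> = (\<integral>\<^sup>+y. \<integral>\<^sup>+m. K (arctan m) * ennreal (1 / (1 + m\<^sup>2)) * (A (ln y + ln (sqrt (1 + m\<^sup>2))) * ennreal (1 / y) * indicator {0<..} y) \<partial>lborel \<partial>lborel)"
  proof (rule nn_integral_cong)
    fix y :: real
    show "(\<integral>\<^sup>+X. G X (- y) \<partial>lborel) = (\<integral>\<^sup>+m. K (arctan m) * ennreal (1 / (1 + m\<^sup>2)) * (A (ln y + ln (sqrt (1 + m\<^sup>2))) * ennreal (1 / y) * indicator {0<..} y) \<partial>lborel)"
    proof (cases "y > 0")
      case True
      have "(\<integral>\<^sup>+X. G X (- y) \<partial>lborel) = ennreal \<bar>y\<bar> * (\<integral>\<^sup>+m. G (0 + y * m) (- y) \<partial>lborel)"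
        by (rule nn_integral_real_affine) (use True in auto)
      also have "\<dots> = (\<integral>\<^sup>+m. ennreal \<bar>y\<bar> * G (0 + y * m) (- y) \<partial>lborel)"
        by (rule nn_integral_cmult[symmetric]) (simp add: G_def)
      also have "\<dots> = (\<integral>\<^sup>+m. K (arctan m) * ennreal (1 / (1 + m\<^sup>2)) * (A (ln y + ln (sqrt (1 + m\<^sup>2))) * ennreal (1 / y) * indicator {0<..} y) \<partial>lborel)"
      proof (intro nn_integral_cong)
        fix m :: real
        have m1: "1 + m\<^sup>2 > 0" by (simp add: add_pos_nonneg)
        have sq: "(y * m)\<^sup>2 + (- y)\<^sup>2 = y\<^sup>2 * (1 + m\<^sup>2)" by (simp add: power2_eq_square algebra_simps)
        have l: "ln (sqrt ((y * m)\<^sup>2 + (- y)\<^sup>2)) = ln y + ln (sqrt (1 + m\<^sup>2))"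
          unfolding sq real_sqrt_mult using True m1 by (simp add: ln_mult)
        have "ennreal \<bar>y\<bar> * ennreal (1 / (y\<^sup>2 * (1 + m\<^sup>2))) = ennreal (1 / (1 + m\<^sup>2)) * ennreal (1 / y)"
          using True m1 by (simp add: power2_eq_square flip: ennreal_mult)
        moreover have "G (0 + y * m) (- y) = A (ln y + ln (sqrt (1 + m\<^sup>2))) * K (arctan m) * ennreal (1 / (y\<^sup>2 * (1 + m\<^sup>2)))"
          unfolding G_def add_0 l unfolding sq using True by simp
        moreover have "indicator {0<..} y = (1::ennreal)" using True by simp
        moreover have "y' * (a * k * E) = k * q * (a * p * i)" if "y' * E = q * p" "i = 1" for y' a k E q p i :: ennreal
        proof -
          have "y' * (a * k * E) = a * k * (y' * E)" by (simp only: mult_ac)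
          also have "\<dots> = k * q * (a * p * i)" unfolding that by (simp add: mult_ac)
          finally show ?thesis .
        qed
        ultimately show "ennreal \<bar>y\<bar> * G (0 + y * m) (- y) = K (arctan m) * ennreal (1 / (1 + m\<^sup>2)) * (A (ln y + ln (sqrt (1 + m\<^sup>2))) * ennreal (1 / y) * indicator {0<..} y)"
          by simp
      qed
      finally show ?thesis .
    qed (simp add: G_def)
  qed
  also have "\<dots> = (\<integral>\<^sup>+m. \<integral>\<^sup>+y. K (arctan m) * ennreal (1 / (1 + m\<^sup>2)) * (A (ln y + ln (sqrt (1 + m\<^sup>2))) * ennreal (1 / y) * indicator {0<..} y) \<partial>lborel \<partial>lborel)"
    by (rule lborel_pair.Fubini') measurable
  also have "\<dots> \<le> (\<integral>\<^sup>+m. K (arctan m) * ennreal (1 / (1 + m\<^sup>2)) * (\<integral>\<^sup>+t. A t \<partial>lborel) \<partial>lborel)"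
  proof (intro nn_integral_mono)
    fix m :: real
    have "(\<integral>\<^sup>+y. K (arctan m) * ennreal (1 / (1 + m\<^sup>2)) * (A (ln y + ln (sqrt (1 + m\<^sup>2))) * ennreal (1 / y) * indicator {0<..} y) \<partial>lborel)
      = K (arctan m) * ennreal (1 / (1 + m\<^sup>2)) * (\<integral>\<^sup>+y. (A (ln y + ln (sqrt (1 + m\<^sup>2))) * ennreal (1 / y) * indicator {0<..} y) \<partial>lborel)"
      by (rule nn_integral_cmult) measurable
    also have "\<dots> \<le> K (arctan m) * ennreal (1 / (1 + m\<^sup>2)) * (\<integral>\<^sup>+t. A t \<partial>lborel)"
      by (intro mult_left_mono nn_integral_log_scale_le A) simp
    finally show "(\<integral>\<^sup>+y. K (arctan m) * ennreal (1 / (1 + m\<^sup>2)) * (A (ln y + ln (sqrt (1 + m\<^sup>2))) * ennreal (1 / y) * indicator {0<..} y) \<partial>lborel)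
      \<le> K (arctan m) * ennreal (1 / (1 + m\<^sup>2)) * (\<integral>\<^sup>+t. A t \<partial>lborel)" .
  qed
  also have "\<dots> = (\<integral>\<^sup>+m. K (arctan m) * ennreal (1 / (1 + m\<^sup>2)) \<partial>lborel) * (\<integral>\<^sup>+t. A t \<partial>lborel)"
    by (rule nn_integral_multc) measurable
  also have "\<dots> \<le> (\<integral>\<^sup>+s. K s * indicator {- (pi/2)..pi/2} s \<partial>lborel) * (\<integral>\<^sup>+t. A t \<partial>lborel)"
    by (intro mult_right_mono nn_integral_arctan_le K) simp
  finally show ?thesis by (simp add: mult.commute)
qed

section \<open>Radial projection and Hausdorff measure\<close>

lemma diameter_norm_image:
  fixes U :: "'a::real_normed_vector set"
  assumes "bounded U" "U \<noteq> {}"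
  shows "norm ` U \<subseteq> {Inf (norm ` U)..Sup (norm ` U)}" "Sup (norm ` U) - Inf (norm ` U) \<le> diameter U"
    "Inf (norm ` U) \<le> Sup (norm ` U)"
proof -
  have ba: "bdd_above (norm ` U)" using assms(1) by (auto simp: bdd_above_def bounded_iff)
  have bb: "bdd_below (norm ` U)" by (rule bdd_belowI2[of _ 0]) simp
  show sub: "norm ` U \<subseteq> {Inf (norm ` U)..Sup (norm ` U)}"
    by (auto intro!: cInf_lower cSup_upper ba bb)
  then show "Inf (norm ` U) \<le> Sup (norm ` U)" using assms(2) by fastforce
  have "Sup (norm ` U) \<le> diameter U + Inf (norm ` U)"
  proof (rule cSup_least)
    fix a assume "a \<in> norm ` U"
    then obtain x where x: "x \<in> U" "a = norm x" by blast
    have "a - diameter U \<le> Inf (norm ` U)"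
    proof (rule cInf_greatest)
      fix b assume "b \<in> norm ` U"
      then obtain y where y: "y \<in> U" "b = norm y" by blast
      have "norm x - norm y \<le> dist x y" by (simp add: dist_norm norm_triangle_ineq2)
      also have "\<dots> \<le> diameter U" by (rule diameter_bounded_bound[OF assms(1) x(1) y(1)])
      finally show "a - diameter U \<le> b" using x y by simp
    qed (use assms in simp)
    then show "a \<le> diameter U + Inf (norm ` U)" by simp
  qed (use assms in simp)
  then show "Sup (norm ` U) - Inf (norm ` U) \<le> diameter U" by simp
qed

text \<open>The norm is 1-Lipschitz, so a cover of the set projects to a cover of A by intervals no
  longer than the diameters.\<close>

lemma lborel_le_hausdorff1_norm:
  fixes T :: "'a::real_normed_vector set"
  assumes A: "A \<in> sets borel" "A \<subseteq> norm ` T"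
  shows "emeasure lborel A \<le> hausdorff1_outer (T \<inter> norm -` A)"
proof -
  have "emeasure lborel A \<le> hausdorff1_pre 1 (T \<inter> norm -` A)"
    unfolding hausdorff1_pre_def
  proof (rule INF_greatest, clarify)
    fix U :: "nat \<Rightarrow> 'a set"
    assume cov: "T \<inter> norm -` A \<subseteq> (\<Union>i. U i)" and U: "\<forall>i. bounded (U i) \<and> diameter (U i) \<le> 1"
    define boundary_int where "boundary_int i = (if U i = {} then {} else {Inf (norm ` U i)..Sup (norm ` U i)})" for i
    have "A \<subseteq> (\<Union>i. boundary_int i)"
    proof
      fix a assume "a \<in> A"
      then obtain x where "x \<in> T" "a = norm x" using A(2) by blast
      with \<open>a \<in> A\<close> cov obtain i where i: "x \<in> U i" by blast
      then have "norm ` U i \<subseteq> boundary_int i" using diameter_norm_image(1)[of "U i"] U by (auto simp only: boundary_int_def split: if_splits)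
      then have "a \<in> boundary_int i" using i \<open>a = norm x\<close> by blast
      then show "a \<in> (\<Union>i. boundary_int i)" by blast
    qed
    then have "emeasure lborel A \<le> emeasure lborel (\<Union>i. boundary_int i)" by (intro emeasure_mono) (auto simp: boundary_int_def)
    also have "\<dots> \<le> (\<Sum>i. emeasure lborel (boundary_int i))"
      by (rule emeasure_subadditive_countably) (auto simp: boundary_int_def)
    also have "\<dots> \<le> (\<Sum>i. ennreal (diameter (U i)))"
    proof (rule suminf_le)
      fix i show "emeasure lborel (boundary_int i) \<le> ennreal (diameter (U i))"
        using diameter_norm_image(2,3)[of "U i"] U by (cases "U i = {}") (auto simp: boundary_int_def ennreal_leI)
    qed auto
    finally show "emeasure lborel A \<le> (\<Sum>i. ennreal (diameter (U i)))" .
  qed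
  also have "\<dots> \<le> hausdorff1_outer (T \<inter> norm -` A)"
    unfolding hausdorff1_outer_def by (intro SUP_upper) auto
  finally show ?thesis .
qed

text \<open>The image under the norm of Hausdorff measure on T dominates length on I. This turns
  integrals along the free surface into integrals in r, with no parametrisation by arc
  length.\<close>

lemma nn_integral_radial_le_hausdorff1:
  fixes T :: "(real \<times> real) set" and \<rho> :: "real \<Rightarrow> ennreal"
  assumes [measurable]: "\<rho> \<in> borel_measurable borel" "I \<in> sets borel" "T \<in> sets borel" and I: "I \<subseteq> norm ` T"
  shows "(\<integral>\<^sup>+r. \<rho> r * indicator I r \<partial>lborel) \<le> (\<integral>\<^sup>+x. \<rho> (norm x) * indicator T x \<partial>hausdorff1)"
proof -
  have [measurable]: "norm \<in> measurable (hausdorff1 :: (real\<times>real) measure) borel"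
    by (simp cong: measurable_cong_sets)
  have [measurable]: "T \<in> sets hausdorff1" using assms(3) by simp
  define M where "M = density lborel (indicator I)"
  define N where "N = distr (density hausdorff1 (indicator T)) borel (norm :: real\<times>real \<Rightarrow> real)"
  have sM: "sets M = sets borel" and sN: "sets N = sets borel" by (auto simp: M_def N_def)
  have "M \<le> N"
  proof (subst le_measure)
    show "sets M = sets N" by (simp add: sM sN)
    show "\<forall>A\<in>sets M. emeasure M A \<le> emeasure N A"
    proof
      fix A assume "A \<in> sets M"
      then have A[measurable]: "A \<in> sets borel" by (simp add: sM)
      have e1: "emeasure M A = emeasure lborel (A \<inter> I)"
      proof -
        have "emeasure M A = (\<integral>\<^sup>+r. indicator I r * indicator A r \<partial>lborel)"
          unfolding M_def by (rule emeasure_density) auto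
        also have "\<dots> = (\<integral>\<^sup>+r. indicator (A \<inter> I) r \<partial>lborel)"
          by (intro nn_integral_cong) (auto simp: indicator_def)
        finally show ?thesis by simp
      qed
      have [measurable]: "norm -` A \<in> sets (hausdorff1 :: (real\<times>real) measure)"
        using measurable_sets_borel[OF _ A, of "norm :: real\<times>real \<Rightarrow> real"] by simp
      have TA: "T \<inter> norm -` A \<in> sets borel" by measurable
      have e2: "emeasure N A = emeasure hausdorff1 (T \<inter> norm -` A)"
      proof -
        have "emeasure N A = emeasure (density hausdorff1 (indicator T)) (norm -` A)"
          unfolding N_def by (subst emeasure_distr) auto
        also have "\<dots> = (\<integral>\<^sup>+x. indicator T x * indicator (norm -` A) x \<partial>hausdorff1)"
          by (rule emeasure_density) measurable
        also have "\<dots> = (\<integral>\<^sup>+x. indicator (T \<inter> norm -` A) x \<partial>hausdorff1)"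
          by (intro nn_integral_cong) (auto simp: indicator_def)
        also have "\<dots> = emeasure hausdorff1 (T \<inter> norm -` A)" using TA by simp
        finally show ?thesis .
      qed
      have "emeasure lborel (A \<inter> I) \<le> hausdorff1_outer (T \<inter> norm -` (A \<inter> I))"
        by (rule lborel_le_hausdorff1_norm) (use I in auto)
      also have "\<dots> \<le> hausdorff1_outer (T \<inter> norm -` A)" by (rule hausdorff1_outer_mono) auto
      also have "\<dots> = emeasure hausdorff1 (T \<inter> norm -` A)" using TA by (rule emeasure_hausdorff1[symmetric])
      finally show "emeasure M A \<le> emeasure N A" by (simp add: e1 e2)
    qed
  qed
  then have "nn_integral M \<rho> \<le> nn_integral N \<rho>" using sM sN by (intro nn_integral_mono_measure) auto
  moreover have "nn_integral M \<rho> = (\<integral>\<^sup>+r. \<rho> r * indicator I r \<partial>lborel)"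
    unfolding M_def by (subst nn_integral_density) (auto simp: mult.commute)
  moreover have "nn_integral N \<rho> = (\<integral>\<^sup>+x. \<rho> (norm x) * indicator T x \<partial>hausdorff1)"
    unfolding N_def by (subst nn_integral_distr, simp, simp, subst nn_integral_density) (auto simp: mult.commute)
  ultimately show ?thesis by simp
qed

text \<open>A continuous W whose increments bound all chords also bounds the length: cut the
  parameter interval so finely that W grows by at most the allowed diameter on each piece, and
  telescope.\<close>

lemma hausdorff1_outer_arc_le:
  fixes p :: "real \<Rightarrow> 'a::metric_space" and W :: "real \<Rightarrow> real"
  assumes ab: "a \<le> b" and W: "continuous_on {a..b} W"
    and le: "\<And>s t. a \<le> s \<Longrightarrow> s \<le> t \<Longrightarrow> t \<le> b \<Longrightarrow> dist (p s) (p t) \<le> W t - W s"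
  shows "hausdorff1_outer (p ` {a..b}) \<le> ennreal (W b - W a)"
  unfolding hausdorff1_outer_def
proof (rule SUP_least)
  fix \<delta> :: real assume "\<delta> \<in> {0<..}"
  then have \<delta>: "\<delta> > 0" by simp
  have "uniformly_continuous_on {a..b} W" using W by (intro compact_uniformly_continuous) auto
  then obtain \<eta> where \<eta>: "\<eta> > 0" "\<And>s t. s \<in> {a..b} \<Longrightarrow> t \<in> {a..b} \<Longrightarrow> dist t s < \<eta> \<Longrightarrow> dist (W t) (W s) < \<delta>"
    unfolding uniformly_continuous_on_def using \<delta> by metis
  obtain n :: nat where n: "real n > (b - a) / \<eta>" "n > 0"
    by (metis less_nat_zero_code linorder_neqE_nat of_nat_0_less_iff order_less_trans reals_Archimedean2 reals_Archimedean2[of "max 0 ((b - a) / \<eta>)"] max_less_iff_conj)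
  define s where "s i = a + (b - a) * real i / real n" for i
  have s0: "s 0 = a" "s n = b" using n by (auto simp: s_def)
  have smono: "s i \<le> s j" if "i \<le> j" for i j
    unfolding s_def using that ab by (intro add_left_mono divide_right_mono mult_left_mono) auto
  have sin: "s i \<in> {a..b}" if "i \<le> n" for i using smono[of 0 i] smono[of i n] that s0 by auto
  have smooth_step: "s (Suc i) - s i < \<eta>" for i
  proof -
    have "s (Suc i) - s i = (b - a) / real n" by (simp add: s_def algebra_simps add_divide_distrib diff_divide_distrib)
    also have "\<dots> < \<eta>" using n \<eta>(1) by (simp add: field_simps)
    finally show ?thesis .
  qed
  define U where "U i = (if i < n then p ` {s i..s (Suc i)} else {})" for i
  have dle: "dist x y \<le> W (s (Suc i)) - W (s i)" if "x \<in> U i" "y \<in> U i" "i < n" for x y i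
  proof -
    obtain q r where qr: "x = p q" "y = p r" "q \<in> {s i..s (Suc i)}" "r \<in> {s i..s (Suc i)}"
      using \<open>x \<in> U i\<close> \<open>y \<in> U i\<close> \<open>i < n\<close> by (auto simp: U_def)
    have "a \<le> s i" "s (Suc i) \<le> b" using sin[of i] sin[of "Suc i"] \<open>i < n\<close> by auto
    then have wm: "W (s i) \<le> W t" "W t \<le> W (s (Suc i))" if "t \<in> {s i..s (Suc i)}" for t
      using order_trans[OF zero_le_dist le[of "s i" t]] order_trans[OF zero_le_dist le[of t "s (Suc i)"]] that
      by simp_all
    have aux: "dist (p q) (p r) \<le> W r - W q" if "q \<le> r" "q \<in> {s i..s (Suc i)}" "r \<in> {s i..s (Suc i)}" for q r
      using le[of q r] that \<open>a \<le> s i\<close> \<open>s (Suc i) \<le> b\<close> by auto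
    show ?thesis
    proof (cases "q \<le> r")
      case True then show ?thesis using aux[of q r] qr wm[of q] wm[of r] by auto
    next
      case False then show ?thesis using aux[of r q] qr wm[of q] wm[of r] by (auto simp: dist_commute)
    qed
  qed
  have dist\<delta>: "W (s (Suc i)) - W (s i) \<le> \<delta>" if "i < n" for i
    using \<eta>(2)[of "s i" "s (Suc i)"] sin[of i] sin[of "Suc i"] that smooth_step[of i] smono[of i "Suc i"]
    by (auto simp: dist_real_def)
  have mono: "0 \<le> W (s (Suc i)) - W (s i)" if "i < n" for i
    using order_trans[OF zero_le_dist le[of "s i" "s (Suc i)"]] sin[of i] sin[of "Suc i"] smono[of i "Suc i"] that
    by auto
  have bd: "bounded (U i)" for i
  proof (cases "i < n")
    case True
    then show ?thesis using dle[OF _ _ True] by (auto simp: bounded_two_points)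
  qed (simp add: U_def)
  have diam: "diameter (U i) \<le> W (s (Suc i)) - W (s i)" if "i < n" for i
    unfolding diameter_def using dle[OF _ _ that] mono[OF that] by (auto intro!: cSUP_least)
  have cov: "p ` {a..b} \<subseteq> (\<Union>i. U i)"
  proof
    fix y assume "y \<in> p ` {a..b}"
    then obtain t where t: "y = p t" "t \<in> {a..b}" by blast
    have "\<exists>i<n. t \<in> {s i..s (Suc i)}"
    proof -
      define k where "k = (LEAST k. t \<le> s k)"
      have ex: "t \<le> s n" using t s0 by simp
      have k: "t \<le> s k" "k \<le> n" unfolding k_def using LeastI[of "\<lambda>k. t \<le> s k", OF ex] Least_le[of "\<lambda>k. t \<le> s k", OF ex] by auto
      show ?thesis
      proof (cases k)
        case 0
        then have "t = a" using k t s0 by simp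
        then show ?thesis using n smono[of 0 1] s0 by (intro exI[of _ 0]) auto
      next
        case (Suc j)
        then have "\<not> t \<le> s j" using not_less_Least[of j "\<lambda>k. t \<le> s k"] by (simp add: k_def)
        then show ?thesis using Suc k by (intro exI[of _ j]) auto
      qed
    qed
    then show "y \<in> (\<Union>i. U i)" using t by (auto simp: U_def)
  qed
  have "hausdorff1_pre \<delta> (p ` {a..b}) \<le> (\<Sum>i. ennreal (diameter (U i)))"
  proof (rule hausdorff1_pre_le[OF cov bd])
    show "diameter (U i) \<le> \<delta>" for i
      using diam[of i] dist\<delta>[of i] \<delta> by (cases "i < n") (auto simp: U_def)
  qed
  also have "\<dots> = (\<Sum>i<n. ennreal (diameter (U i)))"
    by (rule suminf_finite) (auto simp: U_def)
  also have "\<dots> \<le> (\<Sum>i<n. ennreal (W (s (Suc i)) - W (s i)))"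
    by (intro sum_mono ennreal_leI diam) auto
  also have "\<dots> = ennreal (\<Sum>i<n. W (s (Suc i)) - W (s i))"
    using mono by (intro sum_ennreal) auto
  also have "(\<Sum>i<n. W (s (Suc i)) - W (s i)) = W b - W a"
    using sum_lessThan_telescope[of "\<lambda>i. W (s i)" n] s0 by simp
  finally show "hausdorff1_pre \<delta> (p ` {a..b}) \<le> ennreal (W b - W a)" .
qed

subsection \<open>The stream function near the crest\<close>

text \<open>The gradient bound is only known almost everywhere and a segment is null, so f is
  averaged over a small ball carried along the segment. The mean value theorem applies to the
  average, and the radius tends to 0.\<close>

lemma lipschitz_along_AE_bound:
  fixes f :: "real \<times> real \<Rightarrow> real"
  assumes f: "K-lipschitz_on UNIV f" and U: "open U" "convex U" "x \<in> U" "x + e \<in> U"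
    and bd: "AE y in lborel. y \<in> U \<longrightarrow> \<bar>grad f y \<bullet> e\<bar> \<le> M"
  shows "\<bar>f (x + e) - f x\<bar> \<le> M"
proof -
  have K0: "K \<ge> 0" by (rule lipschitz_on_nonneg[OF f])
  have cf: "continuous_on UNIV f" by (rule lipschitz_on_continuous_on[OF f])
  have [measurable]: "f \<in> borel_measurable borel" by (rule borel_measurable_continuous_onI[OF cf])
  have [measurable]: "grad f \<in> borel_measurable borel" by (rule grad_measurable[OF cf])
  obtain \<rho>1 where \<rho>1: "\<rho>1 > 0" "ball x \<rho>1 \<subseteq> U" using U(1,3) open_contains_ball by blast
  obtain \<rho>2 where \<rho>2: "\<rho>2 > 0" "ball (x + e) \<rho>2 \<subseteq> U" using U(1,4) open_contains_ball by blast
  have key: "\<bar>f (x + e) - f x\<bar> \<le> M + 2 * K * \<rho>" if \<rho>: "\<rho> > 0" "\<rho> \<le> min \<rho>1 \<rho>2" for \<rho>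
  proof -
    define V where "V = ball x \<rho>"
    define vol where "vol = measure lborel V"
    have emV: "emeasure lborel V < \<infinity>" unfolding V_def by (rule emeasure_bounded_finite) simp
    have volpos: "vol > 0" using \<rho>(1) by (simp add: vol_def V_def content_ball_pos)
    have [measurable]: "V \<in> sets borel" by (simp add: V_def)
    have inU: "y + t *\<^sub>R e \<in> U" if "y \<in> V" "0 \<le> t" "t \<le> 1" for y t
    proof -
      have "y \<in> U" using that(1) \<rho>1 \<rho> by (auto simp: V_def)
      moreover have "y + e \<in> U"
      proof -
        have "dist (x + e) (y + e) < \<rho>2" using that(1) \<rho> by (simp add: V_def)
        then show ?thesis using \<rho>2(2) by auto
      qed
      ultimately have "(1 - t) *\<^sub>R y + t *\<^sub>R (y + e) \<in> U" using U(2) that unfolding convex_alt by blast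
      then show ?thesis by (simp add: algebra_simps)
    qed
    define m where "m t = (LINT y|lborel. indicator V y * f (y + t *\<^sub>R e))" for t
    define m' where "m' t = (LINT y|lborel. indicator V y * (grad f (y + t *\<^sub>R e) \<bullet> e))" for t
    have shiftAE: "AE y in lborel. P (y + c)" if "AE y in lborel. P y" "Measurable.pred borel P" for P and c :: "real\<times>real"
    proof -
      have "AE y in distr lborel borel ((+) c). P y" using that(1) by (subst lborel_distr_plus)
      then have "AE y in lborel. P (c + y)" by (subst (asm) AE_distr_iff) (use that(2) in auto)
      then show ?thesis by (simp add: add.commute)
    qed
    have GM: "Measurable.pred borel (\<lambda>y. GDERIV f y :> grad f y)"
    proof -
      have "{y. GDERIV f y :> grad f y} = {y. GDERIV f y :> plane_grad f y}"
        by (intro Collect_cong) (metis plane_grad_eq grad_eqI)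
      then show ?thesis using GDERIV_set_measurable[OF cf] by (simp add: pred_def)
    qed
    have int: "integrable lborel (\<lambda>y. c * indicat_real V y)" for c using emV by auto
    have int1: "integrable lborel (\<lambda>y. indicator V y * f (y + t *\<^sub>R e))" for t
    proof -
      have "continuous_on (closure V) (\<lambda>y. f (y + t *\<^sub>R e))"
        by (intro continuous_on_compose2[OF cf] continuous_intros) auto
      then have "bounded ((\<lambda>y. f (y + t *\<^sub>R e)) ` closure V)"
        by (intro compact_imp_bounded compact_continuous_image) (auto simp: V_def compact_closure)
      then obtain B where "\<And>y. y \<in> closure V \<Longrightarrow> \<bar>f (y + t *\<^sub>R e)\<bar> \<le> B" by (auto simp: bounded_iff)
      then have B: "\<And>y. y \<in> V \<Longrightarrow> \<bar>f (y + t *\<^sub>R e)\<bar> \<le> B" using closure_subset by blast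
      show ?thesis
        by (rule Bochner_Integration.integrable_bound[OF int[of B]])
           (use B in \<open>auto simp: indicator_def intro!: AE_I2 order_trans[OF _ abs_ge_self]\<close>)
    qed
    have der: "DERIV m t :> m' t" for t
      unfolding DERIV_def
    proof (subst tendsto_at_iff_sequentially, intro allI impI)
      fix h :: "nat \<Rightarrow> real" assume h: "\<forall>i. h i \<in> UNIV - {0}" "h \<longlonglongrightarrow> 0"
      then have h0: "\<And>i. h i \<noteq> 0" by simp
      have hf: "filterlim h (at 0) sequentially" unfolding filterlim_at using h by auto
      have "(\<lambda>n. LINT y|lborel. indicator V y * dq f e (h n) (y + t *\<^sub>R e)) \<longlonglongrightarrow> m' t"
        unfolding m'_def
      proof (rule integral_dominated_convergence[where w="\<lambda>y. (K * norm e) * indicator V y"])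
        show "AE y in lborel. (\<lambda>n. indicator V y * dq f e (h n) (y + t *\<^sub>R e)) \<longlonglongrightarrow> indicator V y * (grad f (y + t *\<^sub>R e) \<bullet> e)"
          using shiftAE[OF AE_GDERIV_grad[OF f] GM, of "t *\<^sub>R e"]
          by eventually_elim (intro tendsto_intros filterlim_compose[OF GDERIV_dq_tendsto hf])
        show "AE y in lborel. norm (indicator V y * dq f e (h n) (y + t *\<^sub>R e)) \<le> (K * norm e) * indicator V y" for n
          using dq_bound[OF f] by (intro AE_I2) (auto simp: indicator_def)
        show "integrable lborel (\<lambda>y. (K * norm e) * indicat_real V y)" by (rule int)
      qed measurable
      moreover have "(LINT y|lborel. indicator V y * dq f e (h n) (y + t *\<^sub>R e)) = (m (t + h n) - m t) / h n" for n
      proof -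
        have "(m (t + h n) - m t) / h n = (LINT y|lborel. (indicator V y * f (y + (t + h n) *\<^sub>R e) - indicator V y * f (y + t *\<^sub>R e)) / h n)"
          unfolding m_def using int1[of "t + h n"] int1[of t] by simp
        also have "\<dots> = (LINT y|lborel. indicator V y * dq f e (h n) (y + t *\<^sub>R e))"
          by (intro Bochner_Integration.integral_cong) (auto simp: dq_def scaleR_add_left right_diff_distrib add.assoc)
        finally show ?thesis ..
      qed
      ultimately show "((\<lambda>h. (m (t + h) - m t) / h) \<circ> h) \<longlonglongrightarrow> m' t" by (simp add: o_def)
    qed
    have m'b: "\<bar>m' t\<bar> \<le> M * vol" if "0 \<le> t" "t \<le> 1" for t
    proof -
      have ae: "AE y in lborel. \<bar>indicator V y * (grad f (y + t *\<^sub>R e) \<bullet> e)\<bar> \<le> M * indicator V y"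
      proof -
        have [measurable]: "U \<in> sets borel" using U(1) by simp
        have pm: "Measurable.pred borel (\<lambda>y. y \<in> U \<longrightarrow> \<bar>grad f y \<bullet> e\<bar> \<le> M)" by measurable
        show ?thesis using shiftAE[OF bd pm, of "t *\<^sub>R e"]
          by eventually_elim (use inU[of _ t] that in \<open>auto simp: indicator_def\<close>)
      qed
      have i: "integrable lborel (\<lambda>y. indicator V y * (grad f (y + t *\<^sub>R e) \<bullet> e))"
        by (rule Bochner_Integration.integrable_bound[OF int[of M]])
           (use ae in \<open>auto elim!: eventually_mono intro: order_trans[OF _ abs_ge_self]\<close>)
      have "\<bar>m' t\<bar> \<le> (LINT y|lborel. \<bar>indicator V y * (grad f (y + t *\<^sub>R e) \<bullet> e)\<bar>)"
        unfolding m'_def by (rule integral_abs_bound)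
      also have "\<dots> \<le> (LINT y|lborel. M * indicator V y)"
        by (rule integral_mono_AE[OF _ int ae]) (use i in simp)
      also have "\<dots> = M * vol" by (simp add: vol_def)
      finally show ?thesis .
    qed
    obtain z where z: "0 < z" "z < 1" "m 1 - m 0 = (1 - 0) * m' z"
      using MVT2[of 0 1 m m'] der by auto
    then have m10: "\<bar>m 1 - m 0\<bar> \<le> M * vol" using m'b[of z] by simp
    have close: "\<bar>m t - vol * f (x + t *\<^sub>R e)\<bar> \<le> K * \<rho> * vol" for t
    proof -
      have "m t - vol * f (x + t *\<^sub>R e) = (LINT y|lborel. indicator V y * f (y + t *\<^sub>R e) - f (x + t *\<^sub>R e) * indicator V y)"
        using int1[of t] int[of "f (x + t *\<^sub>R e)"] by (simp add: m_def vol_def)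
      also have "\<bar>\<dots>\<bar> \<le> (LINT y|lborel. \<bar>indicator V y * f (y + t *\<^sub>R e) - f (x + t *\<^sub>R e) * indicator V y\<bar>)"
        by (rule integral_abs_bound)
      also have "\<dots> \<le> (LINT y|lborel. (K * \<rho>) * indicator V y)"
      proof (rule integral_mono)
        show "integrable lborel (\<lambda>y. \<bar>indicator V y * f (y + t *\<^sub>R e) - f (x + t *\<^sub>R e) * indicator V y\<bar>)"
          using int1[of t] int[of "f (x + t *\<^sub>R e)"] by simp
        fix y
        show "\<bar>indicator V y * f (y + t *\<^sub>R e) - f (x + t *\<^sub>R e) * indicator V y\<bar> \<le> K * \<rho> * indicator V y"
        proof (cases "y \<in> V")
          case True
          have "\<bar>f (y + t *\<^sub>R e) - f (x + t *\<^sub>R e)\<bar> \<le> K * dist x y"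
            using lipschitz_onD[OF f, of "y + t *\<^sub>R e" "x + t *\<^sub>R e"] by (simp add: dist_real_def dist_commute)
          also have "\<dots> \<le> K * \<rho>" using True K0 by (intro mult_left_mono) (auto simp: V_def)
          finally show ?thesis using True by simp
        qed simp
      qed (rule int)
      also have "\<dots> = K * \<rho> * vol" by (simp add: vol_def)
      finally show ?thesis .
    qed
    have "vol * \<bar>f (x + e) - f x\<bar> = \<bar>vol * f (x + e) - vol * f x\<bar>"
      using volpos by (simp add: abs_mult flip: right_diff_distrib)
    also have "\<dots> \<le> M * vol + 2 * (K * \<rho> * vol)"
      using close[of 0] close[of 1] m10 by simp
    finally have "vol * \<bar>f (x + e) - f x\<bar> \<le> vol * (M + 2 * K * \<rho>)" by (simp add: algebra_simps)
    then show ?thesis using volpos by (simp add: mult_le_cancel_left_pos)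
  qed
  show ?thesis
  proof (rule field_le_epsilon)
    fix \<epsilon> :: real assume "\<epsilon> > 0"
    define \<rho> where "\<rho> = min (min \<rho>1 \<rho>2) (\<epsilon> / (2 * K + 1))"
    have \<rho>: "\<rho> > 0" "\<rho> \<le> min \<rho>1 \<rho>2" "\<rho> \<le> \<epsilon> / (2 * K + 1)"
      using \<rho>1(1) \<rho>2(1) \<open>\<epsilon> > 0\<close> K0 by (auto simp: \<rho>_def)
    have "2 * K * \<rho> \<le> (2 * K + 1) * \<rho>" using \<rho>(1) by simp
    also have "\<dots> \<le> \<epsilon>" using \<rho>(3) K0 by (simp add: field_simps)
    finally show "\<bar>f (x + e) - f x\<bar> \<le> M + \<epsilon>" using key[OF \<rho>(1,2)] by linarith
  qed
qed

lemma GDERIV_cong_open: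
  assumes "open U" "x \<in> U" "\<And>y. y \<in> U \<Longrightarrow> f y = h y"
  shows "GDERIV f x :> D \<longleftrightarrow> GDERIV h x :> D"
  unfolding gderiv_def
proof
  show "(h has_derivative (\<lambda>k. k \<bullet> D)) (at x)" if "(f has_derivative (\<lambda>k. k \<bullet> D)) (at x)"
    by (rule has_derivative_transform_within_open[OF that assms(1,2)]) (rule assms(3))
  show "(f has_derivative (\<lambda>k. k \<bullet> D)) (at x)" if "(h has_derivative (\<lambda>k. k \<bullet> D)) (at x)"
    by (rule has_derivative_transform_within_open[OF that assms(1,2)]) (rule assms(3)[symmetric])
qed

lemma grad_cong_open:
  assumes "open U" "x \<in> U" "\<And>y. y \<in> U \<Longrightarrow> f y = h y"
  shows "grad f x = grad h x"
proof -
  have "GDERIV f x :> D \<longleftrightarrow> GDERIV h x :> D" for D by (rule GDERIV_cong_open[OF assms])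
  then show ?thesis unfolding grad_def by presburger
qed

lemma GDERIV_min_zero:
  assumes "GDERIV f x :> D" "\<And>y. f y \<ge> f x"
  shows "D = 0"
proof -
  have "(f has_derivative (\<lambda>h. h \<bullet> D)) (at x)" using assms(1) by (simp add: gderiv_def)
  from has_derivative_local_min[OF this] assms(2) have "(\<lambda>h. h \<bullet> D) = (\<lambda>h. 0)" by simp
  then have "D \<bullet> D = 0" by metis
  then show ?thesis by simp
qed

lemma grad_zero_outside:
  assumes "\<zeta> \<in> C1_compact_support V" "x \<notin> V"
  shows "grad \<zeta> x = 0"
proof -
  define U where "U = - closure {x. \<zeta> x \<noteq> 0}"
  have "open U" "x \<in> U" "\<And>y. y \<in> U \<Longrightarrow> \<zeta> y = (\<lambda>_. 0) y"
    using assms closure_subset[of "{x. \<zeta> x \<noteq> 0}"] by (auto simp: U_def C1_compact_support_def)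
  from grad_cong_open[OF this] show ?thesis
    using grad_eqI[OF GDERIV_const[of 0 x]] by simp
qed

text \<open>Everything here is independent of the monotone parametrisation of S.\<close>

locale wave =
  fixes g B L \<alpha> F :: real and \<gamma> :: "real \<Rightarrow> real" and S \<Omega> :: "(real \<times> real) set"
    and \<psi> :: "real \<times> real \<Rightarrow> real"
  assumes g0: "g > 0" and B0: "B > 0"
    and holder: "C1_holder_on \<alpha> {0..B} \<gamma>"
    and weak: "weak_solution g B L \<gamma> F S \<Omega> \<psi> 0"
    and F0: "F < 0"
    and T_nonpos: "\<forall>x\<in>\<Omega>. T_fun g B \<gamma> \<psi> x \<le> 0"
    and zero_S: "0 \<in> S"
begin

lemma fd: "open \<Omega>" "connected \<Omega>" "\<Omega> \<subseteq> upper_half_plane F" "frontier \<Omega> = S \<union> bottom F"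
  using weak by (auto simp: weak_solution_def flow_domain_def)

lemma \<Omega>_borel [measurable]: "\<Omega> \<in> sets borel" using fd(1) by simp

lemma S_above: "x \<in> S \<Longrightarrow> snd x > F"
  using weak by (auto simp: weak_solution_def upper_half_plane_def)

lemma S_nonpos: "x \<in> S \<Longrightarrow> snd x \<le> 0"
  using weak g0 by (auto simp: weak_solution_def mult_le_0_iff)

lemma S_borel [measurable]: "S \<in> sets borel"
proof -
  have "S = frontier \<Omega> \<inter> {x. snd x > F}"
    using S_above unfolding fd(4) by (auto simp: bottom_def)
  moreover have "{x::real\<times>real. snd x > F} \<in> sets borel"
    by (intro borel_open open_Collect_less continuous_intros)
  ultimately show ?thesis by auto
qed

lemma \<psi>_S: "x \<in> S \<Longrightarrow> \<psi> x = 0" and \<psi>_nonneg: "x \<in> \<Omega> \<Longrightarrow> 0 \<le> \<psi> x" and \<psi>_le: "x \<in> \<Omega> \<Longrightarrow> \<psi> x \<le> B"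
  using weak by (auto simp: weak_solution_def)

lemma \<gamma>_cont: "continuous_on {0..B} \<gamma>"
proof -
  obtain f' where "\<forall>x\<in>{0..B}. (\<gamma> has_real_derivative f' x) (at x within {0..B})"
    using holder by (auto simp: C1_holder_on_def)
  then show ?thesis by (intro DERIV_continuous_on) auto
qed

definition gamma_bound where "gamma_bound = (SOME M. M > 0 \<and> (\<forall>r\<in>{0..B}. \<bar>\<gamma> r\<bar> \<le> M))"

lemma gamma_bound: "gamma_bound > 0" "r \<in> {0..B} \<Longrightarrow> \<bar>\<gamma> r\<bar> \<le> gamma_bound"
proof -
  have "bounded (\<gamma> ` {0..B})" by (intro compact_imp_bounded compact_continuous_image \<gamma>_cont) simp
  then obtain M where "M > 0" "\<forall>r\<in>{0..B}. \<bar>\<gamma> r\<bar> \<le> M" by (auto simp: bounded_pos)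
  then have "\<exists>M. M > 0 \<and> (\<forall>r\<in>{0..B}. \<bar>\<gamma> r\<bar> \<le> M)" by blast
  from someI_ex[OF this] show "gamma_bound > 0" "r \<in> {0..B} \<Longrightarrow> \<bar>\<gamma> r\<bar> \<le> gamma_bound" by (auto simp: gamma_bound_def)
qed

definition grad_const where "grad_const = \<bar>varpi B \<gamma>\<bar> + gamma_bound"

lemma grad_const0: "grad_const > 0" using gamma_bound(1) by (simp add: grad_const_def add_nonneg_pos)

text \<open>T[\<psi>] \<le> 0 solved for the gradient. The terms in \<psi> can be estimated crudely,
  since near the crest \<psi> turns out to be of higher order than r.\<close>

lemma grad_sq_bound: "(norm (grad \<psi> x))\<^sup>2 \<le> 2 * g * (- snd x) + 2 * grad_const * \<psi> x" if "x \<in> \<Omega>"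
proof -
  have r: "0 \<le> \<psi> x" "\<psi> x \<le> B" using that \<psi>_nonneg \<psi>_le by auto
  have "\<bar>integral {0..\<psi> x} \<gamma>\<bar> \<le> gamma_bound * (\<psi> x - 0)"
    using integral_bound[OF r(1) continuous_on_subset[OF \<gamma>_cont], of gamma_bound] r gamma_bound(2) by auto
  then have G: "- Gamma_hat \<gamma> (\<psi> x) \<le> gamma_bound * \<psi> x" by (simp add: Gamma_hat_def abs_le_iff)
  have "varpi B \<gamma> * \<psi> x \<le> \<bar>varpi B \<gamma>\<bar> * \<psi> x" using r(1) by (intro mult_right_mono) auto
  moreover have "T_fun g B \<gamma> \<psi> x \<le> 0" using T_nonpos that by blast
  ultimately show ?thesis using G unfolding T_fun_def grad_const_def by (simp add: algebra_simps)
qed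

text \<open>Otherwise the upper half plane, which misses the frontier, would lie in \<Omega>, and at
  a large height Y the bound for |\<nabla>\<psi>|^2 would be negative. Points with Y = 0 are then
  excluded by openness.\<close>

lemma \<Omega>_below: "x \<in> \<Omega> \<Longrightarrow> snd x < 0"
proof -
  define H where "H = {x :: real \<times> real. snd x > 0}"
  have cH: "connected H"
  proof (rule convex_connected)
    show "convex H" unfolding H_def using convex_halfspace_gt[of 0 "(0::real, 1::real)"] by (simp add: inner_prod_def)
  qed
  have disj: "H \<inter> frontier \<Omega> = {}"
    using S_nonpos F0 unfolding fd(4) H_def by (force simp: bottom_def)
  have HO: "H \<inter> \<Omega> = {}"
  proof (rule ccontr)
    assume "H \<inter> \<Omega> \<noteq> {}"
    then have "H \<subseteq> \<Omega>" using connected_Int_frontier[OF cH] disj by blast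
    moreover define Y where "Y = grad_const * B / g + 1"
    have "Y > 0" using grad_const0 B0 g0 by (simp add: Y_def add_nonneg_pos)
    ultimately have x: "(0, Y) \<in> \<Omega>" by (auto simp: H_def)
    have "0 \<le> 2 * g * (- Y) + 2 * grad_const * \<psi> (0, Y)"
      using order_trans[OF zero_le_power2 grad_sq_bound[OF x]] by simp
    moreover have "grad_const * \<psi> (0, Y) \<le> grad_const * B" using \<psi>_le[OF x] grad_const0 by (intro mult_left_mono) auto
    moreover have "g * Y = grad_const * B + g" using g0 by (simp add: Y_def field_simps)
    ultimately show False using g0 by simp
  qed
  assume x: "x \<in> \<Omega>"
  show "snd x < 0"
  proof (rule ccontr)
    assume n: "\<not> snd x < 0"
    obtain r where r: "r > 0" "ball x r \<subseteq> \<Omega>" using fd(1) x open_contains_ball by blast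
    have "dist x (x + (0, r/2)) < r" using r(1) by (simp add: dist_norm norm_Pair)
    then have "x + (0, r/2) \<in> \<Omega>" using r(2) by auto
    moreover have "x + (0, r/2) \<in> H" using n r(1) by (simp add: H_def)
    ultimately show False using HO by blast
  qed
qed

definition \<psi>0 :: "real \<times> real \<Rightarrow> real" where
  "\<psi>0 x = (if x \<in> closure \<Omega> then \<psi> x else 0)"

text \<open>Only the behaviour near the crest matters; freezing \<open>\<psi>\<close> below the line \<open>Y = F/2\<close> keeps the
  extension by zero Lipschitz without looking at the bottom.\<close>

definition \<Psi> :: "real \<times> real \<Rightarrow> real" where
  "\<Psi> x = \<psi>0 (fst x, max (F/2) (snd x))"

lemma closure_\<Omega>_cases: "x \<in> closure \<Omega> \<Longrightarrow> snd x > F \<Longrightarrow> x \<in> \<Omega> \<or> x \<in> S"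
  using fd(1,4) by (auto simp: frontier_def interior_open bottom_def)

text \<open>A segment from the closure of \<Omega> to a point outside, both ends above the bottom,
  leaves the closure at a point of S, where \<psi> = 0; and clamping Y does not increase
  distances.\<close>

lemma \<Psi>_lipschitz: "\<exists>K. K-lipschitz_on UNIV \<Psi>"
proof -
  obtain C where C: "C-lipschitz_on (closure \<Omega>) \<psi>" using weak by (auto simp: weak_solution_def)
  have growth_const: "C \<ge> 0" by (rule lipschitz_on_nonneg[OF C])
  have in_out: "\<bar>\<psi> x\<bar> \<le> C * dist x y" if x: "x \<in> closure \<Omega>" "snd x > F" and y: "y \<notin> closure \<Omega>" "snd y > F" for x y
  proof -
    have "closed_segment x y \<inter> frontier (closure \<Omega>) \<noteq> {}"
      by (rule connected_Int_frontier) (use x y in auto)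
    then obtain z where z: "z \<in> closed_segment x y" "z \<in> frontier (closure \<Omega>)" by blast
    have "z \<in> frontier \<Omega>" using z(2) interior_mono[OF closure_subset[of \<Omega>]] by (auto simp: frontier_def)
    moreover have "snd z > F"
    proof -
      obtain t where t: "0 \<le> t" "t \<le> 1" "z = (1 - t) *\<^sub>R x + t *\<^sub>R y" using z(1) by (auto simp: closed_segment_def)
      have "F = (1 - t) * F + t * F" by (simp add: algebra_simps)
      also have "\<dots> < (1 - t) * snd x + t * snd y"
      proof (cases "t = 0")
        case False
        then have "t * F < t * snd y" using t y by simp
        moreover have "(1 - t) * F \<le> (1 - t) * snd x" using t x by (intro mult_left_mono) auto
        ultimately show ?thesis by simp
      qed (use x in simp)
      also have "\<dots> = snd z" by (simp add: t)
      finally show ?thesis .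
    qed
    ultimately have zS: "z \<in> S" unfolding fd(4) by (auto simp: bottom_def)
    then have "z \<in> closure \<Omega>" using fd(4) frontier_def by blast
    then have "\<bar>\<psi> x - \<psi> z\<bar> \<le> C * dist x z" using lipschitz_onD[OF C x(1)] by (simp add: dist_real_def)
    also have "\<dots> \<le> C * dist x y"
      using z(1) growth_const by (intro mult_left_mono) (use dist_in_closed_segment[OF z(1)] in \<open>auto simp: dist_commute\<close>)
    finally show ?thesis using \<psi>_S[OF zS] by simp
  qed
  have lip0: "\<bar>\<psi>0 x - \<psi>0 y\<bar> \<le> C * dist x y" if "snd x > F" "snd y > F" for x y
  proof (cases "x \<in> closure \<Omega>"; cases "y \<in> closure \<Omega>")
    assume "x \<in> closure \<Omega>" "y \<in> closure \<Omega>"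
    then show ?thesis using lipschitz_onD[OF C] by (simp add: \<psi>0_def dist_real_def)
  next
    assume "x \<in> closure \<Omega>" "y \<notin> closure \<Omega>"
    then show ?thesis using in_out[of x y] that by (simp add: \<psi>0_def)
  next
    assume "x \<notin> closure \<Omega>" "y \<in> closure \<Omega>"
    then show ?thesis using in_out[of y x] that by (simp add: \<psi>0_def dist_commute)
  qed (use growth_const in \<open>simp add: \<psi>0_def\<close>)
  have "C-lipschitz_on UNIV \<Psi>"
  proof (rule lipschitz_onI[OF _ growth_const])
    fix x y :: "real \<times> real"
    have "dist (\<Psi> x) (\<Psi> y) \<le> C * dist (fst x, max (F/2) (snd x)) (fst y, max (F/2) (snd y))"
      unfolding \<Psi>_def dist_real_def by (rule lip0) (use F0 in auto)
    also have "\<dots> \<le> C * dist x y"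
    proof (rule mult_left_mono[OF _ growth_const])
      have "\<bar>max (F/2) (snd x) - max (F/2) (snd y)\<bar> \<le> \<bar>snd x - snd y\<bar>" by linarith
      then have "(max (F/2) (snd x) - max (F/2) (snd y))\<^sup>2 \<le> (snd x - snd y)\<^sup>2" by (simp only: abs_le_square_iff)
      then show "dist (fst x, max (F/2) (snd x)) (fst y, max (F/2) (snd y)) \<le> dist x y"
        by (cases x; cases y) (simp add: dist_Pair_Pair dist_real_def)
    qed
    finally show "dist (\<Psi> x) (\<Psi> y) \<le> C * dist x y" .
  qed
  then show ?thesis by blast
qed

lemma \<Psi>_\<Omega>: "x \<in> \<Omega> \<Longrightarrow> snd x > F/2 \<Longrightarrow> \<Psi> x = \<psi> x"
  using closure_subset[of \<Omega>] by (auto simp: \<Psi>_def \<psi>0_def max_def)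

lemma \<Psi>_out: "x \<notin> \<Omega> \<Longrightarrow> snd x > F/2 \<Longrightarrow> \<Psi> x = 0"
proof -
  assume x: "x \<notin> \<Omega>" "snd x > F/2"
  have "(fst x, max (F/2) (snd x)) = x" using x(2) by (cases x) auto
  moreover have "\<psi> x = 0" if "x \<in> closure \<Omega>"
    using closure_\<Omega>_cases[OF that] \<psi>_S[of x] x F0 by auto
  ultimately show "\<Psi> x = 0" by (simp add: \<Psi>_def \<psi>0_def)
qed

lemma \<Psi>_nonneg: "\<Psi> x \<ge> 0"
proof -
  define y where "y = (fst x, max (F/2) (snd x))"
  have "snd y > F" using F0 by (simp add: y_def max_def)
  then have "0 \<le> \<psi> y" if "y \<in> closure \<Omega>"
    using closure_\<Omega>_cases[OF that] \<psi>_S[of y] \<psi>_nonneg[of y] by auto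
  then show ?thesis unfolding \<Psi>_def \<psi>0_def y_def[symmetric] by simp
qed

lemma \<Psi>_zero_above: "snd x \<ge> 0 \<Longrightarrow> \<Psi> x = 0"
proof -
  assume x: "snd x \<ge> 0"
  then have "x \<notin> \<Omega>" using \<Omega>_below[of x] by auto
  then show "\<Psi> x = 0" using \<Psi>_out[of x] x F0 by simp
qed

lemma grad_\<Psi>_\<Omega>: "grad \<Psi> x = grad \<psi> x" if "x \<in> \<Omega>" "snd x > F/2"
proof (rule grad_cong_open[of "\<Omega> \<inter> {x. snd x > F/2}"])
  show "open (\<Omega> \<inter> {x. snd x > F/2})"
    using fd(1) by (intro open_Int open_Collect_less continuous_intros)
qed (use that \<Psi>_\<Omega> in auto)

text \<open>Points of S are included: \<Psi> attains its minimum 0 there, so its gradient vanishes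
  wherever it exists.\<close>

lemma AE_grad_\<Psi>_out: "AE x in lborel. x \<notin> \<Omega> \<longrightarrow> snd x > F/2 \<longrightarrow> grad \<Psi> x = 0"
proof -
  obtain K where "K-lipschitz_on UNIV \<Psi>" using \<Psi>_lipschitz by blast
  from AE_GDERIV_grad[OF this] show ?thesis
    by eventually_elim (metis GDERIV_min_zero \<Psi>_nonneg \<Psi>_out)
qed

lemma grad_\<Psi>_measurable [measurable]: "grad \<Psi> \<in> borel_measurable borel"
  and \<Psi>_continuous: "continuous_on UNIV \<Psi>"
  and \<Psi>_measurable [measurable]: "\<Psi> \<in> borel_measurable borel"
proof -
  show c: "continuous_on UNIV \<Psi>" using \<Psi>_lipschitz lipschitz_on_continuous_on by blast
  show "grad \<Psi> \<in> borel_measurable borel" by (rule grad_measurable[OF c])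
  show "\<Psi> \<in> borel_measurable borel" by (rule borel_measurable_continuous_onI[OF c])
qed

abbreviation "half \<equiv> {x :: real \<times> real. snd x > F/2}"

text \<open>Test functions supported above Y = F/2 see \<psi> only where it agrees with \<Psi>, so
  the gradient integral over \<Omega> becomes one over the plane, to which integration by parts
  applies.\<close>

lemma weak_form:
  assumes \<zeta>: "\<zeta> \<in> C1_compact_support half"
  shows "(LINT x|lborel. grad \<Psi> x \<bullet> grad \<zeta> x) =
    (LINT x:\<Omega>|lborel. \<gamma> (\<psi> x) * \<zeta> x) - (LINT x:S|hausdorff1. sqrt (- 2 * g * snd x) * \<zeta> x)"
    and "\<zeta> \<in> C1_compact_support \<Omega> \<Longrightarrow>
      (LINT x|lborel. grad \<Psi> x \<bullet> grad \<zeta> x) = (LINT x:\<Omega>|lborel. \<gamma> (\<psi> x) * \<zeta> x)"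
proof -
  have half: "half \<subseteq> upper_half_plane F" using F0 by (auto simp: upper_half_plane_def)
  then have \<zeta>': "\<zeta> \<in> C1_compact_support (upper_half_plane F)"
    using \<zeta> by (auto simp: C1_compact_support_def)
  have "grad \<zeta> \<in> borel_measurable borel"
    using \<zeta> by (auto simp: C1_compact_support_def intro: borel_measurable_continuous_onI)
  note [measurable] = this
  have "(LINT x:\<Omega>|lborel. grad \<psi> x \<bullet> grad \<zeta> x) = (LINT x|lborel. indicator \<Omega> x * (grad \<Psi> x \<bullet> grad \<zeta> x))"
    unfolding set_lebesgue_integral_def
  proof (intro Bochner_Integration.integral_cong refl)
    fix x
    show "indicat_real \<Omega> x *\<^sub>R (grad \<psi> x \<bullet> grad \<zeta> x) = indicator \<Omega> x * (grad \<Psi> x \<bullet> grad \<zeta> x)"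
      using grad_zero_outside[OF \<zeta>, of x] grad_\<Psi>_\<Omega>[of x]
      by (cases "x \<in> \<Omega>"; cases "snd x > F/2") auto
  qed
  also have "\<dots> = (LINT x|lborel. grad \<Psi> x \<bullet> grad \<zeta> x)"
  proof (rule integral_cong_AE)
    show "AE x in lborel. indicator \<Omega> x * (grad \<Psi> x \<bullet> grad \<zeta> x) = grad \<Psi> x \<bullet> grad \<zeta> x"
      using AE_grad_\<Psi>_out
    proof eventually_elim
      case (elim x)
      then show ?case using grad_zero_outside[OF \<zeta>, of x] by (cases "x \<in> \<Omega>"; cases "snd x > F/2") auto
    qed
  qed measurable
  finally have eq: "(LINT x:\<Omega>|lborel. grad \<psi> x \<bullet> grad \<zeta> x) = (LINT x|lborel. grad \<Psi> x \<bullet> grad \<zeta> x)" .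
  show "(LINT x|lborel. grad \<Psi> x \<bullet> grad \<zeta> x) =
    (LINT x:\<Omega>|lborel. \<gamma> (\<psi> x) * \<zeta> x) - (LINT x:S|hausdorff1. sqrt (- 2 * g * snd x) * \<zeta> x)"
    using weak \<zeta>' eq by (simp add: weak_solution_def)
  show "(LINT x|lborel. grad \<Psi> x \<bullet> grad \<zeta> x) = (LINT x:\<Omega>|lborel. \<gamma> (\<psi> x) * \<zeta> x)" if "\<zeta> \<in> C1_compact_support \<Omega>"
    using weak that eq by (simp add: weak_solution_def)
qed

lemma AE_grad_\<Psi>_sq: "AE x in lborel. snd x > F/2 \<longrightarrow> (norm (grad \<Psi> x))\<^sup>2 \<le> 2 * g * max 0 (- snd x) + 2 * grad_const * \<Psi> x"
  using AE_grad_\<Psi>_out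
proof eventually_elim
  case (elim x)
  show ?case
  proof (cases "x \<in> \<Omega>")
    case True
    show ?thesis
    proof
      assume s: "snd x > F/2"
      show "(norm (grad \<Psi> x))\<^sup>2 \<le> 2 * g * max 0 (- snd x) + 2 * grad_const * \<Psi> x"
        using grad_sq_bound[OF True] grad_\<Psi>_\<Omega>[OF True s] \<Psi>_\<Omega>[OF True s] \<Omega>_below[OF True] by simp
    qed
  next
    case False
    then show ?thesis using elim g0 grad_const0 \<Psi>_nonneg[of x] by simp
  qed
qed

text \<open>Bootstrap: \<Psi> = O(r), from the Lipschitz bound, gives |\<nabla>\<Psi>|^2 = O(r);
  integrating along the vertical segment up to Y = 0, where \<Psi> = 0, improves this to
  O(r^(3/2)).\<close>

lemma growth: "\<exists>C>0. \<forall>x. norm x < - F / 4 \<longrightarrow> \<Psi> x \<le> C * (norm x * sqrt (norm x))"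
proof -
  obtain K where K: "K-lipschitz_on UNIV \<Psi>" using \<Psi>_lipschitz by blast
  have K0: "K \<ge> 0" by (rule lipschitz_on_nonneg[OF K])
  have z: "\<Psi> 0 = 0" by (rule \<Psi>_zero_above) simp
  have lin: "\<Psi> x \<le> K * norm x" for x
    using lipschitz_onD[OF K, of x 0] z by (simp add: dist_real_def)
  define D where "D = sqrt (2 * (2 * g + 2 * grad_const * K))"
  have "\<Psi> x \<le> D * (norm x * sqrt (norm x))" if nx: "norm x < - F / 4" for x
  proof (cases "snd x < 0")
    case False then show ?thesis using \<Psi>_zero_above[of x] g0 grad_const0 K0 by (simp add: D_def)
  next
    case True
    \<comment> \<open>The doubled radius leaves room for an open convex set that contains the whole
      vertical segment.\<close>
    define r where "r = 2 * norm x"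
    have "norm x > 0" using True by (cases x) (auto simp: zero_prod_def)
    have sndle: "\<bar>snd y\<bar> \<le> norm y" for y :: "real \<times> real" using norm_snd_le[of "snd y" "fst y"] by simp
    have "AE y in lborel. y \<in> ball 0 r \<longrightarrow> \<bar>grad \<Psi> y \<bullet> (0, - snd x)\<bar> \<le> sqrt ((2 * g + 2 * grad_const * K) * r) * norm x"
      using AE_grad_\<Psi>_sq
    proof (eventually_elim, intro impI)
      fix y assume a: "snd y > F/2 \<longrightarrow> (norm (grad \<Psi> y))\<^sup>2 \<le> 2 * g * max 0 (- snd y) + 2 * grad_const * \<Psi> y" and "y \<in> ball 0 r"
      then have ny: "norm y \<le> r" by simp
      have "snd y > F/2" using sndle[of y] \<open>y \<in> ball 0 r\<close> nx by (simp add: r_def)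
      then have "(norm (grad \<Psi> y))\<^sup>2 \<le> 2 * g * max 0 (- snd y) + 2 * grad_const * \<Psi> y" using a by blast
      also have "\<dots> \<le> 2 * g * r + 2 * grad_const * (K * r)"
      proof (intro add_mono mult_left_mono)
        show "max 0 (- snd y) \<le> r" using sndle[of y] ny by linarith
        show "\<Psi> y \<le> K * r" using lin[of y] mult_left_mono[OF ny K0] by linarith
      qed (use g0 grad_const0 in auto)
      also have "\<dots> = (2 * g + 2 * grad_const * K) * r" by (simp add: algebra_simps)
      finally have "norm (grad \<Psi> y) \<le> sqrt ((2 * g + 2 * grad_const * K) * r)" by (rule real_le_rsqrt)
      moreover have "norm (0::real, - snd x) \<le> norm x" using sndle[of x] by (simp add: norm_Pair)
      ultimately have "norm (grad \<Psi> y) * norm (0::real, - snd x) \<le> sqrt ((2 * g + 2 * grad_const * K) * r) * norm x"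
        using g0 grad_const0 K0 by (intro mult_mono) (auto simp: r_def)
      then show "\<bar>grad \<Psi> y \<bullet> (0, - snd x)\<bar> \<le> sqrt ((2 * g + 2 * grad_const * K) * r) * norm x"
        using Cauchy_Schwarz_ineq2 order_trans by blast
    qed
    then have "\<bar>\<Psi> (x + (0, - snd x)) - \<Psi> x\<bar> \<le> sqrt ((2 * g + 2 * grad_const * K) * r) * norm x"
    proof (rule lipschitz_along_AE_bound[OF K open_ball convex_ball, rotated 2])
      show "x \<in> ball 0 r" using \<open>norm x > 0\<close> by (simp add: r_def)
      have "norm (x + (0, - snd x)) \<le> norm x" by (cases x) (simp add: norm_Pair)
      then have "norm (x + (0, - snd x)) < 2 * norm x" using \<open>norm x > 0\<close> by linarith
      then show "x + (0, - snd x) \<in> ball 0 r" by (simp add: r_def)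
    qed
    moreover have "\<Psi> (x + (0, - snd x)) = 0" by (rule \<Psi>_zero_above) simp
    moreover have "sqrt ((2 * g + 2 * grad_const * K) * r) = D * sqrt (norm x)"
    proof -
      have eq: "(2 * g + 2 * grad_const * K) * r = (2 * (2 * g + 2 * grad_const * K)) * norm x" by (simp add: r_def algebra_simps)
      show ?thesis unfolding eq D_def by (rule real_sqrt_mult)
    qed
    ultimately show ?thesis by (simp add: mult_ac)
  qed
  moreover have "D > 0" using g0 grad_const0 K0 by (simp add: D_def add_pos_nonneg)
  ultimately show ?thesis by blast
qed

end

subsection \<open>Cut-off functions\<close>

definition pos_part :: "real \<Rightarrow> real" where "pos_part x = max 0 x"

lemma pos_part_simps [simp]: "x \<le> 0 \<Longrightarrow> pos_part x = 0" "0 \<le> x \<Longrightarrow> pos_part x = x" "pos_part x \<ge> 0"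
  by (auto simp: pos_part_def)

lemma continuous_on_pos_part [continuous_intros]: "continuous_on A f \<Longrightarrow> continuous_on A (\<lambda>x. pos_part (f x))"
  unfolding pos_part_def by (intro continuous_intros)

lemma DERIV_pos_part_power: "((\<lambda>x. pos_part x ^ Suc (Suc n)) has_real_derivative (real (Suc (Suc n)) * pos_part x ^ Suc n)) (at x)"
proof -
  consider "x > 0" | "x < 0" | "x = 0" by linarith
  then show ?thesis
  proof cases
    case 1
    have "((\<lambda>x. x ^ Suc (Suc n)) has_real_derivative (real (Suc (Suc n)) * x ^ Suc n)) (at x)"
      by (rule DERIV_pow[THEN DERIV_cong]) simp
    then have "((\<lambda>x. pos_part x ^ Suc (Suc n)) has_real_derivative (real (Suc (Suc n)) * x ^ Suc n)) (at x)"
      by (rule has_field_derivative_transform_within_open[of _ _ _ "{0<..}"]) (use 1 in auto)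
    then show ?thesis using 1 by simp
  next
    case 2
    have "((\<lambda>x. pos_part x ^ Suc (Suc n)) has_real_derivative 0) (at x)"
      by (rule has_field_derivative_transform_within_open[OF DERIV_const[of 0], of "{..<0}"]) (use 2 in auto)
    then show ?thesis using 2 by simp
  next
    case 3
    have "((\<lambda>h. pos_part h ^ Suc n) \<longlongrightarrow> pos_part 0 ^ Suc n) (at 0)"
      by (intro continuous_within_tendsto_compose'[of 0 UNIV "\<lambda>h. pos_part h ^ Suc n"] tendsto_ident_at)
         (auto intro!: continuous_intros simp: continuous_on_eq_continuous_within[symmetric] pos_part_def)
    then have "((\<lambda>h. (pos_part (0 + h) ^ Suc (Suc n) - pos_part 0 ^ Suc (Suc n)) / h) \<longlongrightarrow> 0) (at 0)"
      by (rule Lim_transform_eventually[THEN tendsto_eq_rhs])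
         (auto simp: eventually_at_filter pos_part_def max_def)
    then show ?thesis using 3 by (simp add: DERIV_def)
  qed
qed

lemma DERIV_pos_part_3: "(f has_real_derivative f') (at x) \<Longrightarrow> ((\<lambda>x. pos_part (f x) ^ 3) has_real_derivative (3 * pos_part (f x) ^ 2 * f')) (at x)"
  using DERIV_chain2[OF DERIV_pos_part_power[of 1]] by (simp add: eval_nat_numeral mult_ac)

lemma DERIV_pos_part_2: "(f has_real_derivative f') (at x) \<Longrightarrow> ((\<lambda>x. pos_part (f x) ^ 2) has_real_derivative (2 * pos_part (f x) * f')) (at x)"
  using DERIV_chain2[OF DERIV_pos_part_power[of 0]] by (simp add: eval_nat_numeral mult_ac)

text \<open>A \<open>C\<^sup>2\<close> step from 0 to 1 on \<open>[0, 1]\<close>: the integral of a quadratic B-spline with knots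
  \<open>0, 1/3, 2/3, 1\<close>.\<close>

definition smooth_step :: "real \<Rightarrow> real" where
  "smooth_step x = 9/2 * (pos_part x ^ 3 - 3 * pos_part (x - 1/3) ^ 3 + 3 * pos_part (x - 2/3) ^ 3 - pos_part (x - 1) ^ 3)"

definition smooth_step1 :: "real \<Rightarrow> real" where
  "smooth_step1 x = 27/2 * (pos_part x ^ 2 - 3 * pos_part (x - 1/3) ^ 2 + 3 * pos_part (x - 2/3) ^ 2 - pos_part (x - 1) ^ 2)"

definition smooth_step2 :: "real \<Rightarrow> real" where
  "smooth_step2 x = 27 * (pos_part x - 3 * pos_part (x - 1/3) + 3 * pos_part (x - 2/3) - pos_part (x - 1))"

lemma DERIV_smooth_step: "(smooth_step has_real_derivative smooth_step1 x) (at x)"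
  unfolding smooth_step_def[abs_def] smooth_step1_def
  by (rule DERIV_pos_part_3 derivative_eq_intros refl | simp)+

lemma DERIV_smooth_step1: "(smooth_step1 has_real_derivative smooth_step2 x) (at x)"
  unfolding smooth_step1_def[abs_def] smooth_step2_def
  by (rule DERIV_pos_part_2 derivative_eq_intros refl | simp)+

lemma continuous_on_smooth_step [continuous_intros]:
  "continuous_on A f \<Longrightarrow> continuous_on A (\<lambda>x. smooth_step (f x))"
  "continuous_on A f \<Longrightarrow> continuous_on A (\<lambda>x. smooth_step1 (f x))"
  "continuous_on A f \<Longrightarrow> continuous_on A (\<lambda>x. smooth_step2 (f x))"
  unfolding smooth_step_def smooth_step1_def smooth_step2_def by (intro continuous_intros; assumption)+

lemma smooth_step_le0: "x \<le> 0 \<Longrightarrow> smooth_step x = 0 \<and> smooth_step1 x = 0 \<and> smooth_step2 x = 0"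
  by (simp add: smooth_step_def smooth_step1_def smooth_step2_def)

lemma smooth_step_ge1: "x \<ge> 1 \<Longrightarrow> smooth_step x = 1 \<and> smooth_step1 x = 0 \<and> smooth_step2 x = 0"
  by (simp add: smooth_step_def smooth_step1_def smooth_step2_def power2_eq_square power3_eq_cube field_simps)

lemma smooth_step1_nonneg: "smooth_step1 x \<ge> 0"
proof -
  consider "x \<le> 0" | "0 \<le> x" "x \<le> 1/3" | "1/3 \<le> x" "x \<le> 2/3" | "2/3 \<le> x" "x \<le> 1" | "x \<ge> 1" by linarith
  then show ?thesis
  proof cases
    case 3
    have "(x - 1/3) * (2/3 - x) \<ge> 0" using 3 by simp
    moreover have "x\<^sup>2 - 3 * (x - 1/3)\<^sup>2 = 2 * ((x - 1/3) * (2/3 - x)) + 1/9" by (simp add: power2_eq_square field_simps)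
    ultimately have "x\<^sup>2 - 3 * (x - 1/3)\<^sup>2 \<ge> 0" by linarith
    then show ?thesis using 3 by (simp add: smooth_step1_def)
  next
    case 4
    have "x\<^sup>2 - 3 * (x - 1/3)\<^sup>2 + 3 * (x - 2/3)\<^sup>2 = (1 - x)\<^sup>2" by (simp add: power2_eq_square field_simps)
    then show ?thesis using 4 by (simp add: smooth_step1_def)
  qed (auto simp: smooth_step_le0 smooth_step_ge1, simp add: smooth_step1_def)
qed

lemma smooth_step_mono: "x \<le> y \<Longrightarrow> smooth_step x \<le> smooth_step y"
  by (rule DERIV_nonneg_imp_nondecreasing) (use DERIV_smooth_step smooth_step1_nonneg in blast)+

lemma smooth_step_range: "0 \<le> smooth_step x" "smooth_step x \<le> 1"
  using smooth_step_mono[of 0 x] smooth_step_mono[of x 0] smooth_step_mono[of x 1] smooth_step_le0[of 0] smooth_step_le0[of x] smooth_step_ge1[of 1] smooth_step_ge1[of x]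
  by (cases "x \<le> 0"; cases "x \<ge> 1"; simp)+

lemma nn_integral_smooth_step1: "(\<integral>\<^sup>+x. ennreal (smooth_step1 x) * indicator {0..1} x \<partial>lborel) = 1"
proof -
  have "(\<integral>\<^sup>+x. ennreal (smooth_step1 x) * indicator {0..1} x \<partial>lborel) = ennreal (smooth_step 1 - smooth_step 0)"
    by (rule nn_integral_FTC_Icc)
       (use DERIV_smooth_step smooth_step1_nonneg in \<open>auto intro!: borel_measurable_continuous_onI continuous_intros\<close>)
  then show ?thesis using smooth_step_le0[of 0] smooth_step_ge1[of 1] by simp
qed

text \<open>The mean value \<open>1/140\<close> of \<open>bump\<close> is \<open>B(4, 4)\<close>.\<close>

locale log_bump =
  fixes ta tb :: real
  assumes len: "ta + 1 \<le> tb"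
begin

definition "\<Lambda> = tb - ta"

lemma \<Lambda>1: "\<Lambda> \<ge> 1" using len by (simp add: \<Lambda>_def)

definition "w t = (t - ta) / \<Lambda>"

text \<open>Third powers make the bump twice continuously differentiable at both ends.\<close>

definition "bump t = pos_part (w t) ^ 3 * pos_part (1 - w t) ^ 3"
definition "bump1 t = (3 * pos_part (w t) ^ 2 * pos_part (1 - w t) ^ 3 - 3 * pos_part (w t) ^ 3 * pos_part (1 - w t) ^ 2) / \<Lambda>"
definition "bump2 t = (6 * pos_part (w t) * pos_part (1 - w t) ^ 3 - 18 * pos_part (w t) ^ 2 * pos_part (1 - w t) ^ 2 + 6 * pos_part (w t) ^ 3 * pos_part (1 - w t)) / \<Lambda>\<^sup>2"

lemma DERIV_w: "(w has_real_derivative (1 / \<Lambda>)) (at t)"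
  unfolding w_def[abs_def] using \<Lambda>1 by (auto intro!: derivative_eq_intros)

lemma DERIV_bump: "(bump has_real_derivative bump1 t) (at t)"
  unfolding bump_def[abs_def] bump1_def using \<Lambda>1
  by - ((rule DERIV_pos_part_3 DERIV_w derivative_eq_intros refl)+, simp add: field_simps)

lemma DERIV_bump1: "(bump1 has_real_derivative bump2 t) (at t)"
  unfolding bump1_def[abs_def] bump2_def using \<Lambda>1
  by - ((rule DERIV_pos_part_3 DERIV_pos_part_2 DERIV_w derivative_eq_intros refl)+, (simp_all add: field_simps power2_eq_square power3_eq_cube)?)

lemma continuous_w [continuous_intros]: "continuous_on A w"
  unfolding w_def[abs_def] using \<Lambda>1 by (intro continuous_intros) auto

lemma continuous_bump [continuous_intros]: "continuous_on A bump" "continuous_on A bump1" "continuous_on A bump2"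
  unfolding bump_def[abs_def] bump1_def[abs_def] bump2_def[abs_def] using \<Lambda>1 by (intro continuous_intros; simp)+

lemma w_range: "t \<in> {ta..tb} \<Longrightarrow> 0 \<le> w t \<and> w t \<le> 1"
  using \<Lambda>1 by (auto simp: w_def \<Lambda>_def field_simps)

lemma bump_out: "t \<notin> {ta..tb} \<Longrightarrow> bump t = 0 \<and> bump1 t = 0 \<and> bump2 t = 0"
proof -
  assume "t \<notin> {ta..tb}"
  then have "w t \<le> 0 \<or> 1 - w t \<le> 0" using \<Lambda>1 by (auto simp: w_def \<Lambda>_def field_simps)
  then show ?thesis by (auto simp: bump_def bump1_def bump2_def)
qed

lemma bump_range: "0 \<le> bump t" "bump t \<le> 1"
proof -
  show "0 \<le> bump t" by (simp add: bump_def)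
  show "bump t \<le> 1"
  proof (cases "t \<in> {ta..tb}")
    case True
    have "pos_part (w t) ^ 3 * pos_part (1 - w t) ^ 3 \<le> 1 * 1"
      using w_range[OF True] by (intro mult_mono power_le_one) auto
    then show ?thesis by (simp add: bump_def)
  qed (simp add: bump_out)
qed

text \<open>Only the power of \<Lambda> matters: over an interval of length \<Lambda> these
  derivatives have bounded integrals, unlike the bump itself. The second derivative is even O(1 /
  \<Lambda>^2), which \<Lambda> \<ge> 1 weakens to the common form.\<close>

lemma bump_deriv_bounds: "\<bar>bump1 t\<bar> \<le> 3 / \<Lambda>" "\<bar>bump2 t\<bar> \<le> 30 / \<Lambda>"
proof -
  have "\<bar>bump1 t\<bar> \<le> 3 / \<Lambda> \<and> \<bar>bump2 t\<bar> \<le> 30 / \<Lambda>"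
  proof (cases "t \<in> {ta..tb}")
    case True
    define p where "p = w t"
    define q where "q = 1 - p"
    have pq: "0 \<le> p" "p \<le> 1" "0 \<le> q" "q \<le> 1" using w_range[OF True] by (auto simp: p_def q_def)
    have wq: "1 - w t = q" "w t = p" by (auto simp: p_def q_def)
    have b: "0 \<le> p ^ i * q ^ j \<and> p ^ i * q ^ j \<le> 1" for i j
      using pq by (auto intro!: mult_le_one power_le_one)
    have "\<bar>3 * p ^ 2 * q ^ 3 - 3 * p ^ 3 * q ^ 2\<bar> \<le> 3"
      using b[of 2 3] b[of 3 2] by (simp add: abs_le_iff mult.assoc)
    then have 1: "\<bar>bump1 t\<bar> \<le> 3 / \<Lambda>"
      unfolding bump1_def wq(1) unfolding wq(2) using \<Lambda>1 pq by (simp add: divide_right_mono)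
    have "\<bar>6 * p * q ^ 3 - 18 * p ^ 2 * q ^ 2 + 6 * p ^ 3 * q\<bar> \<le> 30"
    proof -
      have "0 \<le> p * q ^ 3" "p * q ^ 3 \<le> 1" "0 \<le> p ^ 2 * q ^ 2" "p ^ 2 * q ^ 2 \<le> 1" "0 \<le> p ^ 3 * q" "p ^ 3 * q \<le> 1"
        using b[of 1 3] b[of 2 2] b[of 3 1] by (simp_all only: power_one_right)
      then show ?thesis unfolding abs_le_iff mult.assoc by linarith
    qed
    then have "\<bar>bump2 t\<bar> \<le> 30 / \<Lambda>\<^sup>2"
      unfolding bump2_def wq(1) unfolding wq(2) using \<Lambda>1 pq by (simp add: divide_right_mono)
    also have "30 / \<Lambda>\<^sup>2 \<le> 30 / \<Lambda>" using \<Lambda>1 by (simp add: power2_eq_square field_simps)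
    finally show ?thesis using 1 by blast
  qed (use \<Lambda>1 in \<open>simp add: bump_out\<close>)
  then show "\<bar>bump1 t\<bar> \<le> 3 / \<Lambda>" "\<bar>bump2 t\<bar> \<le> 30 / \<Lambda>" by auto
qed

lemma nn_integral_bump: "(\<integral>\<^sup>+t. ennreal (bump t) \<partial>lborel) = ennreal (\<Lambda> / 140)"
proof -
  define G where "G t = \<Lambda> * (w t ^ 4 / 4 - 3 * w t ^ 5 / 5 + w t ^ 6 / 2 - w t ^ 7 / 7)" for t
  have "(\<integral>\<^sup>+t. ennreal (bump t) \<partial>lborel) = (\<integral>\<^sup>+t. ennreal (bump t) * indicator {ta..tb} t \<partial>lborel)"
    using bump_out by (intro nn_integral_cong) (auto simp: indicator_def)
  also have "\<dots> = ennreal (G tb - G ta)"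
  proof (rule nn_integral_FTC_Icc)
    show "bump \<in> borel_measurable borel" by (intro borel_measurable_continuous_onI continuous_intros)
    show "ta \<le> tb" using len by simp
    fix t assume t: "t \<in> {ta..tb}"
    have "bump t = w t ^ 3 * (1 - w t) ^ 3" using w_range[OF t] by (simp add: bump_def)
    also have "\<dots> = \<Lambda> * (4 * w t ^ 3 / 4 - 15 * w t ^ 4 / 5 + 6 * w t ^ 5 / 2 - 7 * w t ^ 6 / 7) * (1 / \<Lambda>)"
      using \<Lambda>1 by (simp add: eval_nat_numeral algebra_simps)
    finally have hbt: "bump t = \<dots>" .
    show "(G has_real_derivative bump t) (at t)"
      unfolding G_def[abs_def] hbt using \<Lambda>1
      by (auto intro!: derivative_eq_intros DERIV_w simp: field_simps eval_nat_numeral)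
    show "0 \<le> bump t" by (rule bump_range)
  qed
  also have "w tb = 1" "w ta = 0" using \<Lambda>1 by (auto simp: w_def \<Lambda>_def)
  then have "G tb - G ta = \<Lambda> / 140" by (simp add: G_def)
  finally show ?thesis .
qed

text \<open>In terms of t = ln r the exponential is r to the power -3/2.\<close>

definition "crit_bump t = exp (- (3/2) * t) * bump t"
definition "crit_bump1 t = exp (- (3/2) * t) * (bump1 t - 3/2 * bump t)"
definition "crit_bump2 t = exp (- (3/2) * t) * (bump2 t - 3 * bump1 t + 9/4 * bump t)"

lemma DERIV_crit_bump: "(crit_bump has_real_derivative crit_bump1 t) (at t)"
  unfolding crit_bump_def[abs_def] crit_bump1_def
  by (auto intro!: derivative_eq_intros DERIV_bump simp: algebra_simps)

lemma DERIV_crit_bump1: "(crit_bump1 has_real_derivative crit_bump2 t) (at t)"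
  unfolding crit_bump1_def[abs_def] crit_bump2_def
  by (auto intro!: derivative_eq_intros DERIV_bump DERIV_bump1 simp: field_simps)

lemma crit_bump_cont: "continuous_on UNIV crit_bump" "continuous_on UNIV crit_bump1" "continuous_on UNIV crit_bump2"
  unfolding crit_bump_def[abs_def] crit_bump1_def[abs_def] crit_bump2_def[abs_def] by (intro continuous_intros)+

lemma crit_bump_supp: "crit_bump t \<noteq> 0 \<Longrightarrow> ta \<le> t \<and> t \<le> tb" "crit_bump1 t \<noteq> 0 \<Longrightarrow> ta \<le> t \<and> t \<le> tb"
  using bump_out[of t] by (cases "t \<in> {ta..tb}"; simp add: crit_bump_def crit_bump1_def)+

end

lemma half_plane_integral_bound:
  fixes f :: "real \<times> real \<Rightarrow> real" and a k a' k' :: "real \<Rightarrow> real"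
  assumes f: "AE x in lborel. \<bar>f x\<bar> \<le> (if snd x < 0 then (a (ln (norm x)) * k (pol_angle x) + a' (ln (norm x)) * k' (pol_angle x)) / (norm x)\<^sup>2 else 0)"
    and [measurable]: "a \<in> borel_measurable borel" "k \<in> borel_measurable borel" "a' \<in> borel_measurable borel" "k' \<in> borel_measurable borel"
    and nn: "\<And>t. a t \<ge> 0" "\<And>t. k t \<ge> 0" "\<And>t. a' t \<ge> 0" "\<And>t. k' t \<ge> 0"
    and I: "(\<integral>\<^sup>+t. ennreal (a t) \<partial>lborel) \<le> ennreal Ia" "(\<integral>\<^sup>+s. ennreal (k s) * indicator {- (pi/2)..pi/2} s \<partial>lborel) \<le> ennreal Ik"
    and I': "(\<integral>\<^sup>+t. ennreal (a' t) \<partial>lborel) \<le> ennreal Ia'" "(\<integral>\<^sup>+s. ennreal (k' s) * indicator {- (pi/2)..pi/2} s \<partial>lborel) \<le> ennreal Ik'"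
    and pos: "Ia \<ge> 0" "Ik \<ge> 0" "Ia' \<ge> 0" "Ik' \<ge> 0"
  shows "\<bar>LINT x|lborel. f x\<bar> \<le> Ia * Ik + Ia' * Ik'"
    and "f \<in> borel_measurable borel \<Longrightarrow> integrable lborel f"
proof -
  define G where "G a k x = ennreal (a (ln (norm x))) * ennreal (k (arctan (fst x / (- snd x)))) * ennreal (1 / (norm x)\<^sup>2) * indicator {x. snd x < 0} x"
    for a k :: "real \<Rightarrow> real" and x :: "real \<times> real"
  have le: "(\<integral>\<^sup>+x. G a k x \<partial>lborel) \<le> (\<integral>\<^sup>+t. ennreal (a t) \<partial>lborel) * (\<integral>\<^sup>+s. ennreal (k s) * indicator {- (pi/2)..pi/2} s \<partial>lborel)"
    if [measurable]: "a \<in> borel_measurable borel" "k \<in> borel_measurable borel" for a k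
    unfolding G_def by (rule nn_integral_lower_half_plane_le[of "\<lambda>t. ennreal (a t)" "\<lambda>t. ennreal (k t)"]) measurable
  have sn[measurable]: "{x::real\<times>real. snd x < 0} \<in> sets borel" by (intro borel_open open_Collect_less continuous_intros)
  have Gm: "G a k \<in> borel_measurable borel" if [measurable]: "a \<in> borel_measurable borel" "k \<in> borel_measurable borel" for a k
  proof -
    have [measurable]: "(fst :: real\<times>real \<Rightarrow> real) \<in> borel_measurable borel" "(snd :: real\<times>real \<Rightarrow> real) \<in> borel_measurable borel"
      by (intro borel_measurable_continuous_onI continuous_intros)+
    show ?thesis unfolding G_def by measurable
  qed
  have "(\<integral>\<^sup>+x. ennreal \<bar>f x\<bar> \<partial>lborel) \<le> (\<integral>\<^sup>+x. G a k x + G a' k' x \<partial>lborel)"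
  proof (rule nn_integral_mono_AE)
    show "AE x in lborel. ennreal \<bar>f x\<bar> \<le> G a k x + G a' k' x"
      using f
    proof eventually_elim
      case (elim x)
      show ?case
      proof (cases "snd x < 0")
        case True
        then have "\<bar>f x\<bar> \<le> a (ln (norm x)) * k (pol_angle x) * (1 / (norm x)\<^sup>2) + a' (ln (norm x)) * k' (pol_angle x) * (1 / (norm x)\<^sup>2)"
          using elim by (simp add: add_divide_distrib)
        then have "ennreal \<bar>f x\<bar> \<le> ennreal (a (ln (norm x)) * k (pol_angle x) * (1 / (norm x)\<^sup>2)) + ennreal (a' (ln (norm x)) * k' (pol_angle x) * (1 / (norm x)\<^sup>2))"
          using nn by (simp add: ennreal_leI flip: ennreal_plus)
        also have "\<dots> = G a k x + G a' k' x"
          using True nn pol_angle_arctan[OF True] by (simp add: G_def ennreal_mult del: times_divide_eq_right)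
        finally show ?thesis .
      qed (use elim in simp)
    qed
  qed
  also have "\<dots> = (\<integral>\<^sup>+x. G a k x \<partial>lborel) + (\<integral>\<^sup>+x. G a' k' x \<partial>lborel)"
    by (rule nn_integral_add) (auto intro: Gm)
  also have "\<dots> \<le> ennreal Ia * ennreal Ik + ennreal Ia' * ennreal Ik'"
    by (intro add_mono order_trans[OF le] mult_mono I I') auto
  also have "\<dots> = ennreal (Ia * Ik + Ia' * Ik')" using pos by (simp add: ennreal_mult)
  finally have b: "(\<integral>\<^sup>+x. ennreal \<bar>f x\<bar> \<partial>lborel) \<le> ennreal (Ia * Ik + Ia' * Ik')" .
  show "\<bar>LINT x|lborel. f x\<bar> \<le> Ia * Ik + Ia' * Ik'"
  proof (cases "integrable lborel f")
    case True
    have "ennreal \<bar>LINT x|lborel. f x\<bar> \<le> ennreal (Ia * Ik + Ia' * Ik')"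
      using order_trans[OF integral_norm_bound_ennreal[OF True]] b by simp
    then show ?thesis by (subst (asm) ennreal_le_iff) (use pos in auto)
  qed (use pos in \<open>simp add: not_integrable_integral_eq\<close>)
  show "integrable lborel f" if "f \<in> borel_measurable borel"
    using that b by (intro integrableI_bounded) (auto intro: le_less_trans)
qed

text \<open>The cut-off vanishes near the branch cut of the angle and is 1 in the lower half plane, which contains \<open>\<Omega>\<close>.\<close>

definition cut_angle :: "(real \<Rightarrow> real) \<Rightarrow> real \<Rightarrow> real" where
  "cut_angle f s = smooth_step (1 + 2 * cos s) * f s"

definition cut_angle1 :: "(real \<Rightarrow> real) \<Rightarrow> (real \<Rightarrow> real) \<Rightarrow> real \<Rightarrow> real" where
  "cut_angle1 f f' s = smooth_step1 (1 + 2 * cos s) * (- 2 * sin s) * f s + smooth_step (1 + 2 * cos s) * f' s"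

definition cut_angle2 :: "(real \<Rightarrow> real) \<Rightarrow> (real \<Rightarrow> real) \<Rightarrow> (real \<Rightarrow> real) \<Rightarrow> real \<Rightarrow> real" where
  "cut_angle2 f f' f'' s = smooth_step2 (1 + 2 * cos s) * (- 2 * sin s) * (- 2 * sin s) * f s + smooth_step1 (1 + 2 * cos s) * (- 2 * cos s) * f s
     + 2 * (smooth_step1 (1 + 2 * cos s) * (- 2 * sin s) * f' s) + smooth_step (1 + 2 * cos s) * f'' s"

lemma DERIV_cut_angle:
  assumes f: "\<And>s. (f has_real_derivative f' s) (at s)"
  shows "(cut_angle f has_real_derivative cut_angle1 f f' s) (at s)"
  unfolding cut_angle_def[abs_def] cut_angle1_def
  by (auto intro!: derivative_eq_intros DERIV_chain2[OF DERIV_smooth_step] f)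

lemma DERIV_cut_angle1:
  assumes f: "\<And>s. (f has_real_derivative f' s) (at s)" and f': "\<And>s. (f' has_real_derivative f'' s) (at s)"
  shows "(cut_angle1 f f' has_real_derivative cut_angle2 f f' f'' s) (at s)"
  unfolding cut_angle1_def[abs_def] cut_angle2_def
  by (auto intro!: derivative_eq_intros DERIV_chain2[OF DERIV_smooth_step] DERIV_chain2[OF DERIV_smooth_step1] f f' simp: algebra_simps)

lemma cut_angle_zero: "cos s \<le> - 1/2 \<Longrightarrow> cut_angle f s = 0 \<and> cut_angle1 f f' s = 0"
  using smooth_step_le0[of "1 + 2 * cos s"] by (simp add: cut_angle_def cut_angle1_def)

lemma cut_angle_lower:
  assumes "cos s \<ge> 0"
  shows "cut_angle f s = f s" "cut_angle1 f f' s = f' s" "cut_angle2 f f' f'' s = f'' s"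
  using smooth_step_ge1[of "1 + 2 * cos s"] assms by (auto simp: cut_angle_def cut_angle1_def cut_angle2_def)

lemma continuous_cut_angle:
  assumes "continuous_on UNIV f" "continuous_on UNIV f'"
  shows "continuous_on UNIV (cut_angle f)" "continuous_on UNIV (cut_angle1 f f')"
  unfolding cut_angle_def[abs_def] cut_angle1_def[abs_def] using assms by (auto intro!: continuous_intros)

lemma continuous_cut_angle2:
  assumes "continuous_on UNIV f" "continuous_on UNIV f'" "continuous_on UNIV f''"
  shows "continuous_on UNIV (cut_angle2 f f' f'')"
  unfolding cut_angle2_def[abs_def] using assms by (auto intro!: continuous_intros)

lemma lift_C1_cut:
  assumes "log_bump ta tb" and f: "\<And>s. (f has_real_derivative f' s) (at s)" "continuous_on UNIV f'"
  shows "lift_C1 (log_bump.crit_bump ta tb) (cut_angle f) ta tb (log_bump.crit_bump1 ta tb) (cut_angle1 f f')"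
proof -
  interpret log_bump ta tb by fact
  have cf: "continuous_on UNIV f" using f(1) by (auto simp: continuous_on_eq_continuous_at intro: DERIV_isCont)
  show ?thesis
    by unfold_locales (use crit_bump_supp crit_bump_cont DERIV_crit_bump DERIV_cut_angle[OF f(1)] cut_angle_zero continuous_cut_angle[OF cf f(2)] in auto)
qed

lemma lift_C2_cut:
  assumes "log_bump ta tb" and f: "\<And>s. (f has_real_derivative f' s) (at s)" "\<And>s. (f' has_real_derivative f'' s) (at s)" "continuous_on UNIV f''"
  shows "lift_C2 (log_bump.crit_bump ta tb) (cut_angle f) ta tb (log_bump.crit_bump1 ta tb) (cut_angle1 f f') (log_bump.crit_bump2 ta tb) (cut_angle2 f f' f'')"
proof -
  interpret log_bump ta tb by fact
  have cf: "continuous_on UNIV f" "continuous_on UNIV f'"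
    using f(1,2) by (auto simp: continuous_on_eq_continuous_at intro: DERIV_isCont)
  note c = continuous_cut_angle[OF cf] continuous_cut_angle2[OF cf f(3)]
  show ?thesis
    by unfold_locales (use crit_bump_supp crit_bump_cont DERIV_crit_bump DERIV_crit_bump1 DERIV_cut_angle[OF f(1)] DERIV_cut_angle1[OF f(1,2)] cut_angle_zero c in auto)
qed

lemma abs_cos_diff_le: "\<bar>cos a - cos b\<bar> \<le> \<bar>a - b :: real\<bar>"
proof -
  have "cos a - cos b = 2 * sin ((a + b) / 2) * sin ((b - a) / 2)" by (rule cos_diff_cos)
  then have "\<bar>cos a - cos b\<bar> = 2 * \<bar>sin ((a + b) / 2)\<bar> * \<bar>sin ((b - a) / 2)\<bar>" by (simp add: abs_mult)
  also have "\<dots> \<le> 2 * 1 * \<bar>(b - a) / 2\<bar>"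
    by (intro mult_mono abs_sin_x_le_abs_x) auto
  finally show ?thesis by simp
qed

lemma exp_ln_powers:
  assumes "(r::real) > 0"
  shows "r\<^sup>2 * exp (- (3/2) * ln r) = exp (ln r / 2)" "sqrt r = exp (ln r / 2)"
    "r * sqrt r * exp (- (3/2) * ln r) = 1" "exp (- 2 * ln r) = 1 / r\<^sup>2" "sqrt r * exp (- (3/2) * ln r) = 1 / r"
    "exp (- ln r) = 1 / r"
proof -
  have r: "r = exp (ln r)" using assms by simp
  have r2: "r\<^sup>2 = exp (2 * ln r)" using assms by (simp add: exp_double)
  show sq: "sqrt r = exp (ln r / 2)"
    by (rule real_sqrt_unique) (use assms in \<open>auto simp: exp_double[symmetric]\<close>)
  show "r\<^sup>2 * exp (- (3/2) * ln r) = exp (ln r / 2)" unfolding r2 by (simp flip: exp_add)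
  show i: "exp (- ln r) = 1 / r" using assms by (simp add: exp_minus divide_inverse)
  show "exp (- 2 * ln r) = 1 / r\<^sup>2" unfolding r2 by (simp add: exp_minus divide_inverse)
  have "r * sqrt r * exp (- (3/2) * ln r) = exp (ln r) * exp (ln r / 2) * exp (- (3/2) * ln r)"
    using assms by (simp add: sq)
  also have "\<dots> = 1" by (simp flip: exp_add)
  finally show "r * sqrt r * exp (- (3/2) * ln r) = 1" .
  then show "sqrt r * exp (- (3/2) * ln r) = 1 / r" using assms by (simp add: field_simps)
qed

section \<open>Bounds for the boundary integral\<close>

context wave
begin

definition growth_const where "growth_const = (SOME C. C > 0 \<and> (\<forall>x. norm x < - F / 4 \<longrightarrow> \<Psi> x \<le> C * (norm x * sqrt (norm x))))"

lemma growth_const: "growth_const > 0" "norm x < - F / 4 \<Longrightarrow> \<Psi> x \<le> growth_const * (norm x * sqrt (norm x))"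
proof -
  have "\<exists>C. C > 0 \<and> (\<forall>x. norm x < - F / 4 \<longrightarrow> \<Psi> x \<le> C * (norm x * sqrt (norm x)))" using growth by blast
  from someI_ex[OF this] show "growth_const > 0" "norm x < - F / 4 \<Longrightarrow> \<Psi> x \<le> growth_const * (norm x * sqrt (norm x))"
    unfolding growth_const_def by blast+
qed

text \<open>The boundary term of the weak formulation for Q = 0.\<close>

definition boundary_int :: "(real \<times> real \<Rightarrow> real) \<Rightarrow> real" where
  "boundary_int P = (LINT x:S|hausdorff1. sqrt (- 2 * g * snd x) * P x)"

lemma cball_half: "exp t < - F / 4 \<Longrightarrow> cball 0 (exp t) \<subseteq> half"
proof
  fix x :: "real \<times> real" assume "exp t < - F / 4" "x \<in> cball 0 (exp t)"
  moreover have "\<bar>snd x\<bar> \<le> norm x" using norm_snd_le[of "snd x" "fst x"] by simp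
  ultimately show "x \<in> half" by simp
qed

text \<open>The vorticity term is subcritical: r^(-3/2) is exp (t/2) / r^2, so per unit of t it is
  O(exp (tb/2)), as small as desired once tb is sufficiently negative.\<close>

lemma source_bound:
  assumes lb: "log_bump ta tb" and f: "\<And>s. \<bar>f s\<bar> \<le> 1" 
  shows "\<bar>LINT x:\<Omega>|lborel. \<gamma> (\<psi> x) * polar_lift (log_bump.crit_bump ta tb) (cut_angle f) x\<bar> \<le> pi * gamma_bound * exp (tb / 2) * (tb - ta)"
proof -
  interpret log_bump ta tb by fact
  have "\<bar>LINT x|lborel. indicator \<Omega> x *\<^sub>R (\<gamma> (\<psi> x) * polar_lift crit_bump (cut_angle f) x)\<bar> \<le> (gamma_bound * exp (tb / 2) * (tb - ta)) * pi + 0 * 0"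
  proof (rule half_plane_integral_bound(1)[where a="\<lambda>t. gamma_bound * exp (tb / 2) * indicator {ta..tb} t" and k="\<lambda>_. 1" and a'="\<lambda>_. 0" and k'="\<lambda>_. 0"])
    show "AE x in lborel. \<bar>indicat_real \<Omega> x *\<^sub>R (\<gamma> (\<psi> x) * polar_lift crit_bump (cut_angle f) x)\<bar> \<le>
       (if snd x < 0 then (gamma_bound * exp (tb / 2) * indicat_real {ta..tb} (ln (norm x)) * 1 + 0 * 0) / (norm x)\<^sup>2 else 0)"
    proof (intro AE_I2)
      fix x
      show "\<bar>indicat_real \<Omega> x *\<^sub>R (\<gamma> (\<psi> x) * polar_lift crit_bump (cut_angle f) x)\<bar> \<le>
       (if snd x < 0 then (gamma_bound * exp (tb / 2) * indicat_real {ta..tb} (ln (norm x)) * 1 + 0 * 0) / (norm x)\<^sup>2 else 0)"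
      proof (cases "x \<in> \<Omega>")
        case True
        then have s: "snd x < 0" by (rule \<Omega>_below)
        then have x0: "x \<noteq> 0" by auto
        then have n0: "norm x > 0" by simp
        have c: "cos (pol_angle x) \<ge> 0" using pol_angle_lower_bounds[OF s] by (intro cos_ge_zero) auto
        have "\<bar>polar_lift crit_bump (cut_angle f) x\<bar> \<le> exp (tb / 2) * indicator {ta..tb} (ln (norm x)) / (norm x)\<^sup>2"
        proof (cases "ln (norm x) \<in> {ta..tb}")
          case True
          have "\<bar>polar_lift crit_bump (cut_angle f) x\<bar> = exp (- (3/2) * ln (norm x)) * bump (ln (norm x)) * \<bar>f (pol_angle x)\<bar>"
            using x0 bump_range by (simp add: polar_lift_def crit_bump_def cut_angle_lower(1)[OF c] abs_mult)
          also have "\<dots> \<le> exp (- (3/2) * ln (norm x)) * 1 * 1"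
            using bump_range f by (intro mult_mono) auto
          also have "\<dots> = exp (ln (norm x) / 2) / (norm x)\<^sup>2"
            using exp_ln_powers(1)[OF n0] n0 by (simp add: field_simps)
          also have "\<dots> \<le> exp (tb / 2) / (norm x)\<^sup>2" using True by (intro divide_right_mono) auto
          finally show ?thesis using True by simp
        next
          case False
          then show ?thesis using bump_out[OF False] by (simp add: polar_lift_def crit_bump_def)
        qed
        moreover have "\<bar>\<gamma> (\<psi> x)\<bar> \<le> gamma_bound" using gamma_bound(2) \<psi>_nonneg[OF True] \<psi>_le[OF True] by auto
        ultimately have "\<bar>\<gamma> (\<psi> x)\<bar> * \<bar>polar_lift crit_bump (cut_angle f) x\<bar> \<le> gamma_bound * (exp (tb / 2) * indicator {ta..tb} (ln (norm x)) / (norm x)\<^sup>2)"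
          using gamma_bound(1) by (intro mult_mono) auto
        then show ?thesis using True s by (simp add: abs_mult mult_ac)
      qed (use gamma_bound(1) in simp)
    qed
    show "(\<integral>\<^sup>+t. ennreal (gamma_bound * exp (tb / 2) * indicat_real {ta..tb} t) \<partial>lborel) \<le> ennreal (gamma_bound * exp (tb / 2) * (tb - ta))"
    proof -
      have "(\<integral>\<^sup>+t. ennreal (gamma_bound * exp (tb / 2) * indicat_real {ta..tb} t) \<partial>lborel) = (\<integral>\<^sup>+t. ennreal (gamma_bound * exp (tb / 2)) * indicator {ta..tb} t \<partial>lborel)"
        by (intro nn_integral_cong) (auto simp: indicator_def)
      also have "\<dots> = ennreal (gamma_bound * exp (tb / 2)) * ennreal (tb - ta)"
        using len by (subst nn_integral_cmult_indicator) auto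
      finally show ?thesis using gamma_bound(1) len by (simp add: ennreal_mult)
    qed
    show "(\<integral>\<^sup>+s. ennreal 1 * indicator {- (pi/2)..pi/2} s \<partial>lborel) \<le> ennreal pi"
      by (subst nn_integral_cmult_indicator) auto
  qed (use gamma_bound(1) len in auto)
  then show ?thesis by (simp add: set_lebesgue_integral_def mult_ac)
qed

lemma boundary_int_lift:
  assumes lb: "log_bump ta tb" and tb: "exp tb < - F / 4"
    and f: "\<And>s. (f has_real_derivative f' s) (at s)" "continuous_on UNIV f'"
  shows "boundary_int (polar_lift (log_bump.crit_bump ta tb) (cut_angle f)) =
    (LINT x:\<Omega>|lborel. \<gamma> (\<psi> x) * polar_lift (log_bump.crit_bump ta tb) (cut_angle f) x)
    - (LINT x|lborel. grad \<Psi> x \<bullet> grad (polar_lift (log_bump.crit_bump ta tb) (cut_angle f)) x)"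
proof -
  interpret l: lift_C1 "log_bump.crit_bump ta tb" "cut_angle f" ta tb "log_bump.crit_bump1 ta tb" "cut_angle1 f f'"
    by (rule lift_C1_cut[OF lb f])
  show ?thesis unfolding boundary_int_def
    using weak_form(1)[OF l.lift_C1_compact_support[OF cball_half[OF tb]]] by simp
qed

text \<open>Since \<open>r\<close> to the power \<open>- 3/2\<close> times \<open>f\<close> is harmonic, the Laplacian of the test function only involves
  derivatives of \<open>bump\<close>; this is why the last term does not grow with \<open>tb - ta\<close>.\<close>

lemma boundary_int_le_of_mode:
  assumes lb: "log_bump ta tb" and tb: "exp tb < - F / 4"
    and f: "\<And>s. (f has_real_derivative f' s) (at s)" "\<And>s. (f' has_real_derivative - (9/4) * f s) (at s)" "\<And>s. \<bar>f s\<bar> \<le> 1"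
  shows "boundary_int (polar_lift (log_bump.crit_bump ta tb) (cut_angle f)) \<le> pi * gamma_bound * exp (tb / 2) * (tb - ta) + pi * (39 * growth_const)"
proof -
  interpret log_bump ta tb by fact
  define f'' where "f'' s = - (9/4) * f s" for s
  have cf: "continuous_on UNIV f" "continuous_on UNIV f'"
    using f(1,2) by (auto simp: continuous_on_eq_continuous_at intro: DERIV_isCont)
  have cf'': "continuous_on UNIV f''" unfolding f''_def by (intro continuous_intros cf)
  interpret l: lift_C2 crit_bump "cut_angle f" ta tb crit_bump1 "cut_angle1 f f'" crit_bump2 "cut_angle2 f f' f''"
    by (rule lift_C2_cut[OF lb f(1) _ cf'']) (unfold f''_def, rule f(2))
  obtain K where K: "K-lipschitz_on UNIV \<Psi>" using \<Psi>_lipschitz by blast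
  \<comment> \<open>\<open>R\<close> is \<Psi> times the Laplacian of the test function.\<close>
  define R where "R x = \<Psi> x * (polar_lift (\<lambda>t. exp (-2*t) * crit_bump2 t) (cut_angle f) x + polar_lift (\<lambda>t. exp (-2*t) * crit_bump t) (cut_angle2 f f' f'') x)" for x
  have "\<bar>LINT x|lborel. R x\<bar> \<le> (39 * growth_const) * pi + 0 * 0"
  proof (rule half_plane_integral_bound(1)[where a="\<lambda>t. growth_const * (39 / \<Lambda>) * indicator {ta..tb} t" and k="\<lambda>_. 1" and a'="\<lambda>_. 0" and k'="\<lambda>_. 0"])
    show "AE x in lborel. \<bar>R x\<bar> \<le> (if snd x < 0 then (growth_const * (39 / \<Lambda>) * indicat_real {ta..tb} (ln (norm x)) * 1 + 0 * 0) / (norm x)\<^sup>2 else 0)"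
    proof (intro AE_I2)
      fix x
      show "\<bar>R x\<bar> \<le> (if snd x < 0 then (growth_const * (39 / \<Lambda>) * indicat_real {ta..tb} (ln (norm x)) * 1 + 0 * 0) / (norm x)\<^sup>2 else 0)"
      proof (cases "snd x < 0")
        case s: True
        then have x0: "x \<noteq> 0" by auto
        then have n0: "norm x > 0" by simp
        have c: "cos (pol_angle x) \<ge> 0" using pol_angle_lower_bounds[OF s] by (intro cos_ge_zero) auto
        define t where "t = ln (norm x)"
        have "polar_lift (\<lambda>t. exp (-2*t) * crit_bump2 t) (cut_angle f) x + polar_lift (\<lambda>t. exp (-2*t) * crit_bump t) (cut_angle2 f f' f'') x
          = exp (-2*t) * (crit_bump2 t - 9/4 * crit_bump t) * f (pol_angle x)"
          using x0 by (simp add: polar_lift_def cut_angle_lower[OF c] f''_def t_def algebra_simps)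
        also have "crit_bump2 t - 9/4 * crit_bump t = exp (- (3/2) * t) * (bump2 t - 3 * bump1 t)"
          by (simp add: crit_bump_def crit_bump2_def algebra_simps)
        finally have R: "R x = \<Psi> x * (exp (-2*t) * (exp (- (3/2) * t) * (bump2 t - 3 * bump1 t)) * f (pol_angle x))"
          by (simp add: R_def)
        show ?thesis
        proof (cases "t \<in> {ta..tb}")
          case True
          have "norm x = exp t" using n0 by (simp add: t_def)
          also have "\<dots> \<le> exp tb" using True by simp
          finally have P: "\<Psi> x \<le> growth_const * (norm x * sqrt (norm x))" using growth_const(2)[of x] tb by linarith
          \<comment> \<open>39 = 30 + 3 * 3, from the bounds on the two derivatives.\<close>
          have h: "\<bar>bump2 t - 3 * bump1 t\<bar> \<le> 39 / \<Lambda>"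
            using bump_deriv_bounds[of t] by (simp add: abs_le_iff)
          have "\<bar>R x\<bar> = \<Psi> x * (exp (-2*t) * (exp (- (3/2) * t) * \<bar>bump2 t - 3 * bump1 t\<bar>) * \<bar>f (pol_angle x)\<bar>)"
            unfolding R using \<Psi>_nonneg by (simp add: abs_mult)
          \<comment> \<open>The growth r^(3/2) of \<Psi> cancels the weight exp (- 3/2 t); the
            factor exp (-2 t) is 1 / r^2.\<close>
          also have "\<dots> \<le> (growth_const * (norm x * sqrt (norm x))) * (exp (-2*t) * (exp (- (3/2) * t) * (39 / \<Lambda>)) * 1)"
            using h f(3) P \<Lambda>1 growth_const(1) by (intro mult_mono mult_nonneg_nonneg) auto
          also have "\<dots> = growth_const * (39 / \<Lambda>) * (norm x * sqrt (norm x) * exp (- (3/2) * t)) * exp (-2*t)"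
            by (simp add: mult_ac)
          also have "\<dots> = growth_const * (39 / \<Lambda>) / (norm x)\<^sup>2"
            unfolding t_def exp_ln_powers(3,4)[OF n0] by simp
          finally show ?thesis using True s by (simp add: t_def)
        next
          case False
          then show ?thesis unfolding R using bump_out[OF False] growth_const(1) \<Lambda>1 s by (simp add: t_def)
        qed
      qed (use \<Psi>_zero_above in \<open>simp add: R_def\<close>)
    qed
    show "(\<integral>\<^sup>+t. ennreal (growth_const * (39 / \<Lambda>) * indicat_real {ta..tb} t) \<partial>lborel) \<le> ennreal (39 * growth_const)"
    proof -
      have "(\<integral>\<^sup>+t. ennreal (growth_const * (39 / \<Lambda>) * indicat_real {ta..tb} t) \<partial>lborel) = (\<integral>\<^sup>+t. ennreal (growth_const * (39 / \<Lambda>)) * indicator {ta..tb} t \<partial>lborel)"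
        by (intro nn_integral_cong) (auto simp: indicator_def)
      also have "\<dots> = ennreal (growth_const * (39 / \<Lambda>)) * ennreal \<Lambda>"
        using len by (subst nn_integral_cmult_indicator) (auto simp: \<Lambda>_def)
      also have "\<dots> = ennreal (growth_const * (39 / \<Lambda>) * \<Lambda>)" using growth_const(1) \<Lambda>1 by (intro ennreal_mult[symmetric]) auto
      also have "growth_const * (39 / \<Lambda>) * \<Lambda> = 39 * growth_const" using \<Lambda>1 by simp
      finally show ?thesis by simp
    qed
    show "(\<integral>\<^sup>+s. ennreal 1 * indicator {- (pi/2)..pi/2} s \<partial>lborel) \<le> ennreal pi"
      by (subst nn_integral_cmult_indicator) auto
  qed (use growth_const(1) \<Lambda>1 in auto)
  moreover have "(LINT x|lborel. grad \<Psi> x \<bullet> grad (polar_lift crit_bump (cut_angle f)) x) = - (LINT x|lborel. R x)"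
    unfolding R_def by (rule l.integral_grad_lift[OF K])
  ultimately show ?thesis
    using boundary_int_lift[OF lb tb f(1) cf(2)] source_bound[of ta tb f, OF lb f(3)] by (simp add: abs_le_iff mult_ac)
qed

text \<open>The cut-off \<open>\<phi>\<close> rises from 0 to 1 across a thin sector just below the ray, so that the gradient
  bound given by \<open>T[\<psi>] \<le> 0\<close> controls the boundary integral near the ray with the sharp constant.\<close>

lemma boundary_int_le_of_sector:
  assumes lb: "log_bump ta tb" and tb: "exp tb < - F / 4" "exp tb \<le> 1"
    and \<tau>: "\<tau> = 1 \<or> \<tau> = - 1" and \<theta>: "\<theta> \<ge> 0" and \<delta>: "\<delta> > 0"
    and near: "\<And>x. x \<in> \<Omega> \<Longrightarrow> norm x \<le> exp tb \<Longrightarrow> \<tau> * pol_angle x \<le> \<theta> + \<delta>"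
  shows "boundary_int (polar_lift (log_bump.crit_bump ta tb) (cut_angle (\<lambda>s. smooth_step ((\<tau> * s - (\<theta> - 2 * \<delta>)) / \<delta>)))) \<le>
    pi * gamma_bound * exp (tb / 2) * (tb - ta) + 15 * sqrt (2 * g + 2 * grad_const * growth_const) * \<delta> * (tb - ta)
    + sqrt (2 * g * (max 0 (cos \<theta>) + 2 * \<delta>) + 2 * grad_const * growth_const * exp (tb / 2)) * ((tb - ta) / 140)"
proof -
  interpret log_bump ta tb by fact
  define \<beta> where "\<beta> = \<theta> - 2 * \<delta>"
  define f where "f s = smooth_step ((\<tau> * s - \<beta>) / \<delta>)" for s
  define f' where "f' s = smooth_step1 ((\<tau> * s - \<beta>) / \<delta>) * (\<tau> / \<delta>)" for s
  have Df: "(f has_real_derivative f' s) (at s)" for s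
    unfolding f_def[abs_def] f'_def
    by (rule DERIV_chain2[OF DERIV_smooth_step]) (use \<delta> in \<open>auto intro!: derivative_eq_intros\<close>)
  have cf': "continuous_on UNIV f'" unfolding f'_def[abs_def] using \<delta> by (intro continuous_intros) auto
  have f01: "\<bar>f s\<bar> \<le> 1" "f s \<ge> 0" for s using smooth_step_range by (auto simp: f_def)
  interpret l: lift_C1 crit_bump "cut_angle f" ta tb crit_bump1 "cut_angle1 f f'"
    by (rule lift_C1_cut[OF lb Df cf'])
  define M2 where "M2 = sqrt (2 * g + 2 * grad_const * growth_const)"
  define Mc where "Mc = sqrt (2 * g * (max 0 (cos \<theta>) + 2 * \<delta>) + 2 * grad_const * growth_const * exp (tb / 2))"
  have M0: "M2 \<ge> 0" "Mc \<ge> 0" using g0 grad_const0 growth_const(1) \<delta> by (auto simp: M2_def Mc_def)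
  have "\<bar>LINT x|lborel. grad \<Psi> x \<bullet> grad (polar_lift crit_bump (cut_angle f)) x\<bar> \<le> (5 * M2 * \<Lambda>) * (3 * \<delta>) + (Mc * (\<Lambda> / 140)) * 1"
  \<comment> \<open>The first product bounds the radial derivative, which is nonzero only on angles
    of total length 3 \<delta>; the second bounds the angular derivative, whose profile has integral
    at most 1 over the angles.\<close>
  proof (rule half_plane_integral_bound(1)[where a="\<lambda>t. 5 * M2 * indicator {ta..tb} t" and k="\<lambda>s. indicator {\<theta> - 2 * \<delta>..\<theta> + \<delta>} (\<tau> * s)"
        and a'="\<lambda>t. Mc * bump t" and k'="\<lambda>s. smooth_step1 ((\<tau> * s - \<beta>) / \<delta>) / \<delta>"])
    show "AE x in lborel. \<bar>grad \<Psi> x \<bullet> grad (polar_lift crit_bump (cut_angle f)) x\<bar> \<le>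
      (if snd x < 0 then (5 * M2 * indicat_real {ta..tb} (ln (norm x)) * indicat_real {\<theta> - 2 * \<delta>..\<theta> + \<delta>} (\<tau> * pol_angle x)
         + Mc * bump (ln (norm x)) * (smooth_step1 ((\<tau> * pol_angle x - \<beta>) / \<delta>) / \<delta>)) / (norm x)\<^sup>2 else 0)"
      using AE_grad_\<Psi>_sq AE_grad_\<Psi>_out
    proof eventually_elim
      case (elim x)
      define t s where "t = ln (norm x)" and "s = pol_angle x"
      define RHS where "RHS = 5 * M2 * indicat_real {ta..tb} t * indicat_real {\<theta> - 2 * \<delta>..\<theta> + \<delta>} (\<tau> * s) + Mc * bump t * (smooth_step1 ((\<tau> * s - \<beta>) / \<delta>) / \<delta>)"
      have RHS0: "RHS \<ge> 0" unfolding RHS_def using M0 bump_range smooth_step1_nonneg \<delta> by auto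
      show ?case
      proof (cases "x \<in> \<Omega> \<and> t \<in> {ta..tb}")
        case False
        have "grad \<Psi> x \<bullet> grad (polar_lift crit_bump (cut_angle f)) x = 0"
        proof (cases "x \<in> \<Omega>")
          case True
          then have "t \<notin> {ta..tb}" using False by blast
          then have "bump t = 0" "bump1 t = 0" using bump_out by auto
          then have "crit_bump t = 0" "crit_bump1 t = 0" by (auto simp: crit_bump_def crit_bump1_def)
          then show ?thesis by (simp add: l.grad_lift l.gX_def l.gY_def polar_lift_def t_def zero_prod_def[symmetric])
        next
          case False
          show ?thesis
          proof (cases "snd x > F/2")
            case True then show ?thesis using elim(2) False by simp
          next
            case f: False
            have "x \<notin> cball 0 (exp tb)" using cball_half[OF tb(1)] f by blast
            then show ?thesis using l.grad_support[of x] by force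
          qed
        qed
        then show ?thesis using RHS0 by (simp add: RHS_def t_def s_def)
      next
        case True
        then have x: "x \<in> \<Omega>" and t: "t \<in> {ta..tb}" by auto
        have sx: "snd x < 0" by (rule \<Omega>_below[OF x])
        then have x0: "x \<noteq> 0" by auto
        then have n0: "norm x > 0" by simp
        have nt: "norm x = exp t" using n0 by (simp add: t_def)
        have nx: "norm x \<le> exp tb" using t nt by simp
        have c: "cos s \<ge> 0" using pol_angle_lower_bounds[OF sx] unfolding s_def by (intro cos_ge_zero) auto
        have half: "snd x > F/2" using cball_half[OF tb(1)] nx by auto
        define sr where "sr = sqrt (norm x)"
        have sr: "sr > 0" "sr \<le> exp (tb / 2)" "sr \<le> 1" "norm x = sr * sr"
        proof -
          show "sr > 0" using n0 by (simp add: sr_def)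
          show "norm x = sr * sr" using n0 by (simp add: sr_def)
          show "sr \<le> exp (tb / 2)" unfolding sr_def exp_ln_powers(2)[OF n0] using t by (simp add: t_def)
          then show "sr \<le> 1" using tb(2) by (simp add: order_trans)
        qed
        \<comment> \<open>|\<nabla>\<Psi>| \<le> sqrt r * \<open>q\<close>, and \<open>q\<close>
          tends to sqrt (2 g cos s) as r tends to 0: the value prescribed on a free surface at angle
          s.\<close>
        define q where "q = sqrt (2 * g * cos s + 2 * grad_const * growth_const * sr)"
        have q0: "q \<ge> 0" using g0 grad_const0 growth_const(1) c sr by (simp add: q_def)
        have G: "norm (grad \<Psi> x) \<le> sr * q"
        proof -
          have "(norm (grad \<Psi> x))\<^sup>2 \<le> 2 * g * max 0 (- snd x) + 2 * grad_const * \<Psi> x" using elim(1) half by blast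
          also have "\<dots> \<le> 2 * g * (norm x * cos s) + 2 * grad_const * (growth_const * (norm x * sr))"
          proof (intro add_mono mult_left_mono)
            show "max 0 (- snd x) \<le> norm x * cos s" using snd_polar[OF x0] sx by (simp add: s_def)
            show "\<Psi> x \<le> growth_const * (norm x * sr)" unfolding sr_def using growth_const(2)[of x] nx tb(1) by simp
          qed (use g0 grad_const0 in auto)
          also have "\<dots> = sr\<^sup>2 * (2 * g * cos s + 2 * grad_const * growth_const * sr)" unfolding sr(4) by (simp add: power2_eq_square algebra_simps)
          finally have "norm (grad \<Psi> x) \<le> sqrt (sr\<^sup>2 * (2 * g * cos s + 2 * grad_const * growth_const * sr))" by (rule real_le_rsqrt)
          then show ?thesis using sr(1) by (simp add: real_sqrt_mult q_def)
        qed
        have qM2: "q \<le> M2" unfolding q_def M2_def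
          using g0 grad_const0 growth_const(1) sr cos_le_one[of s] by (intro real_sqrt_le_mono add_mono) (auto intro!: mult_left_le)
        have gl: "norm (grad (polar_lift crit_bump (cut_angle f)) x) \<le> (\<bar>crit_bump1 t\<bar> * \<bar>f s\<bar> + \<bar>crit_bump t\<bar> * \<bar>f' s\<bar>) / norm x"
        proof -
          have "grad (polar_lift crit_bump (cut_angle f)) x = (1 / norm x) *\<^sub>R ((crit_bump1 t * f s) *\<^sub>R (sin s, - cos s) + (crit_bump t * f' s) *\<^sub>R (cos s, sin s))"
            using x0 exp_ln_powers(6)[OF n0]
            unfolding l.grad_lift l.gX_def l.gY_def polar_lift_def t_def[symmetric] s_def[symmetric]
            by (simp add: cut_angle_lower[OF c] add_divide_distrib diff_divide_distrib)
          then have "norm (grad (polar_lift crit_bump (cut_angle f)) x) = (1 / norm x) * norm ((crit_bump1 t * f s) *\<^sub>R (sin s, - cos s) + (crit_bump t * f' s) *\<^sub>R (cos s, sin s))"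
            by (simp only: norm_scaleR) simp
          also have "\<dots> \<le> (1 / norm x) * (\<bar>crit_bump1 t * f s\<bar> * 1 + \<bar>crit_bump t * f' s\<bar> * 1)"
          proof (rule mult_left_mono)
            have u: "norm (sin s, - cos s) = 1" "norm (cos s, sin s) = 1" by (simp_all add: norm_Pair)
            show "norm ((crit_bump1 t * f s) *\<^sub>R (sin s, - cos s) + (crit_bump t * f' s) *\<^sub>R (cos s, sin s)) \<le> \<bar>crit_bump1 t * f s\<bar> * 1 + \<bar>crit_bump t * f' s\<bar> * 1"
              by (rule order_trans[OF norm_triangle_ineq]) (simp only: norm_scaleR u order_refl)
          qed simp
          finally show ?thesis by (simp add: abs_mult)
        qed
        define E where "E = exp (- (3/2) * t)"
        \<comment> \<open>5 rounds up 3 / \<Lambda> + 3/2, given \<Lambda> \<ge> 1.\<close>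
        have A1: "\<bar>crit_bump1 t\<bar> \<le> E * 5"
        proof -
          have "\<bar>bump1 t - 3/2 * bump t\<bar> \<le> 3 / \<Lambda> + 3/2" using bump_deriv_bounds(1)[of t] bump_range[of t] by (simp add: abs_le_iff)
          also have "3 / \<Lambda> \<le> 3" using \<Lambda>1 by (simp add: field_simps)
          finally have "\<bar>bump1 t - 3/2 * bump t\<bar> \<le> 5" by simp
          then show ?thesis by (simp add: crit_bump1_def abs_mult E_def)
        qed
        have A0: "\<bar>crit_bump t\<bar> = E * bump t" using bump_range by (simp add: crit_bump_def E_def)
        have srE: "sr * E / norm x = 1 / (norm x)\<^sup>2"
          using exp_ln_powers(5)[OF n0] by (simp add: sr_def E_def t_def power2_eq_square)
        \<comment> \<open>Below the sector \<open>f\<close> vanishes, and above it there is no fluid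
          by \<open>near\<close>.\<close>
        have k1: "q * \<bar>f s\<bar> \<le> M2 * indicat_real {\<theta> - 2 * \<delta>..\<theta> + \<delta>} (\<tau> * s)"
        proof (cases "\<tau> * s < \<theta> - 2 * \<delta>")
          case True
          then have "f s = 0" using smooth_step_le0[of "(\<tau> * s - \<beta>) / \<delta>"] \<delta> by (simp add: f_def \<beta>_def divide_nonpos_pos)
          then show ?thesis using M0 by simp
        next
          case False
          then have "\<tau> * s \<in> {\<theta> - 2 * \<delta>..\<theta> + \<delta>}" using near[OF x nx] by (simp add: s_def)
          moreover have "q * \<bar>f s\<bar> \<le> M2 * 1" using qM2 f01 q0 M0 by (intro mult_mono) auto
          ultimately show ?thesis by simp
        qed
        \<comment> \<open>\<open>f'\<close> lives on \<theta> - 2 \<delta> < \<tau> s < \<theta> -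
          \<delta>, where cos s \<le> cos \<theta> + 2 \<delta>; this is what makes the constant
          sharp as \<delta> tends to 0.\<close>
        have k2: "q * \<bar>f' s\<bar> \<le> Mc * (smooth_step1 ((\<tau> * s - \<beta>) / \<delta>) / \<delta>)"
        proof -
          have af': "\<bar>f' s\<bar> = smooth_step1 ((\<tau> * s - \<beta>) / \<delta>) / \<delta>"
            using \<tau> \<delta> smooth_step1_nonneg by (auto simp: f'_def abs_mult)
          show ?thesis
          proof (cases "0 < (\<tau> * s - \<beta>) / \<delta> \<and> (\<tau> * s - \<beta>) / \<delta> < 1")
            case True
            then have b: "\<theta> - 2 * \<delta> < \<tau> * s" "\<tau> * s < \<theta> - \<delta>" using \<delta> by (auto simp: \<beta>_def field_simps)
            have "cos s = cos (\<tau> * s)" using \<tau> by auto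
            also have "\<dots> \<le> cos \<theta> + 2 * \<delta>" using abs_cos_diff_le[of "\<tau> * s" \<theta>] b by linarith
            finally have "q \<le> Mc" unfolding q_def Mc_def
              using g0 grad_const0 growth_const(1) sr by (intro real_sqrt_le_mono add_mono mult_left_mono) auto
            then show ?thesis unfolding af' using smooth_step1_nonneg \<delta> by (intro mult_right_mono) auto
          next
            case False
            then have "smooth_step1 ((\<tau> * s - \<beta>) / \<delta>) = 0"
              using smooth_step_le0[of "(\<tau> * s - \<beta>) / \<delta>"] smooth_step_ge1[of "(\<tau> * s - \<beta>) / \<delta>"] by linarith
            then show ?thesis unfolding af' by simp
          qed
        qed
        have "\<bar>grad \<Psi> x \<bullet> grad (polar_lift crit_bump (cut_angle f)) x\<bar> \<le> (sr * q) * ((\<bar>crit_bump1 t\<bar> * \<bar>f s\<bar> + \<bar>crit_bump t\<bar> * \<bar>f' s\<bar>) / norm x)"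
          using G gl by (intro order_trans[OF Cauchy_Schwarz_ineq2] mult_mono) (use sr q0 in auto)
        also have "\<dots> \<le> (sr * q) * ((E * 5 * \<bar>f s\<bar> + E * bump t * \<bar>f' s\<bar>) / norm x)"
          using A1 A0 sr q0 by (intro mult_left_mono divide_right_mono add_mono mult_right_mono) auto
        also have "\<dots> = (5 * (q * \<bar>f s\<bar>) + bump t * (q * \<bar>f' s\<bar>)) * (sr * E / norm x)"
          by (simp add: add_divide_distrib algebra_simps)
        also have "\<dots> = (5 * (q * \<bar>f s\<bar>) + bump t * (q * \<bar>f' s\<bar>)) / (norm x)\<^sup>2" unfolding srE by simp
        also have "\<dots> \<le> RHS / (norm x)\<^sup>2"
        proof (rule divide_right_mono)
          have "5 * (q * \<bar>f s\<bar>) \<le> 5 * (M2 * indicat_real {\<theta> - 2 * \<delta>..\<theta> + \<delta>} (\<tau> * s))" using k1 by simp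
          moreover have "bump t * (q * \<bar>f' s\<bar>) \<le> bump t * (Mc * (smooth_step1 ((\<tau> * s - \<beta>) / \<delta>) / \<delta>))" using k2 bump_range by (intro mult_left_mono) auto
          ultimately show "5 * (q * \<bar>f s\<bar>) + bump t * (q * \<bar>f' s\<bar>) \<le> RHS" unfolding RHS_def using t by (simp add: mult_ac)
        qed simp
        finally show ?thesis using sx by (simp add: RHS_def t_def s_def)
      qed
    qed
    show "(\<integral>\<^sup>+t. ennreal (5 * M2 * indicat_real {ta..tb} t) \<partial>lborel) \<le> ennreal (5 * M2 * \<Lambda>)"
    proof -
      have "(\<integral>\<^sup>+t. ennreal (5 * M2 * indicat_real {ta..tb} t) \<partial>lborel) = (\<integral>\<^sup>+t. ennreal (5 * M2) * indicator {ta..tb} t \<partial>lborel)"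
        by (intro nn_integral_cong) (auto simp: indicator_def)
      also have "\<dots> = ennreal (5 * M2) * ennreal \<Lambda>"
        using len by (subst nn_integral_cmult_indicator) (auto simp: \<Lambda>_def)
      also have "\<dots> = ennreal (5 * M2 * \<Lambda>)" using M0 \<Lambda>1 by (intro ennreal_mult[symmetric]) auto
      finally show ?thesis by simp
    qed
    show "(\<integral>\<^sup>+s. ennreal (indicat_real {\<theta> - 2 * \<delta>..\<theta> + \<delta>} (\<tau> * s)) * indicator {- (pi/2)..pi/2} s \<partial>lborel) \<le> ennreal (3 * \<delta>)"
    proof -
      define I where "I = (if \<tau> = 1 then {\<theta> - 2 * \<delta>..\<theta> + \<delta>} else {- (\<theta> + \<delta>)..- (\<theta> - 2 * \<delta>)})"
      have "(\<integral>\<^sup>+s. ennreal (indicat_real {\<theta> - 2 * \<delta>..\<theta> + \<delta>} (\<tau> * s)) * indicator {- (pi/2)..pi/2} s \<partial>lborel) \<le> (\<integral>\<^sup>+s. indicator I s \<partial>lborel)"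
        using \<tau> by (intro nn_integral_mono) (auto simp: indicator_def I_def)
      also have "\<dots> = ennreal (3 * \<delta>)" using \<delta> by (auto simp: I_def)
      finally show ?thesis .
    qed
    show "(\<integral>\<^sup>+t. ennreal (Mc * bump t) \<partial>lborel) \<le> ennreal (Mc * (\<Lambda> / 140))"
    proof -
      have [measurable]: "bump \<in> borel_measurable borel" by (intro borel_measurable_continuous_onI continuous_intros)
      have "(\<integral>\<^sup>+t. ennreal (Mc * bump t) \<partial>lborel) = (\<integral>\<^sup>+t. ennreal Mc * ennreal (bump t) \<partial>lborel)"
        using M0 bump_range by (intro nn_integral_cong) (simp add: ennreal_mult)
      also have "\<dots> = ennreal Mc * ennreal (\<Lambda> / 140)" by (subst nn_integral_cmult) (auto simp: nn_integral_bump)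
      also have "\<dots> = ennreal (Mc * (\<Lambda> / 140))" using M0 \<Lambda>1 by (intro ennreal_mult[symmetric]) auto
      finally show ?thesis by simp
    qed
    show "(\<integral>\<^sup>+s. ennreal (smooth_step1 ((\<tau> * s - \<beta>) / \<delta>) / \<delta>) * indicator {- (pi/2)..pi/2} s \<partial>lborel) \<le> ennreal 1"
    proof -
      have [measurable]: "smooth_step1 \<in> borel_measurable borel" by (intro borel_measurable_continuous_onI continuous_intros)
      have "(\<integral>\<^sup>+s. ennreal (smooth_step1 ((\<tau> * s - \<beta>) / \<delta>) / \<delta>) * indicator {- (pi/2)..pi/2} s \<partial>lborel)
        \<le> (\<integral>\<^sup>+s. ennreal (1 / \<delta>) * (ennreal (smooth_step1 (- \<beta> / \<delta> + (\<tau> / \<delta>) * s)) * indicator {0..1} (- \<beta> / \<delta> + (\<tau> / \<delta>) * s)) \<partial>lborel)"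
      proof (intro nn_integral_mono)
        fix s
        have e: "(\<tau> * s - \<beta>) / \<delta> = - \<beta> / \<delta> + (\<tau> / \<delta>) * s" by (simp add: diff_divide_distrib)
        have "ennreal (smooth_step1 ((\<tau> * s - \<beta>) / \<delta>) / \<delta>) = ennreal (1 / \<delta>) * ennreal (smooth_step1 (- \<beta> / \<delta> + (\<tau> / \<delta>) * s))"
          unfolding e using \<delta> smooth_step1_nonneg by (simp flip: ennreal_mult)
        moreover have "smooth_step1 (- \<beta> / \<delta> + (\<tau> / \<delta>) * s) = 0" if "- \<beta> / \<delta> + (\<tau> / \<delta>) * s \<notin> {0..1}"
          using smooth_step_le0[of "- \<beta> / \<delta> + (\<tau> / \<delta>) * s"] smooth_step_ge1[of "- \<beta> / \<delta> + (\<tau> / \<delta>) * s"] that by force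
        ultimately show "ennreal (smooth_step1 ((\<tau> * s - \<beta>) / \<delta>) / \<delta>) * indicator {- (pi/2)..pi/2} s \<le>
          ennreal (1 / \<delta>) * (ennreal (smooth_step1 (- \<beta> / \<delta> + (\<tau> / \<delta>) * s)) * indicator {0..1} (- \<beta> / \<delta> + (\<tau> / \<delta>) * s))"
          by (cases "- \<beta> / \<delta> + (\<tau> / \<delta>) * s \<in> {0..1}") (auto simp: indicator_def)
      qed
      also have "\<dots> = ennreal \<bar>\<tau> / \<delta>\<bar> * (\<integral>\<^sup>+s. ennreal (smooth_step1 (- \<beta> / \<delta> + (\<tau> / \<delta>) * s)) * indicator {0..1} (- \<beta> / \<delta> + (\<tau> / \<delta>) * s) \<partial>lborel)"
        using \<tau> \<delta> by (subst nn_integral_cmult) auto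
      also have "\<dots> = (\<integral>\<^sup>+y. ennreal (smooth_step1 y) * indicator {0..1} y \<partial>lborel)"
        using \<tau> \<delta> by (intro nn_integral_real_affine[symmetric]) auto
      also have "\<dots> = 1" by (rule nn_integral_smooth_step1)
      finally show ?thesis by simp
    qed
    have m: "bump \<in> borel_measurable borel" "smooth_step1 \<in> borel_measurable borel"
      by (intro borel_measurable_continuous_onI continuous_intros)+
    note [measurable] = m
    show "(\<lambda>t. 5 * M2 * indicat_real {ta..tb} t) \<in> borel_measurable borel"
      "(\<lambda>s. indicat_real {\<theta> - 2 * \<delta>..\<theta> + \<delta>} (\<tau> * s)) \<in> borel_measurable borel"
      "(\<lambda>t. Mc * bump t) \<in> borel_measurable borel" "(\<lambda>s. smooth_step1 ((\<tau> * s - \<beta>) / \<delta>) / \<delta>) \<in> borel_measurable borel"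
      by measurable
  qed (use M0 \<Lambda>1 \<delta> bump_range smooth_step1_nonneg in auto)
  then have "- (LINT x|lborel. grad \<Psi> x \<bullet> grad (polar_lift crit_bump (cut_angle f)) x) \<le> 15 * M2 * \<delta> * \<Lambda> + Mc * (\<Lambda> / 140)"
    by (simp add: abs_le_iff mult_ac)
  moreover have "f = (\<lambda>s. smooth_step ((\<tau> * s - (\<theta> - 2 * \<delta>)) / \<delta>))" by (simp add: f_def[abs_def] \<beta>_def)
  ultimately show ?thesis
    using boundary_int_lift[OF lb tb(1) Df cf'] source_bound[of ta tb f, OF lb f01(1)] unfolding M2_def Mc_def \<Lambda>_def
    by (simp add: abs_le_iff)
qed

text \<open>Comparison and additivity need genuine integrals: a non-integrable function would have
  integral 0 by default. Continuity, bounded support and finite length of S there suffice.\<close>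

lemma boundary_int_integrable:
  assumes P: "continuous_on UNIV P" "\<And>x. P x \<noteq> 0 \<Longrightarrow> norm x \<le> \<rho>" and fin: "hausdorff1_outer (S \<inter> cball 0 \<rho>) < \<infinity>"
  shows "integrable hausdorff1 (\<lambda>x. indicator S x *\<^sub>R (sqrt (- 2 * g * snd x) * P x))"
proof -
  define k where "k x = sqrt (- 2 * g * snd x) * P x" for x
  have ck: "continuous_on UNIV k" unfolding k_def by (intro continuous_intros P)
  have "bounded (k ` cball 0 \<rho>)"
    by (intro compact_imp_bounded compact_continuous_image continuous_on_subset[OF ck]) auto
  then obtain B where B: "\<And>x. x \<in> cball 0 \<rho> \<Longrightarrow> \<bar>k x\<bar> \<le> B" unfolding bounded_iff real_norm_def by blast
  have [measurable]: "k \<in> borel_measurable (hausdorff1 :: (real\<times>real) measure)"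
    using borel_measurable_continuous_onI[OF ck] by (simp cong: measurable_cong_sets)
  have [measurable]: "S \<in> sets hausdorff1" by simp
  have SC: "S \<inter> cball 0 \<rho> \<in> sets borel" by auto
  have "integrable hausdorff1 (\<lambda>x. B * indicat_real (S \<inter> cball 0 \<rho>) x)"
    using fin emeasure_hausdorff1[OF SC] SC by auto
  then have "integrable hausdorff1 (\<lambda>x. indicator S x *\<^sub>R k x)"
  proof (rule Bochner_Integration.integrable_bound)
    show "AE x in hausdorff1. norm (indicat_real S x *\<^sub>R k x) \<le> norm (B * indicat_real (S \<inter> cball 0 \<rho>) x)"
    proof (intro AE_I2)
      fix x
      show "norm (indicat_real S x *\<^sub>R k x) \<le> norm (B * indicat_real (S \<inter> cball 0 \<rho>) x)"
        using B[of x] P(2)[of x] by (cases "P x = 0") (auto simp: indicator_def k_def)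
    qed
  qed measurable
  then show ?thesis unfolding k_def .
qed

text \<open>On T the weight sqrt (- 2 g Y) is at least sqrt (2 g c r); against r^(-3/2) dr this is a
  multiple of dt, and the bump has integral \<Lambda> / 140. Radial projection gives dr as a lower
  bound for arc length, so the direction of the curve plays no part.\<close>

lemma boundary_int_lower:
  assumes lb: "log_bump ta tb" and T: "T \<in> sets borel" "T \<subseteq> S" "{exp ta..exp tb} \<subseteq> norm ` T"
    and c: "c \<ge> 0" "\<And>x. x \<in> T \<Longrightarrow> c * norm x \<le> - snd x" and \<kappa>: "\<kappa> \<ge> 0"
    and P: "\<And>x. x \<in> S \<Longrightarrow> P x \<ge> 0" "\<And>x. x \<in> T \<Longrightarrow> x \<noteq> 0 \<Longrightarrow> P x \<ge> \<kappa> * log_bump.crit_bump ta tb (ln (norm x))"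
    and int: "integrable hausdorff1 (\<lambda>x. indicator S x *\<^sub>R (sqrt (- 2 * g * snd x) * P x))"
  shows "\<kappa> * sqrt (2 * g * c) * ((tb - ta) / 140) \<le> boundary_int P"
proof -
  interpret log_bump ta tb by fact
  define D where "D = \<kappa> * sqrt (2 * g * c)"
  have D0: "D \<ge> 0" using \<kappa> c(1) g0 by (simp add: D_def)
  define \<rho> where "\<rho> r = (if r > 0 then ennreal (D * bump (ln r) / r) else 0)" for r
  have [measurable]: "bump \<in> borel_measurable borel" by (intro borel_measurable_continuous_onI continuous_intros)
  have [measurable]: "\<rho> \<in> borel_measurable borel" unfolding \<rho>_def by measurable
  have nn: "0 \<le> indicator S x *\<^sub>R (sqrt (- 2 * g * snd x) * P x)" for x
  proof (cases "x \<in> S")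
    case True
    then have "- 2 * g * snd x \<ge> 0" using S_nonpos[OF True] g0 by (simp add: mult_nonneg_nonpos)
    then show ?thesis using True P(1)[OF True] by simp
  qed simp
  have "ennreal (D * (\<Lambda> / 140)) = (\<integral>\<^sup>+t. ennreal D * ennreal (bump t) \<partial>lborel)"
    using D0 \<Lambda>1 by (subst nn_integral_cmult) (auto simp: nn_integral_bump ennreal_mult[symmetric])
  also have "\<dots> = (\<integral>\<^sup>+t. \<rho> (exp t) * ennreal (exp t) * indicator {ta..tb} t \<partial>lborel)"
  proof (intro nn_integral_cong)
    fix t
    have "\<rho> (exp t) * ennreal (exp t) = ennreal (D * bump t / exp t * exp t)"
      unfolding \<rho>_def using D0 bump_range by (simp add: ennreal_mult[symmetric] del: ennreal_mult)
    also have "\<dots> = ennreal D * ennreal (bump t)" using D0 bump_range by (simp add: ennreal_mult)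
    finally show "ennreal D * ennreal (bump t) = \<rho> (exp t) * ennreal (exp t) * indicator {ta..tb} t"
      using bump_out[of t] by (cases "t \<in> {ta..tb}") auto
  qed
  also have "\<dots> = (\<integral>\<^sup>+r. \<rho> r * indicator {exp ta..exp tb} r \<partial>lborel)"
    by (rule nn_integral_substitution_aux[symmetric]) (use len in \<open>auto intro!: derivative_eq_intros continuous_intros\<close>)
  also have "\<dots> \<le> (\<integral>\<^sup>+x. \<rho> (norm x) * indicator T x \<partial>hausdorff1)"
    by (rule nn_integral_radial_le_hausdorff1) (use T in auto)
  also have "\<dots> \<le> (\<integral>\<^sup>+x. ennreal (indicator S x *\<^sub>R (sqrt (- 2 * g * snd x) * P x)) \<partial>hausdorff1)"
  proof (intro nn_integral_mono)
    fix x :: "real \<times> real"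
    show "\<rho> (norm x) * indicator T x \<le> ennreal (indicator S x *\<^sub>R (sqrt (- 2 * g * snd x) * P x))"
    proof (cases "x \<in> T \<and> x \<noteq> 0")
      case True
      then have xS: "x \<in> S" and n0: "norm x > 0" using T(2) by auto
      define t where "t = ln (norm x)"
      have "sqrt (2 * g * c) * sqrt (norm x) \<le> sqrt (- 2 * g * snd x)"
        unfolding real_sqrt_mult[symmetric]
      proof (rule real_sqrt_le_mono)
        have "2 * g * (c * norm x) \<le> 2 * g * (- snd x)" using c(2)[of x] True g0 by (intro mult_left_mono) auto
        then show "2 * g * c * norm x \<le> - 2 * g * snd x" by (simp add: mult_ac)
      qed
      moreover have "\<kappa> * crit_bump t \<le> P x" using P(2)[of x] True by (simp add: t_def)
      ultimately have "(sqrt (2 * g * c) * sqrt (norm x)) * (\<kappa> * crit_bump t) \<le> sqrt (- 2 * g * snd x) * P x"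
        using \<kappa> bump_range n0 c(1) g0 S_nonpos[OF xS] by (intro mult_mono) (auto simp: crit_bump_def mult_nonneg_nonpos)
      moreover have "(sqrt (2 * g * c) * sqrt (norm x)) * (\<kappa> * crit_bump t) = D * bump t * (sqrt (norm x) * exp (- (3/2) * t))"
        by (simp add: D_def crit_bump_def mult_ac)
      moreover have "sqrt (norm x) * exp (- (3/2) * t) = 1 / norm x" unfolding t_def by (rule exp_ln_powers(5)[OF n0])
      ultimately have "D * bump t / norm x \<le> sqrt (- 2 * g * snd x) * P x" by simp
      then show ?thesis using True xS n0 by (simp add: \<rho>_def t_def ennreal_leI)
    next
      case False
      then show ?thesis by (auto simp: \<rho>_def indicator_def)
    qed
  qed
  also have "\<dots> = ennreal (boundary_int P)"
    unfolding boundary_int_def set_lebesgue_integral_def by (rule nn_integral_eq_integral[OF int]) (use nn in auto)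
  finally have le: "ennreal (D * (\<Lambda> / 140)) \<le> ennreal (boundary_int P)" .
  have "boundary_int P \<ge> 0" unfolding boundary_int_def set_lebesgue_integral_def by (rule Bochner_Integration.integral_nonneg) (use nn in auto)
  with le have "D * (\<Lambda> / 140) \<le> boundary_int P" by (subst (asm) ennreal_le_iff) auto
  then show ?thesis by (simp add: D_def \<Lambda>_def)
qed

end

subsection \<open>The angles at the crest\<close>

lemma pol_angle_polar:
  assumes "r > 0" "- pi < s" "s \<le> pi"
  shows "pol_angle (r * sin s, - r * cos s) = s"
proof -
  have "exp (Complex (ln r) s) = pol_z (r * sin s, - r * cos s)"
    using assms(1) by (simp add: complex_eq_iff Re_exp Im_exp pol_z_def)
  moreover have "Ln (exp (Complex (ln r) s)) = Complex (ln r) s"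
    by (rule Ln_exp) (use assms in auto)
  ultimately show ?thesis by (simp add: pol_angle_def)
qed

lemma small_scale:
  fixes b \<epsilon> :: real
  assumes "b > 0" "\<epsilon> > 0"
  obtains tb where "exp tb < b" "exp (tb / 2) < \<epsilon>"
proof -
  \<comment> \<open>The witness 2 ln m satisfies exp (tb / 2) = m and exp tb = m^2 < m.\<close>
  define m where "m = min \<epsilon> (min 1 b) / 2"
  have m: "0 < m" "m < 1" "m < \<epsilon>" "m < b" using assms by (auto simp: m_def min_def)
  have h: "exp (2 * ln m / 2) = m" using m(1) by simp
  have "exp (2 * ln m) = m * m" using m(1) by (simp add: exp_double power2_eq_square)
  also have "\<dots> < m * 1" using m by (intro mult_strict_left_mono) auto
  finally have "exp (2 * ln m) < b" using m(4) by simp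
  then show ?thesis using that[of "2 * ln m"] h m(3) by simp
qed

section \<open>Geometry of the free surface near the crest\<close>

locale crest = wave +
  fixes u v :: "real \<Rightarrow> real" and d e \<theta>p \<theta>m :: real
  assumes L0: "L > 0"
    and cont_p: "continuous_on UNIV (\<lambda>s. (u s, v s))"
    and inj_p: "inj (\<lambda>s. (u s, v s))"
    and S_p: "S = range (\<lambda>s. (u s, v s))"
    and p0: "u 0 = 0" "v 0 = 0"
    and mono_u: "mono u"
    and de: "d < 0" "0 < e"
    and mono_v: "mono_on {d..0} v" "antimono_on {0..e} v"
    and \<theta>: "0 \<le> \<theta>p" "\<theta>p \<le> pi/2" "0 \<le> \<theta>m" "\<theta>m \<le> pi/2"
    and lim_p: "((\<lambda>s. pol_angle (u s, v s)) \<longlongrightarrow> \<theta>p) (at_right 0)"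
    and lim_m: "((\<lambda>s. pol_angle (u s, v s)) \<longlongrightarrow> - \<theta>m) (at_left 0)"
begin

definition "p s = (u s, v s)"

lemma p_cont: "continuous_on A p"
  using cont_p unfolding p_def[abs_def] by (rule continuous_on_subset) simp

lemma p_S: "p s \<in> S" and S_cases: "x \<in> S \<Longrightarrow> \<exists>s. x = p s"
  using S_p by (auto simp: p_def)

lemma p_0: "p 0 = 0" using p0 by (simp add: p_def zero_prod_def)

lemma p_eq_0_iff: "p s = 0 \<longleftrightarrow> s = 0"
  using inj_p p_0 unfolding p_def inj_def by metis

lemma u_le_norm: "\<bar>u s\<bar> \<le> norm (p s)"
  using norm_fst_le[of "u s" "v s"] by (simp add: p_def)

text \<open>The crest is carried along by the period. The parametrisation used here is the periodic
  one provided by \<open>periodic_curve\<close>, a priori unrelated to (u, v).\<close>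

lemma S_translates: "(2 * L * real n, 0) \<in> S \<and> (- (2 * L * real n), 0) \<in> S"
proof -
  obtain c :: "real \<Rightarrow> real \<times> real" and P :: real where c: "range c = S" "\<And>s. c (s + P) = c s + (2 * L, 0)"
  proof -
    have "periodic_curve L S" using weak by (simp add: weak_solution_def)
    then show ?thesis unfolding periodic_curve_def
    proof (elim exE conjE, goal_cases)
      case (1 c P) then show ?case using that[of c P] by blast
    qed
  qed
  have c': "c (s - P) = c s - (2 * L, 0)" for s using c(2)[of "s - P"] by (simp add: algebra_simps)
  show ?thesis
  proof (induction n)
    case 0 then show ?case using zero_S by (simp add: zero_prod_def)
  next
    case (Suc n)
    then obtain s t where "c s = (2 * L * real n, 0)" "c t = (- (2 * L * real n), 0)" using c(1) by (metis rangeE)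
    then have "c (s + P) = (2 * L * real (Suc n), 0)" "c (t - P) = (- (2 * L * real (Suc n)), 0)"
      unfolding c(2) c' by (auto simp: algebra_simps)
    then show ?case using c(1) by (metis rangeI)
  qed
qed

lemma u_reaches: "\<exists>s. u s \<ge> 1" "\<exists>s. u s \<le> - 1"
proof -
  obtain n :: nat where n: "1 / (2 * L) < real n" using reals_Archimedean2 by blast
  then have n1: "2 * L * real n \<ge> 1" using L0 by (simp add: field_simps)
  obtain s t where "(2 * L * real n, 0) = p s" "(- (2 * L * real n), 0) = p t"
    using S_translates[of n] S_cases by metis
  then have "u s \<ge> 1" "u t \<le> - 1" using n1 by (auto simp: p_def)
  then show "\<exists>s. u s \<ge> 1" "\<exists>s. u s \<le> - 1" by blast+
qed

text \<open>Away from \<open>s = 0\<close> the curve stays away from the crest: far out because \<open>u\<close> is monotone and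
  unbounded, in between by injectivity and compactness.\<close>

lemma near_crest: "\<eta> > 0 \<Longrightarrow> \<exists>b>0. \<forall>s. norm (p s) < b \<longrightarrow> \<bar>s\<bar> < \<eta>"
proof -
  assume \<eta>: "\<eta> > 0"
  obtain s0 s1 where s: "u s0 \<le> - 1" "u s1 \<ge> 1" using u_reaches by blast
  define K where "K = {s0..s1} \<inter> {s. \<eta> \<le> \<bar>s\<bar>}"
  have "compact K" unfolding K_def by (intro compact_Int_closed closed_Collect_le continuous_intros) simp
  have out: "norm (p s) \<ge> 1" if "s \<notin> {s0..s1}" for s
  proof -
    have "u s \<le> u s0 \<or> u s1 \<le> u s" using that mono_u by (auto simp: mono_def)
    then have "\<bar>u s\<bar> \<ge> 1" using s by linarith
    then show ?thesis using u_le_norm[of s] by linarith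
  qed
  show ?thesis
  proof (cases "K = {}")
    case True
    show ?thesis
    proof (intro exI[of _ 1] conjI allI impI)
      fix s assume "norm (p s) < 1"
      then have "s \<in> {s0..s1}" using out[of s] by force
      then show "\<bar>s\<bar> < \<eta>" using True by (auto simp: K_def)
    qed simp
  next
    case False
    obtain m where m: "m \<in> K" "\<And>s. s \<in> K \<Longrightarrow> norm (p m) \<le> norm (p s)"
      using continuous_attains_inf[OF \<open>compact K\<close> False, of "\<lambda>s. norm (p s)"]
      by (auto intro!: continuous_intros p_cont)
    have "norm (p m) > 0" using m(1) \<eta> p_eq_0_iff[of m] by (auto simp: K_def)
    show ?thesis
    proof (intro exI[of _ "min 1 (norm (p m))"] conjI allI impI)
      fix s assume a: "norm (p s) < min 1 (norm (p m))"
      then have "s \<in> {s0..s1}" "s \<notin> K" using out[of s] m(2)[of s] by force+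
      then show "\<bar>s\<bar> < \<eta>" by (auto simp: K_def)
    qed (use \<open>norm (p m) > 0\<close> in simp)
  qed
qed

text \<open>For |s| small both u and v are monotone on either side of the crest, so the increments
  of u + v, respectively u - v, bound the length.\<close>

lemma finite_length_near_crest: "\<exists>\<rho>>0. hausdorff1_outer (S \<inter> cball 0 \<rho>) < \<infinity>"
proof -
  obtain b where b: "b > 0" "\<And>s. norm (p s) < b \<Longrightarrow> \<bar>s\<bar> < min (- d) e"
    using near_crest[of "min (- d) e"] de by auto
  have dle: "dist (p s) (p t) \<le> (u t - u s) + \<bar>v t - v s\<bar>" if "s \<le> t" for s t
  proof -
    have "dist (p s) (p t) = norm (u t - u s, v t - v s)" 
      using dist_norm[of "p t" "p s"] by (simp add: p_def dist_commute)
    also have "\<dots> \<le> \<bar>u t - u s\<bar> + \<bar>v t - v s\<bar>" using norm_Pair_le[of "u t - u s" "v t - v s"] by simp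
    finally show ?thesis using mono_u that by (simp add: mono_def)
  qed
  have cu: "continuous_on A u" "continuous_on A v" for A
    using continuous_on_fst[OF p_cont, of A] continuous_on_snd[OF p_cont, of A] by (auto simp: p_def)
  have 1: "hausdorff1_outer (p ` {d..0}) \<le> ennreal ((u 0 + v 0) - (u d + v d))"
  proof (rule hausdorff1_outer_arc_le[of d 0 "\<lambda>s. u s + v s"])
    fix s t assume "d \<le> s" "s \<le> t" "t \<le> (0::real)"
    then have "v s \<le> v t" using mono_v(1) by (auto simp: mono_on_def)
    then show "dist (p s) (p t) \<le> u t + v t - (u s + v s)" using dle[OF \<open>s \<le> t\<close>] by simp
  qed (use de in \<open>auto intro!: continuous_intros cu\<close>)
  have 2: "hausdorff1_outer (p ` {0..e}) \<le> ennreal ((u e - v e) - (u 0 - v 0))"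
  proof (rule hausdorff1_outer_arc_le[of 0 e "\<lambda>s. u s - v s"])
    fix s t assume "0 \<le> s" "s \<le> t" "t \<le> e"
    then have "v t \<le> v s" using mono_v(2) by (auto simp: monotone_on_def)
    then show "dist (p s) (p t) \<le> u t - v t - (u s - v s)" using dle[OF \<open>s \<le> t\<close>] by simp
  qed (use de in \<open>auto intro!: continuous_intros cu\<close>)
  have "S \<inter> cball 0 (b/2) \<subseteq> p ` {d..0} \<union> p ` {0..e}"
  proof
    fix x assume x: "x \<in> S \<inter> cball 0 (b/2)"
    then obtain s where s: "x = p s" using S_cases by blast
    then have "norm (p s) < b" using x b(1) by simp
    then have "s \<in> {d..0} \<or> s \<in> {0..e}" using b(2)[of s] by auto
    then show "x \<in> p ` {d..0} \<union> p ` {0..e}" using s by blast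
  qed
  then have "hausdorff1_outer (S \<inter> cball 0 (b/2)) \<le> hausdorff1_outer (p ` {d..0} \<union> p ` {0..e})"
    by (rule hausdorff1_outer_mono)
  also have "\<dots> \<le> hausdorff1_outer (p ` {d..0}) + hausdorff1_outer (p ` {0..e})" by (rule hausdorff1_outer_Un)
  also have "\<dots> < \<infinity>" using le_less_trans[OF 1 ennreal_less_top] le_less_trans[OF 2 ennreal_less_top] by simp
  finally show ?thesis using b(1) by (intro exI[of _ "b/2"]) auto
qed

text \<open>The sign \<tau> = 1 or -1 stands for the right or left side of the crest, so that \<tau>
  * \<open>pol_angle\<close> is the angle measured from the downward vertical towards that side, and
  each argument is given once for both sides.\<close>

definition ray :: "real \<Rightarrow> real" where "ray \<tau> = (if \<tau> = 1 then \<theta>p else \<theta>m)"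

lemma ray_range: "0 \<le> ray \<tau>" "ray \<tau> \<le> pi/2" using \<theta> by (auto simp: ray_def)

lemma angle_near:
  assumes "\<delta> > 0" "\<tau> = 1 \<or> \<tau> = - 1"
  obtains \<eta> where "\<eta> > 0" "\<And>s. 0 < s \<Longrightarrow> s < \<eta> \<Longrightarrow> \<bar>\<tau> * pol_angle (p (\<tau> * s)) - ray \<tau>\<bar> < \<delta>"
proof (cases "\<tau> = 1")
  case True
  have "\<forall>\<^sub>F s in at_right 0. dist (pol_angle (u s, v s)) \<theta>p < \<delta>" by (rule tendstoD[OF lim_p assms(1)])
  then obtain \<eta> where "\<eta> > 0" "\<And>s. 0 < s \<Longrightarrow> s < \<eta> \<Longrightarrow> dist (pol_angle (u s, v s)) \<theta>p < \<delta>"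
    unfolding eventually_at_right_field by auto
  then show ?thesis using that[of \<eta>] True by (auto simp: p_def ray_def dist_real_def)
next
  case False
  then have \<tau>: "\<tau> = - 1" using assms by simp
  have "\<forall>\<^sub>F s in at_left 0. dist (pol_angle (u s, v s)) (- \<theta>m) < \<delta>" by (rule tendstoD[OF lim_m assms(1)])
  then obtain \<eta> where \<eta>: "\<eta> < 0" "\<And>s. \<eta> < s \<Longrightarrow> s < 0 \<Longrightarrow> dist (pol_angle (u s, v s)) (- \<theta>m) < \<delta>"
    unfolding eventually_at_left_field by auto
  show ?thesis
  proof (rule that[of "- \<eta>"])
    fix s assume "0 < s" "s < - \<eta>"
    then show "\<bar>\<tau> * pol_angle (p (\<tau> * s)) - ray \<tau>\<bar> < \<delta>"
      using \<eta>(2)[of "- s"] by (simp add: \<tau> p_def ray_def dist_real_def abs_minus_commute)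
  qed (use \<eta> in simp)
qed

text \<open>Confines all of S near the crest to two thin sectors, so that the sign of a test
  function on S is decided by its angular factor near two angles.\<close>

lemma sectors:
  assumes "\<delta> > 0"
  obtains b where "b > 0" "\<And>x. x \<in> S \<Longrightarrow> x \<noteq> 0 \<Longrightarrow> norm x < b \<Longrightarrow> \<exists>\<tau>\<in>{1, -1}. \<bar>\<tau> * pol_angle x - ray \<tau>\<bar> < \<delta>"
proof -
  obtain \<eta>1 where \<eta>1: "\<eta>1 > 0" "\<And>s. 0 < s \<Longrightarrow> s < \<eta>1 \<Longrightarrow> \<bar>1 * pol_angle (p (1 * s)) - ray 1\<bar> < \<delta>"
    using angle_near[OF assms, of 1] by blast
  obtain \<eta>2 where \<eta>2: "\<eta>2 > 0" "\<And>s. 0 < s \<Longrightarrow> s < \<eta>2 \<Longrightarrow> \<bar>(- 1) * pol_angle (p ((- 1) * s)) - ray (- 1)\<bar> < \<delta>"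
    using angle_near[OF assms, of "- 1"] by blast
  obtain b where b: "b > 0" "\<And>s. norm (p s) < b \<Longrightarrow> \<bar>s\<bar> < min \<eta>1 \<eta>2"
    using near_crest[of "min \<eta>1 \<eta>2"] \<eta>1(1) \<eta>2(1) by auto
  show ?thesis
  proof (rule that[OF b(1)])
    fix x assume x: "x \<in> S" "x \<noteq> 0" "norm x < b"
    then obtain s where s: "x = p s" using S_cases by blast
    then have "s \<noteq> 0" "\<bar>s\<bar> < min \<eta>1 \<eta>2" using x b(2) p_0 by auto
    then show "\<exists>\<tau>\<in>{1, -1}. \<bar>\<tau> * pol_angle x - ray \<tau>\<bar> < \<delta>"
      using \<eta>1(2)[of s] \<eta>2(2)[of "- s"] s by (cases "s > 0") auto
  qed
qed

text \<open>The arc is the image of a compact parameter interval on one side of 0, so it omits the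
  crest; the intermediate value theorem makes the norm run through the whole range of the
  bump.\<close>

lemma arcs:
  assumes "\<delta> > 0" "\<tau> = 1 \<or> \<tau> = - 1"
  obtains b where "b > 0" "\<And>ta tb. ta \<le> tb \<Longrightarrow> exp tb < b \<Longrightarrow> \<exists>T. T \<in> sets borel \<and> T \<subseteq> S \<and> {exp ta..exp tb} \<subseteq> norm ` T \<and>
      (\<forall>x\<in>T. x \<noteq> 0 \<and> \<bar>\<tau> * pol_angle x - ray \<tau>\<bar> < \<delta>)"
proof -
  obtain \<eta> where \<eta>: "\<eta> > 0" "\<And>s. 0 < s \<Longrightarrow> s < \<eta> \<Longrightarrow> \<bar>\<tau> * pol_angle (p (\<tau> * s)) - ray \<tau>\<bar> < \<delta>"
    using angle_near[OF assms] by blast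
  define s1 where "s1 = \<eta> / 2"
  have s1: "0 < s1" "s1 < \<eta>" using \<eta>(1) by (auto simp: s1_def)
  define c where "c s = p (\<tau> * s)" for s
  have cone_profile: "continuous_on A c" for A unfolding c_def by (intro continuous_on_compose2[OF p_cont[of UNIV]] continuous_intros) auto
  have c0: "c s \<noteq> 0" if "s \<noteq> 0" for s
  proof -
    have "\<tau> * s \<noteq> 0" using assms(2) that by auto
    then show ?thesis by (simp add: c_def p_eq_0_iff)
  qed
  show ?thesis
  proof (rule that[of "norm (c s1)"])
    show "norm (c s1) > 0" using c0 s1 by simp
    fix ta tb :: real assume t: "ta \<le> tb" "exp tb < norm (c s1)"
    have "isCont (\<lambda>s. norm (c s)) 0"
      using cone_profile[of UNIV] by (simp add: continuous_on_eq_continuous_at)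
    then have "((\<lambda>s. norm (c s)) \<longlongrightarrow> norm (c 0)) (at 0)" by (simp add: isCont_def)
    then have "\<forall>\<^sub>F s in at 0. norm (c s) < exp ta" by (rule order_tendstoD) (simp add: c_def p_0)
    then obtain r where r: "r > 0" "\<And>s. s \<noteq> 0 \<Longrightarrow> \<bar>s\<bar> < r \<Longrightarrow> norm (c s) < exp ta"
      unfolding eventually_at by (auto simp: dist_real_def)
    define s0 where "s0 = min (r/2) s1"
    have s0: "0 < s0" "s0 \<le> s1" "norm (c s0) < exp ta" using r s1 by (auto simp: s0_def)
    define T where "T = c ` {s0..s1}"
    have "compact T" unfolding T_def by (intro compact_continuous_image cone_profile) simp
    then have "T \<in> sets borel" by (simp add: borel_compact)
    moreover have "T \<subseteq> S" using p_S by (auto simp: T_def c_def)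
    moreover have "{exp ta..exp tb} \<subseteq> norm ` T"
    proof
      fix r assume "r \<in> {exp ta..exp tb}"
      then have "norm (c s0) \<le> r" "r \<le> norm (c s1)" using s0 t by auto
      from IVT'[of "\<lambda>s. norm (c s)", OF this s0(2)] obtain s where "s0 \<le> s" "s \<le> s1" "norm (c s) = r"
        by (auto intro!: continuous_intros cone_profile)
      then show "r \<in> norm ` T" by (auto simp: T_def)
    qed
    moreover have "\<forall>x\<in>T. x \<noteq> 0 \<and> \<bar>\<tau> * pol_angle x - ray \<tau>\<bar> < \<delta>"
    proof
      fix x assume "x \<in> T"
      then obtain s where "x = c s" "0 < s" "s < \<eta>" using s0 s1 by (auto simp: T_def)
      then show "x \<noteq> 0 \<and> \<bar>\<tau> * pol_angle x - ray \<tau>\<bar> < \<delta>" using c0[of s] \<eta>(2)[of s] by (simp add: c_def)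
    qed
    ultimately show "\<exists>T. T \<in> sets borel \<and> T \<subseteq> S \<and> {exp ta..exp tb} \<subseteq> norm ` T \<and>
      (\<forall>x\<in>T. x \<noteq> 0 \<and> \<bar>\<tau> * pol_angle x - ray \<tau>\<bar> < \<delta>)" by blast
  qed
qed

text \<open>A point of \<open>\<Omega>\<close> above the sector could be moved on a circular arc into the upper half plane
  without meeting \<open>S\<close>.\<close>

lemma fluid_below_ray:
  assumes "\<delta> > 0" "\<tau> = 1 \<or> \<tau> = - 1"
  obtains b where "b > 0" "\<And>x. x \<in> \<Omega> \<Longrightarrow> norm x < b \<Longrightarrow> \<tau> * pol_angle x \<le> ray \<tau> + \<delta>"
proof -
  obtain b0 where b0: "b0 > 0" "\<And>x. x \<in> S \<Longrightarrow> x \<noteq> 0 \<Longrightarrow> norm x < b0 \<Longrightarrow> \<exists>\<tau>\<in>{1, -1}. \<bar>\<tau> * pol_angle x - ray \<tau>\<bar> < \<delta>"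
    using sectors[OF assms(1)] by blast
  show ?thesis
  proof (rule that[of "min b0 (- F)"])
    show "min b0 (- F) > 0" using b0(1) F0 by simp
    fix x assume x: "x \<in> \<Omega>" "norm x < min b0 (- F)"
    show "\<tau> * pol_angle x \<le> ray \<tau> + \<delta>"
    proof (rule ccontr)
      assume n: "\<not> \<tau> * pol_angle x \<le> ray \<tau> + \<delta>"
      have sx: "snd x < 0" by (rule \<Omega>_below[OF x(1)])
      then have x0: "x \<noteq> 0" by auto
      define r where "r = norm x"
      have r: "r > 0" "r < b0" "r < - F" using x0 x(2) by (auto simp: r_def)
      define c where "c s = (r * sin (\<tau> * s), - r * cos (\<tau> * s))" for s
      have nc: "norm (c s) = r" for s
      proof -
        have "(r * sin (\<tau> * s))\<^sup>2 + (- r * cos (\<tau> * s))\<^sup>2 = r\<^sup>2" by (simp add: power_mult_distrib flip: distrib_left)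
        then show ?thesis using r by (simp add: c_def norm_Pair)
      qed
      define s0 where "s0 = \<tau> * pol_angle x"
      have \<tau>\<tau>: "\<tau> * (\<tau> * y) = y" for y using assms(2) by auto
      have s0: "\<bar>s0\<bar> < pi/2" using pol_angle_lower_bounds[OF sx] assms(2) by (auto simp: s0_def)
      have cx: "c s0 = x" using fst_polar[OF x0] snd_polar[OF x0]
        by (simp add: c_def s0_def \<tau>\<tau> r_def prod_eq_iff)
      \<comment> \<open>The angle 3 \<pi>/4 lies beyond the horizontal and below \<pi>, so the arc
        ends above \<Omega> without meeting the branch cut.\<close>
      have conn: "connected (c ` {s0..3 * pi / 4})"
        unfolding c_def by (intro connected_continuous_image continuous_intros) simp
      have "s0 \<le> 3 * pi / 4" using s0 pi_gt_zero by linarith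
      then have "c s0 \<in> c ` {s0..3 * pi / 4}" by (intro imageI) simp
      then have meets: "c ` {s0..3 * pi / 4} \<inter> \<Omega> \<noteq> {}" using cx x(1) by auto
      have "c (3 * pi / 4) \<notin> \<Omega>"
      proof -
        have "cos (\<tau> * (3 * pi / 4)) = cos (3 * pi / 4)" using assms(2) by auto
        also have "\<dots> < cos (pi / 2)" by (rule cos_monotone_0_pi) (use pi_gt_zero in auto)
        finally have "r * cos (\<tau> * (3 * pi / 4)) < 0" using r(1) by (intro mult_pos_neg) simp_all
        then have "snd (c (3 * pi / 4)) > 0" by (simp add: c_def)
        then show ?thesis using \<Omega>_below[of "c (3 * pi / 4)"] by auto
      qed
      moreover have "s0 \<le> 3 * pi / 4" using s0 pi_gt_zero by linarith
      then have "c (3 * pi / 4) \<in> c ` {s0..3 * pi / 4}" by (intro imageI) simp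
      ultimately have ne: "c ` {s0..3 * pi / 4} - \<Omega> \<noteq> {}" by blast
      obtain s where s: "s0 \<le> s" "s \<le> 3 * pi / 4" "c s \<in> frontier \<Omega>"
        using connected_Int_frontier[OF conn meets ne] by auto
      have "snd (c s) \<ge> - r"
        using norm_snd_le[of "snd (c s)" "fst (c s)"] nc[of s] by simp
      then have "snd (c s) > F" using r by simp
      then have cS: "c s \<in> S" using s(3) unfolding fd(4) by (auto simp: bottom_def)
      have c0: "c s \<noteq> 0" using nc[of s] r by auto
      have "pol_angle (c s) = \<tau> * s"
        unfolding c_def by (rule pol_angle_polar[OF r(1)]) (use s s0 assms(2) pi_gt_zero in auto)
      moreover have "norm (c s) < b0" using nc r by simp
      ultimately obtain \<tau>' where \<tau>': "\<tau>' \<in> {1, -1}" "\<bar>\<tau>' * (\<tau> * s) - ray \<tau>'\<bar> < \<delta>"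
        using b0(2)[OF cS c0] by metis
      have "s > ray \<tau> + \<delta>" using n s(1) by (simp add: s0_def)
      moreover have "s < ray \<tau> + \<delta>"
      proof (cases "\<tau>' = \<tau>")
        case True then show ?thesis using \<tau>'(2) by (simp add: \<tau>\<tau> abs_less_iff)
      next
        \<comment> \<open>A point of S near the other ray would require s < \<delta>, but s >
          \<open>ray \<tau>\<close> + \<delta>.\<close>
        case False
        then have "\<tau>' * (\<tau> * s) = - s" using \<tau>'(1) assms(2) by auto
        then show ?thesis using \<tau>'(2) ray_range(1)[of \<tau>'] ray_range(1)[of \<tau>] \<open>s > ray \<tau> + \<delta>\<close> assms(1) by (simp add: abs_less_iff)
      qed
      ultimately show False by simp
    qed
  qed
qed

section \<open>Testing with harmonic modes\<close>

definition cos_mode :: "real \<Rightarrow> real \<Rightarrow> real \<Rightarrow> real" where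
  "cos_mode \<sigma> m s = \<sigma> * cos (3/2 * (s - m))"

lemma cos_mode_facts:
  assumes "\<sigma> = 1 \<or> \<sigma> = - 1"
  shows "(cos_mode \<sigma> m has_real_derivative - (3/2) * \<sigma> * sin (3/2 * (s - m))) (at s)"
    and "((\<lambda>s. - (3/2) * \<sigma> * sin (3/2 * (s - m))) has_real_derivative - (9/4) * cos_mode \<sigma> m s) (at s)"
    and "\<bar>cos_mode \<sigma> m s\<bar> \<le> 1" and "\<bar>cos_mode \<sigma> m s - cos_mode \<sigma> m r\<bar> \<le> 3/2 * \<bar>s - r\<bar>"
proof -
  show "(cos_mode \<sigma> m has_real_derivative - (3/2) * \<sigma> * sin (3/2 * (s - m))) (at s)"
    unfolding cos_mode_def[abs_def] by (auto intro!: derivative_eq_intros)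
  show "((\<lambda>s. - (3/2) * \<sigma> * sin (3/2 * (s - m))) has_real_derivative - (9/4) * cos_mode \<sigma> m s) (at s)"
    unfolding cos_mode_def by (auto intro!: derivative_eq_intros)
  show "\<bar>cos_mode \<sigma> m s\<bar> \<le> 1" using assms by (auto simp: cos_mode_def abs_mult)
  have "cos_mode \<sigma> m s - cos_mode \<sigma> m r = \<sigma> * (cos (3/2 * (s - m)) - cos (3/2 * (r - m)))" by (simp add: cos_mode_def algebra_simps)
  then have "\<bar>cos_mode \<sigma> m s - cos_mode \<sigma> m r\<bar> = \<bar>cos (3/2 * (s - m)) - cos (3/2 * (r - m))\<bar>" using assms by (auto simp: abs_mult)
  also have "\<dots> \<le> \<bar>3/2 * (s - m) - 3/2 * (r - m)\<bar>" by (rule abs_cos_diff_le)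
  also have "3/2 * (s - m) - 3/2 * (r - m) = 3/2 * (s - r)" by (simp add: field_simps)
  also have "\<bar>3/2 * (s - r)\<bar> = 3/2 * \<bar>s - r\<bar>" by (simp only: abs_mult)
  finally show "\<bar>cos_mode \<sigma> m s - cos_mode \<sigma> m r\<bar> \<le> 3/2 * \<bar>s - r\<bar>" .
qed

lemma S_lift_value:
  assumes "log_bump ta tb" "x \<in> S" "x \<noteq> 0"
  shows "polar_lift (log_bump.crit_bump ta tb) (cut_angle f) x = log_bump.crit_bump ta tb (ln (norm x)) * f (pol_angle x)"
proof -
  have "cos (pol_angle x) \<ge> 0"
  proof -
    have "norm x * cos (pol_angle x) \<ge> 0" using S_nonpos[OF assms(2)] snd_polar[OF assms(3)] by simp
    then show ?thesis using assms(3) by (simp add: zero_le_mult_iff)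
  qed
  then show ?thesis using assms(3) by (simp add: polar_lift_def cut_angle_lower(1))
qed

lemma S_depth: "x \<in> S \<Longrightarrow> x \<noteq> 0 \<Longrightarrow> \<bar>\<tau> * pol_angle x - ray \<tau>\<bar> < \<delta> \<Longrightarrow> \<tau> = 1 \<or> \<tau> = - 1 \<Longrightarrow> (cos (ray \<tau>) - \<delta>) * norm x \<le> - snd x"
proof -
  assume a: "x \<in> S" "x \<noteq> 0" "\<bar>\<tau> * pol_angle x - ray \<tau>\<bar> < \<delta>" "\<tau> = 1 \<or> \<tau> = - 1"
  have "cos (pol_angle x) = cos (\<tau> * pol_angle x)" using a(4) by auto
  then have "cos (ray \<tau>) - \<delta> \<le> cos (pol_angle x)" using abs_cos_diff_le[of "\<tau> * pol_angle x" "ray \<tau>"] a(3) by linarith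
  then have "(cos (ray \<tau>) - \<delta>) * norm x \<le> cos (pol_angle x) * norm x" by (intro mult_right_mono) auto
  then show ?thesis using snd_polar[OF a(2)] by (simp add: mult.commute)
qed

text \<open>Nonnegativity of f on all of S near the crest allows every part of S except the arc T to
  be dropped; only on T is a quantitative bound required.\<close>

lemma boundary_int_test_inequality:
  assumes lb: "log_bump ta tb" and T: "T \<in> sets borel" "T \<subseteq> S" "{exp ta..exp tb} \<subseteq> norm ` T"
    and Tang: "\<forall>x\<in>T. x \<noteq> 0 \<and> \<bar>\<tau> * pol_angle x - ray \<tau>\<bar> < \<delta>" and \<tau>: "\<tau> = 1 \<or> \<tau> = - 1"
    and \<delta>: "\<delta> \<le> cos (ray \<tau>)" and \<kappa>: "\<kappa> \<ge> 0"
    and b: "exp tb < b"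
    and fpos: "\<And>x. x \<in> S \<Longrightarrow> x \<noteq> 0 \<Longrightarrow> norm x < b \<Longrightarrow> f (pol_angle x) \<ge> 0"
    and fT: "\<And>x. x \<in> S \<Longrightarrow> x \<noteq> 0 \<Longrightarrow> norm x < b \<Longrightarrow> \<bar>\<tau> * pol_angle x - ray \<tau>\<bar> < \<delta> \<Longrightarrow> f (pol_angle x) \<ge> \<kappa>"
    and fin: "hausdorff1_outer (S \<inter> cball 0 (exp tb)) < \<infinity>"
    and f: "continuous_on UNIV f"
  shows "\<kappa> * sqrt (2 * g * (cos (ray \<tau>) - \<delta>)) * ((tb - ta) / 140) \<le> boundary_int (polar_lift (log_bump.crit_bump ta tb) (cut_angle f))"
proof -
  interpret log_bump ta tb by fact
  interpret l: lift_profile crit_bump "cut_angle f" ta tb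
    by unfold_locales (use crit_bump_supp cut_angle_zero in auto)
  have pA0: "crit_bump t \<ge> 0" for t using bump_range by (simp add: crit_bump_def)
  have inb: "norm x < b" if "x \<noteq> 0" "crit_bump (ln (norm x)) \<noteq> 0" for x :: "real\<times>real"
  proof -
    have "ln (norm x) \<le> tb" using crit_bump_supp(1)[OF that(2)] by simp
    then have "norm x \<le> exp tb" using that(1) by (metis exp_le_cancel_iff exp_ln norm_eq_zero norm_ge_zero order_le_less)
    then show ?thesis using b by simp
  qed
  show ?thesis
  proof (rule boundary_int_lower[OF lb T _ _ \<kappa>])
    show "cos (ray \<tau>) - \<delta> \<ge> 0" using \<delta> by simp
    show "(cos (ray \<tau>) - \<delta>) * norm x \<le> - snd x" if "x \<in> T" for x
      using S_depth[of x \<tau> \<delta>] that T(2) Tang \<tau> by blast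
    show "0 \<le> polar_lift crit_bump (cut_angle f) x" if "x \<in> S" for x
    proof (cases "x = 0 \<or> crit_bump (ln (norm x)) = 0")
      case False
      then show ?thesis using S_lift_value[OF lb that] fpos[OF that] inb[of x] pA0 by simp
    qed (auto simp: polar_lift_def)
    show "\<kappa> * crit_bump (ln (norm x)) \<le> polar_lift crit_bump (cut_angle f) x" if "x \<in> T" "x \<noteq> 0" for x
    proof (cases "crit_bump (ln (norm x)) = 0")
      case False
      have xS: "x \<in> S" using that T by blast
      have "\<kappa> \<le> f (pol_angle x)" using fT[OF xS that(2) inb[OF that(2) False]] Tang that(1) by blast
      then have "\<kappa> * crit_bump (ln (norm x)) \<le> f (pol_angle x) * crit_bump (ln (norm x))" by (rule mult_right_mono[OF _ pA0])
      then show ?thesis using S_lift_value[OF lb xS that(2), of f] by (simp add: mult.commute)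
    qed (simp add: polar_lift_def)
    show "integrable hausdorff1 (\<lambda>x. indicat_real S x *\<^sub>R (sqrt (- 2 * g * snd x) * polar_lift crit_bump (cut_angle f) x))"
    proof (rule boundary_int_integrable[OF _ _ fin])
      show "continuous_on UNIV (polar_lift crit_bump (cut_angle f))"
        by (intro l.lift_continuous crit_bump_cont) (auto simp: cut_angle_def[abs_def] intro!: continuous_intros f)
      show "norm x \<le> exp tb" if "polar_lift crit_bump (cut_angle f) x \<noteq> 0" for x using l.lift_support[OF that] by simp
    qed
  qed
qed

text \<open>Were cos positive on one ray, the boundary integral would grow at least like q
  \<Lambda>, while its upper bound grows like an arbitrarily small multiple of \<Lambda> plus a
  constant. First tb is fixed, then \<Lambda>.\<close>

lemma pos_definite_case:
  assumes \<sigma>: "\<sigma> = 1 \<or> \<sigma> = - 1" and k: "k > 0"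
    and hk: "cos_mode \<sigma> m (ray 1) \<ge> k" "cos_mode \<sigma> m (- ray (- 1)) \<ge> k" and \<tau>: "\<tau> = 1 \<or> \<tau> = - 1"
  shows "cos (ray \<tau>) \<le> 0"
proof (rule ccontr)
  assume n: "\<not> cos (ray \<tau>) \<le> 0"
  \<comment> \<open>Changing the angle by k / 3 alters the mode by at most 3/2 * k / 3 = k /
    2.\<close>
  define \<delta> where "\<delta> = min (k / 3) (cos (ray \<tau>) / 2)"
  have \<delta>: "\<delta> > 0" "\<delta> \<le> k / 3" "\<delta> \<le> cos (ray \<tau>) / 2" using n k by (auto simp: \<delta>_def)
  define q where "q = k / 2 * sqrt (2 * g * (cos (ray \<tau>) - \<delta>)) / 140"
  have q: "q > 0" using k g0 \<delta> n by (simp add: q_def)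
  obtain b1 where b1: "b1 > 0" "\<And>x. x \<in> S \<Longrightarrow> x \<noteq> 0 \<Longrightarrow> norm x < b1 \<Longrightarrow> \<exists>\<tau>\<in>{1, -1}. \<bar>\<tau> * pol_angle x - ray \<tau>\<bar> < \<delta>"
    using sectors[OF \<delta>(1)] by blast
  obtain b2 where b2: "b2 > 0" "\<And>ta tb. ta \<le> tb \<Longrightarrow> exp tb < b2 \<Longrightarrow> \<exists>T. T \<in> sets borel \<and> T \<subseteq> S \<and> {exp ta..exp tb} \<subseteq> norm ` T \<and>
      (\<forall>x\<in>T. x \<noteq> 0 \<and> \<bar>\<tau> * pol_angle x - ray \<tau>\<bar> < \<delta>)"
    using arcs[OF \<delta>(1) \<tau>] by blast
  obtain \<rho> where \<rho>: "\<rho> > 0" "hausdorff1_outer (S \<inter> cball 0 \<rho>) < \<infinity>" using finite_length_near_crest by blast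
  obtain tb where tb: "exp tb < min (min b1 b2) (min \<rho> (- F / 4))" "exp (tb / 2) < q / (2 * pi * gamma_bound)"
    using small_scale[of "min (min b1 b2) (min \<rho> (- F / 4))" "q / (2 * pi * gamma_bound)"] b1(1) b2(1) \<rho>(1) F0 q gamma_bound(1) by auto
  \<comment> \<open>78 = 2 * 39: the source term takes at most q / 2 per unit of length, and the
    remaining q / 2 has to beat 39 \<pi> \<open>growth_const\<close>.\<close>
  define ta where "ta = tb - (1 + 78 * pi * growth_const / q)"
  have lb: "log_bump ta tb" using growth_const(1) q by unfold_locales (simp add: ta_def)
  obtain T where T: "T \<in> sets borel" "T \<subseteq> S" "{exp ta..exp tb} \<subseteq> norm ` T" "\<forall>x\<in>T. x \<noteq> 0 \<and> \<bar>\<tau> * pol_angle x - ray \<tau>\<bar> < \<delta>"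
    using b2(2)[of ta tb] log_bump.len[OF lb] tb(1) by auto
  have fin: "hausdorff1_outer (S \<inter> cball 0 (exp tb)) < \<infinity>"
    using tb(1) by (intro le_less_trans[OF hausdorff1_outer_mono \<rho>(2)]) auto
  have fk: "k / 2 \<le> cos_mode \<sigma> m (pol_angle x)" if x: "x \<in> S" "x \<noteq> 0" "norm x < b1" for x
  proof -
    obtain \<tau>' where \<tau>': "\<tau>' \<in> {1, -1}" "\<bar>\<tau>' * pol_angle x - ray \<tau>'\<bar> < \<delta>" using b1(2)[OF x] by blast
    have "cos_mode \<sigma> m (\<tau>' * ray \<tau>') \<ge> k" using hk \<tau>'(1) by auto
    moreover have "\<bar>pol_angle x - \<tau>' * ray \<tau>'\<bar> < \<delta>" using \<tau>' by (auto simp: abs_minus_commute abs_less_iff)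
    moreover have "3/2 * \<bar>pol_angle x - \<tau>' * ray \<tau>'\<bar> \<le> k / 2" using calculation(2) \<delta>(2) by simp
    ultimately show ?thesis
      using order_trans[OF abs_ge_minus_self cos_mode_facts(4)[OF \<sigma>, of m "pol_angle x" "\<tau>' * ray \<tau>'"]] by simp
  qed
  have "k / 2 * sqrt (2 * g * (cos (ray \<tau>) - \<delta>)) * ((tb - ta) / 140) \<le> boundary_int (polar_lift (log_bump.crit_bump ta tb) (cut_angle (cos_mode \<sigma> m)))"
  proof (rule boundary_int_test_inequality[OF lb T \<tau>, where b=b1])
    show "\<delta> \<le> cos (ray \<tau>)" using \<delta> n by linarith
    show "0 \<le> cos_mode \<sigma> m (pol_angle x)" if "x \<in> S" "x \<noteq> 0" "norm x < b1" for x using fk[OF that] k by linarith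
    show "continuous_on UNIV (cos_mode \<sigma> m)" unfolding cos_mode_def[abs_def] by (intro continuous_intros)
  qed (use k tb fin fk in auto)
  also have "\<dots> \<le> pi * gamma_bound * exp (tb / 2) * (tb - ta) + pi * (39 * growth_const)"
    by (rule boundary_int_le_of_mode[OF lb _ cos_mode_facts(1,2,3)[OF \<sigma>]]) (use tb in simp)
  finally have "q * (tb - ta) \<le> pi * gamma_bound * exp (tb / 2) * (tb - ta) + pi * (39 * growth_const)" by (simp add: q_def)
  moreover have "pi * gamma_bound * exp (tb / 2) * (tb - ta) \<le> q / 2 * (tb - ta)"
  proof (rule mult_right_mono)
    show "pi * gamma_bound * exp (tb / 2) \<le> q / 2" using tb(2) gamma_bound(1) by (simp add: field_simps)
    show "0 \<le> tb - ta" using growth_const(1) q by (simp add: ta_def)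
  qed
  ultimately have "q * (tb - ta) \<le> 78 * pi * growth_const" by simp
  moreover have "q * (tb - ta) = q + 78 * pi * growth_const" using q by (simp add: ta_def distrib_left)
  ultimately show False using q by linarith
qed

text \<open>Were the ray on side \<tau> steeper, its contribution sqrt (2 g c1) would exceed the
  sharp bound sqrt (2 g c2) for the sector on the other side. Adding the sector cut-off to the mode
  makes the sum nonnegative on S, so that the lower bound applies.\<close>

lemma balanced_case:
  assumes sum: "\<theta>p + \<theta>m = 2 * pi / 3" and \<tau>: "\<tau> = 1 \<or> \<tau> = - 1"
  shows "cos (ray \<tau>) \<le> cos (ray (- \<tau>))"
proof (rule ccontr)
  assume n: "\<not> cos (ray \<tau>) \<le> cos (ray (- \<tau>))"
  define c1 c2 where "c1 = cos (ray \<tau>)" and "c2 = cos (ray (- \<tau>))"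
  have c: "c2 < c1" "0 \<le> c2" "0 < c1"
  proof -
    show "c2 < c1" using n by (simp add: c1_def c2_def)
    show "0 \<le> c2" unfolding c2_def using ray_range[of "- \<tau>"] by (intro cos_ge_zero) auto
    then show "0 < c1" using \<open>c2 < c1\<close> by simp
  qed
  define M2 where "M2 = sqrt (2 * g + 2 * grad_const * growth_const)"
  define \<Delta> where "\<Delta> = sqrt (2 * g * c1) / 140 - sqrt (2 * g * c2) / 140"
  have \<Delta>: "\<Delta> > 0" using c g0 by (simp add: \<Delta>_def)
  \<comment> \<open>\<open>h \<delta>\<close> is the growth rate in \<Lambda> of lower minus upper
    bound, source terms aside; it tends to \<open>\<Delta>\<close> as \<delta> tends to 0.\<close>
  define h where "h \<delta> = (1 - 3/2 * \<delta>) * sqrt (2 * g * (c1 - \<delta>)) / 140 - 15 * M2 * \<delta> - sqrt (2 * g * (c2 + 2 * \<delta>) + \<delta>) / 140" for \<delta>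
  have "continuous_on UNIV h" unfolding h_def by (intro continuous_intros) auto
  then have "isCont h 0" by (simp add: continuous_on_eq_continuous_at)
  then have "(h \<longlongrightarrow> h 0) (at_right 0)" by (simp add: isCont_def filterlim_at_split)
  moreover have "h 0 = \<Delta>" by (simp add: h_def \<Delta>_def)
  ultimately have "\<forall>\<^sub>F \<delta> in at_right 0. h \<delta> > \<Delta> / 2" using \<Delta> by (intro order_tendstoD(1)) auto
  moreover have "\<forall>\<^sub>F \<delta> in at_right 0. \<delta> < min (1/2) c1" using c by (intro order_tendstoD(2)[OF tendsto_ident_at]) auto
  moreover have "\<forall>\<^sub>F \<delta> in at_right 0. (0::real) < \<delta>" by (rule eventually_at_right_less)
  ultimately have "\<forall>\<^sub>F \<delta> in at_right 0. h \<delta> > \<Delta> / 2 \<and> \<delta> < min (1/2) c1 \<and> 0 < \<delta>" by eventually_elim simp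
  then obtain \<delta> where \<delta>: "h \<delta> > \<Delta> / 2" "\<delta> < 1/2" "\<delta> < c1" "0 < \<delta>"
    using eventually_happens trivial_limit_at_right_real by fastforce
  have \<tau>': "- \<tau> = 1 \<or> - \<tau> = - 1" using \<tau> by auto
  obtain b1 where b1: "b1 > 0" "\<And>x. x \<in> S \<Longrightarrow> x \<noteq> 0 \<Longrightarrow> norm x < b1 \<Longrightarrow> \<exists>\<tau>\<in>{1, -1}. \<bar>\<tau> * pol_angle x - ray \<tau>\<bar> < \<delta>"
    using sectors[OF \<delta>(4)] by blast
  obtain b2 where b2: "b2 > 0" "\<And>ta tb. ta \<le> tb \<Longrightarrow> exp tb < b2 \<Longrightarrow> \<exists>T. T \<in> sets borel \<and> T \<subseteq> S \<and> {exp ta..exp tb} \<subseteq> norm ` T \<and>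
      (\<forall>x\<in>T. x \<noteq> 0 \<and> \<bar>\<tau> * pol_angle x - ray \<tau>\<bar> < \<delta>)"
    using arcs[OF \<delta>(4) \<tau>] by blast
  obtain b3 where b3: "b3 > 0" "\<And>x. x \<in> \<Omega> \<Longrightarrow> norm x < b3 \<Longrightarrow> - \<tau> * pol_angle x \<le> ray (- \<tau>) + \<delta>"
    using fluid_below_ray[OF \<delta>(4) \<tau>'] by blast
  obtain \<rho> where \<rho>: "\<rho> > 0" "hausdorff1_outer (S \<inter> cball 0 \<rho>) < \<infinity>" using finite_length_near_crest by blast
  \<comment> \<open>The 8 leaves the two source terms at most \<Delta> / 4 together; the other bound
    pushes the term with exp (tb / 2) under the root below \<delta>.\<close>
  obtain tb where tb: "exp tb < min (min (min b1 b2) (min b3 1)) (min \<rho> (- F / 4))"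
      "exp (tb / 2) < min (\<Delta> / (8 * pi * gamma_bound)) (\<delta> / (2 * grad_const * growth_const))"
    using small_scale[of "min (min (min b1 b2) (min b3 1)) (min \<rho> (- F / 4))" "min (\<Delta> / (8 * pi * gamma_bound)) (\<delta> / (2 * grad_const * growth_const))"]
      b1(1) b2(1) b3(1) \<rho>(1) F0 \<Delta> gamma_bound(1) \<delta>(4) grad_const0 growth_const(1) by auto
  \<comment> \<open>156 = 4 * 39: of the rate \<Delta> / 2, the source terms leave \<Delta> / 4 to
    beat 39 \<pi> \<open>growth_const\<close>.\<close>
  define ta where "ta = tb - (1 + 156 * pi * growth_const / \<Delta>)"
  have lb: "log_bump ta tb" using growth_const(1) \<Delta> by unfold_locales (simp add: ta_def)
  interpret log_bump ta tb by fact
  obtain T where T: "T \<in> sets borel" "T \<subseteq> S" "{exp ta..exp tb} \<subseteq> norm ` T" "\<forall>x\<in>T. x \<noteq> 0 \<and> \<bar>\<tau> * pol_angle x - ray \<tau>\<bar> < \<delta>"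
    using b2(2)[of ta tb] log_bump.len[OF lb] tb(1) by auto
  have fin: "hausdorff1_outer (S \<inter> cball 0 (exp tb)) < \<infinity>"
    using tb(1) by (intro le_less_trans[OF hausdorff1_outer_mono \<rho>(2)]) auto
  \<comment> \<open>\<open>f\<close> is 1 on one ray and -1 on the other; \<open>\<phi>\<close> makes up for the negative sign there.\<close>
  define f where "f = cos_mode 1 (\<tau> * ray \<tau>)"
  define \<phi> where "\<phi> s = smooth_step ((- \<tau> * s - (ray (- \<tau>) - 2 * \<delta>)) / \<delta>)" for s
  have one: "(1::real) = 1 \<or> (1::real) = - 1" by simp
  have f1: "f (\<tau> * ray \<tau>) = 1" by (simp add: f_def cos_mode_def)
  have fc: "continuous_on UNIV f" unfolding f_def cos_mode_def[abs_def] by (intro continuous_intros)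
  have \<phi>c: "continuous_on UNIV \<phi>" unfolding \<phi>_def[abs_def] using \<delta>(4) by (intro continuous_intros) auto
  have fp: "1 - 3/2 * \<delta> \<le> f (pol_angle x)" if "\<bar>\<tau> * pol_angle x - ray \<tau>\<bar> < \<delta>" for x
  proof -
    have "\<bar>pol_angle x - \<tau> * ray \<tau>\<bar> < \<delta>" using \<tau> that by (auto simp: abs_minus_commute abs_less_iff)
    then show ?thesis
      using order_trans[OF abs_ge_minus_self cos_mode_facts(4)[OF one, of "\<tau> * ray \<tau>" "pol_angle x" "\<tau> * ray \<tau>"]] f1
      unfolding f_def by simp
  qed
  have P1: "f (pol_angle x) + \<phi> (pol_angle x) \<ge> 1 - 3/2 * \<delta>" if "\<bar>\<tau> * pol_angle x - ray \<tau>\<bar> < \<delta>" for x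
    using fp[OF that] smooth_step_range(1) by (auto simp: \<phi>_def intro: add_increasing2)
  have P2: "f (pol_angle x) + \<phi> (pol_angle x) \<ge> 0" if x: "x \<in> S" "x \<noteq> 0" "norm x < b1" for x
  proof -
    obtain \<tau>' where t': "\<tau>' \<in> {1, -1}" "\<bar>\<tau>' * pol_angle x - ray \<tau>'\<bar> < \<delta>" using b1(2)[OF x] by blast
    show ?thesis
    proof (cases "\<tau>' = \<tau>")
      case True then show ?thesis using P1[of x] t'(2) \<delta>(2) by simp
    next
      case False
      then have "\<tau>' = - \<tau>" using t'(1) \<tau> by auto
      \<comment> \<open>The step starts 2 \<delta> below the ray so as to have reached 1 at distance
        \<delta>, where points of S may already lie.\<close>
      then have "- \<tau> * pol_angle x - (ray (- \<tau>) - 2 * \<delta>) \<ge> \<delta>" using t'(2) by (simp add: abs_less_iff)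
      then have "(- \<tau> * pol_angle x - (ray (- \<tau>) - 2 * \<delta>)) / \<delta> \<ge> 1" using \<delta>(4) by (simp add: le_divide_eq)
      then have "\<phi> (pol_angle x) = 1" using smooth_step_ge1 by (simp add: \<phi>_def)
      then show ?thesis using cos_mode_facts(3)[OF one, of "\<tau> * ray \<tau>" "pol_angle x"] by (simp add: f_def abs_le_iff)
    qed
  qed
  have lower: "(1 - 3/2 * \<delta>) * sqrt (2 * g * (cos (ray \<tau>) - \<delta>)) * ((tb - ta) / 140) \<le> boundary_int (polar_lift crit_bump (cut_angle (\<lambda>s. f s + \<phi> s)))"
  proof (rule boundary_int_test_inequality[OF lb T \<tau>, where b=b1])
    show "\<delta> \<le> cos (ray \<tau>)" using \<delta>(3) by (simp add: c1_def)
    show "continuous_on UNIV (\<lambda>s. f s + \<phi> s)" by (intro continuous_intros fc \<phi>c)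
  qed (use \<delta> tb fin P1 P2 in auto)
  have split: "boundary_int (polar_lift crit_bump (cut_angle (\<lambda>s. f s + \<phi> s))) = boundary_int (polar_lift crit_bump (cut_angle f)) + boundary_int (polar_lift crit_bump (cut_angle \<phi>))"
  proof -
    have int: "integrable hausdorff1 (\<lambda>x. indicat_real S x *\<^sub>R (sqrt (- 2 * g * snd x) * polar_lift crit_bump (cut_angle k) x))"
      if k: "continuous_on UNIV k" for k
    proof (rule boundary_int_integrable[OF _ _ fin])
      interpret l: lift_profile crit_bump "cut_angle k" ta tb by unfold_locales (use crit_bump_supp cut_angle_zero in auto)
      show "continuous_on UNIV (polar_lift crit_bump (cut_angle k))"
        by (intro l.lift_continuous crit_bump_cont) (auto simp: cut_angle_def[abs_def] intro!: continuous_intros k)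
      show "norm x \<le> exp tb" if "polar_lift crit_bump (cut_angle k) x \<noteq> 0" for x using l.lift_support[OF that] by simp
    qed
    have "boundary_int (polar_lift crit_bump (cut_angle (\<lambda>s. f s + \<phi> s))) = (LINT x|hausdorff1. indicat_real S x *\<^sub>R (sqrt (- 2 * g * snd x) * polar_lift crit_bump (cut_angle f) x)
       + indicat_real S x *\<^sub>R (sqrt (- 2 * g * snd x) * polar_lift crit_bump (cut_angle \<phi>) x))"
      unfolding boundary_int_def set_lebesgue_integral_def
      by (intro Bochner_Integration.integral_cong) (auto simp: polar_lift_def cut_angle_def algebra_simps)
    also have "\<dots> = boundary_int (polar_lift crit_bump (cut_angle f)) + boundary_int (polar_lift crit_bump (cut_angle \<phi>))"
      unfolding boundary_int_def set_lebesgue_integral_def by (rule Bochner_Integration.integral_add[OF int[OF fc] int[OF \<phi>c]])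
    finally show ?thesis .
  qed
  have upper1: "boundary_int (polar_lift crit_bump (cut_angle f)) \<le> pi * gamma_bound * exp (tb / 2) * (tb - ta) + pi * (39 * growth_const)"
    unfolding f_def by (rule boundary_int_le_of_mode[OF lb _ cos_mode_facts(1,2,3)[OF one]]) (use tb in simp)
  have upper2: "boundary_int (polar_lift crit_bump (cut_angle \<phi>)) \<le> pi * gamma_bound * exp (tb / 2) * (tb - ta) + 15 * M2 * \<delta> * (tb - ta)
      + sqrt (2 * g * (max 0 (cos (ray (- \<tau>))) + 2 * \<delta>) + 2 * grad_const * growth_const * exp (tb / 2)) * ((tb - ta) / 140)"
    unfolding \<phi>_def[abs_def] M2_def
    by (rule boundary_int_le_of_sector[OF lb _ _ \<tau>' ray_range(1) \<delta>(4)]) (use tb b3(2) in auto)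
  have len0: "0 \<le> tb - ta" using growth_const(1) \<Delta> by (simp add: ta_def)
  have "sqrt (2 * g * (max 0 (cos (ray (- \<tau>))) + 2 * \<delta>) + 2 * grad_const * growth_const * exp (tb / 2)) \<le> sqrt (2 * g * (c2 + 2 * \<delta>) + \<delta>)"
  proof (rule real_sqrt_le_mono)
    have "exp (tb / 2) \<le> \<delta> / (2 * grad_const * growth_const)" using tb(2) by simp
    then have "2 * grad_const * growth_const * exp (tb / 2) \<le> \<delta>" using grad_const0 growth_const(1) by (simp add: le_divide_eq mult.commute)
    then show "2 * g * (max 0 (cos (ray (- \<tau>))) + 2 * \<delta>) + 2 * grad_const * growth_const * exp (tb / 2) \<le> 2 * g * (c2 + 2 * \<delta>) + \<delta>"
      using c(2) by (simp add: c2_def max_def)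
  qed
  then have "sqrt (2 * g * (max 0 (cos (ray (- \<tau>))) + 2 * \<delta>) + 2 * grad_const * growth_const * exp (tb / 2)) * ((tb - ta) / 140)
     \<le> sqrt (2 * g * (c2 + 2 * \<delta>) + \<delta>) * ((tb - ta) / 140)"
    using len0 by (intro mult_right_mono) auto
  note sq = this
  have "h \<delta> * (tb - ta) \<le> 2 * (pi * gamma_bound * exp (tb / 2) * (tb - ta)) + pi * (39 * growth_const)"
  proof -
    have eq: "h \<delta> * (tb - ta) = (1 - 3/2 * \<delta>) * sqrt (2 * g * (c1 - \<delta>)) * ((tb - ta) / 140) - 15 * M2 * \<delta> * (tb - ta)
        - sqrt (2 * g * (c2 + 2 * \<delta>) + \<delta>) * ((tb - ta) / 140)"
      by (simp add: h_def field_simps)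
    show ?thesis unfolding eq using sq lower split upper1 upper2 unfolding c1_def[symmetric] by linarith
  qed
  moreover have "2 * (pi * gamma_bound * exp (tb / 2) * (tb - ta)) \<le> \<Delta> / 4 * (tb - ta)"
  proof -
    have "exp (tb / 2) \<le> \<Delta> / (8 * pi * gamma_bound)" using tb(2) by simp
    then have "2 * (pi * gamma_bound * exp (tb / 2)) \<le> \<Delta> / 4" using gamma_bound(1) by (simp add: field_simps)
    then show ?thesis using mult_right_mono[OF _ len0] by fastforce
  qed
  moreover have "\<Delta> / 2 * (tb - ta) \<le> h \<delta> * (tb - ta)" using \<delta>(1) len0 by (intro mult_right_mono) auto
  ultimately have "\<Delta> * (tb - ta) \<le> 156 * pi * growth_const" by simp
  moreover have "\<Delta> * (tb - ta) = \<Delta> + 156 * pi * growth_const" using \<Delta> by (simp add: ta_def distrib_left)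
  ultimately show False using \<Delta> by linarith
qed

text \<open>With m the bisector of the wedge, the mode has modulus |cos (3/4 (\<theta>p +
  \<theta>m))| on both rays. The argument is at most 3 \<pi>/4, so this vanishes only if the angles
  add up to 2 \<pi>/3.\<close>

theorem angle_dichotomy: "(\<theta>p = pi/3 \<and> \<theta>m = pi/3) \<or> (\<theta>p = pi/2 \<and> \<theta>m = pi/2)"
proof (cases "\<theta>p + \<theta>m = 2 * pi / 3")
  case True
  have "cos \<theta>p = cos \<theta>m" using balanced_case[OF True, of 1] balanced_case[OF True, of "- 1"] by (simp add: ray_def)
  then have "\<theta>p = \<theta>m" using cos_inj_pi[of \<theta>p \<theta>m] \<theta> pi_gt_zero by simp
  then show ?thesis using True by simp
next
  case False
  define c where "c = cos (3/4 * (\<theta>p + \<theta>m))"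
  have c0: "c \<noteq> 0"
  proof
    assume "c = 0"
    then have "cos (3/4 * (\<theta>p + \<theta>m)) = cos (pi/2)" by (simp add: c_def)
    then have "3/4 * (\<theta>p + \<theta>m) = pi/2" by (rule cos_inj_pi[rotated 4]) (use \<theta> pi_gt_zero in auto)
    then show False using False by simp
  qed
  define \<sigma> where "\<sigma> = sgn c"
  have \<sigma>: "\<sigma> = 1 \<or> \<sigma> = - 1" using c0 by (auto simp: \<sigma>_def sgn_if)
  define m where "m = (\<theta>p - \<theta>m) / 2"
  have "cos_mode \<sigma> m \<theta>p = \<bar>c\<bar>" "cos_mode \<sigma> m (- \<theta>m) = \<bar>c\<bar>"
  proof -
    have e1: "3/2 * (\<theta>p - m) = 3/4 * (\<theta>p + \<theta>m)" by (simp add: m_def field_simps)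
    have e2: "3/2 * (- \<theta>m - m) = - (3/4 * (\<theta>p + \<theta>m))" by (simp add: m_def field_simps)
    show "cos_mode \<sigma> m \<theta>p = \<bar>c\<bar>" unfolding cos_mode_def e1 c_def[symmetric] by (simp add: \<sigma>_def sgn_if)
    show "cos_mode \<sigma> m (- \<theta>m) = \<bar>c\<bar>" unfolding cos_mode_def e2 cos_minus c_def[symmetric] by (simp add: \<sigma>_def sgn_if)
  qed
  then have hk: "cos_mode \<sigma> m (ray 1) \<ge> \<bar>c\<bar>" "cos_mode \<sigma> m (- ray (- 1)) \<ge> \<bar>c\<bar>" by (auto simp: ray_def)
  have "cos (ray \<tau>) \<le> 0" if "\<tau> = 1 \<or> \<tau> = - 1" for \<tau>
    by (rule pos_definite_case[OF \<sigma> _ hk that]) (use c0 in simp)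
  then have "cos \<theta>p \<le> 0" "cos \<theta>m \<le> 0" by (force simp: ray_def)+
  moreover have "cos x > 0" if "0 \<le> x" "x < pi/2" for x using that by (intro cos_gt_zero_pi) auto
  ultimately have "\<theta>p = pi/2" "\<theta>m = pi/2" using \<theta> by force+
  then show ?thesis by blast
qed

end

subsection \<open>Excluding a flat crest\<close>

lemma DERIV_pos_part_4: "(f has_real_derivative f') (at x) \<Longrightarrow> ((\<lambda>x. pos_part (f x) ^ 4) has_real_derivative (4 * pos_part (f x) ^ 3 * f')) (at x)"
  using DERIV_chain2[OF DERIV_pos_part_power[of 2]] by (simp add: eval_nat_numeral mult_ac)

text \<open>The angular factor \<open>9 y\<^sup>3 - 4 y\<^sup>4\<close> with \<open>y = cos (k s)\<close> satisfies \<open>f'' \<ge> - (11/5) k\<^sup>2 f\<close> where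
  \<open>y > 0\<close>. Since \<open>(11/5) k\<^sup>2 < (3/2)\<^sup>2\<close> for \<open>k = 1.01\<close>, it yields \<open>C\<^sup>2\<close> subsolutions in a cone of angle
  less than \<open>\<pi>\<close> that decay more slowly than \<open>r\<close> to the power \<open>- 3/2\<close>.\<close>

definition cone_rate :: real where "cone_rate = 101/100"
definition decay_rate :: real where "decay_rate = sqrt (11/5) * cone_rate"

lemma decay_rate_facts: "decay_rate\<^sup>2 = 11/5 * cone_rate\<^sup>2" "0 < decay_rate" "decay_rate < 3/2"
proof -
  show 1: "decay_rate\<^sup>2 = 11/5 * cone_rate\<^sup>2" by (simp add: decay_rate_def power_mult_distrib)
  show "0 < decay_rate" by (simp add: decay_rate_def cone_rate_def)
  \<comment> \<open>11/5 * 1.01^2 = 2.24422, just under 9/4.\<close>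
  have "decay_rate\<^sup>2 < (3/2)\<^sup>2" unfolding 1 by (simp add: cone_rate_def power2_eq_square)
  then show "decay_rate < 3/2" by (rule power2_less_imp_less) simp
qed

definition cone_profile :: "real \<Rightarrow> real" where "cone_profile s = 9 * pos_part (cos (cone_rate * s)) ^ 3 - 4 * pos_part (cos (cone_rate * s)) ^ 4"
definition cone_profile1 :: "real \<Rightarrow> real" where
  "cone_profile1 s = (27 * pos_part (cos (cone_rate * s)) ^ 2 - 16 * pos_part (cos (cone_rate * s)) ^ 3) * (- cone_rate * sin (cone_rate * s))"
definition cone_profile2 :: "real \<Rightarrow> real" where
  "cone_profile2 s = (54 * pos_part (cos (cone_rate * s)) - 48 * pos_part (cos (cone_rate * s)) ^ 2) * (- cone_rate * sin (cone_rate * s)) * (- cone_rate * sin (cone_rate * s))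
     - (27 * pos_part (cos (cone_rate * s)) ^ 2 - 16 * pos_part (cos (cone_rate * s)) ^ 3) * (cone_rate\<^sup>2 * cos (cone_rate * s))"

lemma DERIV_cos_cone_rate: "((\<lambda>s. cos (cone_rate * s)) has_real_derivative (- cone_rate * sin (cone_rate * s))) (at s)"
  by (auto intro!: derivative_eq_intros)

lemma DERIV_sin_cone_rate: "((\<lambda>s. sin (cone_rate * s)) has_real_derivative (cone_rate * cos (cone_rate * s))) (at s)"
  by (auto intro!: derivative_eq_intros)

lemma DERIV_cone_profile: "(cone_profile has_real_derivative cone_profile1 s) (at s)"
  unfolding cone_profile_def[abs_def] cone_profile1_def
  by ((rule DERIV_pos_part_3 DERIV_pos_part_4 DERIV_cos_cone_rate derivative_eq_intros refl)+, simp add: algebra_simps)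

lemma DERIV_cone_profile1: "(cone_profile1 has_real_derivative cone_profile2 s) (at s)"
  unfolding cone_profile1_def[abs_def] cone_profile2_def
  by ((rule DERIV_pos_part_2 DERIV_pos_part_3 DERIV_cos_cone_rate DERIV_sin_cone_rate derivative_eq_intros refl)+, simp add: algebra_simps power2_eq_square)

lemma cone_profile_cont: "continuous_on UNIV cone_profile" "continuous_on UNIV cone_profile1" "continuous_on UNIV cone_profile2"
  unfolding cone_profile_def[abs_def] cone_profile1_def[abs_def] cone_profile2_def[abs_def] by (intro continuous_intros)+

lemma pos_part_cos: "0 \<le> pos_part (cos x)" "pos_part (cos x) \<le> 1" by (auto simp: pos_part_def)

lemma cone_profile_range: "0 \<le> cone_profile s" "cone_profile s \<le> 9"
proof -
  define y where "y = pos_part (cos (cone_rate * s))"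
  have y: "0 \<le> y" "y \<le> 1" unfolding y_def by (rule pos_part_cos)+
  have e: "cone_profile s = y ^ 3 * (9 - 4 * y)" by (simp add: cone_profile_def y_def eval_nat_numeral algebra_simps)
  show "0 \<le> cone_profile s" unfolding e using y by (intro mult_nonneg_nonneg) auto
  have "y ^ 3 * (9 - 4 * y) \<le> 1 * 9" using y by (intro mult_mono power_le_one) auto
  then show "cone_profile s \<le> 9" unfolding e by simp
qed

lemma cone_profile_pos: "cos (cone_rate * s) > 0 \<Longrightarrow> cone_profile s > 0"
proof -
  assume c: "cos (cone_rate * s) > 0"
  have "cone_profile s = cos (cone_rate * s) ^ 3 * (9 - 4 * cos (cone_rate * s))"
    using c by (simp add: cone_profile_def eval_nat_numeral algebra_simps)
  also have "\<dots> > 0"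
  proof (intro mult_pos_pos)
    show "9 - 4 * cos (cone_rate * s) > 0" using cos_le_one[of "cone_rate * s"] by linarith
  qed (use c in auto)
  finally show ?thesis .
qed

lemma cone_profile_zero: "cos (cone_rate * s) \<le> 0 \<Longrightarrow> cone_profile s = 0" by (simp add: cone_profile_def)

text \<open>With sin^2 = 1 - y^2 the expression is k^2 y (1 - y) (54 + 6 y - 276/5 y^2), whose last
  factor is at least 24/5 on [0, 1]. The ratio 11/5 is (27 - 16) / (9 - 4), which puts a root at y =
  1, the axis of the cone.\<close>

lemma cone_profile_subsolution: "cone_profile2 s + decay_rate\<^sup>2 * cone_profile s \<ge> 0"
proof (cases "cos (cone_rate * s) \<le> 0")
  case True then show ?thesis by (simp add: cone_profile2_def cone_profile_def)
next
  case False
  define y where "y = cos (cone_rate * s)"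
  have y: "0 < y" "y \<le> 1" using False by (auto simp: y_def)
  have sin2: "sin (cone_rate * s) * sin (cone_rate * s) = 1 - y\<^sup>2" unfolding y_def using sin_squared_eq[of "cone_rate * s"] by (simp add: power2_eq_square)
  have "cone_profile2 s = cone_rate\<^sup>2 * ((54 * y - 48 * y\<^sup>2) * (sin (cone_rate * s) * sin (cone_rate * s)) - (27 * y\<^sup>2 - 16 * y ^ 3) * y)"
    using y by (simp add: cone_profile2_def flip: y_def) (simp add: algebra_simps power2_eq_square)
  also have "\<dots> = cone_rate\<^sup>2 * ((54 * y - 48 * y\<^sup>2) * (1 - y\<^sup>2) - (27 * y\<^sup>2 - 16 * y ^ 3) * y)" by (simp only: sin2)
  finally have "cone_profile2 s + decay_rate\<^sup>2 * cone_profile s = cone_rate\<^sup>2 * ((54 * y - 48 * y\<^sup>2) * (1 - y\<^sup>2) - (27 * y\<^sup>2 - 16 * y ^ 3) * y + 11/5 * (9 * y ^ 3 - 4 * y ^ 4))"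
    using y unfolding decay_rate_facts(1) by (simp add: cone_profile_def flip: y_def) (simp add: algebra_simps)
  also have "(54 * y - 48 * y\<^sup>2) * (1 - y\<^sup>2) - (27 * y\<^sup>2 - 16 * y ^ 3) * y + 11/5 * (9 * y ^ 3 - 4 * y ^ 4)
     = y * ((1 - y) * (54 + 6 * y - 276/5 * y\<^sup>2))"
    by (simp add: eval_nat_numeral field_simps)
  also have "cone_rate\<^sup>2 * (y * ((1 - y) * (54 + 6 * y - 276/5 * y\<^sup>2))) \<ge> 0"
  proof (intro mult_nonneg_nonneg)
    have "y\<^sup>2 \<le> y" using y by (simp add: power2_eq_square mult_left_le)
    then show "0 \<le> 54 + 6 * y - 276/5 * y\<^sup>2" using y by linarith
  qed (use y in auto)
  finally show ?thesis .
qed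

text \<open>The cosine of the half-angle of the cone on which \<open>cone_profile\<close> is
  positive. As \<open>cone_rate\<close> > 1, this cone lies strictly inside the lower half
  plane.\<close>

definition cone_cos :: real where "cone_cos = cos (pi / (2 * cone_rate))"

lemma cone_cos_pos: "cone_cos > 0"
  unfolding cone_cos_def by (rule cos_gt_zero_pi) (use pi_gt_zero in \<open>auto simp: cone_rate_def field_simps\<close>)

text \<open>The bound |s| \<le> \<pi> excludes further arcs with cos (k s) > 0, because k \<pi> < 3
  \<pi>/2.\<close>

lemma cone_angle:
  assumes "\<bar>s\<bar> \<le> pi"
  shows "cos (cone_rate * s) > 0 \<Longrightarrow> cone_cos \<le> cos s" and "cone_cos < cos s \<Longrightarrow> cos (cone_rate * s) > 0"
proof -
  have kkp: "cone_rate > 0" by (simp add: cone_rate_def)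
  have half: "0 \<le> pi / (2 * cone_rate)" "pi / (2 * cone_rate) \<le> pi" using pi_gt_zero by (auto simp: cone_rate_def field_simps)
  show "cone_cos \<le> cos s" if c: "cos (cone_rate * s) > 0"
  proof (rule ccontr)
    assume "\<not> cone_cos \<le> cos s"
    then have n: "cos \<bar>s\<bar> < cos (pi / (2 * cone_rate))" by (simp add: cone_cos_def)
    have "pi / (2 * cone_rate) < \<bar>s\<bar>"
      using n cos_monotone_0_pi_le[of "\<bar>s\<bar>" "pi / (2 * cone_rate)"] half by linarith
    then have "pi / 2 < cone_rate * \<bar>s\<bar>" using kkp by (simp add: field_simps)
    moreover have "cone_rate * \<bar>s\<bar> \<le> 3 * pi / 2" using mult_left_mono[OF assms, of cone_rate] pi_gt_zero by (simp add: cone_rate_def)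
    ultimately have "cos (cone_rate * \<bar>s\<bar> - pi) \<ge> 0" by (intro cos_ge_zero) auto
    then have "cos (cone_rate * \<bar>s\<bar>) \<le> 0" by (simp add: cos_diff)
    moreover have "cos (cone_rate * \<bar>s\<bar>) = cos (cone_rate * s)" by (cases "s \<ge> 0") auto
    ultimately show False using c by simp
  qed
  show "cos (cone_rate * s) > 0" if c: "cone_cos < cos s"
  proof -
    have "\<bar>s\<bar> < pi / (2 * cone_rate)"
    proof (rule ccontr)
      assume "\<not> \<bar>s\<bar> < pi / (2 * cone_rate)"
      then have "cos \<bar>s\<bar> \<le> cone_cos" unfolding cone_cos_def using half assms by (intro cos_monotone_0_pi_le) auto
      then show False using c by simp
    qed
    then have "\<bar>cone_rate * s\<bar> < pi / 2" using kkp by (simp add: abs_mult field_simps)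
    then show ?thesis by (intro cos_gt_zero_pi) auto
  qed
qed

context log_bump
begin

text \<open>The analogue of \<open>crit_bump\<close> with r to the power -
  \<open>decay_rate\<close>.\<close>

definition "sub_bump t = exp (- decay_rate * t) * bump t"
definition "sub_bump1 t = exp (- decay_rate * t) * (bump1 t - decay_rate * bump t)"
definition "sub_bump2 t = exp (- decay_rate * t) * (bump2 t - 2 * decay_rate * bump1 t + decay_rate\<^sup>2 * bump t)"

lemma DERIV_sub_bump: "(sub_bump has_real_derivative sub_bump1 t) (at t)"
  unfolding sub_bump_def[abs_def] sub_bump1_def
  by (auto intro!: derivative_eq_intros DERIV_bump simp: algebra_simps)

lemma DERIV_sub_bump1: "(sub_bump1 has_real_derivative sub_bump2 t) (at t)"
  unfolding sub_bump1_def[abs_def] sub_bump2_def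
  by (auto intro!: derivative_eq_intros DERIV_bump DERIV_bump1 simp: algebra_simps power2_eq_square)

lemma sub_bump_cont: "continuous_on UNIV sub_bump" "continuous_on UNIV sub_bump1" "continuous_on UNIV sub_bump2"
  unfolding sub_bump_def[abs_def] sub_bump1_def[abs_def] sub_bump2_def[abs_def] by (intro continuous_intros)+

lemma sub_bump_supp: "sub_bump t \<noteq> 0 \<Longrightarrow> ta \<le> t \<and> t \<le> tb" "sub_bump1 t \<noteq> 0 \<Longrightarrow> ta \<le> t \<and> t \<le> tb"
    "sub_bump2 t \<noteq> 0 \<Longrightarrow> ta \<le> t \<and> t \<le> tb"
  using bump_out[of t] by (cases "t \<in> {ta..tb}"; simp add: sub_bump_def sub_bump1_def sub_bump2_def)+

lemma lift_C2_q: "lift_C2 sub_bump (cut_angle cone_profile) ta tb sub_bump1 (cut_angle1 cone_profile cone_profile1) sub_bump2 (cut_angle2 cone_profile cone_profile1 cone_profile2)"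
  by unfold_locales
     (use sub_bump_supp sub_bump_cont DERIV_sub_bump DERIV_sub_bump1 DERIV_cut_angle[OF DERIV_cone_profile] DERIV_cut_angle1[OF DERIV_cone_profile DERIV_cone_profile1] cut_angle_zero
       continuous_cut_angle[OF cone_profile_cont(1,2)] continuous_cut_angle2[OF cone_profile_cont] in auto)

text \<open>As \<open>\<Lambda> \<rightarrow> \<infinity>\<close>, \<open>\<Lambda>\<^sup>3 bump\<close> tends to \<open>\<tau>\<^sup>3\<close> with \<open>\<tau> = tb - t\<close>, for which the expression is \<open>6 \<tau> + 6 decay_rate \<tau>\<^sup>2\<close>.\<close>

lemma bump_supersolution:
  assumes big: "\<Lambda> \<ge> 100"
  shows "\<Lambda> ^ 3 * (bump2 t - 2 * decay_rate * bump1 t) \<ge>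
    5 * indicator {tb - 2..tb - 1} t - (18 * (tb - t) ^ 2 + 9 * (tb - t) ^ 3) * indicator {ta..tb} t / \<Lambda>"
proof (cases "t \<in> {ta..tb}")
  case False
  then have "t \<notin> {tb - 2..tb - 1}" using big by (auto simp: \<Lambda>_def)
  then show ?thesis using False bump_out[OF False] by simp
next
  case True
  define x \<tau> where "x = w t" and "\<tau> = tb - t"
  have x: "0 \<le> x" "x \<le> 1" using w_range[OF True] by (auto simp: x_def)
  have \<tau>: "\<tau> \<ge> 0" using True by (simp add: \<tau>_def)
  have L0: "\<Lambda> > 0" using big by simp
  \<comment> \<open>Each power of 1 - w contributes \<tau> / \<Lambda>; together with the \<Lambda>
    in the denominators of the derivatives this absorbs \<Lambda>^3 in the leading terms.\<close>
  have x1: "1 - w t = \<tau> / \<Lambda>" using L0 by (simp add: w_def \<tau>_def \<Lambda>_def field_simps)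
  have h2: "\<Lambda> ^ 3 * bump2 t = 6 * x * \<tau> ^ 3 / \<Lambda>\<^sup>2 - 18 * x\<^sup>2 * \<tau>\<^sup>2 / \<Lambda> + 6 * x ^ 3 * \<tau>"
    unfolding bump2_def x1 using x \<tau> L0 by (simp add: x_def[symmetric]) (simp add: eval_nat_numeral field_simps)
  have h1: "\<Lambda> ^ 3 * bump1 t = 3 * x\<^sup>2 * \<tau> ^ 3 / \<Lambda> - 3 * x ^ 3 * \<tau>\<^sup>2"
    unfolding bump1_def x1 using x \<tau> L0 by (simp add: x_def[symmetric]) (simp add: eval_nat_numeral field_simps)
  have E1: "\<Lambda> ^ 3 * (bump2 t - 2 * decay_rate * bump1 t) = \<Lambda> ^ 3 * bump2 t - 2 * decay_rate * (\<Lambda> ^ 3 * bump1 t)" by (simp add: algebra_simps)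
  have E2: "\<Lambda> ^ 3 * bump2 t - 2 * decay_rate * (\<Lambda> ^ 3 * bump1 t) = 6 * x * \<tau> ^ 3 / \<Lambda>\<^sup>2 + 6 * decay_rate * x ^ 3 * \<tau>\<^sup>2 + 6 * x ^ 3 * \<tau> - (x\<^sup>2 * (18 * \<tau>\<^sup>2) + x\<^sup>2 * (6 * decay_rate * \<tau> ^ 3)) / \<Lambda>"
    unfolding h1 h2 by (simp add: add_divide_distrib algebra_simps)
  have "\<Lambda> ^ 3 * (bump2 t - 2 * decay_rate * bump1 t) \<ge> 6 * x ^ 3 * \<tau> - (18 * \<tau>\<^sup>2 + 9 * \<tau> ^ 3) / \<Lambda>"
  proof -
    have xx: "x\<^sup>2 \<le> 1" using x by (simp add: power_le_one)
    have "x\<^sup>2 * (18 * \<tau>\<^sup>2) \<le> 1 * (18 * \<tau>\<^sup>2)" using xx by (intro mult_right_mono) auto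
    \<comment> \<open>6 * \<open>decay_rate\<close> < 9.\<close>
    moreover have "x\<^sup>2 * (6 * decay_rate * \<tau> ^ 3) \<le> 1 * (9 * \<tau> ^ 3)"
      using xx \<tau> decay_rate_facts by (intro mult_mono mult_right_mono) auto
    ultimately have "(x\<^sup>2 * (18 * \<tau>\<^sup>2) + x\<^sup>2 * (6 * decay_rate * \<tau> ^ 3)) / \<Lambda> \<le> (18 * \<tau>\<^sup>2 + 9 * \<tau> ^ 3) / \<Lambda>"
      using L0 by (intro divide_right_mono) linarith+
    moreover have "0 \<le> 6 * x * \<tau> ^ 3 / \<Lambda>\<^sup>2 + 6 * decay_rate * x ^ 3 * \<tau>\<^sup>2" using x \<tau> decay_rate_facts by auto
    ultimately show ?thesis unfolding E1 E2 by linarith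
  qed
  moreover have "6 * x ^ 3 * \<tau> \<ge> 5 * indicator {tb - 2..tb - 1} t"
  proof (cases "t \<in> {tb - 2..tb - 1}")
    \<comment> \<open>Here x \<ge> 98/100 and \<tau> \<ge> 1, so the term is at least 6 * 9/10 >
      5.\<close>
    case True
    then have t: "1 \<le> \<tau>" "\<tau> \<le> 2" by (auto simp: \<tau>_def)
    have "\<tau> / \<Lambda> \<le> 2 / 100" using t big by (intro frac_le) auto
    then have "x \<ge> 98/100" using x1 unfolding x_def by linarith
    then have "x ^ 3 \<ge> (98/100) ^ 3" by (intro power_mono) auto
    then have "x ^ 3 \<ge> 9/10" by (simp add: power3_eq_cube)
    then have "x ^ 3 * \<tau> \<ge> 9/10 * 1" using t x by (intro mult_mono) auto
    then show ?thesis using True by simp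
  qed (use x \<tau> in auto)
  ultimately show ?thesis using True by (simp add: \<tau>_def)
qed

end

text \<open>Half of the exponential is spent on the polynomial, through x^2 / 2 \<le> e^x and x^3 /
  6 \<le> e^x for x = \<mu> \<tau> / 2; the other half stays integrable.\<close>

lemma exp_beats_cube:
  fixes \<mu> \<tau> :: real
  assumes "\<mu> > 0" "\<tau> \<ge> 0"
  shows "(18 * \<tau> ^ 2 + 9 * \<tau> ^ 3) * exp (- \<mu> * \<tau>) \<le> (144 / \<mu>\<^sup>2 + 432 / \<mu> ^ 3) * exp (- (\<mu> / 2) * \<tau>)"
proof -
  define x where "x = \<mu> * \<tau> / 2"
  have x: "x \<ge> 0" using assms by (simp add: x_def)
  have t: "\<tau> = 2 * x / \<mu>" using assms by (simp add: x_def)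
  have e2: "x\<^sup>2 / 2 \<le> exp x" using exp_lower_Taylor_quadratic[OF x] x by simp
  have e3: "x ^ 3 / 6 \<le> exp x"
  proof -
    have "(\<Sum>k\<in>{3}. x ^ k /\<^sub>R fact k) \<le> (\<Sum>k. x ^ k /\<^sub>R fact k)"
      by (rule sum_le_suminf) (use x summable_exp[of x] in \<open>auto simp: divide_inverse mult.commute\<close>)
    then show ?thesis by (simp add: exp_def fact_numeral field_simps)
  qed
  have "18 * \<tau> ^ 2 + 9 * \<tau> ^ 3 = 144 / \<mu>\<^sup>2 * (x\<^sup>2 / 2) + 432 / \<mu> ^ 3 * (x ^ 3 / 6)"
    unfolding t by (simp add: power_divide power_mult_distrib)
  also have "\<dots> \<le> 144 / \<mu>\<^sup>2 * exp x + 432 / \<mu> ^ 3 * exp x"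
    using e2 e3 assms by (intro add_mono mult_left_mono) auto
  finally have "(18 * \<tau> ^ 2 + 9 * \<tau> ^ 3) * exp (- \<mu> * \<tau>) \<le> ((144 / \<mu>\<^sup>2 + 432 / \<mu> ^ 3) * exp x) * exp (- \<mu> * \<tau>)"
    by (intro mult_right_mono) (auto simp: distrib_right)
  also have "\<dots> = (144 / \<mu>\<^sup>2 + 432 / \<mu> ^ 3) * exp (- (\<mu> / 2) * \<tau>)"
  proof -
    have "exp x * exp (- \<mu> * \<tau>) = exp (- (\<mu> / 2) * \<tau>)" by (simp add: x_def flip: exp_add)
    then show ?thesis by (simp only: mult.assoc)
  qed
  finally show ?thesis .
qed

context wave
begin

text \<open>By periodicity the lowest point over one compact period is the lowest of all. This
  leaves a strip above the bottom that is free of S.\<close>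

lemma S_above_strip: "\<exists>m>F. \<forall>x\<in>S. m \<le> snd x"
proof -
  have "periodic_curve L S" using weak by (simp add: weak_solution_def)
  then obtain c :: "real \<Rightarrow> real \<times> real" and P :: real where c: "continuous_on UNIV c" "range c = S" "P > 0" "\<And>s. c (s + P) = c s + (2 * L, 0)"
    unfolding periodic_curve_def
  proof (elim exE conjE, goal_cases)
    case (1 c P) then show ?case using 1(1)[of c P] by blast
  qed
  have per: "snd (c (s + real n * P)) = snd (c s)" for s n
  proof (induction n)
    case (Suc n)
    have "c (s + real (Suc n) * P) = c (s + real n * P) + (2 * L, 0)" using c(4)[of "s + real n * P"] by (simp add: algebra_simps)
    then show ?case using Suc by simp
  qed simp
  have "continuous_on {0..P} (\<lambda>s. snd (c s))" by (intro continuous_intros continuous_on_subset[OF c(1)]) simp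
  moreover have "{0..P} \<noteq> {}" using c(3) by simp
  ultimately obtain t where t: "t \<in> {0..P}" "\<And>s. s \<in> {0..P} \<Longrightarrow> snd (c t) \<le> snd (c s)"
    using continuous_attains_inf[OF compact_Icc] by blast
  have "snd (c t) \<le> snd (c s)" for s
  proof -
    define n where "n = \<lfloor>s / P\<rfloor>"
    have "of_int n \<le> s / P" "s / P < of_int n + 1" by (auto simp: n_def)
    then have n: "of_int n * P \<le> s" "s < (of_int n + 1) * P" using c(3) by (simp_all add: field_simps)
    define r where "r = s - of_int n * P"
    have r: "r \<in> {0..P}" using n by (auto simp: r_def algebra_simps)
    have "snd (c s) = snd (c r)"
    proof (cases "n \<ge> 0")
      case True
      then have "s = r + real (nat n) * P" by (simp add: r_def)
      then show ?thesis using per[of r "nat n"] by simp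
    next
      case False
      then have "r = s + real (nat (- n)) * P" by (simp add: r_def)
      then show ?thesis using per[of s "nat (- n)"] by simp
    qed
    then show ?thesis using t(2)[OF r] by simp
  qed
  then have "\<forall>x\<in>S. snd (c t) \<le> snd x" using c(2) by blast
  moreover have "snd (c t) > F" using S_above c(2) by blast
  ultimately show ?thesis by blast
qed

end

section \<open>The fluid below a flat crest\<close>

context crest
begin

text \<open>As u is monotone, a second point with u = 0 would make u vanish in between, so S would
  leave the crest vertically, at angle 0 instead of \<pi>/2.\<close>

lemma S_on_axis:
  assumes flat: "\<theta>p = pi/2" "\<theta>m = pi/2" and x: "x \<in> S" "fst x = 0"
  shows "x = 0"
proof (rule ccontr)
  assume "x \<noteq> 0"
  obtain s where s: "x = p s" using S_cases x(1) by blast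
  then have "s \<noteq> 0" "u s = 0" using \<open>x \<noteq> 0\<close> p_0 x(2) by (auto simp: p_def)
  define \<tau> where "\<tau> = sgn s"
  have \<tau>: "\<tau> = 1 \<or> \<tau> = - 1" "\<tau> * \<bar>s\<bar> = s" using \<open>s \<noteq> 0\<close> by (auto simp: \<tau>_def sgn_if)
  obtain \<eta> where \<eta>: "\<eta> > 0" "\<And>r. 0 < r \<Longrightarrow> r < \<eta> \<Longrightarrow> \<bar>\<tau> * pol_angle (p (\<tau> * r)) - ray \<tau>\<bar> < pi/2"
    using angle_near[OF _ \<tau>(1), of "pi/2"] pi_gt_zero by auto
  define r where "r = min (\<eta>/2) \<bar>s\<bar>"
  have r: "0 < r" "r < \<eta>" "r \<le> \<bar>s\<bar>" using \<eta>(1) \<open>s \<noteq> 0\<close> by (auto simp: r_def)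
  have "u (\<tau> * r) = 0"
  proof (cases "s > 0")
    case True
    then have "0 \<le> \<tau> * r" "\<tau> * r \<le> s" using r by (auto simp: \<tau>_def)
    then have "u 0 \<le> u (\<tau> * r)" "u (\<tau> * r) \<le> u s" using mono_u by (auto simp: mono_def)
    then show ?thesis using \<open>u s = 0\<close> p0 by simp
  next
    case False
    then have "\<tau> * r \<le> 0" "s \<le> \<tau> * r" using r \<open>s \<noteq> 0\<close> by (auto simp: \<tau>_def)
    then have "u (\<tau> * r) \<le> u 0" "u s \<le> u (\<tau> * r)" using mono_u by (auto simp: mono_def)
    then show ?thesis using \<open>u s = 0\<close> p0 by simp
  qed
  define y where "y = p (\<tau> * r)"
  have y: "fst y = 0" using \<open>u (\<tau> * r) = 0\<close> by (simp add: y_def p_def)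
  have "y \<noteq> 0" using p_eq_0_iff[of "\<tau> * r"] \<tau>(1) r by (auto simp: y_def)
  moreover have "snd y \<le> 0" unfolding y_def by (rule S_nonpos[OF p_S])
  ultimately have "snd y < 0" using y by (cases y) (auto simp: zero_prod_def)
  then have "pol_angle y = 0" using y by (simp add: pol_angle_arctan)
  moreover have "ray \<tau> = pi/2" unfolding ray_def using flat by simp
  ultimately show False using \<eta>(2)[OF r(1,2)] by (simp add: y_def)
qed

text \<open>The strip between the bottom and the lowest level of S misses the frontier and contains
  points of \<Omega> close to (0, F), so it lies in \<Omega>; from there the axis runs up to the
  crest without meeting the frontier.\<close>

lemma axis_in_fluid:
  assumes flat: "\<theta>p = pi/2" "\<theta>m = pi/2" and Y: "F < Y" "Y < 0"
  shows "(0, Y) \<in> \<Omega>"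
proof -
  obtain m where m: "m > F" "\<And>x. x \<in> S \<Longrightarrow> m \<le> snd x" using S_above_strip by blast
  have m0: "m \<le> 0" using m(2)[OF zero_S] by simp
  define Z where "Z = {x :: real \<times> real. F < snd x \<and> snd x < m}"
  have cZ: "connected Z"
  proof (rule convex_connected)
    have "Z = {x. (0, 1) \<bullet> x > F} \<inter> {x. (0, 1) \<bullet> x < m}" by (auto simp: Z_def inner_prod_def)
    then show "convex Z" by (simp add: convex_Int convex_halfspace_gt convex_halfspace_lt)
  qed
  have "Z \<inter> frontier \<Omega> = {}" using m(2) unfolding fd(4) by (force simp: Z_def bottom_def)
  moreover have "Z \<inter> \<Omega> \<noteq> {}"
  proof -
    have "(0, F) \<in> closure \<Omega>" using fd(4) by (auto simp: frontier_def bottom_def)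
    then obtain y where y: "y \<in> \<Omega>" "dist y (0, F) < m - F"
      using m(1) unfolding closure_approachable by (metis diff_gt_0_iff_gt)
    have "\<bar>snd y - F\<bar> \<le> dist y (0, F)" using norm_snd_le[of "snd y - F" "fst y"] by (cases y) (simp add: dist_norm)
    then have "snd y < m" using y(2) by linarith
    moreover have "F < snd y" using fd(3) y(1) by (auto simp: upper_half_plane_def)
    ultimately show ?thesis using y(1) by (auto simp: Z_def)
  qed
  ultimately have ZO: "Z \<subseteq> \<Omega>" using connected_Int_frontier[OF cZ] by blast
  define V where "V = (\<lambda>y. (0::real, y)) ` {F<..<0}"
  have cV: "connected V" unfolding V_def by (intro connected_continuous_image continuous_intros) simp
  have "V \<inter> frontier \<Omega> = {}"
    using S_on_axis[OF flat] unfolding fd(4) by (force simp: V_def bottom_def zero_prod_def)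
  moreover have "(0, (F + m) / 2) \<in> V \<inter> Z" using m(1) m0 F0 by (auto simp: V_def Z_def)
  then have "V \<inter> \<Omega> \<noteq> {}" using ZO by blast
  ultimately have "V \<subseteq> \<Omega>" using connected_Int_frontier[OF cV] by blast
  then show ?thesis using Y by (auto simp: V_def)
qed

text \<open>The truncated cone is convex and misses S, whose angles are close to \<pi>/2; it meets
  \<Omega> on the axis, hence lies in it.\<close>

lemma cone_in_fluid:
  assumes flat: "\<theta>p = pi/2" "\<theta>m = pi/2" and \<sigma>: "\<sigma> > 0" "\<sigma> \<le> 1"
  obtains b where "b > 0" "\<And>x. x \<noteq> 0 \<Longrightarrow> norm x < b \<Longrightarrow> \<sigma> * norm x \<le> - snd x \<Longrightarrow> x \<in> \<Omega>"
proof -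
  obtain b0 where b0: "b0 > 0" "\<And>x. x \<in> S \<Longrightarrow> x \<noteq> 0 \<Longrightarrow> norm x < b0 \<Longrightarrow> \<exists>\<tau>\<in>{1, -1}. \<bar>\<tau> * pol_angle x - ray \<tau>\<bar> < \<sigma>"
    using sectors[OF \<sigma>(1)] by blast
  define b where "b = min b0 (- F)"
  have b: "b > 0" using b0(1) F0 by (simp add: b_def)
  define C where "C = ball (0 :: real\<times>real) b \<inter> {x. \<sigma> * norm x \<le> - snd x} \<inter> {x. snd x < 0}"
  have "convex {x :: real\<times>real. \<sigma> * norm x \<le> - snd x}"
  proof (rule convexI)
    fix x y :: "real\<times>real" and a c :: real
    assume xy: "x \<in> {x. \<sigma> * norm x \<le> - snd x}" "y \<in> {x. \<sigma> * norm x \<le> - snd x}" and ac: "0 \<le> a" "0 \<le> c" "a + c = 1"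
    have "\<sigma> * norm (a *\<^sub>R x + c *\<^sub>R y) \<le> \<sigma> * (a * norm x + c * norm y)"
      using \<sigma>(1) ac norm_triangle_ineq[of "a *\<^sub>R x" "c *\<^sub>R y"] by (intro mult_left_mono) auto
    also have "\<dots> = a * (\<sigma> * norm x) + c * (\<sigma> * norm y)" by (simp add: algebra_simps)
    also have "\<dots> \<le> a * (- snd x) + c * (- snd y)" using xy ac by (intro add_mono mult_left_mono) auto
    finally show "a *\<^sub>R x + c *\<^sub>R y \<in> {x. \<sigma> * norm x \<le> - snd x}" by simp
  qed
  moreover have "convex {x :: real\<times>real. snd x < 0}"
    using convex_halfspace_lt[of "(0::real, 1::real)" 0] by (simp add: inner_prod_def)
  ultimately have cC: "connected C" unfolding C_def by (intro convex_connected convex_Int convex_ball)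
  have "C \<inter> frontier \<Omega> = {}"
  proof (rule ccontr)
    assume "C \<inter> frontier \<Omega> \<noteq> {}"
    then obtain x where x: "x \<in> C" "x \<in> frontier \<Omega>" by blast
    have nx: "norm x < b" "x \<noteq> 0" "\<sigma> * norm x \<le> - snd x" using x(1) by (auto simp: C_def)
    have "\<bar>snd x\<bar> \<le> norm x" using norm_snd_le[of "snd x" "fst x"] by simp
    moreover have "norm x < - F" using nx(1) by (simp add: b_def)
    ultimately have "snd x > F" by linarith
    then have xS: "x \<in> S" using x(2) unfolding fd(4) by (auto simp: bottom_def)
    obtain \<tau> where \<tau>: "\<tau> \<in> {1, -1}" "\<bar>\<tau> * pol_angle x - ray \<tau>\<bar> < \<sigma>"
      using b0(2)[OF xS nx(2)] nx(1) unfolding b_def by (meson min_less_iff_conj)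
    have "ray \<tau> = pi/2" unfolding ray_def using flat by simp
    then have "\<bar>cos (\<tau> * pol_angle x) - cos (pi/2)\<bar> < \<sigma>" using abs_cos_diff_le[of "\<tau> * pol_angle x" "pi/2"] \<tau>(2) by simp
    moreover have "cos (\<tau> * pol_angle x) = cos (pol_angle x)" using \<tau>(1) by auto
    ultimately have "cos (pol_angle x) < \<sigma>" by simp
    then have "norm x * cos (pol_angle x) < norm x * \<sigma>" using nx(2) by (intro mult_strict_left_mono) auto
    then show False using nx(3) snd_polar[OF nx(2)] by (simp add: mult.commute)
  qed
  moreover have "C \<inter> \<Omega> \<noteq> {}"
  proof -
    have "(0, - b / 2) \<in> \<Omega>" by (rule axis_in_fluid[OF flat]) (use b F0 in \<open>auto simp: b_def min_def\<close>)
    moreover have "(0, - b / 2) \<in> C" using b \<sigma> by (auto simp: C_def norm_Pair mult_left_le_one_le)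
    ultimately show ?thesis by blast
  qed
  ultimately have "C \<subseteq> \<Omega>" using connected_Int_frontier[OF cC] by blast
  then show ?thesis
  proof (intro that[OF b])
    fix x :: "real\<times>real" assume "C \<subseteq> \<Omega>" and x: "x \<noteq> 0" "norm x < b" "\<sigma> * norm x \<le> - snd x"
    have "\<sigma> * norm x > 0" using \<sigma>(1) x(1) by simp
    then have "x \<in> C" using x by (auto simp: C_def)
    then show "x \<in> \<Omega>" using \<open>C \<subseteq> \<Omega>\<close> by blast
  qed
qed

text \<open>\<Psi> r^(- \<open>decay_rate\<close>) \<open>cone_profile\<close> as a density for dt
  ds, written as one for dX dY. The angle appears as an arctangent, which makes measurability
  evident.\<close>

definition rad_density :: "real \<times> real \<Rightarrow> real" where
  "rad_density x = (if snd x < 0 then \<Psi> x * exp (- decay_rate * ln (norm x)) * cone_profile (arctan (fst x / (- snd x))) / (norm x)\<^sup>2 else 0)"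

lemma rad_density_measurable [measurable]: "rad_density \<in> borel_measurable borel"
proof -
  have [measurable]: "{x::real\<times>real. snd x < 0} \<in> sets borel" by (intro borel_open open_Collect_less continuous_intros)
  have [measurable]: "(fst :: real\<times>real \<Rightarrow> real) \<in> borel_measurable borel" "(snd :: real\<times>real \<Rightarrow> real) \<in> borel_measurable borel"
    by (intro borel_measurable_continuous_onI continuous_intros)+
  have [measurable]: "cone_profile \<in> borel_measurable borel" by (rule borel_measurable_continuous_onI[OF cone_profile_cont(1)])
  show ?thesis unfolding rad_density_def[abs_def] by measurable
qed

lemma rad_density_nonneg: "rad_density x \<ge> 0"
  using \<Psi>_nonneg cone_profile_range by (auto simp: rad_density_def)

text \<open>As \<Psi> = O(r^(3/2)) and 3/2 - \<open>decay_rate\<close> > 0, the density is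
  integrable towards the crest; this is the gain from a rate below 3/2.\<close>

lemma rad_density_bound:
  assumes "snd x < 0" "norm x < - F / 4"
  shows "rad_density x \<le> 9 * growth_const * exp ((3/2 - decay_rate) * ln (norm x)) / (norm x)\<^sup>2"
proof -
  have n0: "norm x > 0" using assms(1) by auto
  define t where "t = ln (norm x)"
  have "\<Psi> x * exp (- decay_rate * t) * cone_profile (arctan (fst x / (- snd x))) \<le> (growth_const * (norm x * sqrt (norm x))) * exp (- decay_rate * t) * 9"
    using growth_const(2)[OF assms(2)] growth_const(1) cone_profile_range by (intro mult_mono) auto
  also have "norm x * sqrt (norm x) = exp (3/2 * t)"
  proof -
    have "norm x * sqrt (norm x) = exp t * exp (t / 2)" using exp_ln_powers(2)[OF n0] n0 by (simp add: t_def)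
    then show ?thesis by (simp flip: exp_add)
  qed
  also have "(growth_const * exp (3/2 * t)) * exp (- decay_rate * t) * 9 = 9 * growth_const * exp ((3/2 - decay_rate) * t)"
  proof -
    have "exp (3/2 * t) * exp (- decay_rate * t) = exp ((3/2 - decay_rate) * t)" by (simp add: left_diff_distrib flip: exp_add)
    then show ?thesis by (simp add: mult_ac)
  qed
  finally show ?thesis using assms(1) by (simp add: rad_density_def t_def divide_right_mono)
qed

text \<open>The outer scale tb stays fixed while the bump is stretched towards the crest. As
  \<gamma>(\<psi>) \<ge> 0 there, the integral of \<Psi> times the Laplacian of the test function is
  at most 0. After scaling by \<Lambda>^3 the integrand is positive in a fixed annulus, up to an
  error whose integral is O(1 / \<Lambda>); in the limit \<Psi> vanishes on a piece of the
  cone.\<close>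

theorem flat_crest_impossible:
  assumes flat: "\<theta>p = pi/2" "\<theta>m = pi/2"
    and \<psi>Y: "\<forall>x\<in>\<Omega>. snd (grad \<psi> x) < 0"
    and \<gamma>0: "0 < \<delta>" "\<delta> \<le> B" "\<And>r. r \<in> {0..\<delta>} \<Longrightarrow> \<gamma> r \<ge> 0"
  shows False
proof -
  have sig1: "cone_cos \<le> 1" by (simp add: cone_cos_def)
  obtain b where b: "b > 0" "\<And>x. x \<noteq> 0 \<Longrightarrow> norm x < b \<Longrightarrow> cone_cos * norm x \<le> - snd x \<Longrightarrow> x \<in> \<Omega>"
    using cone_in_fluid[OF flat cone_cos_pos sig1] by blast
  \<comment> \<open>exp tb < 1 and exp tb < \<delta> / \<open>growth_const\<close> give \<psi> \<le>
    \<delta> on the support of the test function, where \<gamma>(\<psi>) \<ge> 0.\<close>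
  obtain tb where tb: "exp tb < min (min b (- F / 4)) (min 1 (\<delta> / growth_const))"
    using small_scale[of "min (min b (- F / 4)) (min 1 (\<delta> / growth_const))" 1] b(1) F0 \<gamma>0(1) growth_const(1) by auto
  have tb0: "tb < 0" using tb by simp
  have r1: "norm x < - F / 4" "norm x < b" "norm x \<le> 1" if "norm x \<le> exp tb" for x :: "real\<times>real"
    using that tb by (simp_all, linarith+)
  define \<mu> where "\<mu> = 3/2 - decay_rate"
  have \<mu>: "\<mu> > 0" using decay_rate_facts by (simp add: \<mu>_def)
  define D where "D = 9 * growth_const * (144 / \<mu>\<^sup>2 + 432 / \<mu> ^ 3)"
  have D0: "D > 0" using growth_const(1) \<mu> by (auto simp: D_def intro!: mult_pos_pos add_pos_pos)
  \<comment> \<open>The annulus on which \<open>bump_supersolution\<close> has its positive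
    term.\<close>
  define E where "E = {x::real\<times>real. ln (norm x) \<in> {tb - 2..tb - 1}}"
  have [measurable]: "E \<in> sets borel" unfolding E_def by measurable
  define Q where "Q = (LINT x|lborel. rad_density x * indicator E x)"
  have lnle: "norm x \<le> exp tb" if "ln (norm x) \<le> tb" "snd x < 0" for x :: "real\<times>real"
  proof -
    have "norm x > 0" using that(2) by auto
    then show ?thesis using that(1) by (metis exp_le_cancel_iff exp_ln)
  qed
  have intE: "integrable lborel (\<lambda>x. rad_density x * indicator E x)"
  proof (rule half_plane_integral_bound(2)[where a="\<lambda>t. 9 * growth_const * indicator {tb - 2..tb - 1} t" and k="\<lambda>_. 1" and a'="\<lambda>_. 0" and k'="\<lambda>_. 0"
        and Ia="9 * growth_const" and Ik=pi and Ia'=0 and Ik'=0])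
    show "AE x in lborel. \<bar>rad_density x * indicat_real E x\<bar> \<le> (if snd x < 0 then (9 * growth_const * indicat_real {tb - 2..tb - 1} (ln (norm x)) * 1 + 0 * 0) / (norm x)\<^sup>2 else 0)"
    proof (intro AE_I2)
      fix x
      show "\<bar>rad_density x * indicat_real E x\<bar> \<le> (if snd x < 0 then (9 * growth_const * indicat_real {tb - 2..tb - 1} (ln (norm x)) * 1 + 0 * 0) / (norm x)\<^sup>2 else 0)"
      proof (cases "snd x < 0 \<and> x \<in> E")
        case True
        then have s: "snd x < 0" and t: "ln (norm x) \<in> {tb - 2..tb - 1}" by (auto simp: E_def)
        have "rad_density x \<le> 9 * growth_const * exp ((3/2 - decay_rate) * ln (norm x)) / (norm x)\<^sup>2"
          by (rule rad_density_bound[OF s r1(1)[OF lnle[OF _ s]]]) (use t in simp)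
        also have "\<dots> \<le> 9 * growth_const * 1 / (norm x)\<^sup>2"
        proof (intro divide_right_mono mult_left_mono)
          have "(3/2 - decay_rate) * ln (norm x) \<le> 0" using \<mu> t tb0 by (intro mult_nonneg_nonpos) (auto simp: \<mu>_def)
          then show "exp ((3/2 - decay_rate) * ln (norm x)) \<le> 1" by simp
        qed (use growth_const(1) in auto)
        finally show ?thesis using s t rad_density_nonneg[of x] True by simp
      next
        case False
        then show ?thesis using growth_const(1) by (auto simp: rad_density_def E_def)
      qed
    qed
    show "(\<integral>\<^sup>+t. ennreal (9 * growth_const * indicat_real {tb - 2..tb - 1} t) \<partial>lborel) \<le> ennreal (9 * growth_const)"
    proof -
      have "(\<integral>\<^sup>+t. ennreal (9 * growth_const * indicat_real {tb - 2..tb - 1} t) \<partial>lborel) = (\<integral>\<^sup>+t. ennreal (9 * growth_const) * indicator {tb - 2..tb - 1} t \<partial>lborel)"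
        by (intro nn_integral_cong) (auto simp: indicator_def)
      then show ?thesis by (subst (asm) nn_integral_cmult_indicator) auto
    qed
    show "(\<integral>\<^sup>+s. ennreal 1 * indicator {- (pi/2)..pi/2} s \<partial>lborel) \<le> ennreal pi"
      by (subst nn_integral_cmult_indicator) auto
    show "(\<lambda>x. rad_density x * indicat_real E x) \<in> borel_measurable borel" by measurable
  qed (use growth_const(1) in auto)
  have key: "5 * Q \<le> D * (2 / \<mu>) * pi / \<Lambda>" if \<Lambda>: "\<Lambda> \<ge> 100" for \<Lambda>
  proof -
    define ta where "ta = tb - \<Lambda>"
    interpret lb: log_bump ta tb by unfold_locales (use \<Lambda> in \<open>simp add: ta_def\<close>)
    have LL: "lb.\<Lambda> = \<Lambda>" unfolding lb.\<Lambda>_def by (simp add: ta_def)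
    interpret l: lift_C2 lb.sub_bump "cut_angle cone_profile" ta tb lb.sub_bump1 "cut_angle1 cone_profile cone_profile1" lb.sub_bump2 "cut_angle2 cone_profile cone_profile1 cone_profile2"
      by (rule lb.lift_C2_q)
    obtain K where K: "K-lipschitz_on UNIV \<Psi>" using \<Psi>_lipschitz by blast
    define \<zeta> where "\<zeta> = polar_lift lb.sub_bump (cut_angle cone_profile)"
    \<comment> \<open>A compact set that contains the support and is contained in \<Omega>, so that
      the weak formulation without boundary term applies.\<close>
    define M where "M = {x::real\<times>real. exp ta \<le> norm x} \<inter> {x. norm x \<le> exp tb} \<inter> {x. cone_cos * norm x \<le> - snd x}"
    have supp: "x \<in> M" if "\<zeta> x \<noteq> 0" for x
    proof -
      have nz: "\<not> (norm x < exp ta \<or> norm x > exp tb \<or> snd x \<ge> norm x / 2)" using that l.lift_zero[of x] by (auto simp: \<zeta>_def)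
      then have n: "norm x > 0" using exp_gt_zero[of ta] by linarith
      then have x0: "x \<noteq> 0" by auto
      have "cut_angle cone_profile (pol_angle x) \<noteq> 0" using that x0 by (auto simp: \<zeta>_def polar_lift_def)
      then have "cone_profile (pol_angle x) \<noteq> 0" by (auto simp: cut_angle_def)
      then have "cos (cone_rate * pol_angle x) > 0" using cone_profile_zero by (auto simp: not_le[symmetric])
      then have "cone_cos \<le> cos (pol_angle x)" using cone_angle(1)[of "pol_angle x"] pol_angle_bounds[OF x0] by auto
      then have "norm x * cone_cos \<le> norm x * cos (pol_angle x)" by (intro mult_left_mono) auto
      then show ?thesis using nz snd_polar[OF x0] by (simp add: M_def mult.commute)
    qed
    have "closed M" unfolding M_def by (intro closed_Int closed_Collect_le continuous_intros)
    have MO: "M \<subseteq> \<Omega>"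
    proof
      fix x assume x: "x \<in> M"
      have "norm x > 0" using x less_le_trans[OF exp_gt_zero[of ta]] by (auto simp: M_def)
      then show "x \<in> \<Omega>" using b(2)[of x] r1(2)[of x] x by (auto simp: M_def)
    qed
    have Mhalf: "M \<subseteq> half" using cball_half[of tb] tb by (auto simp: M_def)
    have cl: "closure {x. \<zeta> x \<noteq> 0} \<subseteq> M" by (rule closure_minimal[OF _ \<open>closed M\<close>]) (use supp in auto)
    have \<zeta>U: "\<zeta> \<in> C1_compact_support UNIV" unfolding \<zeta>_def by (rule l.lift_C1_compact_support) simp
    have \<zeta>1: "\<zeta> \<in> C1_compact_support half" and \<zeta>2: "\<zeta> \<in> C1_compact_support \<Omega>"
      using \<zeta>U cl MO Mhalf by (auto simp: C1_compact_support_def)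
    have \<zeta>0: "\<zeta> x \<ge> 0" for x
      using lb.bump_range cone_profile_range smooth_step_range by (auto simp: \<zeta>_def polar_lift_def lb.sub_bump_def cut_angle_def)
    have src: "0 \<le> (LINT x:\<Omega>|lborel. \<gamma> (\<psi> x) * \<zeta> x)"
      unfolding set_lebesgue_integral_def
    proof (rule Bochner_Integration.integral_nonneg)
      fix x
      show "0 \<le> indicat_real \<Omega> x *\<^sub>R (\<gamma> (\<psi> x) * \<zeta> x)"
      proof (cases "\<zeta> x = 0 \<or> x \<notin> \<Omega>")
        case False
        then have x: "x \<in> \<Omega>" "x \<in> M" using supp by auto
        then have nx: "norm x \<le> exp tb" by (simp add: M_def)
        have "\<psi> x = \<Psi> x" using \<Psi>_\<Omega>[OF x(1)] Mhalf x(2) by auto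
        also have "\<dots> \<le> growth_const * (norm x * sqrt (norm x))" by (rule growth_const(2)[OF r1(1)[OF nx]])
        also have "\<dots> \<le> growth_const * (exp tb * 1)" using nx r1(3)[OF nx] growth_const(1) by (intro mult_left_mono mult_mono) auto
        also have "\<dots> \<le> \<delta>" using tb growth_const(1) by (simp add: field_simps)
        finally have "\<psi> x \<in> {0..\<delta>}" using \<psi>_nonneg[OF x(1)] by simp
        then show ?thesis using \<gamma>0(3) \<zeta>0 by simp
      qed auto
    qed
    define R where "R x = \<Psi> x * (polar_lift (\<lambda>t. exp (-2*t) * lb.sub_bump2 t) (cut_angle cone_profile) x + polar_lift (\<lambda>t. exp (-2*t) * lb.sub_bump t) (cut_angle2 cone_profile cone_profile1 cone_profile2) x)" for x
    have Rneg: "(LINT x|lborel. R x) \<le> 0"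
    proof -
      have "(LINT x|lborel. grad \<Psi> x \<bullet> grad \<zeta> x) = - (LINT x|lborel. R x)"
        unfolding R_def \<zeta>_def by (rule l.integral_grad_lift[OF K])
      then show ?thesis using weak_form(2)[OF \<zeta>1 \<zeta>2] src by simp
    qed
    \<comment> \<open>\<open>N\<close> / \<Lambda> is the error term of
      \<open>bump_supersolution\<close>, weighted by the density.\<close>
    define N where "N x = rad_density x * ((18 * (tb - ln (norm x)) ^ 2 + 9 * (tb - ln (norm x)) ^ 3) * indicator {ta..tb} (ln (norm x)))" for x :: "real\<times>real"
    have Nm: "N \<in> borel_measurable borel" unfolding N_def by measurable
    define a where "a t = D * exp (- (\<mu> / 2) * (tb - t)) * indicator {ta..tb} t" for t
    have am: "a \<in> borel_measurable borel" unfolding a_def by measurable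
    have Nbound: "AE x in lborel. \<bar>N x\<bar> \<le> (if snd x < 0 then (a (ln (norm x)) * 1 + 0 * 0) / (norm x)\<^sup>2 else 0)"
    proof (intro AE_I2)
      fix x
      show "\<bar>N x\<bar> \<le> (if snd x < 0 then (a (ln (norm x)) * 1 + 0 * 0) / (norm x)\<^sup>2 else 0)"
      proof (cases "snd x < 0 \<and> ln (norm x) \<in> {ta..tb}")
        case True
        define t where "t = ln (norm x)"
        have s: "snd x < 0" and t: "t \<in> {ta..tb}" using True by (auto simp: t_def)
        define p where "p = 18 * (tb - t) ^ 2 + 9 * (tb - t) ^ 3"
        have p0: "p \<ge> 0" using t by (simp add: p_def)
        have q: "rad_density x \<le> 9 * growth_const * exp (\<mu> * t) / (norm x)\<^sup>2"
          unfolding \<mu>_def t_def by (rule rad_density_bound[OF s r1(1)[OF lnle[OF _ s]]]) (use True in simp)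
        have "\<mu> * t = \<mu> * tb + - \<mu> * (tb - t)" by (simp add: algebra_simps)
        \<comment> \<open>tb < 0 makes the factor exp (\<mu> tb) at most 1.\<close>
        then have "\<mu> * t \<le> - \<mu> * (tb - t)" using \<mu> tb0 by (simp add: mult_pos_neg less_imp_le)
        then have e: "exp (\<mu> * t) \<le> exp (- \<mu> * (tb - t))" by simp
        have "\<bar>N x\<bar> = rad_density x * p" using t p0 rad_density_nonneg[of x] by (simp add: N_def p_def t_def[symmetric])
        also have "\<dots> \<le> (9 * growth_const * exp (\<mu> * t) / (norm x)\<^sup>2) * p" using q p0 by (rule mult_right_mono)
        also have "\<dots> = 9 * growth_const / (norm x)\<^sup>2 * (p * exp (\<mu> * t))" by simp
        also have "\<dots> \<le> 9 * growth_const / (norm x)\<^sup>2 * (p * exp (- \<mu> * (tb - t)))"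
          using growth_const(1) p0 e by (intro mult_left_mono) auto
        also have "\<dots> \<le> 9 * growth_const / (norm x)\<^sup>2 * ((144 / \<mu>\<^sup>2 + 432 / \<mu> ^ 3) * exp (- (\<mu> / 2) * (tb - t)))"
          unfolding p_def using growth_const(1) t exp_beats_cube[OF \<mu>, of "tb - t"] by (intro mult_left_mono) auto
        also have "\<dots> = a t / (norm x)\<^sup>2" using t by (simp add: a_def D_def)
        finally show ?thesis using s by (simp add: t_def)
      next
        case False
        then show ?thesis using D0 by (auto simp: N_def rad_density_def a_def)
      qed
    qed
    have Ia: "(\<integral>\<^sup>+t. ennreal (a t) \<partial>lborel) \<le> ennreal (D * (2 / \<mu>))"
    proof -
      define G where "G t = D * (2 / \<mu>) * exp (- (\<mu> / 2) * (tb - t))" for t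
      have "(\<integral>\<^sup>+t. ennreal (a t) \<partial>lborel) = (\<integral>\<^sup>+t. ennreal (D * exp (- (\<mu> / 2) * (tb - t))) * indicator {ta..tb} t \<partial>lborel)"
        by (intro nn_integral_cong) (auto simp: a_def indicator_def)
      also have "\<dots> = ennreal (G tb - G ta)"
        by (rule nn_integral_FTC_Icc)
           (use D0 \<mu> lb.len in \<open>auto simp: G_def[abs_def] intro!: derivative_eq_intros\<close>)
      also have "\<dots> \<le> ennreal (D * (2 / \<mu>))" using D0 \<mu> by (intro ennreal_leI) (simp add: G_def)
      finally show ?thesis .
    qed
    have one: "(\<integral>\<^sup>+s. ennreal 1 * indicator {- (pi/2)..pi/2} s \<partial>lborel) \<le> ennreal pi"
      by (subst nn_integral_cmult_indicator) auto
    note bump = half_plane_integral_bound[OF Nbound am _ _ _ _ _ _ _ Ia one, where Ia'=0 and Ik'=0]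
    have a0: "a t \<ge> 0" for t using D0 by (simp add: a_def)
    have Nle: "(LINT x|lborel. N x) \<le> D * (2 / \<mu>) * pi" and Nint: "integrable lborel N"
      using bump a0 Nm D0 \<mu> by (auto simp: abs_le_iff)
    have low: "5 * (rad_density x * indicator E x) - N x / \<Lambda> \<le> \<Lambda> ^ 3 * R x" for x
    proof (cases "snd x < 0")
      case False
      then show ?thesis using \<Psi>_zero_above[of x] by (simp add: rad_density_def N_def R_def)
    next
      case s: True
      then have x0: "x \<noteq> 0" by auto
      then have n0: "norm x > 0" by simp
      define t s' where "t = ln (norm x)" and "s' = pol_angle x"
      have c: "cos s' \<ge> 0" using pol_angle_lower_bounds[OF s] unfolding s'_def by (intro cos_ge_zero) auto
      define Z where "Z = \<Psi> x * exp (- decay_rate * t) / (norm x)\<^sup>2"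
      have Z0: "Z \<ge> 0" using \<Psi>_nonneg by (simp add: Z_def)
      have q: "rad_density x = Z * cone_profile s'" using s pol_angle_arctan[OF s] by (simp add: rad_density_def Z_def t_def s'_def)
      have "R x = Z * ((lb.bump2 t - 2 * decay_rate * lb.bump1 t + decay_rate\<^sup>2 * lb.bump t) * cone_profile s' + lb.bump t * cone_profile2 s')"
        using x0 exp_ln_powers(4)[OF n0]
        by (simp add: R_def polar_lift_def t_def[symmetric] s'_def[symmetric] cut_angle_lower[OF c] lb.sub_bump_def lb.sub_bump2_def Z_def algebra_simps add_divide_distrib diff_divide_distrib)
      also have "\<dots> = Z * cone_profile s' * (lb.bump2 t - 2 * decay_rate * lb.bump1 t) + Z * lb.bump t * (cone_profile2 s' + decay_rate\<^sup>2 * cone_profile s')"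
        by (simp add: algebra_simps)
      also have "\<dots> \<ge> Z * cone_profile s' * (lb.bump2 t - 2 * decay_rate * lb.bump1 t)"
        using Z0 lb.bump_range cone_profile_subsolution[of s'] by simp
      finally have "R x \<ge> rad_density x * (lb.bump2 t - 2 * decay_rate * lb.bump1 t)" by (simp add: q)
      then have "\<Lambda> ^ 3 * R x \<ge> \<Lambda> ^ 3 * (rad_density x * (lb.bump2 t - 2 * decay_rate * lb.bump1 t))" using \<Lambda> by (intro mult_left_mono) auto
      moreover have "\<Lambda> ^ 3 * (rad_density x * (lb.bump2 t - 2 * decay_rate * lb.bump1 t)) = rad_density x * (\<Lambda> ^ 3 * (lb.bump2 t - 2 * decay_rate * lb.bump1 t))" by simp
      moreover have "rad_density x * (\<Lambda> ^ 3 * (lb.bump2 t - 2 * decay_rate * lb.bump1 t)) \<ge>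
          rad_density x * (5 * indicator {tb - 2..tb - 1} t - (18 * (tb - t) ^ 2 + 9 * (tb - t) ^ 3) * indicator {ta..tb} t / \<Lambda>)"
        using lb.bump_supersolution[of t] \<Lambda> unfolding LL by (intro mult_left_mono rad_density_nonneg) auto
      moreover have "rad_density x * (5 * indicator {tb - 2..tb - 1} t - (18 * (tb - t) ^ 2 + 9 * (tb - t) ^ 3) * indicator {ta..tb} t / \<Lambda>)
         = 5 * (rad_density x * indicator E x) - N x / \<Lambda>"
        by (simp add: N_def E_def t_def indicator_def right_diff_distrib)
      ultimately show ?thesis by linarith
    qed
    show ?thesis
    proof (cases "integrable lborel R")
      case True
      have "(LINT x|lborel. 5 * (rad_density x * indicator E x) - N x / \<Lambda>) \<le> (LINT x|lborel. \<Lambda> ^ 3 * R x)"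
        by (rule integral_mono[OF _ _ low]) (use intE Nint True in auto)
      also have "\<dots> = \<Lambda> ^ 3 * (LINT x|lborel. R x)" by simp
      also have "\<dots> \<le> 0" using Rneg \<Lambda> by (intro mult_nonneg_nonpos) auto
      finally have "5 * Q \<le> (LINT x|lborel. N x) / \<Lambda>" using intE Nint by (simp add: Q_def)
      also have "\<dots> \<le> D * (2 / \<mu>) * pi / \<Lambda>" using Nle \<Lambda> by (intro divide_right_mono) auto
      finally show ?thesis .
    next
      \<comment> \<open>A contradiction: \<open>R\<close> is continuous with bounded support, hence
        integrable.\<close>
      case False
      have "integrable lborel R"
      proof -
        interpret x1: lift_profile "\<lambda>t. exp (-2*t) * lb.sub_bump2 t" "cut_angle cone_profile" ta tb
          by unfold_locales (use lb.sub_bump_supp(3) cut_angle_zero in auto)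
        interpret x2: lift_profile "\<lambda>t. exp (-2*t) * lb.sub_bump t" "cut_angle2 cone_profile cone_profile1 cone_profile2" ta tb
          by unfold_locales (use lb.sub_bump_supp(1) l.k.K'_supp in auto)
        have cR: "continuous_on UNIV R" unfolding R_def
          by (intro continuous_intros \<Psi>_continuous x1.lift_continuous x2.lift_continuous lb.sub_bump_cont
              continuous_cut_angle[OF cone_profile_cont(1,2)] continuous_cut_angle2[OF cone_profile_cont])
        have "bounded (R ` cball 0 (exp tb))"
          by (intro compact_imp_bounded compact_continuous_image continuous_on_subset[OF cR]) auto
        then obtain BB where BB: "\<And>x. x \<in> cball 0 (exp tb) \<Longrightarrow> \<bar>R x\<bar> \<le> BB" unfolding bounded_iff real_norm_def by blast
        have R0: "R x \<noteq> 0 \<Longrightarrow> x \<in> cball 0 (exp tb)" for x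
          using x1.lift_support[of x] x2.lift_support[of x] unfolding R_def
          by (metis add_0 mult_zero_right)
        show ?thesis
        proof (rule integrable_bounded_support[where M="max 0 BB" and U="cball 0 (exp tb)"])
          show "AE x in lborel. \<bar>R x\<bar> \<le> max 0 BB"
          proof (intro AE_I2)
            fix x show "\<bar>R x\<bar> \<le> max 0 BB" using BB[of x] R0[of x] by (cases "R x = 0") auto
          qed
        qed (use R0 borel_measurable_continuous_onI[OF cR] in auto)
      qed
      with False show ?thesis by simp
    qed
  qed
  have "Q \<le> 0"
  proof (rule ccontr)
    assume "\<not> Q \<le> 0"
    then have Q: "Q > 0" by simp
    define c where "c = D * (2 / \<mu>) * pi"
    have c0: "c > 0" using D0 \<mu> by (simp add: c_def)
    \<comment> \<open>With this choice \<open>key\<close> gives 5 Q \<Lambda> \<le> c, although Q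
      \<Lambda> = 100 Q + c.\<close>
    define \<Lambda> where "\<Lambda> = 100 + c / Q"
    have "\<Lambda> \<ge> 100" using c0 Q by (simp add: \<Lambda>_def)
    then have "5 * Q \<le> c / \<Lambda>" unfolding c_def by (rule key)
    moreover have "\<Lambda> > 0" "Q * \<Lambda> = 100 * Q + c" using c0 Q by (auto simp: \<Lambda>_def distrib_left add_pos_pos)
    ultimately have "5 * (Q * \<Lambda>) \<le> c" by (simp add: field_simps)
    then show False using \<open>Q * \<Lambda> = 100 * Q + c\<close> Q c0 by simp
  qed
  moreover have "Q \<ge> 0" unfolding Q_def by (rule Bochner_Integration.integral_nonneg) (use rad_density_nonneg in auto)
  ultimately have "Q = 0" by simp
  then have ae: "AE x in lborel. rad_density x * indicat_real E x = 0"
    unfolding Q_def by (subst (asm) integral_nonneg_eq_0_iff_AE[OF intE]) (use rad_density_nonneg in auto)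
  \<comment> \<open>An open part of the annulus on which \<open>cone_profile\<close> is positive, so
    that a vanishing density means \<Psi> = 0.\<close>
  define W where "W = {x::real\<times>real. exp (tb - 2) < norm x} \<inter> {x. norm x < exp (tb - 1)} \<inter> {x. cone_cos * norm x < - snd x}"
  have oW: "open W" unfolding W_def by (intro open_Int open_Collect_less continuous_intros)
  have Wfacts: "x \<in> \<Omega>" "snd x > F/2" "x \<in> E" "rad_density x = 0 \<longleftrightarrow> \<Psi> x = 0" if x: "x \<in> W" for x
  proof -
    have n0: "norm x > 0" using x less_trans[OF exp_gt_zero[of "tb - 2"]] by (auto simp: W_def)
    then have x0: "x \<noteq> 0" by auto
    have "exp (tb - 1) < exp tb" by simp
    moreover have "norm x < exp (tb - 1)" using x by (auto simp: W_def)
    ultimately have nx: "norm x \<le> exp tb" by linarith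
    show "x \<in> \<Omega>" using b(2)[OF x0 r1(2)[OF nx]] x by (auto simp: W_def)
    then have s: "snd x < 0" by (rule \<Omega>_below)
    show "snd x > F/2" using cball_half[of tb] tb nx by auto
    have "ln (exp (tb - 2)) < ln (norm x)" "ln (norm x) < ln (exp (tb - 1))"
      using x n0 by (auto simp: W_def simp del: ln_exp)
    then show "x \<in> E" by (simp add: E_def)
    have "norm x * cone_cos < norm x * cos (pol_angle x)" using x snd_polar[OF x0] by (simp add: W_def mult.commute)
    then have "cone_cos < cos (pol_angle x)" using n0 by simp
    then have "cos (cone_rate * pol_angle x) > 0" using cone_angle(2)[of "pol_angle x"] pol_angle_bounds[OF x0] by auto
    then have "cone_profile (pol_angle x) > 0" by (rule cone_profile_pos)
    then have "cone_profile (arctan (fst x / (- snd x))) > 0" by (simp only: pol_angle_arctan[OF s])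
    then show "rad_density x = 0 \<longleftrightarrow> \<Psi> x = 0" using s n0 by (simp add: rad_density_def)
  qed
  \<comment> \<open>Almost everywhere becomes everywhere, since \<Psi> is continuous and a nonempty
    open set is not null.\<close>
  have \<Psi>W: "\<Psi> x = 0" if "x \<in> W" for x
  proof (rule ccontr)
    assume "\<Psi> x \<noteq> 0"
    define O' where "O' = W \<inter> {x. \<Psi> x \<noteq> 0}"
    have "open O'" unfolding O'_def by (intro open_Int oW open_Collect_neq \<Psi>_continuous continuous_intros)
    moreover have "x \<in> O'" using that \<open>\<Psi> x \<noteq> 0\<close> by (simp add: O'_def)
    moreover have "O' \<in> null_sets lborel"
    proof -
      have "AE x in lborel. x \<notin> O'" using ae by eventually_elim (use Wfacts in \<open>auto simp: O'_def\<close>)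
      then show ?thesis using \<open>open O'\<close> by (simp add: AE_iff_null_sets)
    qed
    ultimately show False using open_not_negligible[of O'] by (auto simp: negligible_iff_null_sets null_sets_completionI)
  qed
  \<comment> \<open>A point of the axis, at a radius strictly between exp (tb - 2) and exp (tb -
    1).\<close>
  define x1 :: "real\<times>real" where "x1 = (0, - exp (tb - 3/2))"
  have "x1 \<in> W"
  proof -
    have "cone_cos < 1"
    proof -
      have "cos (pi / (2 * cone_rate)) < cos 0" by (rule cos_monotone_0_pi) (use pi_gt_zero in \<open>auto simp: cone_rate_def field_simps\<close>)
      then show ?thesis by (simp add: cone_cos_def)
    qed
    then show ?thesis by (simp add: W_def x1_def norm_Pair)
  qed
  have "grad \<psi> x1 = grad \<Psi> x1" using grad_\<Psi>_\<Omega>[OF Wfacts(1,2)[OF \<open>x1 \<in> W\<close>]] by simp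
  also have "\<dots> = grad (\<lambda>_. 0) x1" by (rule grad_cong_open[OF oW \<open>x1 \<in> W\<close>]) (rule \<Psi>W)
  also have "\<dots> = 0" by (rule grad_eqI[OF GDERIV_const])
  finally have "snd (grad \<psi> x1) = 0" by simp
  then show False using \<psi>Y Wfacts(1)[OF \<open>x1 \<in> W\<close>] by force
qed

end

subsection \<open>Slopes and angles\<close>

text \<open>The angle between the downward vertical and a ray of slope q. The infinite slope is
  singled out because \<open>enn2real\<close> sends it to 0, which would give the
  horizontal.\<close>

definition slope_angle :: "ennreal \<Rightarrow> real" where
  "slope_angle q = (if q = \<infinity> then 0 else pi/2 - arctan (enn2real q))"

lemma slope_angle_bounds: "0 \<le> slope_angle q" "slope_angle q \<le> pi/2"
  using arctan_ubound[of "enn2real q"] pi_gt_zero by (auto simp: slope_angle_def)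

lemma slope_angle_eq_half_pi: "slope_angle q = pi/2 \<longleftrightarrow> q = 0"
  using pi_gt_zero by (cases q) (auto simp: slope_angle_def)

lemma slope_angle_eq_third_pi: "slope_angle q = pi/3 \<longleftrightarrow> q = ennreal (1 / sqrt 3)"
proof (cases q)
  case (real r)
  have "arctan (1 / sqrt 3) = pi / 6" using tan_30 pi_gt_zero by (intro arctan_unique) auto
  then have "pi/2 - arctan r = pi/3 \<longleftrightarrow> arctan r = arctan (1 / sqrt 3)" by (auto simp: field_simps)
  then show ?thesis using real by (simp add: slope_angle_def arctan_eq_iff)
qed (use pi_gt_zero in \<open>simp add: slope_angle_def\<close>)

text \<open>Carries limits of quotients over to angles; continuity at the infinite slope is the
  limit \<pi>/2 of the arctangent.\<close>

lemma tendsto_slope_angle: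
  assumes f: "(f \<longlongrightarrow> q) G"
  shows "((\<lambda>s. slope_angle (f s)) \<longlongrightarrow> slope_angle q) G"
proof (cases "q = \<infinity>")
  case True
  have "((\<lambda>s. slope_angle (f s)) \<longlongrightarrow> 0) G"
  proof (rule order_tendstoI)
    fix a :: real assume "a < 0"
    then show "\<forall>\<^sub>F s in G. a < slope_angle (f s)"
      using slope_angle_bounds(1) by (intro always_eventually) (auto intro: less_le_trans)
  next
    fix a :: real assume a: "0 < a"
    have "((\<lambda>M. pi/2 - arctan M) \<longlongrightarrow> pi/2 - pi/2) at_top"
      by (intro tendsto_intros tendsto_arctan_at_top)
    then have "\<forall>\<^sub>F M in at_top. pi/2 - arctan M < a" using a by (intro order_tendstoD(2)) auto
    then obtain M where M: "M \<ge> 0" "pi/2 - arctan M < a"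
      using eventually_happens'[OF _ eventually_conj[OF eventually_ge_at_top[of 0]]] by fastforce
    have "\<forall>\<^sub>F s in G. ennreal M < f s" using f True by (intro order_tendstoD(1)) auto
    then show "\<forall>\<^sub>F s in G. slope_angle (f s) < a"
    proof eventually_elim
      case (elim s)
      show ?case
      proof (cases "f s")
        case (real r)
        then have "arctan M < arctan r" using elim M(1) by (simp add: ennreal_less_iff arctan_less_iff)
        then show ?thesis using real M(2) by (simp add: slope_angle_def)
      qed (use a in \<open>simp add: slope_angle_def\<close>)
    qed
  qed
  then show ?thesis using True by (simp add: slope_angle_def)
next
  case False
  have "((\<lambda>s. pi/2 - arctan (enn2real (f s))) \<longlongrightarrow> pi/2 - arctan (enn2real q)) G"
    using f False by (intro tendsto_intros) (auto simp: ennreal_enn2real_if)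
  moreover have "\<forall>\<^sub>F s in G. f s < \<infinity>" using f False by (intro order_tendstoD(2)) (auto simp: less_top)
  then have "\<forall>\<^sub>F s in G. pi/2 - arctan (enn2real (f s)) = slope_angle (f s)"
    by eventually_elim (auto simp: slope_angle_def)
  ultimately show ?thesis using False by (simp add: slope_angle_def Lim_transform_eventually)
qed

text \<open>The sign of a restores the side of the vertical. For a = 0 the point is on the downward
  vertical and both sides are 0.\<close>

lemma pol_angle_eq_slope_angle:
  assumes "(a, b) \<noteq> 0" "b \<le> 0"
  shows "pol_angle (a, b) = sgn a * slope_angle (ennreal \<bar>b\<bar> / ennreal \<bar>a\<bar>)"
proof (cases "b = 0")
  case True
  then have a: "a \<noteq> 0" using assms(1) by (simp add: zero_prod_def)
  show ?thesis
  proof (cases "a > 0")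
    case True
    then show ?thesis using pol_angle_polar[of a "pi/2"] pi_gt_zero \<open>b = 0\<close> by (simp add: slope_angle_def)
  next
    case False
    then show ?thesis using pol_angle_polar[of "- a" "- (pi/2)"] pi_gt_zero \<open>b = 0\<close> a by (simp add: slope_angle_def)
  qed
next
  case False
  then have b: "b < 0" using assms(2) by simp
  have e: "pol_angle (a, b) = arctan (a / - b)" using pol_angle_arctan[of "(a, b)"] b by simp
  show ?thesis
  proof (cases "a = 0")
    case False
    then have "ennreal \<bar>b\<bar> / ennreal \<bar>a\<bar> = ennreal (\<bar>b\<bar> / \<bar>a\<bar>)" by (simp add: divide_ennreal)
    then have s: "slope_angle (ennreal \<bar>b\<bar> / ennreal \<bar>a\<bar>) = pi/2 - arctan (\<bar>b\<bar> / \<bar>a\<bar>)" by (simp add: slope_angle_def)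
    have "arctan (\<bar>a\<bar> / - b) = pi/2 - arctan (\<bar>b\<bar> / \<bar>a\<bar>)"
      using arctan_inverse[of "\<bar>b\<bar> / \<bar>a\<bar>"] divide_neg_pos[of b "\<bar>a\<bar>"] b False by (simp add: inverse_eq_divide)
    moreover have "arctan (a / - b) = sgn a * arctan (\<bar>a\<bar> / - b)"
      using arctan_minus[of "a / b"] False by (cases "a > 0") auto
    ultimately show ?thesis unfolding e s by simp
  qed (use e in simp)
qed

theorem theorem5p8:
  fixes g B L \<alpha> F d e :: real
    and \<gamma> u v :: "real \<Rightarrow> real"
    and S \<Omega> :: "(real \<times> real) set"
    and \<psi> :: "real \<times> real \<Rightarrow> real"
    and q_plus q_minus :: ennreal
  assumes "g > 0" and "B > 0" and "L > 0" and "0 < \<alpha>" and "\<alpha> < 1"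
    and "C1_holder_on \<alpha> {0..B} \<gamma>"
    and "extreme_wave g B L \<gamma> F S \<Omega> \<psi> 0"
    and "F < 0"
    and "\<forall>x\<in>\<Omega>. snd (grad \<psi> x) < 0"
    and "continuous_on UNIV (\<lambda>s. (u s, v s))"
    and "inj (\<lambda>s. (u s, v s))"
    and "S = range (\<lambda>s. (u s, v s))"
    and "u 0 = 0" and "v 0 = 0"
    and "mono u"
    and "d < 0" and "0 < e"
    and "mono_on {d..0} v" and "antimono_on {0..e} v"
    and "\<forall>x\<in>\<Omega>. T_fun g B \<gamma> \<psi> x \<le> 0"
    and "(slope_quotient u v \<longlongrightarrow> q_plus) (at_right 0)"
    and "(slope_quotient u v \<longlongrightarrow> q_minus) (at_left 0)"
  shows "((q_plus = ennreal (1 / sqrt 3) \<and> q_minus = ennreal (1 / sqrt 3)) \<or>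
          (q_plus = 0 \<and> q_minus = 0)) \<and>
         ((\<exists>\<delta>. 0 < \<delta> \<and> \<delta> \<le> B \<and> (\<forall>r\<in>{0..\<delta>}. \<gamma> r \<ge> 0)) \<longrightarrow>
            q_plus = ennreal (1 / sqrt 3) \<and> q_minus = ennreal (1 / sqrt 3))"
proof -
  have weak: "weak_solution g B L \<gamma> F S \<Omega> \<psi> 0" using assms(7) by (simp add: extreme_wave_def)
  have zero: "(0::real\<times>real) \<in> S" using assms(12-14) by (auto simp: zero_prod_def intro: rev_image_eqI[of 0])
  interpret w: wave g B L \<alpha> F \<gamma> S \<Omega> \<psi>
    by unfold_locales (use assms weak zero in auto)
  have angle: "pol_angle (u s, v s) = sgn (u s) * slope_angle (slope_quotient u v s)" if "s \<noteq> 0" for s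
    unfolding slope_quotient_def
  proof (rule pol_angle_eq_slope_angle)
    show "(u s, v s) \<noteq> 0" using assms(11,13,14) that unfolding inj_def zero_prod_def by metis
    show "v s \<le> 0" using w.S_nonpos[of "(u s, v s)"] assms(12) by auto
  qed
  \<comment> \<open>Where u vanishes the sign is 0; the quotient is then infinite by convention and
    its angle 0, so \<open>right\<close> and \<open>left\<close> hold with a fixed sign there
    too.\<close>
  have top: "slope_angle (slope_quotient u v s) = 0" if "s \<noteq> 0" "u s = 0" for s
  proof -
    have "v s \<noteq> 0" using assms(11,13,14) that unfolding inj_def by metis
    then show ?thesis using that by (simp add: slope_quotient_def slope_angle_def)
  qed
  have right: "pol_angle (u s, v s) = slope_angle (slope_quotient u v s)" if "0 < s" for s
  proof -
    have "0 \<le> u s" using monoD[OF assms(15), of 0 s] that assms(13) by simp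
    then show ?thesis using angle[of s] top[of s] that by (cases "u s = 0") auto
  qed
  have left: "pol_angle (u s, v s) = - slope_angle (slope_quotient u v s)" if "s < 0" for s
  proof -
    have "u s \<le> 0" using monoD[OF assms(15), of s 0] that assms(13) by simp
    then show ?thesis using angle[of s] top[of s] that by (cases "u s = 0") auto
  qed
  have lim_p: "((\<lambda>s. pol_angle (u s, v s)) \<longlongrightarrow> slope_angle q_plus) (at_right 0)"
    by (rule Lim_transform_eventually[OF tendsto_slope_angle[OF assms(21)]])
       (use right in \<open>auto simp: eventually_at_filter\<close>)
  have lim_m: "((\<lambda>s. pol_angle (u s, v s)) \<longlongrightarrow> - slope_angle q_minus) (at_left 0)"
    by (rule Lim_transform_eventually[OF tendsto_minus[OF tendsto_slope_angle[OF assms(22)]]])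
       (use left in \<open>auto simp: eventually_at_filter\<close>)
  interpret crest g B L \<alpha> F \<gamma> S \<Omega> \<psi> u v d e "slope_angle q_plus" "slope_angle q_minus"
    by unfold_locales (fact assms lim_p lim_m slope_angle_bounds)+
  show ?thesis
    using angle_dichotomy flat_crest_impossible[OF _ _ assms(9)]
    unfolding slope_angle_eq_half_pi slope_angle_eq_third_pi by blast
qed

end
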